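(* Let $\varphi\in\mathcal{M}$, let $0<\alpha\le 1$, let $\mathfrak{B}=\{b_m:m\in\mathbb{N}_0\}$ be a periodic sequence of complex numbers, and let $h_1>0$, $h_2>0$. Suppose that the elements of the set $$L(\alpha,h_1,h_2)=\{h_1\log p: p\in\mathbb{P}\}\cup\{h_2\log(m+\alpha): m\in\mathbb{N}_0\}\cup\{\pi\}$$ are linearly independent over $\mathbb{Q}$. Let $D_1$ be an open subset of $D_\varphi$, $D_2$ an open subset of $D_\zeta$, and $\underline{H}=H(D_1)\times H(D_2)$. For $N\in\mathbb{N}$ define the probability measure on $(\underline{H},\mathcal{B}(\underline{H}))$ $$P_N(A)=\frac{1}{N+1}\#\big\{0\le k\le N:\ \underline{Z}(s_1+ikh_1,s_2+ikh_2)\in A\big\},\qquad A\in\mathcal{B}(\underline{H}),$$ where $\underline{Z}(s_1,s_2)=(\varphi(s_1),\zeta(s_2,\alpha;\mathfrak{B}))$ is regarded as an element of $\underline{H}$. Then $P_N$ converges weakly to $P_{\underline{Z}}$ as $N\to\infty$.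
   Context: $\mathbb{P}$ denotes the set of primes, $p_m$ the $m$-th prime, $\mathbb{N}_0=\mathbb{N}\cup\{0\}$. For an open set $G\subset\mathbb{C}$, $H(G)$ is the space of holomorphic functions on $G$ with the topology of uniform convergence on compact subsets; $\mathcal{B}(\cdot)$ denotes the Borel $\sigma$-field. Class $\mathcal{M}$: for $m\in\mathbb{N}$ let $g(m)\in\mathbb{N}$, $f(j,m)\in\mathbb{N}$ ($1\le j\le g(m)$), $a_m^{(j)}\in\mathbb{C}$, with $g(m)\le C_1p_m^{\alpha_0}$ and $|a_m^{(j)}|\le p_m^{\beta_0}$ for constants $C_1>0$, $\alpha_0,\beta_0\ge0$. Put $A_m(X)=\prod_{j=1}^{g(m)}(1-a_m^{(j)}X^{f(j,m)})$, $\widetilde\varphi(s)=\prod_{m=1}^\infty A_m(p_m^{-s})^{-1}$ (absolutely convergent for $\sigma>\alpha_0+\beta_0+1$) and $\varphi(s)=\widetilde\varphi(s+\alpha_0+\beta_0)=\sum_{k\ge1}c_kk^{-s}$ ($\sigma>1$). $\varphi\in\mathcal{M}$ means moreover: (i) $\varphi$ continues meromorphically to $\sigma\ge\sigma_0$ for some $1/2\le\sigma_0<1$, with all poles $s_1(\varphi),\dots,s_l(\varphi)$ in this region lying in a compact set disjoint from the line $\sigma=\sigma_0$; (ii) $\varphi(\sigma+it)=O(|t|^{C_2})$ for $\sigma\ge\sigma_0$, some $C_2>0$; (iii) $\int_0^T|\varphi(\sigma_0+it)|^2dt=O(T)$. Then $D_\varphi=\{s:\sigma>\sigma_0,\ \sigma\ne\Re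 s_j(\varphi),\ j=1,\dots,l\}$. Periodic Hurwitz zeta-function: if $\mathfrak{B}$ has minimal period $l$, $\zeta(s,\alpha;\mathfrak{B})=\sum_{m\ge0}b_m(m+\alpha)^{-s}$ for $\sigma>1$, continued analytically to $\mathbb{C}$ except a possible simple pole at $s=1$ with residue $b=\frac1l\sum_{r=0}^{l-1}b_r$. $D_\zeta=\{\sigma>1/2\}$ if $b=0$, and $D_\zeta=\{\sigma>1/2,\sigma\ne1\}$ otherwise. Random elements: $\gamma=\{|s|=1\}$, $\Omega_1=\prod_{p\in\mathbb{P}}\gamma_p$, $\Omega_2=\prod_{m\in\mathbb{N}_0}\gamma_m$ (all factors $\gamma$), $\Omega=\Omega_1\times\Omega_2$ with probability Haar measure $m_H=m_{H1}\times m_{H2}$. For $\omega_1\in\Omega_1$, $\omega_1(p)$ is its $p$-th coordinate and $\omega_1(m)=\prod_p\omega_1(p)^{g_p}$ if $m=\prod_pp^{g_p}$; $\omega_2(m)$ is the $m$-th coordinate of $\omega_2\in\Omega_2$. Define $\varphi(s_1,\omega_1)=\sum_{m\ge1}c_m\omega_1(m)m^{-s_1}$, $\zeta(s_2,\alpha,\omega_2;\mathfrak{B})=\sum_{m\ge0}b_m\omega_2(m)(m+\alpha)^{-s_2}$, and the $\underline{H}$-valued random element $\underline{Z}(\underline{s},\omega)=(\varphi(s_1,\omega_1),\zeta(s_2,\alpha,\omega_2;\mathfrak{B}))$ on $(\Omega,\mathcal{B}(\Omega),m_H)$. $P_{\underline{Z}}(A)=m_H\{\omega:\underline{Z}(\underline{s},\omega)\in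 A\}$, $A\in\mathcal{B}(\underline{H})$, is its distribution.
   Formalization: The elements of L(α,h₁,h₂) are taken as a listed family: the numbers h₁ log p, h₂ log(m+α), π must also be pairwise distinct; read as a bare set, a coincidence such as h₁ log 2 = h₂ log(1+α) would be allowed and the claim would fail. *)

theory Defs
  imports
    "HOL-Probability.Probability"
    "HOL-Complex_Analysis.Complex_Analysis"
    "HOL-Library.Landau_Symbols"
begin

section \<open>Spaces of holomorphic functions, Borel fields, weak convergence\<close>

text \<open>
  Elements of \<open>H(D)\<close> are represented by functions that are \<open>undefined\<close> outside \<open>D\<close>, so
  that equality in \<open>H(D)\<close> is equality on \<open>D\<close>.
\<close>

definition hol_space :: "complex set \<Rightarrow> (complex \<Rightarrow> complex) set" where
  "hol_space D = {f \<in> extensional D. f holomorphic_on D}"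

definition hol_topology :: "complex set \<Rightarrow> (complex \<Rightarrow> complex) topology" where
  "hol_topology D = topology (\<lambda>U. U \<subseteq> hol_space D \<and>
     (\<forall>f\<in>U. \<exists>K e. compact K \<and> K \<subseteq> D \<and> e > 0 \<and>
        {g \<in> hol_space D. \<forall>z\<in>K. dist (g z) (f z) < e} \<subseteq> U))"

lemma istopology_hol:
  "istopology (\<lambda>U. U \<subseteq> hol_space D \<and>
     (\<forall>f\<in>U. \<exists>K e. compact K \<and> K \<subseteq> D \<and> e > 0 \<and>
        {g \<in> hol_space D. \<forall>z\<in>K. dist (g z) (f z) < e} \<subseteq> U))"
  (is "istopology (\<lambda>U. U \<subseteq> _ \<and> (\<forall>f\<in>U. ?nbhd U f))")
  unfolding istopology_def
proof (intro conjI allI impI)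
  fix S T
  assume S: "S \<subseteq> hol_space D \<and> (\<forall>f\<in>S. ?nbhd S f)"
    and T: "T \<subseteq> hol_space D \<and> (\<forall>f\<in>T. ?nbhd T f)"
  show "S \<inter> T \<subseteq> hol_space D" using S by blast
  show "\<forall>f\<in>S \<inter> T. ?nbhd (S \<inter> T) f"
  proof
    fix f assume f: "f \<in> S \<inter> T"
    from S f obtain K1 e1 where 1: "compact K1" "K1 \<subseteq> D" "e1 > 0"
      "{g \<in> hol_space D. \<forall>z\<in>K1. dist (g z) (f z) < e1} \<subseteq> S" by blast
    from T f obtain K2 e2 where 2: "compact K2" "K2 \<subseteq> D" "e2 > 0"
      "{g \<in> hol_space D. \<forall>z\<in>K2. dist (g z) (f z) < e2} \<subseteq> T" by blast
    show "?nbhd (S \<inter> T) f"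
      using 1 2 by (intro exI[of _ "K1 \<union> K2"] exI[of _ "min e1 e2"]) auto
  qed
next
  fix \<K>
  assume \<K>: "\<forall>U\<in>\<K>. U \<subseteq> hol_space D \<and> (\<forall>f\<in>U. ?nbhd U f)"
  show "\<Union>\<K> \<subseteq> hol_space D" using \<K> by blast
  show "\<forall>f\<in>\<Union>\<K>. ?nbhd (\<Union>\<K>) f"
  proof
    fix f assume "f \<in> \<Union>\<K>"
    then obtain U where U: "U \<in> \<K>" "f \<in> U" by blast
    have "?nbhd U f"
      using bspec[OF conjunct2[OF bspec[OF \<K> U(1)]] U(2)] .
    then obtain K e where "compact K" "K \<subseteq> D" "e > 0"
      "{g \<in> hol_space D. \<forall>z\<in>K. dist (g z) (f z) < e} \<subseteq> U" by (elim exE conjE)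
    with U show "?nbhd (\<Union>\<K>) f" by (intro exI[of _ K] exI[of _ e] conjI) (assumption | blast)+
  qed
qed

lemma openin_hol_topology:
  "openin (hol_topology D) U \<longleftrightarrow> U \<subseteq> hol_space D \<and>
     (\<forall>f\<in>U. \<exists>K e. compact K \<and> K \<subseteq> D \<and> e > 0 \<and>
        {g \<in> hol_space D. \<forall>z\<in>K. dist (g z) (f z) < e} \<subseteq> U)"
  unfolding hol_topology_def by (subst topology_inverse'[OF istopology_hol]) (rule refl)

lemma topspace_hol_topology [simp]: "topspace (hol_topology D) = hol_space D"
proof -
  have "openin (hol_topology D) (hol_space D)"
    unfolding openin_hol_topology
    by (auto intro!: exI[of _ "{}::complex set"] exI[of _ "1::real"])
  then have "hol_space D \<subseteq> topspace (hol_topology D)"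
    by (rule openin_subset)
  moreover have "topspace (hol_topology D) \<subseteq> hol_space D"
    using openin_topspace[of "hol_topology D"] unfolding openin_hol_topology by (rule conjunct1)
  ultimately show ?thesis by (rule subset_antisym[rotated])
qed

definition borel_of :: "'a topology \<Rightarrow> 'a measure" where
  "borel_of T = sigma (topspace T) {U. openin T U}"

lemma space_borel_of [simp]: "space (borel_of T) = topspace T"
  unfolding borel_of_def by (rule space_measure_of) (auto dest: openin_subset)

lemma sets_borel_of: "sets (borel_of T) = sigma_sets (topspace T) {U. openin T U}"
  unfolding borel_of_def by (rule sets_measure_of) (auto dest: openin_subset)

definition weakly_converges :: "'a topology \<Rightarrow> (nat \<Rightarrow> 'a measure) \<Rightarrow> 'a measure \<Rightarrow> bool" where
  "weakly_converges T P Q \<longleftrightarrow>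
     (\<forall>F :: 'a \<Rightarrow> real. continuous_map T euclideanreal F \<and> bounded (F ` topspace T) \<longrightarrow>
        (\<lambda>N. \<integral>x. F x \<partial>P N) \<longlonglongrightarrow> (\<integral>x. F x \<partial>Q))"


section \<open>The Matsumoto zeta-functions of class \<open>\<M>\<close>\<close>

text \<open>The \<open>m\<close>-th prime for \<open>m \<ge> 1\<close>; \<open>enumerate\<close> counts from \<open>0\<close>.\<close>

definition nth_prime :: "nat \<Rightarrow> nat" where
  "nth_prime m = enumerate {p. prime p} (m - 1)"

definition euler_poly ::
  "(nat \<Rightarrow> nat) \<Rightarrow> (nat \<Rightarrow> nat \<Rightarrow> nat) \<Rightarrow> (nat \<Rightarrow> nat \<Rightarrow> complex) \<Rightarrow> nat \<Rightarrow> complex \<Rightarrow> complex" where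
  "euler_poly g f a m X = (\<Prod>j = 1..g m. 1 - a m j * X ^ f j m)"

definition matsumoto_product ::
  "(nat \<Rightarrow> nat) \<Rightarrow> (nat \<Rightarrow> nat \<Rightarrow> nat) \<Rightarrow> (nat \<Rightarrow> nat \<Rightarrow> complex) \<Rightarrow> complex \<Rightarrow> complex" where
  "matsumoto_product g f a s =
     (\<Prod>i. inverse (euler_poly g f a (Suc i) (of_nat (nth_prime (Suc i)) powr (- s))))"

text \<open>
  \<open>\<phi>\<close> is the continued function, and \<open>\<sigma>\<^sub>0\<close> is part of the data since \<open>D\<^sub>\<phi>\<close> depends on it.
  Indices of \<open>g\<close>, \<open>f\<close>, \<open>a\<close>, \<open>c\<close> start at \<open>1\<close>; \<open>a m j\<close> stands for \<open>a\<^sub>m\<^sup>(\<^sup>j\<^sup>)\<close>. The expansion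
  \<open>dirichlet_series\<close> determines \<open>c k\<close> for \<open>k \<ge> 1\<close>. The predicate \<open>meromorphic_on\<close> leaves the
  values at a discrete set of points unspecified, whence \<open>analytic\<close>. The poles in the closed
  half-plane are finite in number, because they lie in a compact set.
\<close>

locale class_M =
  fixes g :: "nat \<Rightarrow> nat" and f :: "nat \<Rightarrow> nat \<Rightarrow> nat" and a :: "nat \<Rightarrow> nat \<Rightarrow> complex"
    and \<alpha>\<^sub>0 \<beta>\<^sub>0 \<sigma>\<^sub>0 :: real and c :: "nat \<Rightarrow> complex" and \<phi> :: "complex \<Rightarrow> complex"
  assumes exponents_nonneg: "\<alpha>\<^sub>0 \<ge> 0" "\<beta>\<^sub>0 \<ge> 0"
    and g_pos: "\<forall>m\<ge>1. g m \<ge> 1"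
    and f_pos: "\<forall>m\<ge>1. \<forall>j\<in>{1..g m}. f j m \<ge> 1"
    and g_bound: "\<exists>C\<^sub>1>0. \<forall>m\<ge>1. real (g m) \<le> C\<^sub>1 * real (nth_prime m) powr \<alpha>\<^sub>0"
    and a_bound: "\<forall>m\<ge>1. \<forall>j\<in>{1..g m}. cmod (a m j) \<le> real (nth_prime m) powr \<beta>\<^sub>0"
    and euler_product:
      "\<forall>s. Re s > 1 \<longrightarrow> \<phi> s = matsumoto_product g f a (s + of_real (\<alpha>\<^sub>0 + \<beta>\<^sub>0))"
    and dirichlet_series:
      "\<forall>s. Re s > 1 \<longrightarrow> (\<lambda>k. c (Suc k) * of_nat (Suc k) powr (- s)) sums \<phi> s"
    and sigma0: "1 / 2 \<le> \<sigma>\<^sub>0" "\<sigma>\<^sub>0 < 1"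
    and meromorphic: "\<phi> meromorphic_on {s. Re s \<ge> \<sigma>\<^sub>0}"
    and analytic: "\<phi> analytic_on {s. Re s \<ge> \<sigma>\<^sub>0 \<and> \<not> is_pole \<phi> s}"
    and poles:
      "\<exists>K. compact K \<and> K \<inter> {s. Re s = \<sigma>\<^sub>0} = {} \<and> {s. Re s \<ge> \<sigma>\<^sub>0 \<and> is_pole \<phi> s} \<subseteq> K"
    and growth:
      "\<exists>C\<^sub>2>0. \<exists>B t\<^sub>0. \<forall>s. Re s \<ge> \<sigma>\<^sub>0 \<and> \<bar>Im s\<bar> \<ge> t\<^sub>0 \<longrightarrow> cmod (\<phi> s) \<le> B * \<bar>Im s\<bar> powr C\<^sub>2"
    and mean_square: "(\<lambda>T. integral {0..T} (\<lambda>t. (cmod (\<phi> (Complex \<sigma>\<^sub>0 t)))\<^sup>2)) \<in> O(\<lambda>T. T)"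

definition D_phi :: "real \<Rightarrow> (complex \<Rightarrow> complex) \<Rightarrow> complex set" where
  "D_phi \<sigma>\<^sub>0 \<phi> = {s. Re s > \<sigma>\<^sub>0 \<and> (\<forall>z. Re z \<ge> \<sigma>\<^sub>0 \<and> is_pole \<phi> z \<longrightarrow> Re s \<noteq> Re z)}"


section \<open>Periodic Hurwitz zeta-functions\<close>

definition periodic_seq :: "(nat \<Rightarrow> complex) \<Rightarrow> bool" where
  "periodic_seq b \<longleftrightarrow> (\<exists>l>0. \<forall>m. b (m + l) = b m)"

definition min_period :: "(nat \<Rightarrow> complex) \<Rightarrow> nat" where
  "min_period b = (LEAST l. l > 0 \<and> (\<forall>m. b (m + l) = b m))"

definition period_mean :: "(nat \<Rightarrow> complex) \<Rightarrow> complex" where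
  "period_mean b = (\<Sum>r<min_period b. b r) / of_nat (min_period b)"

text \<open>
  The residue at \<open>1\<close> is \<open>period_mean b\<close>, so the continuation is entire iff this vanishes; by
  the identity theorem the conditions below determine the function outside the exceptional set.
\<close>

definition periodic_hurwitz_zeta :: "real \<Rightarrow> (nat \<Rightarrow> complex) \<Rightarrow> complex \<Rightarrow> complex" where
  "periodic_hurwitz_zeta \<alpha> b = (SOME Z.
     Z holomorphic_on (if period_mean b = 0 then UNIV else - {1}) \<and>
     (\<forall>s. Re s > 1 \<longrightarrow> (\<lambda>m. b m * of_real (real m + \<alpha>) powr (- s)) sums Z s))"

definition D_zeta :: "(nat \<Rightarrow> complex) \<Rightarrow> complex set" where
  "D_zeta b = (if period_mean b = 0 then {s. Re s > 1 / 2} else {s. Re s > 1 / 2 \<and> Re s \<noteq> 1})"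


section \<open>The set \<open>L(\<alpha>, h\<^sub>1, h\<^sub>2)\<close>\<close>

text \<open>
  Linear independence is that of the family, i.e. of the elements listed with multiplicity: a
  coincidence such as \<open>h\<^sub>1 log p = h\<^sub>2 log (m + \<alpha>)\<close> counts as a linear relation. (With such a
  coincidence \<open>p\<^sup>i\<^sup>k\<^sup>h\<^sup>1 = (m + \<alpha>)\<^sup>i\<^sup>k\<^sup>h\<^sup>2\<close> for all \<open>k\<close>, and the limit law would not be governed
  by the Haar measure on the full torus.)
\<close>

datatype L_index = Log_prime nat | Log_shift nat | Pi_elem

definition L_indices :: "L_index set" where
  "L_indices = Log_prime ` {p. prime p} \<union> range Log_shift \<union> {Pi_elem}"

fun L_elem :: "real \<Rightarrow> real \<Rightarrow> real \<Rightarrow> L_index \<Rightarrow> real" where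
  "L_elem \<alpha> h\<^sub>1 h\<^sub>2 (Log_prime p) = h\<^sub>1 * ln (real p)"
| "L_elem \<alpha> h\<^sub>1 h\<^sub>2 (Log_shift m) = h\<^sub>2 * ln (real m + \<alpha>)"
| "L_elem \<alpha> h\<^sub>1 h\<^sub>2 Pi_elem = pi"

definition rat_independent_family :: "'i set \<Rightarrow> ('i \<Rightarrow> real) \<Rightarrow> bool" where
  "rat_independent_family I v \<longleftrightarrow>
     inj_on v I \<and> \<not> module.dependent (\<lambda>(q::rat) (x::real). of_rat q * x) (v ` I)"


section \<open>Haar measure on the tori and the limiting random element\<close>

definition torus :: "'i set \<Rightarrow> ('i \<Rightarrow> complex) topology" where
  "torus I = product_topology (\<lambda>_. top_of_set (sphere 0 1)) I"

definition torus_mult :: "'i set \<Rightarrow> ('i \<Rightarrow> complex) \<Rightarrow> ('i \<Rightarrow> complex) \<Rightarrow> 'i \<Rightarrow> complex" where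
  "torus_mult I \<omega> x = (\<lambda>i\<in>I. \<omega> i * x i)"

definition is_prob_haar :: "'i set \<Rightarrow> ('i \<Rightarrow> complex) measure \<Rightarrow> bool" where
  "is_prob_haar I M \<longleftrightarrow> prob_space M \<and> space M = topspace (torus I) \<and>
     sets M = sets (borel_of (torus I)) \<and>
     (\<forall>\<omega>\<in>topspace (torus I). \<forall>A\<in>sets M. emeasure M (torus_mult I \<omega> ` A) = emeasure M A)"

definition haar_torus :: "'i set \<Rightarrow> ('i \<Rightarrow> complex) measure" where
  "haar_torus I = (THE M. is_prob_haar I M)"

text \<open>\<open>m\<^sub>H = m\<^sub>H\<^sub>1 \<times> m\<^sub>H\<^sub>2\<close> on \<open>\<Omega> = \<Omega>\<^sub>1 \<times> \<Omega>\<^sub>2\<close>.\<close>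

definition haar_Omega :: "((nat \<Rightarrow> complex) \<times> (nat \<Rightarrow> complex)) measure" where
  "haar_Omega = haar_torus {p. prime p} \<Otimes>\<^sub>M haar_torus UNIV"

definition omega_ext :: "(nat \<Rightarrow> complex) \<Rightarrow> nat \<Rightarrow> complex" where
  "omega_ext \<omega> m = (\<Prod>p\<in>prime_factors m. \<omega> p ^ multiplicity p m)"

text \<open>
  The sum of a series of functions as an element of \<open>H(D)\<close>. The random series below converge
  throughout \<open>D\<close>, and then to a holomorphic function, only for almost all \<open>\<omega>\<close>; on the
  exceptional null set the random element is given the value \<open>0\<close>.
\<close>

definition series_elem :: "complex set \<Rightarrow> (nat \<Rightarrow> complex \<Rightarrow> complex) \<Rightarrow> complex \<Rightarrow> complex" where
  "series_elem D u = (if \<forall>s\<in>D. summable (\<lambda>m. u m s) then (\<lambda>s\<in>D. \<Sum>m. u m s) else (\<lambda>s\<in>D. 0))"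

definition phi_random ::
  "(nat \<Rightarrow> complex) \<Rightarrow> complex set \<Rightarrow> (nat \<Rightarrow> complex) \<Rightarrow> complex \<Rightarrow> complex" where
  "phi_random c D \<omega> =
     series_elem D (\<lambda>k s. c (Suc k) * omega_ext \<omega> (Suc k) * of_nat (Suc k) powr (- s))"

definition zeta_random ::
  "real \<Rightarrow> (nat \<Rightarrow> complex) \<Rightarrow> complex set \<Rightarrow> (nat \<Rightarrow> complex) \<Rightarrow> complex \<Rightarrow> complex" where
  "zeta_random \<alpha> b D \<omega> =
     series_elem D (\<lambda>m s. b m * \<omega> m * of_real (real m + \<alpha>) powr (- s))"

definition H_prod ::
  "complex set \<Rightarrow> complex set \<Rightarrow> ((complex \<Rightarrow> complex) \<times> (complex \<Rightarrow> complex)) topology" where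
  "H_prod D\<^sub>1 D\<^sub>2 = prod_topology (hol_topology D\<^sub>1) (hol_topology D\<^sub>2)"

definition P_Z ::
  "(nat \<Rightarrow> complex) \<Rightarrow> real \<Rightarrow> (nat \<Rightarrow> complex) \<Rightarrow> complex set \<Rightarrow> complex set \<Rightarrow>
     ((complex \<Rightarrow> complex) \<times> (complex \<Rightarrow> complex)) measure" where
  "P_Z c \<alpha> b D\<^sub>1 D\<^sub>2 = distr haar_Omega (borel_of (H_prod D\<^sub>1 D\<^sub>2))
     (\<lambda>(\<omega>\<^sub>1, \<omega>\<^sub>2). (phi_random c D\<^sub>1 \<omega>\<^sub>1, zeta_random \<alpha> b D\<^sub>2 \<omega>\<^sub>2))"


section \<open>The discrete shifts\<close>

definition Z_shift ::
  "(complex \<Rightarrow> complex) \<Rightarrow> real \<Rightarrow> (nat \<Rightarrow> complex) \<Rightarrow> real \<Rightarrow> real \<Rightarrow> complex set \<Rightarrow> complex set \<Rightarrow>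
     nat \<Rightarrow> (complex \<Rightarrow> complex) \<times> (complex \<Rightarrow> complex)" where
  "Z_shift \<phi> \<alpha> b h\<^sub>1 h\<^sub>2 D\<^sub>1 D\<^sub>2 k =
     ((\<lambda>s\<in>D\<^sub>1. \<phi> (s + \<i> * of_nat k * of_real h\<^sub>1)),
      (\<lambda>s\<in>D\<^sub>2. periodic_hurwitz_zeta \<alpha> b (s + \<i> * of_nat k * of_real h\<^sub>2)))"

definition empirical :: "'a topology \<Rightarrow> (nat \<Rightarrow> 'a) \<Rightarrow> nat \<Rightarrow> 'a measure" where
  "empirical T X N = distr (uniform_count_measure {0..N}) (borel_of T) X"

lemma measure_empirical:
  assumes "\<And>k. k \<le> N \<Longrightarrow> X k \<in> topspace T" and "A \<in> sets (borel_of T)"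
  shows "measure (empirical T X N) A = 1 / real (N + 1) * real (card {k. 0 \<le> k \<and> k \<le> N \<and> X k \<in> A})"
proof -
  have meas: "X \<in> measurable (uniform_count_measure {0..N}) (borel_of T)"
    using assms(1) by (auto simp: measurable_def sets_uniform_count_measure space_uniform_count_measure)
  have "measure (empirical T X N) A =
      measure (uniform_count_measure {0..N}) (X -` A \<inter> {0..N})"
    unfolding empirical_def
    by (subst measure_distr[OF meas assms(2)]) (simp add: space_uniform_count_measure)
  also have "\<dots> = real (card (X -` A \<inter> {0..N})) / real (N + 1)"
    by (subst measure_uniform_count_measure) auto
  also have "X -` A \<inter> {0..N} = {k. 0 \<le> k \<and> k \<le> N \<and> X k \<in> A}" by auto
  finally show ?thesis by simp
qed

definition P_N ::
  "(complex \<Rightarrow> complex) \<Rightarrow> real \<Rightarrow> (nat \<Rightarrow> complex) \<Rightarrow> real \<Rightarrow> real \<Rightarrow> complex set \<Rightarrow> complex set \<Rightarrow>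
     nat \<Rightarrow> ((complex \<Rightarrow> complex) \<times> (complex \<Rightarrow> complex)) measure" where
  "P_N \<phi> \<alpha> b h\<^sub>1 h\<^sub>2 D\<^sub>1 D\<^sub>2 N = empirical (H_prod D\<^sub>1 D\<^sub>2) (Z_shift \<phi> \<alpha> b h\<^sub>1 h\<^sub>2 D\<^sub>1 D\<^sub>2) N"

end

theory Submission
  imports Defs "HOL-Real_Asymp.Real_Asymp"
begin

text \<open>
  Both components are treated alike, as a Dirichlet series \<open>\<Sum>a\<^sub>m (m + \<alpha>)\<^bsup>-s\<^esup>\<close> with a mean square of
  order \<open>T\<close> on the left edge of a strip and coefficients rotated by an orthonormal system of
  characters; the Euler product plays no role. Shifting a contour with the weight
  \<open>exp (z\<^sup>2 + n z) / z\<close> approximates the continued function at \<open>s + i k h\<close> by a Dirichlet polynomial,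
  with an error \<open>exp (- \<delta> n) w\<^sub>k\<close> uniform in \<open>s\<close>, where \<open>w\<^sub>k\<close> is bounded in mean. Parseval along the
  shifts carries this over to the coefficients in mean square, and a Rademacher--Menshov maximal
  inequality then shows that the same polynomials, with rotated coefficients, approximate the
  random series. For polynomials the theorem is equidistribution on the torus, a consequence of
  linear independence and the Stone--Weierstrass theorem. Continuous functionals are reduced to
  Lipschitz ones by infimal convolution, and for these the approximation errors are negligible.
\<close>

subsection \<open>Gaussian kernels\<close>

text \<open>The analytic input lives on one vertical line and above all poles: a mean square and
  polynomial growth. Bounds for the coefficients are therefore drawn from the function, and not
  conversely. The Gaussian factor exp (z^2) serves twice: it kills the horizontal sides of the
  contour against any power, and it makes sums over the shifts comparable with integrals, so that a
  continuous mean square controls discrete shifts. Infimal convolutions lie below the functional, so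
  lower bounds for F and for - F give weak convergence without any tightness argument. The number pi
  belongs to the independent family because the shifts are discrete: a character is constant along
  them as soon as its frequency is a multiple of 2 pi.\<close>

lemma gaussian_integral_le:
  fixes c p q x :: real
  assumes "c > 0"
  shows "integral {p..q} (\<lambda>t. exp (- (t - x)\<^sup>2 / (2 * c\<^sup>2))) \<le> sqrt (2 * pi * c\<^sup>2)"
proof -
  let ?f = "\<lambda>t. exp (- (t - x)\<^sup>2 / (2 * c\<^sup>2))"
  have eq: "?f t = sqrt (2 * pi * c\<^sup>2) * normal_density x c t" for t
    using assms by (simp add: normal_density_def)
  have int: "integrable lborel ?f"
    unfolding eq using assms by (intro integrable_mult_right integrable_normal_density)
  have si: "set_integrable lborel {p..q} ?f"
    unfolding set_integrable_def by (rule integrable_mult_indicator) (use int in auto)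
  have "integral {p..q} ?f = (LINT t:{p..q}|lborel. ?f t)"
    using si by (rule set_borel_integral_eq_integral(2)[symmetric])
  also have "\<dots> \<le> (LINT t|lborel. ?f t)"
    unfolding set_lebesgue_integral_def
    by (intro integral_mono int si[unfolded set_integrable_def]) (auto simp: indicator_def)
  also have "\<dots> = sqrt (2 * pi * c\<^sup>2)"
    unfolding eq using assms by simp
  finally show ?thesis .
qed

lemma gaussian_integral_le': "integral {p..q} (\<lambda>t::real. exp (- (t - x)\<^sup>2 / 2)) \<le> sqrt (2 * pi)"
  using gaussian_integral_le[of 1 p q x] by simp

text \<open>Each sample is compared with the integral of a Gaussian of variance 2 over the cell to
  its right: there (t - x)^2 \<le> 2 (x - k h)^2 + 2 h^2, so the shift within the cell costs the
  factor exp (h^2 / 2). The bound is free of x and N; this is what turns sums over shifts into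
  integrals.\<close>

lemma gaussian_sum_le:
  fixes h :: real
  assumes h: "h > 0"
  shows "(\<Sum>k<N. exp (- (x - real k * h)\<^sup>2 / 2)) \<le> exp (h\<^sup>2 / 2) / h * sqrt (4 * pi)"
proof -
  let ?g = "\<lambda>t. exp (- (t - x)\<^sup>2 / (2 * (sqrt 2)\<^sup>2))"
  have int: "?g integrable_on {p..q}" for p q
    by (intro integrable_continuous_real continuous_intros) auto
  have step: "exp (- (x - real k * h)\<^sup>2 / 2) \<le> exp (h\<^sup>2 / 2) / h * integral {real k * h..real (Suc k) * h} ?g" for k
  proof -
    let ?e = "exp (- (x - real k * h)\<^sup>2 / 2) / exp (h\<^sup>2 / 2)"
    have "integral {real k * h..real (Suc k) * h} (\<lambda>_. ?e) \<le> integral {real k * h..real (Suc k) * h} ?g"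
    proof (rule integral_le)
      fix t assume t: "t \<in> {real k * h..real (Suc k) * h}"
      have 1: "(real k * h - t)\<^sup>2 \<le> h\<^sup>2"
        using t h by (intro power2_le_iff_abs_le[THEN iffD2]) (auto simp: algebra_simps)
      have "(t - x)\<^sup>2 \<le> 2 * (x - real k * h)\<^sup>2 + 2 * (real k * h - t)\<^sup>2"
        using sum_squares_bound[of "x - real k * h" "real k * h - t"]
        by (simp add: power2_eq_square algebra_simps)
      then have "(t - x)\<^sup>2 \<le> 2 * (x - real k * h)\<^sup>2 + 2 * h\<^sup>2" using 1 by linarith
      then show "?e \<le> ?g t" by (simp add: exp_diff[symmetric] field_simps)
    qed (use int in auto)
    then show ?thesis using h by (simp add: field_simps)
  qed
  have "(\<Sum>k<N. exp (- (x - real k * h)\<^sup>2 / 2))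
      \<le> exp (h\<^sup>2 / 2) / h * integral {0..real N * h} ?g"
  proof (induction N)
    case (Suc N)
    have "integral {0..real N * h} ?g + integral {real N * h..real (Suc N) * h} ?g
        = integral {0..real (Suc N) * h} ?g"
      by (rule Henstock_Kurzweil_Integration.integral_combine) (use h int in \<open>auto simp: algebra_simps\<close>)
    then show ?case using add_mono[OF Suc.IH step[of N]]
      by (simp only: sum.lessThan_Suc flip: distrib_left)
  qed simp
  also have "\<dots> \<le> exp (h\<^sup>2 / 2) / h * sqrt (4 * pi)"
    using gaussian_integral_le[of "sqrt 2" 0 "real N * h" x] h
    by (intro mult_left_mono) (auto simp: algebra_simps)
  finally show ?thesis .
qed

text \<open>Cauchy's formula at 0 on a rectangle. The right side is kept as an integral because it
  becomes the Dirichlet polynomial; on the left side |z| \<ge> p gives the factor 1 / p; the two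
  horizontal sides have length p + q each.\<close>

lemma rect_cauchy_bound:
  fixes g :: "complex \<Rightarrow> complex" and p q U B :: real
  assumes pos: "p > 0" "q > 0" "U > 0"
    and hol: "g holomorphic_on cbox (Complex (-p) (-U)) (Complex q U)"
    and B: "\<And>z. -p \<le> Re z \<Longrightarrow> Re z \<le> q \<Longrightarrow> \<bar>Im z\<bar> = U \<Longrightarrow> cmod (g z / z) \<le> B"
  shows "cmod (complex_of_real (2 * pi) * g 0 - integral {-U..U} (\<lambda>u. g (Complex q u) / Complex q u))
     \<le> integral {-U..U} (\<lambda>u. cmod (g (Complex (-p) u))) / p + 2 * (p + q) * B"
proof -
  define a b c d where "a = Complex (-p) (-U)" "b = Complex q (-U)" "c = Complex q U" "d = Complex (-p) U"
  note abcd = a_b_c_d_def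
  define f where "f = (\<lambda>z. g z / z)"
  let ?R = "cbox a c"
  have mem: "z \<in> ?R \<longleftrightarrow> -p \<le> Re z \<and> Re z \<le> q \<and> -U \<le> Im z \<and> Im z \<le> U" for z
    by (auto simp: abcd in_cbox_complex_iff)
  have contg: "continuous_on ?R g"
    using hol unfolding abcd by (rule holomorphic_on_imp_continuous_on)
  have contf: "continuous_on (?R - {0}) f"
    unfolding f_def using contg by (intro continuous_intros) (auto intro: continuous_on_subset)
  have seg: "closed_segment x y \<subseteq> ?R" if "x \<in> ?R" "y \<in> ?R" for x y
    using that by (intro closed_segment_subset) (auto simp: convex_box)
  have corners: "a \<in> ?R" "b \<in> ?R" "c \<in> ?R" "d \<in> ?R" using pos by (auto simp: mem) (auto simp: abcd)
  have zero: "0 \<in> box a c" using pos by (auto simp: abcd in_box_complex_iff)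
  have img: "path_image (rectpath a c) \<subseteq> ?R - {0}"
    using path_image_rectpath_cbox_minus_box[of a c] pos zero by (auto simp: abcd)
  have C: "((\<lambda>w. g w / (w - 0)) has_contour_integral
      complex_of_real (2 * pi) * \<i> * winding_number (rectpath a c) 0 * g 0) (rectpath a c)"
    by (rule Cauchy_integral_formula_convex_simple[of ?R])
       (use hol zero img in \<open>auto simp: abcd convex_box interior_cbox\<close>)
  have rp: "rectpath a c = linepath a b +++ linepath b c +++ linepath c d +++ linepath d a"
    by (simp add: rectpath_def abcd Let_def)
  have zseg: "0 \<notin> closed_segment a b" "0 \<notin> closed_segment b c" "0 \<notin> closed_segment c d" "0 \<notin> closed_segment d a"
    using img unfolding rp by (auto simp: path_image_join)
  have ci: "f contour_integrable_on linepath x y"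
    if "x \<in> ?R" "y \<in> ?R" "0 \<notin> closed_segment x y" for x y
    by (rule contour_integrable_continuous_linepath, rule continuous_on_subset[OF contf])
       (use seg[OF that(1,2)] that(3) in auto)
  note cis = ci[OF corners(1,2) zseg(1)] ci[OF corners(2,3) zseg(2)] ci[OF corners(3,4) zseg(3)] ci[OF corners(4,1) zseg(4)]
  define R where "R = integral {-U..U} (\<lambda>u. g (Complex q u) / Complex q u)"
  define L where "L = integral {-U..U} (\<lambda>u. f (Complex (-p) u))"
  have I2: "contour_integral (linepath b c) f = \<i> * R"
    unfolding R_def f_def by (rule contour_integral_linepath_same_Re) (use pos in \<open>auto simp: abcd\<close>)
  have "contour_integral (linepath d a) f = - contour_integral (linepath a d) f"
    by (rule contour_integral_reverse_linepath, rule continuous_on_subset[OF contf])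
       (use seg corners zseg in \<open>auto simp: closed_segment_commute\<close>)
  also have "contour_integral (linepath a d) f = \<i> * L"
    unfolding L_def by (rule contour_integral_linepath_same_Re) (use pos in \<open>auto simp: abcd\<close>)
  finally have I4: "contour_integral (linepath d a) f = - (\<i> * L)" .
  define I1 where "I1 = contour_integral (linepath a b) f"
  define I3 where "I3 = contour_integral (linepath c d) f"
  have "contour_integral (rectpath a c) f = I1 + (\<i> * R + (I3 + - (\<i> * L)))"
    unfolding rp I2[symmetric] I4[symmetric] I1_def I3_def
    by (simp add: contour_integral_join cis valid_path_join contour_integrable_joinI)
  moreover have "contour_integral (rectpath a c) f = 2 * pi * \<i> * g 0"
    using contour_integral_unique[OF C] winding_number_rectpath[OF zero] by (simp add: f_def)
  ultimately have "2 * pi * \<i> * g 0 = I1 + (\<i> * R + (I3 + - (\<i> * L)))" by simp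
  then have "\<i> * (2 * pi * g 0 - R + L) = I1 + I3" by (simp add: algebra_simps)
  then have "2 * pi * g 0 - R + L = (I1 + I3) / \<i>"
    by (metis complex_i_not_zero nonzero_mult_div_cancel_left)
  then have "2 * pi * g 0 - R = (I1 + I3) / \<i> - L" by (simp add: algebra_simps)
  then have 1: "cmod (2 * pi * g 0 - R) \<le> cmod I1 + cmod I3 + cmod L"
    using norm_triangle_ineq4[of "(I1 + I3) / \<i>" L] norm_triangle_ineq[of I1 I3]
    by (simp add: norm_divide norm_mult)
  have B0: "B \<ge> 0" using B[of a] pos by (auto simp: abcd intro: order.trans[OF norm_ge_zero])
  have "cmod I1 \<le> B * cmod (b - a)" unfolding I1_def
  proof (rule contour_integral_bound_linepath[OF cis(1) B0])
    fix x assume x: "x \<in> closed_segment a b"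
    obtain u where "x = (1 - u) *\<^sub>R a + u *\<^sub>R b" using x by (auto simp: closed_segment_def)
    then have "Im x = (1 - u) * Im a + u * Im b" by simp
    then have "Im x = -U" by (simp add: abcd algebra_simps)
    then show "cmod (f x) \<le> B" unfolding f_def using seg[OF corners(1,2)] x pos by (intro B) (auto simp: mem)
  qed
  also have "cmod (b - a) = p + q" using pos by (simp add: abcd complex_diff cmod_def)
  finally have b1: "cmod I1 \<le> (p + q) * B" by (simp add: mult.commute)
  have "cmod I3 \<le> B * cmod (d - c)" unfolding I3_def
  proof (rule contour_integral_bound_linepath[OF cis(3) B0])
    fix x assume x: "x \<in> closed_segment c d"
    obtain u where "x = (1 - u) *\<^sub>R c + u *\<^sub>R d" using x by (auto simp: closed_segment_def)
    then have "Im x = (1 - u) * Im c + u * Im d" by simp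
    then have "Im x = U" by (simp add: abcd algebra_simps)
    then show "cmod (f x) \<le> B" unfolding f_def using seg[OF corners(3,4)] x pos by (intro B) (auto simp: mem)
  qed
  also have "cmod (d - c) = p + q" using pos by (simp add: abcd complex_diff cmod_def)
  finally have b3: "cmod I3 \<le> (p + q) * B" by (simp add: mult.commute)
  have cl: "continuous_on {-U..U} (\<lambda>u. g (Complex (-p) u))"
    by (rule continuous_on_compose2[OF contg]) (use pos in \<open>auto simp: mem intro!: continuous_intros\<close>)
  have "cmod L \<le> integral {-U..U} (\<lambda>u. cmod (g (Complex (-p) u)) / p)"
    unfolding L_def f_def
  proof (rule integral_norm_bound_integral)
    have ne: "Complex (-p) u \<noteq> 0" for u using pos by (simp add: complex_eq_iff)
    show "(\<lambda>u. g (Complex (-p) u) / Complex (-p) u) integrable_on {-U..U}"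
      using ne by (intro integrable_continuous_real continuous_intros cl) auto
    show "(\<lambda>u. cmod (g (Complex (-p) u)) / p) integrable_on {-U..U}"
      using pos by (intro integrable_continuous_real continuous_intros cl) auto
    fix u
    have "p \<le> cmod (Complex (-p) u)" using abs_Re_le_cmod[of "Complex (-p) u"] pos by simp
    then show "cmod (g (Complex (-p) u) / Complex (-p) u) \<le> cmod (g (Complex (-p) u)) / p"
      using pos by (simp add: norm_divide frac_le)
  qed
  then have "cmod L \<le> integral {-U..U} (\<lambda>u. cmod (g (Complex (-p) u))) / p" by simp
  then show ?thesis using 1 b1 b3 unfolding R_def by (simp add: algebra_simps)
qed

section \<open>The smoothing weight\<close>

lemma norm_exp_square_plus:
  "cmod (exp (z\<^sup>2 + of_real x * z)) = exp ((Re z)\<^sup>2 - (Im z)\<^sup>2 + x * Re z)"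
  by (simp add: norm_exp_eq_Re power2_eq_square)

text \<open>The integrand of the inversion integral of exp (z^2 + x z) / z on the line of real part
  3. Adding 3 to a point of real part at least 1/2 leads to real part at least 7/2, well inside
  absolute convergence.\<close>

definition smooth_kernel :: "real \<Rightarrow> real \<Rightarrow> complex" where
  "smooth_kernel x u = exp ((Complex 3 u)\<^sup>2 + of_real x * Complex 3 u) / Complex 3 u"

text \<open>A smoothed step function, in fact the distribution function of the centred normal law of
  variance 2. The coefficient of index m receives its value at n - ln (m + \<alpha>), so the cutoff
  sits near exp n.\<close>

definition smooth_weight :: "real \<Rightarrow> complex" where
  "smooth_weight x = (LINT u|lborel. smooth_kernel x u) / (2 * pi)"

lemma norm_smooth_kernel_le: "cmod (smooth_kernel x u) \<le> exp (9 + 3 * x) * exp (- u\<^sup>2 / 2)"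
proof -
  have "1 \<le> cmod (Complex 3 u)" using abs_Re_le_cmod[of "Complex 3 u"] by simp
  then have "cmod (smooth_kernel x u) \<le> exp (9 - u\<^sup>2 + x * 3) / 1"
    unfolding smooth_kernel_def norm_divide norm_exp_square_plus by (intro frac_le) auto
  also have "\<dots> \<le> exp (9 + 3 * x + - u\<^sup>2 / 2)" by simp
  finally show ?thesis by (simp only: exp_add)
qed

lemma continuous_on_smooth_kernel: "continuous_on A (smooth_kernel x)"
  unfolding smooth_kernel_def by (intro continuous_intros) (auto simp: complex_eq_iff)

lemma smooth_kernel_measurable [measurable]: "smooth_kernel x \<in> borel_measurable borel"
  by (intro borel_measurable_continuous_onI continuous_on_smooth_kernel)

text \<open>The contour has finite height, so the weight first appears as a truncated integral; the
  Gaussian decay of the kernel gives the limit by dominated convergence.\<close>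

lemma tendsto_smooth_weight:
  "((\<lambda>U. integral {-U..U} (smooth_kernel x)) \<longlongrightarrow> 2 * pi * smooth_weight x) at_top"
proof -
  have gi: "integrable lborel (\<lambda>u. exp (9 + 3 * x) * exp (- u\<^sup>2 / 2))"
  proof (rule integrable_mult_right)
    have "(\<lambda>u::real. exp (- u\<^sup>2 / 2)) = (\<lambda>u. sqrt (2 * pi) * normal_density 0 1 u)"
      by (auto simp: normal_density_def)
    then show "integrable lborel (\<lambda>u::real. exp (- u\<^sup>2 / 2))" by simp
  qed
  have "((\<lambda>U. LINT u|lborel. indicator {-U..U} u *\<^sub>R smooth_kernel x u) \<longlongrightarrow> (LINT u|lborel. smooth_kernel x u)) at_top"
  proof (rule integral_dominated_convergence_at_top[OF _ _ gi])
    show "AE u in lborel. ((\<lambda>U. indicator {-U..U} u *\<^sub>R smooth_kernel x u) \<longlongrightarrow> smooth_kernel x u) at_top"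
    proof (rule AE_I2, rule tendsto_eventually)
      fix u :: real
      show "\<forall>\<^sub>F U in at_top. indicator {-U..U} u *\<^sub>R smooth_kernel x u = smooth_kernel x u"
        using eventually_ge_at_top[of "\<bar>u\<bar>"] by eventually_elim (auto simp: abs_le_iff minus_le_iff)
    qed
    show "\<forall>\<^sub>F U in at_top. AE u in lborel. cmod (indicator {-U..U} u *\<^sub>R smooth_kernel x u) \<le> exp (9 + 3 * x) * exp (- u\<^sup>2 / 2)"
      by (intro always_eventually allI AE_I2) (use norm_smooth_kernel_le[of x] in \<open>auto simp: indicator_def\<close>)
  qed auto
  moreover have "(LINT u|lborel. indicator {-U..U} u *\<^sub>R smooth_kernel x u) = integral {-U..U} (smooth_kernel x)" for U
  proof -
    have "set_integrable lborel {-U..U} (smooth_kernel x)"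
      by (rule borel_integrable_atLeastAtMost') (rule continuous_on_smooth_kernel)
    from set_borel_integral_eq_integral(2)[OF this] show ?thesis by (simp add: set_lebesgue_integral_def)
  qed
  ultimately show ?thesis by (simp add: smooth_weight_def)
qed

text \<open>The residue at 0 is 1. Moving the line from real part 3 to real part -1 leaves at most
  exp (1 - x) sqrt (2 pi), and the horizontal sides vanish as U grows.\<close>

lemma smooth_weight_tendsto_1: "(smooth_weight \<longlongrightarrow> 1) at_top"
proof -
  have lim: "((\<lambda>U. A + 8 * (exp (9 - U\<^sup>2 + 3 * x) / U)) \<longlongrightarrow> A) at_top" for A x :: real
    by real_asymp
  have bound: "cmod (2 * pi * 1 - 2 * pi * smooth_weight x) \<le> exp (1 - x) * sqrt (2 * pi)" if x: "x > 0" for x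
  proof (rule tendsto_le[of at_top])
    show "((\<lambda>U. exp (1 - x) * sqrt (2 * pi) + 8 * (exp (9 - U\<^sup>2 + 3 * x) / U)) \<longlongrightarrow> exp (1 - x) * sqrt (2 * pi)) at_top"
      by (rule lim)
    show "((\<lambda>U. cmod (2 * pi * 1 - integral {-U..U} (smooth_kernel x))) \<longlongrightarrow> cmod (2 * pi * 1 - 2 * pi * smooth_weight x)) at_top"
      by (intro tendsto_intros tendsto_smooth_weight)
    show "\<forall>\<^sub>F U in at_top. cmod (2 * pi * 1 - integral {-U..U} (smooth_kernel x))
        \<le> exp (1 - x) * sqrt (2 * pi) + 8 * (exp (9 - U\<^sup>2 + 3 * x) / U)"
      using eventually_gt_at_top[of 0]
    proof eventually_elim
      case (elim U)
      let ?g = "\<lambda>z. exp (z\<^sup>2 + of_real x * z)"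
      have 7: "cmod (complex_of_real (2 * pi) * ?g 0 - integral {-U..U} (\<lambda>u. ?g (Complex 3 u) / Complex 3 u))
        \<le> integral {-U..U} (\<lambda>u. cmod (?g (Complex (-1) u))) / 1 + 2 * (1 + 3) * (exp (9 - U\<^sup>2 + 3 * x) / U)"
      proof (rule rect_cauchy_bound)
        show "?g holomorphic_on cbox (Complex (- 1) (- U)) (Complex 3 U)" by (intro holomorphic_intros)
        fix z assume z: "- 1 \<le> Re z" "Re z \<le> 3" "\<bar>Im z\<bar> = U"
        have 1: "(Re z)\<^sup>2 \<le> 3\<^sup>2" using z by (intro power2_le_iff_abs_le[THEN iffD2]) auto
        have 2: "x * Re z \<le> 3 * x" using z x by simp
        have 3: "(Im z)\<^sup>2 = U\<^sup>2" using z by (metis power2_abs)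
        have 4: "U \<le> cmod z" using z abs_Im_le_cmod[of z] by simp
        show "cmod (?g z / z) \<le> exp (9 - U\<^sup>2 + 3 * x) / U"
          unfolding norm_divide norm_exp_square_plus using 1 2 3 4 elim by (intro frac_le) auto
      qed (use elim in auto)
      have 5: "integral {-U..U} (\<lambda>u. cmod (?g (Complex (-1) u))) \<le> integral {-U..U} (\<lambda>u. exp (1 - x) * exp (- (u - 0)\<^sup>2 / 2))"
      proof (rule integral_le)
        show "(\<lambda>u. cmod (?g (Complex (-1) u))) integrable_on {-U..U}"
          by (intro integrable_continuous_real continuous_intros)
        show "(\<lambda>u. exp (1 - x) * exp (- (u - 0)\<^sup>2 / 2)) integrable_on {-U..U}"
          by (intro integrable_continuous_real continuous_intros) auto
        show "cmod (?g (Complex (-1) u)) \<le> exp (1 - x) * exp (- (u - 0)\<^sup>2 / 2)" for u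
          unfolding norm_exp_square_plus by (simp flip: exp_add)
      qed
      have "integral {-U..U} (\<lambda>u. exp (1 - x) * exp (- (u - 0)\<^sup>2 / 2)) \<le> exp (1 - x) * sqrt (2 * pi)"
        using gaussian_integral_le'[of "-U" U 0] by simp
      with 5 have 6: "integral {-U..U} (\<lambda>u. cmod (?g (Complex (-1) u))) \<le> exp (1 - x) * sqrt (2 * pi)"
        by (rule order.trans)
      show ?case using order.trans[OF 7 add_right_mono] 6 by (simp add: smooth_kernel_def[abs_def])
    qed
  qed auto
  have "((\<lambda>x. 2 * pi * 1 - 2 * pi * smooth_weight x) \<longlongrightarrow> 0) at_top"
  proof (rule Lim_null_comparison)
    show "\<forall>\<^sub>F x in at_top. cmod (2 * pi * 1 - 2 * pi * smooth_weight x) \<le> exp (1 - x) * sqrt (2 * pi)"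
      using eventually_gt_at_top[of 0] by eventually_elim (rule bound)
    show "((\<lambda>x. exp (1 - x) * sqrt (2 * pi)) \<longlongrightarrow> 0) at_top" by real_asymp
  qed
  then have "((\<lambda>x. 1 - (2 * pi * 1 - 2 * pi * smooth_weight x) / of_real (2 * pi)) \<longlongrightarrow> 1 - 0 / complex_of_real (2 * pi)) at_top"
    by (intro tendsto_intros) auto
  then show ?thesis by (simp add: diff_divide_distrib)
qed

subsection \<open>Mean approximation by Dirichlet polynomials on a vertical strip\<close>

lemma summable_shift_powr:
  fixes \<alpha> p :: real
  assumes "\<alpha> > 0" "p > 1"
  shows "summable (\<lambda>m. (real m + \<alpha>) powr (- p))"
proof (rule summable_comparison_test')
  show "summable (\<lambda>m. real m powr (- p))" using assms by (simp add: summable_real_powr_iff)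
  fix m :: nat assume "m \<ge> 1"
  then show "norm ((real m + \<alpha>) powr (- p)) \<le> real m powr (- p)"
    using assms by (simp add: powr_mono2')
qed

lemma norm_shift_powr:
  assumes "\<alpha> > 0"
  shows "cmod (complex_of_real (real m + \<alpha>) powr s) = (real m + \<alpha>) powr Re s"
  using assms by (simp add: norm_powr_real_powr del: of_real_add)

definition dpoly :: "real \<Rightarrow> (nat \<Rightarrow> complex) \<Rightarrow> nat \<Rightarrow> complex \<Rightarrow> complex" where
  "dpoly \<alpha> x M s = (\<Sum>m<M. x m * complex_of_real (real m + \<alpha>) powr (- s))"

text \<open>Cauchy's formula for F (s + z) exp (z^2 + n z) / z. On the left side, at real part
  \<open>\<sigma>\<^sub>0\<close>, the weight gains exp (- n p); on the right side the Dirichlet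
  series converges absolutely and is cut at M, the rest costing \<tau> times the mass of the
  kernel.\<close>

lemma smoothing_estimate:
  fixes F :: "complex \<Rightarrow> complex" and a :: "nat \<Rightarrow> complex"
  assumes \<alpha>: "\<alpha> > 0" and p: "p > 0" and U: "U > 0" and n: "n \<ge> 0" and M: "M \<ge> 1"
    and hol: "F holomorphic_on {z. Re z \<ge> \<sigma>\<^sub>0 \<and> Im z \<ge> T\<^sub>0}"
    and s: "Re s = \<sigma>\<^sub>0 + p" "Im s - U \<ge> T\<^sub>0" and \<sigma>\<^sub>0: "\<sigma>\<^sub>0 \<ge> 1 / 2"
    and series: "\<And>z. Re z > 1 \<Longrightarrow> (\<lambda>m. a m * complex_of_real (real m + \<alpha>) powr (- z)) sums F z"
    and summ: "summable (\<lambda>m. cmod (a m) * (real m + \<alpha>) powr (- 7 / 2))"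
    and tail: "(\<Sum>m. cmod (a (m + M)) * (real (m + M) + \<alpha>) powr (- 7 / 2)) \<le> \<tau>"
    and Bh: "\<And>z. \<sigma>\<^sub>0 \<le> Re z \<Longrightarrow> Re z \<le> Re s + 3 \<Longrightarrow> \<bar>Im z - Im s\<bar> = U \<Longrightarrow> cmod (F z) \<le> Bh"
  shows "cmod (complex_of_real (2 * pi) * F s - (\<Sum>m<M. a m * complex_of_real (real m + \<alpha>) powr (- s) *
            integral {-U..U} (smooth_kernel (n - ln (real m + \<alpha>)))))
     \<le> exp (p\<^sup>2 - n * p) / p * integral {-U..U} (\<lambda>u. cmod (F (Complex \<sigma>\<^sub>0 (Im s + u))) * exp (- u\<^sup>2))
       + 2 * (p + 3) * (Bh * exp ((p + 3)\<^sup>2 - U\<^sup>2 + 3 * n) / U) + \<tau> * exp (9 + 3 * n) * sqrt (2 * pi)"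
proof -
  define g where "g = (\<lambda>z. F (s + z) * exp (z\<^sup>2 + of_real n * z))"
  define tl where "tl = (\<lambda>u. F (s + Complex 3 u) - (\<Sum>m<M. a m * complex_of_real (real m + \<alpha>) powr (- (s + Complex 3 u))))"
  let ?R = "cbox (Complex (-p) (-U)) (Complex 3 U)"
  let ?H = "{z. Re z \<ge> \<sigma>\<^sub>0 \<and> Im z \<ge> T\<^sub>0}"
  let ?I = "\<lambda>m. integral {-U..U} (smooth_kernel (n - ln (real m + \<alpha>)))"
  have mem: "z \<in> ?R \<longleftrightarrow> -p \<le> Re z \<and> Re z \<le> 3 \<and> -U \<le> Im z \<and> Im z \<le> U" for z
    by (auto simp: in_cbox_complex_iff)
  have sh: "s + z \<in> ?H" if "z \<in> ?R" for z using that s by (auto simp: mem)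
  have holF: "(\<lambda>z. F (s + z)) holomorphic_on ?R"
    by (rule holomorphic_on_compose_gen[OF _ hol, of "\<lambda>z. s + z" ?R, unfolded o_def])
       (use sh in \<open>auto intro!: holomorphic_intros\<close>)
  have 1: "cmod (complex_of_real (2 * pi) * g 0 - integral {-U..U} (\<lambda>u. g (Complex 3 u) / Complex 3 u))
     \<le> integral {-U..U} (\<lambda>u. cmod (g (Complex (-p) u))) / p + 2 * (p + 3) * (Bh * exp ((p + 3)\<^sup>2 - U\<^sup>2 + 3 * n) / U)"
  proof (rule rect_cauchy_bound)
    show "g holomorphic_on ?R" unfolding g_def by (intro holomorphic_intros holF)
    fix z assume z: "-p \<le> Re z" "Re z \<le> 3" "\<bar>Im z\<bar> = U"
    have b1: "cmod (F (s + z)) \<le> Bh" using z s by (intro Bh) auto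
    have b2: "(Re z)\<^sup>2 \<le> (p + 3)\<^sup>2" using z p by (intro power2_le_iff_abs_le[THEN iffD2]) auto
    have b3: "n * Re z \<le> 3 * n" using z n by (metis mult.commute mult_left_mono)
    have b4: "(Im z)\<^sup>2 = U\<^sup>2" using z by (metis power2_abs)
    have b5: "U \<le> cmod z" using z abs_Im_le_cmod[of z] by simp
    show "cmod (g z / z) \<le> Bh * exp ((p + 3)\<^sup>2 - U\<^sup>2 + 3 * n) / U"
      unfolding g_def norm_divide norm_mult norm_exp_square_plus
      using b1 b2 b3 b4 b5 U order.trans[OF norm_ge_zero b1] by (intro frac_le mult_mono) auto
  qed (use p U in auto)
  have contR: "continuous_on {-U..U} (\<lambda>u. F (s + Complex 3 u))"
    by (rule continuous_on_compose2[OF holomorphic_on_imp_continuous_on[OF holF]])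
       (use p in \<open>auto simp: mem intro!: continuous_intros\<close>)
  have lpos: "real m + \<alpha> > 0" for m using \<alpha> by simp
  have lne: "complex_of_real (real m + \<alpha>) \<noteq> 0" for m using lpos[of m] by (metis less_irrefl of_real_eq_0_iff)
  have contT: "continuous_on {-U..U} tl"
    unfolding tl_def using contR lne lpos[THEN less_imp_le] by (intro continuous_intros) auto
  \<comment> \<open>The factor (m + \<alpha>)^(-z) is exp (- z ln (m + \<alpha>)): inside the kernel
    it merely replaces n by n - ln (m + \<alpha>).\<close>
  have ker: "complex_of_real (real m + \<alpha>) powr (- (s + Complex 3 u)) * smooth_kernel n u =
      complex_of_real (real m + \<alpha>) powr (- s) * smooth_kernel (n - ln (real m + \<alpha>)) u" for m u
    using lne[of m] lpos[of m]
    by (simp add: smooth_kernel_def powr_def Ln_of_real algebra_simps flip: exp_add del: of_real_add)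
  have Ieq: "integral {-U..U} (\<lambda>u. g (Complex 3 u) / Complex 3 u) =
      (\<Sum>m<M. a m * complex_of_real (real m + \<alpha>) powr (- s) * ?I m) + integral {-U..U} (\<lambda>u. tl u * smooth_kernel n u)"
  proof -
    have "g (Complex 3 u) / Complex 3 u = (\<Sum>m<M. a m * complex_of_real (real m + \<alpha>) powr (- s) * smooth_kernel (n - ln (real m + \<alpha>)) u) + tl u * smooth_kernel n u" for u
    proof -
      have "g (Complex 3 u) / Complex 3 u = F (s + Complex 3 u) * smooth_kernel n u"
        by (simp add: g_def smooth_kernel_def)
      also have "F (s + Complex 3 u) = (\<Sum>m<M. a m * complex_of_real (real m + \<alpha>) powr (- (s + Complex 3 u))) + tl u"
        by (simp add: tl_def)
      finally show ?thesis by (simp only: distrib_right sum_distrib_right mult.assoc ker)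
    qed
    then have "integral {-U..U} (\<lambda>u. g (Complex 3 u) / Complex 3 u) = integral {-U..U} (\<lambda>u. 
      (\<Sum>m<M. a m * complex_of_real (real m + \<alpha>) powr (- s) * smooth_kernel (n - ln (real m + \<alpha>)) u) + tl u * smooth_kernel n u)"
      by simp
    also have "\<dots> = integral {-U..U} (\<lambda>u. (\<Sum>m<M. a m * complex_of_real (real m + \<alpha>) powr (- s) * smooth_kernel (n - ln (real m + \<alpha>)) u)) + integral {-U..U} (\<lambda>u. tl u * smooth_kernel n u)"
      by (intro Henstock_Kurzweil_Integration.integral_add integrable_continuous_real continuous_intros continuous_on_smooth_kernel contT)
    also have "integral {-U..U} (\<lambda>u. (\<Sum>m<M. a m * complex_of_real (real m + \<alpha>) powr (- s) * smooth_kernel (n - ln (real m + \<alpha>)) u))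
       = (\<Sum>m<M. integral {-U..U} (\<lambda>u. a m * complex_of_real (real m + \<alpha>) powr (- s) * smooth_kernel (n - ln (real m + \<alpha>)) u))"
      by (intro integral_sum integrable_continuous_real continuous_intros continuous_on_smooth_kernel) auto
    finally show ?thesis by simp
  qed
  have tlb: "cmod (tl u) \<le> \<tau>" for u
  proof -
    let ?z = "s + Complex 3 u"
    let ?f = "\<lambda>m. a m * complex_of_real (real m + \<alpha>) powr (- ?z)"
    have S: "?f sums F ?z" using s p \<sigma>\<^sub>0 by (intro series) auto
    have "(\<lambda>m. ?f (m + M)) sums tl u"
      unfolding tl_def using S by (rule sums_split_initial_segment)
    then have "tl u = (\<Sum>m. ?f (m + M))" by (rule sums_unique)
    also have "cmod \<dots> \<le> (\<Sum>m. cmod (a (m + M)) * (real (m + M) + \<alpha>) powr (- 7 / 2))"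
    proof (rule norm_suminf_le)
      show "summable (\<lambda>m. cmod (a (m + M)) * (real (m + M) + \<alpha>) powr (- 7 / 2))"
        using summ by (rule summable_ignore_initial_segment)
      fix m
      \<comment> \<open>The base is at least 1 because M \<ge> 1, and the real part is at least 1/2
        + 3 = 7/2.\<close>
      have "(real (m + M) + \<alpha>) powr (- Re ?z) \<le> (real (m + M) + \<alpha>) powr (- 7 / 2)"
        using M \<alpha> s p \<sigma>\<^sub>0 by (intro powr_mono) auto
      then show "cmod (?f (m + M)) \<le> cmod (a (m + M)) * (real (m + M) + \<alpha>) powr (- 7 / 2)"
        using norm_shift_powr[OF \<alpha>, of "m + M" "- ?z"] by (simp add: norm_mult mult_left_mono)
    qed
    finally show ?thesis using tail by simp
  qed
  have "cmod (integral {-U..U} (\<lambda>u. tl u * smooth_kernel n u)) \<le> integral {-U..U} (\<lambda>u. \<tau> * exp (9 + 3 * n) * exp (- (u - 0)\<^sup>2 / 2))"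
  proof (rule integral_norm_bound_integral)
    show "cmod (tl u * smooth_kernel n u) \<le> \<tau> * exp (9 + 3 * n) * exp (- (u - 0)\<^sup>2 / 2)" for u
      using mult_mono[OF tlb[of u] norm_smooth_kernel_le[of n u]] order.trans[OF norm_ge_zero tlb[of u]]
      by (simp add: norm_mult mult_ac)
  qed (auto intro!: integrable_continuous_real continuous_intros contT continuous_on_smooth_kernel)
  also have "\<dots> = \<tau> * exp (9 + 3 * n) * integral {-U..U} (\<lambda>u. exp (- (u - 0)\<^sup>2 / 2))" by simp
  also have "\<dots> \<le> \<tau> * exp (9 + 3 * n) * sqrt (2 * pi)"
    using order.trans[OF norm_ge_zero tlb[of 0]] by (intro mult_left_mono gaussian_integral_le') auto
  finally have 2: "cmod (integral {-U..U} (\<lambda>u. tl u * smooth_kernel n u)) \<le> \<tau> * exp (9 + 3 * n) * sqrt (2 * pi)" .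
  have 3: "integral {-U..U} (\<lambda>u. cmod (g (Complex (-p) u))) / p =
     exp (p\<^sup>2 - n * p) / p * integral {-U..U} (\<lambda>u. cmod (F (Complex \<sigma>\<^sub>0 (Im s + u))) * exp (- u\<^sup>2))"
  proof -
    have "s + Complex (-p) u = Complex \<sigma>\<^sub>0 (Im s + u)" for u using s by (simp add: complex_eq_iff)
    then have "cmod (g (Complex (-p) u)) = exp (p\<^sup>2 - n * p) * (cmod (F (Complex \<sigma>\<^sub>0 (Im s + u))) * exp (- u\<^sup>2))" for u
      unfolding g_def norm_mult norm_exp_square_plus by (simp add: exp_diff exp_minus exp_add field_simps)
    then show ?thesis by simp
  qed
  have "complex_of_real (2 * pi) * F s - (\<Sum>m<M. a m * complex_of_real (real m + \<alpha>) powr (- s) * ?I m)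
      = (complex_of_real (2 * pi) * g 0 - integral {-U..U} (\<lambda>u. g (Complex 3 u) / Complex 3 u)) + integral {-U..U} (\<lambda>u. tl u * smooth_kernel n u)"
    unfolding Ieq by (simp add: g_def)
  then have "cmod (complex_of_real (2 * pi) * F s - (\<Sum>m<M. a m * complex_of_real (real m + \<alpha>) powr (- s) * ?I m))
      \<le> cmod (complex_of_real (2 * pi) * g 0 - integral {-U..U} (\<lambda>u. g (Complex 3 u) / Complex 3 u)) + cmod (integral {-U..U} (\<lambda>u. tl u * smooth_kernel n u))"
    by (simp only: norm_triangle_ineq)
  then show ?thesis using 1 2 unfolding 3 by linarith
qed

text \<open>Nonnegativity of the integral of (f - c)^2 e at c = W / J. The quadratic in c uses only
  that the mass of e is at most J, so J may be any upper bound.\<close>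

lemma weighted_cauchy_schwarz:
  fixes f e :: "real \<Rightarrow> real"
  assumes cf: "continuous_on {p..q} f" and ce: "continuous_on {p..q} e"
    and e: "\<And>x. x \<in> {p..q} \<Longrightarrow> e x \<ge> 0" and J: "J > 0" "integral {p..q} e \<le> J"
  shows "(integral {p..q} (\<lambda>x. f x * e x))\<^sup>2 \<le> J * integral {p..q} (\<lambda>x. (f x)\<^sup>2 * e x)"
proof -
  define W where "W = integral {p..q} (\<lambda>x. f x * e x)"
  define c where "c = W / J"
  have "0 \<le> integral {p..q} (\<lambda>x. (f x - c)\<^sup>2 * e x)"
    using e by (intro integral_nonneg integrable_continuous_real continuous_intros cf ce) auto
  also have "(\<lambda>x. (f x - c)\<^sup>2 * e x) = (\<lambda>x. ((f x)\<^sup>2 * e x - 2 * c * (f x * e x)) + c\<^sup>2 * e x)"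
    by (auto simp: power2_eq_square algebra_simps)
  also have "integral {p..q} \<dots> = integral {p..q} (\<lambda>x. (f x)\<^sup>2 * e x) - 2 * c * W + c\<^sup>2 * integral {p..q} e"
    unfolding W_def
    by (subst Henstock_Kurzweil_Integration.integral_add Henstock_Kurzweil_Integration.integral_diff,
       (intro integrable_continuous_real continuous_intros cf ce)+)+ simp
  also have "c\<^sup>2 * integral {p..q} e \<le> c\<^sup>2 * J" using J by (intro mult_left_mono) auto
  finally have "0 \<le> integral {p..q} (\<lambda>x. (f x)\<^sup>2 * e x) - W\<^sup>2 / J"
    using J by (simp add: c_def power2_eq_square field_simps)
  then show ?thesis using J by (simp add: W_def field_simps)
qed

text \<open>The common shape of the two components: \<phi> with \<alpha> = 1 and indices lowered by
  one, and the periodic zeta-function. Apart from the series, everything is required only above the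
  height \<open>T\<^sub>0\<close>, beyond the poles, because the shifts move upwards. The growth
  bound may depend on the width R of the strip; it is applied on the horizontal sides.\<close>

locale mean_strip =
  fixes \<alpha> :: real and a :: "nat \<Rightarrow> complex" and F :: "complex \<Rightarrow> complex" and \<sigma>\<^sub>0 T\<^sub>0 A :: real
  assumes \<alpha>: "0 < \<alpha>" "\<alpha> \<le> 1" and \<sigma>\<^sub>0: "\<sigma>\<^sub>0 \<ge> 1 / 2" and T\<^sub>0: "T\<^sub>0 > 0"
    and holo: "F holomorphic_on {z. Re z \<ge> \<sigma>\<^sub>0 \<and> Im z \<ge> T\<^sub>0}"
    and growth: "\<And>R. \<exists>B C. \<forall>z. \<sigma>\<^sub>0 \<le> Re z \<and> Re z \<le> R \<and> Im z \<ge> T\<^sub>0 \<longrightarrow> cmod (F z) \<le> B * Im z powr C"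
    and mean_square: "\<And>T. T \<ge> T\<^sub>0 \<Longrightarrow> integral {T\<^sub>0..T} (\<lambda>t. (cmod (F (Complex \<sigma>\<^sub>0 t)))\<^sup>2) \<le> A * T"
    and series: "\<And>z. Re z > 1 \<Longrightarrow> (\<lambda>m. a m * complex_of_real (real m + \<alpha>) powr (- z)) sums F z"
begin

text \<open>Convergence at the point 9/8 bounds the coefficients by the power 9/8 of m + \<alpha>;
  taken from 7/2 it leaves the summable exponent 19/8.\<close>

lemma coeff_summable: "summable (\<lambda>m. cmod (a m) * (real m + \<alpha>) powr (- 7 / 2))"
proof -
  have "(\<lambda>m. a m * complex_of_real (real m + \<alpha>) powr (- (9 / 8))) sums F (9 / 8)"
    by (rule series) simp
  then have "(\<lambda>m. a m * complex_of_real (real m + \<alpha>) powr (- (9 / 8))) \<longlonglongrightarrow> 0"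
    by (intro summable_LIMSEQ_zero sums_summable)
  then have "Bseq (\<lambda>m. a m * complex_of_real (real m + \<alpha>) powr (- (9 / 8)))"
    by (intro convergent_imp_Bseq convergentI)
  then obtain B where B: "\<And>m. cmod (a m * complex_of_real (real m + \<alpha>) powr (- (9 / 8))) \<le> B"
    unfolding Bseq_def by blast
  show ?thesis
  proof (rule summable_comparison_test')
    show "summable (\<lambda>m. B * (real m + \<alpha>) powr (- (19 / 8)))"
      using \<alpha> by (intro summable_mult summable_shift_powr) auto
    fix m :: nat
    have "cmod (a m) * (real m + \<alpha>) powr (- 7 / 2) = cmod (a m) * (real m + \<alpha>) powr (- (9 / 8)) * (real m + \<alpha>) powr (- (19 / 8))"
      by (simp flip: powr_add)
    also have "\<dots> \<le> B * (real m + \<alpha>) powr (- (19 / 8))"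
      using B[of m] norm_shift_powr[OF \<alpha>(1), of m "- (9 / 8)"] by (intro mult_right_mono) (auto simp: norm_mult)
    finally show "norm (cmod (a m) * (real m + \<alpha>) powr (- 7 / 2)) \<le> B * (real m + \<alpha>) powr (- (19 / 8))" by simp
  qed
qed

lemma cont_line: "continuous_on {p..q} (\<lambda>t. F (Complex \<sigma>\<^sub>0 t))" if "p \<ge> T\<^sub>0"
  by (rule continuous_on_compose2[OF holomorphic_on_imp_continuous_on[OF holo]])
     (use that in \<open>auto intro!: continuous_intros\<close>)

text \<open>The window contains the left side of the contour for the shift k: that side has
  half-height k h / 2, and for large k its centre is within k h / 4 of k h. Below the height
  \<open>T\<^sub>0\<close> nothing is known about F, hence the default 0.\<close>

definition local_mean :: "real \<Rightarrow> nat \<Rightarrow> real" where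
  "local_mean h k = (if real k * h / 4 \<ge> T\<^sub>0
     then integral {real k * h / 4..2 * (real k * h)} (\<lambda>x. cmod (F (Complex \<sigma>\<^sub>0 x)) * exp (- (x - real k * h)\<^sup>2 / 2)) else 0)"

lemma local_mean_nonneg: "local_mean h k \<ge> 0"
  unfolding local_mean_def
  by (auto intro!: integral_nonneg integrable_continuous_real continuous_intros cont_line)

text \<open>Cauchy--Schwarz against the Gaussian weight for each k, then summation over k under the
  integral: by \<open>gaussian_sum_le\<close> the total weight at every height is bounded, and a
  single mean square up to 2 N h remains.\<close>

lemma local_mean_square:
  assumes h: "h > 0"
  shows "\<exists>C\<ge>0. \<forall>N. (\<Sum>k\<le>N. (local_mean h k)\<^sup>2) \<le> C * real (N + 1)"
proof -
  define J where "J = sqrt (2 * pi)"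
  define G where "G = exp (h\<^sup>2 / 2) / h * sqrt (4 * pi)"
  have JG: "J > 0" "G > 0" using h by (auto simp: J_def G_def)
  have A0: "A \<ge> 0"
  proof -
    have "0 \<le> integral {T\<^sub>0..T\<^sub>0} (\<lambda>t. (cmod (F (Complex \<sigma>\<^sub>0 t)))\<^sup>2)" by simp
    also have "\<dots> \<le> A * T\<^sub>0" by (rule mean_square) simp
    finally show ?thesis using T\<^sub>0 by (simp add: zero_le_mult_iff)
  qed
  have "(\<Sum>k\<le>N. (local_mean h k)\<^sup>2) \<le> J * G * A * 2 * h * real (N + 1)" for N
  proof (cases "real N * h / 4 \<ge> T\<^sub>0")
    case False
    have "local_mean h k = 0" if "k \<le> N" for k
    proof -
      have "real k * h / 4 \<le> real N * h / 4" using that h by (simp add: mult_right_mono)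
      then show ?thesis using False by (simp add: local_mean_def)
    qed
    then have "(\<Sum>k\<le>N. (local_mean h k)\<^sup>2) = 0" by simp
    then show ?thesis using JG A0 h by simp
  next
    case True
    define T where "T = 2 * (real N * h)"
    have T: "T \<ge> T\<^sub>0" using True T\<^sub>0 by (simp add: T_def)
    define f where "f = (\<lambda>x. cmod (F (Complex \<sigma>\<^sub>0 x)))"
    define e where "e = (\<lambda>k x. exp (- (x - real k * h)\<^sup>2 / 2))"
    have cf: "continuous_on {p..q} f" if "p \<ge> T\<^sub>0" for p q
      unfolding f_def by (intro continuous_intros cont_line that)
    have ce: "continuous_on S (e k)" for k S unfolding e_def by (intro continuous_intros) auto
    have io: "(\<lambda>x. (f x)\<^sup>2 * e k x) integrable_on {p..q}" if "p \<ge> T\<^sub>0" for k p q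
      by (intro integrable_continuous_real continuous_intros cf ce that)
    have one: "(local_mean h k)\<^sup>2 \<le> J * integral {T\<^sub>0..T} (\<lambda>x. (f x)\<^sup>2 * e k x)" if "k \<le> N" for k
    proof (cases "real k * h / 4 \<ge> T\<^sub>0")
      case True
      have kN: "2 * (real k * h) \<le> T" using that h by (simp add: T_def mult_right_mono)
      have "(local_mean h k)\<^sup>2 = (integral {real k * h / 4..2 * (real k * h)} (\<lambda>x. f x * e k x))\<^sup>2"
        using True by (simp add: local_mean_def f_def e_def)
      also have "\<dots> \<le> J * integral {real k * h / 4..2 * (real k * h)} (\<lambda>x. (f x)\<^sup>2 * e k x)"
        by (rule weighted_cauchy_schwarz[OF cf ce _ JG(1)])
           (use True gaussian_integral_le'[of "real k * h / 4" "2 * (real k * h)" "real k * h"]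
            in \<open>auto simp: e_def J_def\<close>)
      also have "\<dots> \<le> J * integral {T\<^sub>0..T} (\<lambda>x. (f x)\<^sup>2 * e k x)"
        using JG True kN by (intro mult_left_mono integral_subset_le io) (auto simp: e_def)
      finally show ?thesis .
    next
      case False
      have "0 \<le> integral {T\<^sub>0..T} (\<lambda>x. (f x)\<^sup>2 * e k x)"
        by (intro integral_nonneg io) (auto simp: e_def)
      then show ?thesis using False JG by (simp add: local_mean_def)
    qed
    have "(\<Sum>k\<le>N. (local_mean h k)\<^sup>2) \<le> (\<Sum>k\<le>N. J * integral {T\<^sub>0..T} (\<lambda>x. (f x)\<^sup>2 * e k x))"
      by (intro sum_mono one) auto
    also have "\<dots> = J * integral {T\<^sub>0..T} (\<lambda>x. \<Sum>k\<le>N. (f x)\<^sup>2 * e k x)"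
      by (subst integral_sum) (auto intro!: io simp: sum_distrib_left)
    also have "\<dots> \<le> J * integral {T\<^sub>0..T} (\<lambda>x. (f x)\<^sup>2 * G)"
    proof (intro mult_left_mono integral_le integrable_sum io)
      show "(\<lambda>x. (f x)\<^sup>2 * G) integrable_on {T\<^sub>0..T}"
        by (intro integrable_continuous_real continuous_intros cf) auto
      fix x assume "x \<in> {T\<^sub>0..T}"
      have "(\<Sum>k\<le>N. e k x) \<le> G"
        using gaussian_sum_le[OF h, of x "Suc N"] by (simp add: e_def G_def lessThan_Suc_atMost)
      then show "(\<Sum>k\<le>N. (f x)\<^sup>2 * e k x) \<le> (f x)\<^sup>2 * G"
        by (simp add: mult_left_mono flip: sum_distrib_left)
    qed (use JG in auto)
    also have "\<dots> = J * G * integral {T\<^sub>0..T} (\<lambda>x. (f x)\<^sup>2)" by simp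
    also have "\<dots> \<le> J * G * (A * T)"
      using mean_square[OF T] JG by (intro mult_left_mono) (auto simp: f_def)
    also have "\<dots> \<le> J * G * A * 2 * h * real (N + 1)"
      using JG A0 h by (simp add: T_def mult_ac mult_left_mono)
    finally show ?thesis .
  qed
  moreover have "J * G * A * 2 * h \<ge> 0" using JG A0 h by simp
  ultimately show ?thesis by blast
qed

text \<open>The contour is centred at the shifted point and its height grows with \<open>k\<close>, so that the horizontal
  sides contribute nothing in the limit; the left side yields \<open>w\<^sub>k\<close>, essentially \<open>local_mean\<close>.\<close>

lemma approximants:
  assumes h: "h > 0" and K: "bounded K" and d: "d > 0" "\<And>s. s \<in> K \<Longrightarrow> Re s \<ge> \<sigma>\<^sub>0 + d"
  obtains x :: "nat \<Rightarrow> nat \<Rightarrow> complex" and M :: "nat \<Rightarrow> nat" and w :: "nat \<Rightarrow> real" and \<delta> C :: real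
  where "\<And>n m. m \<ge> M n \<Longrightarrow> x n m = 0" "\<And>m. (\<lambda>n. x n m) \<longlonglongrightarrow> a m"
    "\<delta> > 0" "\<And>k. w k \<ge> 0" "C \<ge> 0" "\<And>N. (\<Sum>k\<le>N. (w k)\<^sup>2) \<le> C * real (N + 1)"
    "\<And>n. \<forall>\<^sub>F k in sequentially. \<forall>s\<in>K.
       cmod (F (s + \<i> * of_nat k * of_real h) - dpoly \<alpha> (x n) (M n) (s + \<i> * of_nat k * of_real h)) \<le> exp (- \<delta> * real n) * w k"
proof -
  obtain R where R: "R \<ge> 1" "\<And>s. s \<in> K \<Longrightarrow> cmod s \<le> R"
    using K unfolding bounded_pos by (metis linorder_le_cases order.trans)
  \<comment> \<open>Since p \<ge> d, the left side gains exp (- \<delta> n); since \<delta> \<le> 1,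
    errors of size exp (- n) are absorbed as well.\<close>
  define \<delta> where "\<delta> = min d 1"
  have \<delta>: "\<delta> > 0" "\<delta> \<le> d" "\<delta> \<le> 1" using d by (auto simp: \<delta>_def)
  define b where "b = (\<lambda>m. cmod (a m) * (real m + \<alpha>) powr (- 7 / 2))"
  have sb: "summable b" using coeff_summable by (simp add: b_def)
  \<comment> \<open>In the estimate the tail is multiplied by exp (9 + 3 n) sqrt (2 pi); the cut M
    is chosen so that the product is at most exp (- n).\<close>
  have "\<exists>M\<ge>1. (\<Sum>m. b (m + M)) \<le> exp (- real n) * exp (- (9 + 3 * real n)) / sqrt (2 * pi)" for n :: nat
  proof -
    let ?e = "exp (- real n) * exp (- (9 + 3 * real n)) / sqrt (2 * pi)"
    have "?e > 0" by simp
    from suminf_exist_split[OF this sb] obtain N where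
      N: "\<And>n. n \<ge> N \<Longrightarrow> norm (\<Sum>i. b (i + n)) < ?e" by blast
    from N[of "max N 1"] show ?thesis by (intro exI[of _ "max N 1"]) auto
  qed
  then obtain M where M: "\<And>n. M n \<ge> 1"
      "\<And>n. (\<Sum>m. b (m + M n)) \<le> exp (- real n) * exp (- (9 + 3 * real n)) / sqrt (2 * pi)" by metis
  obtain B' C where B': "\<And>z. \<sigma>\<^sub>0 \<le> Re z \<Longrightarrow> Re z \<le> R + 3 \<Longrightarrow> Im z \<ge> T\<^sub>0 \<Longrightarrow> cmod (F z) \<le> B' * Im z powr C"
    using growth[of "R + 3"] by blast
  define B where "B = max B' 0"
  define C\<^sub>1 where "C\<^sub>1 = max C 0"
  have BC: "B \<ge> 0" "C\<^sub>1 \<ge> 0" by (auto simp: B_def C\<^sub>1_def)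
  have B: "cmod (F z) \<le> B * Im z powr C\<^sub>1" if "\<sigma>\<^sub>0 \<le> Re z" "Re z \<le> R + 3" "Im z \<ge> T\<^sub>0" "Im z \<ge> 1" for z
  proof -
    have "B' * Im z powr C \<le> B * Im z powr C\<^sub>1"
      using that BC by (intro mult_mono powr_mono) (auto simp: B_def C\<^sub>1_def)
    with B'[OF that(1-3)] show ?thesis by linarith
  qed
  define x where "x = (\<lambda>n m. if m < M n then a m * smooth_weight (real n - ln (real m + \<alpha>)) else 0)"
  define A\<^sub>1 where "A\<^sub>1 = exp (R\<^sup>2) / d * exp (R\<^sup>2)"
  have A1: "A\<^sub>1 \<ge> 0" using d by (simp add: A\<^sub>1_def)
  \<comment> \<open>\<open>A\<^sub>1\<close> collects exp (p^2) and 1 / p from the left side,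
    bounded through R and d, and a second exp (R^2) from recentring the Gaussian at k h. The 3
    stands for three errors of size exp (- n): horizontal sides, tail, and truncation of the
    weights.\<close>
  define w where "w = (\<lambda>k. A\<^sub>1 * local_mean h k + 3)"
  have w0: "w k \<ge> 0" for k using A1 local_mean_nonneg by (simp add: w_def)
  obtain C\<^sub>2 where C2: "C\<^sub>2 \<ge> 0" "\<And>N. (\<Sum>k\<le>N. (local_mean h k)\<^sup>2) \<le> C\<^sub>2 * real (N + 1)"
    using local_mean_square[OF h] by blast
  have wsum: "(\<Sum>k\<le>N. (w k)\<^sup>2) \<le> (2 * A\<^sub>1\<^sup>2 * C\<^sub>2 + 18) * real (N + 1)" for N
  proof -
    have "(w k)\<^sup>2 \<le> 2 * A\<^sub>1\<^sup>2 * (local_mean h k)\<^sup>2 + 18" for k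
      using sum_squares_bound[of "A\<^sub>1 * local_mean h k" 3]
      by (simp add: w_def power2_eq_square algebra_simps)
    then have "(\<Sum>k\<le>N. (w k)\<^sup>2) \<le> (\<Sum>k\<le>N. 2 * A\<^sub>1\<^sup>2 * (local_mean h k)\<^sup>2 + 18)" by (intro sum_mono) auto
    also have "\<dots> = 2 * A\<^sub>1\<^sup>2 * (\<Sum>k\<le>N. (local_mean h k)\<^sup>2) + 18 * real (N + 1)"
      by (simp add: sum.distrib sum_distrib_left)
    also have "\<dots> \<le> 2 * A\<^sub>1\<^sup>2 * (C\<^sub>2 * real (N + 1)) + 18 * real (N + 1)"
      by (intro add_mono mult_left_mono C2) auto
    finally show ?thesis by (simp add: algebra_simps)
  qed
  have x_lim: "(\<lambda>n. x n m) \<longlonglongrightarrow> a m" for m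
  proof (cases "a m = 0")
    case True
    then have "(\<lambda>n. x n m) = (\<lambda>_. a m)" by (auto simp: x_def)
    then show ?thesis by simp
  next
    case False
    define \<tau> where "\<tau> = b m"
    have lam: "real m + \<alpha> > 0" using \<alpha> by simp
    have \<tau>: "\<tau> > 0" using False lam by (simp add: \<tau>_def b_def)
    \<comment> \<open>The choice of M n does not by itself make it grow. But a non-zero coefficient
      of index m \<ge> M n would keep the tail above \<tau> = b m, while the tails tend to
      0.\<close>
    have Minf: "\<forall>\<^sub>F n in sequentially. m < M n"
    proof -
      have "(\<lambda>n. exp (- real n) * exp (- (9 + 3 * real n)) / sqrt (2 * pi)) \<longlonglongrightarrow> 0"
      proof -
        have "(\<lambda>n. exp (- real n) * exp (- (9 + 3 * real n)) / c) \<longlonglongrightarrow> 0" if "c > 0" for c :: real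
          using that by real_asymp
        from this[of "sqrt (2 * pi)"] show ?thesis by simp
      qed
      from order_tendstoD(2)[OF this \<tau>] show ?thesis
      proof eventually_elim
        case (elim n)
        show ?case
        proof (rule ccontr)
          assume "\<not> m < M n"
          then have "b m = b ((m - M n) + M n)" by simp
          also have "\<dots> \<le> (\<Sum>m. b (m + M n))"
            using sum_le_suminf[OF summable_ignore_initial_segment[OF sb, of "M n"], of "{m - M n}"]
            by (auto simp: b_def)
          finally show False using M(2)[of n] elim by (simp add: \<tau>_def)
        qed
      qed
    qed
    have "filterlim (\<lambda>n. real n - ln (real m + \<alpha>)) at_top sequentially" by real_asymp
    from filterlim_compose[OF smooth_weight_tendsto_1 this]
    have "(\<lambda>n. a m * smooth_weight (real n - ln (real m + \<alpha>))) \<longlonglongrightarrow> a m * 1"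
      by (intro tendsto_mult_left)
    then have "(\<lambda>n. a m * smooth_weight (real n - ln (real m + \<alpha>))) \<longlonglongrightarrow> a m" by simp
    then show ?thesis
      by (rule Lim_transform_eventually) (use Minf in eventually_elim, simp add: x_def)
  qed
  have main: "\<forall>\<^sub>F k in sequentially. \<forall>s\<in>K.
       cmod (F (s + \<i> * of_nat k * of_real h) - dpoly \<alpha> (x n) (M n) (s + \<i> * of_nat k * of_real h)) \<le> exp (- \<delta> * real n) * w k" for n
  proof -
    let ?W = "\<lambda>m. smooth_weight (real n - ln (real m + \<alpha>))"
    let ?I = "\<lambda>U m. integral {-U..U} (smooth_kernel (real n - ln (real m + \<alpha>)))"
    \<comment> \<open>The horizontal sides at half-height k h / 2, with F bounded through its growth
      at heights up to 2 k h. For fixed n the Gaussian beats the power as k grows, but not uniformly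
      in n; this is why the approximation holds only eventually in k.\<close>
    let ?hor = "\<lambda>k::nat. 2 * (R + 3) * (B * (2 * (real k * h)) powr C\<^sub>1 * exp ((R + 3)\<^sup>2 - (real k * h / 2)\<^sup>2 + 3 * real n) / (real k * h / 2))"
    let ?fin = "\<lambda>k::nat. \<Sum>m<M n. cmod (a m) * \<alpha> powr (- R) * cmod (?I (real k * h / 2) m - 2 * pi * ?W m)"
    have kh: "filterlim (\<lambda>k. real k * h / c) at_top sequentially" if "c > 0" for c
      using that h by real_asymp
    have e1: "\<forall>\<^sub>F k in sequentially. real k * h / 4 \<ge> max (max R T\<^sub>0) 1"
      using kh[of 4] unfolding filterlim_at_top by auto
    have "?hor \<longlonglongrightarrow> 0"
    proof -
      have "(\<lambda>k. 2 * r * (B * (2 * (real k * h)) powr C\<^sub>1 * exp (q - (real k * h / 2)\<^sup>2 + 3 * real n) / (real k * h / 2))) \<longlonglongrightarrow> 0" for r q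
        using h by real_asymp
      then show ?thesis .
    qed
    then have e2: "\<forall>\<^sub>F k in sequentially. ?hor k < exp (- real n)"
      by (rule order_tendstoD) simp
    have "?fin \<longlonglongrightarrow> (\<Sum>m<M n. cmod (a m) * \<alpha> powr (- R) * cmod (2 * pi * ?W m - 2 * pi * ?W m))"
      by (intro tendsto_intros filterlim_compose[OF tendsto_smooth_weight kh]) auto
    then have "?fin \<longlonglongrightarrow> 0" by simp
    then have e3: "\<forall>\<^sub>F k in sequentially. ?fin k < exp (- real n)"
      by (rule order_tendstoD) simp
    show ?thesis using e1 e2 e3
    proof eventually_elim
      case (elim k)
      define H where "H = real k * h"
      define U where "U = H / 2"
      have H: "R \<le> H / 4" "T\<^sub>0 \<le> H / 4" "1 \<le> H / 4" using elim(1) by (auto simp: H_def)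
      show ?case
      proof
        fix s0 assume s0: "s0 \<in> K"
        define s where "s = s0 + \<i> * of_nat k * of_real h"
        define p where "p = Re s0 - \<sigma>\<^sub>0"
        have Res: "Re s = \<sigma>\<^sub>0 + p" and Ims: "Im s = Im s0 + H" by (simp_all add: s_def p_def H_def)
        have absI: "\<bar>Im s0\<bar> \<le> R" using R(2)[OF s0] abs_Im_le_cmod[of s0] by linarith
        have absR: "Re s0 \<le> R" using R(2)[OF s0] abs_Re_le_cmod[of s0] by linarith
        have p: "p \<ge> d" "p > 0" "p \<le> R" "Re s \<le> R" using d(2)[OF s0] d(1) absR \<sigma>\<^sub>0 Res by (auto simp: p_def)
        have U: "U > 0" using H by (simp add: U_def)
        define Bh where "Bh = B * (2 * H) powr C\<^sub>1"
        have est: "cmod (complex_of_real (2 * pi) * F s - (\<Sum>m<M n. a m * complex_of_real (real m + \<alpha>) powr (- s) * ?I U m))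
          \<le> exp (p\<^sup>2 - real n * p) / p * integral {-U..U} (\<lambda>u. cmod (F (Complex \<sigma>\<^sub>0 (Im s + u))) * exp (- u\<^sup>2))
           + 2 * (p + 3) * (Bh * exp ((p + 3)\<^sup>2 - U\<^sup>2 + 3 * real n) / U)
           + exp (- real n) * exp (- (9 + 3 * real n)) / sqrt (2 * pi) * exp (9 + 3 * real n) * sqrt (2 * pi)"
        proof (rule smoothing_estimate[OF \<alpha>(1) p(2) U _ M(1) holo Res _ \<sigma>\<^sub>0 series coeff_summable])
          show "T\<^sub>0 \<le> Im s - U" using H absI by (simp add: Ims U_def)
          show "(\<Sum>m. cmod (a (m + M n)) * (real (m + M n) + \<alpha>) powr (- 7 / 2))
             \<le> exp (- real n) * exp (- (9 + 3 * real n)) / sqrt (2 * pi)" using M(2)[of n] by (simp add: b_def)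
          fix z assume z: "\<sigma>\<^sub>0 \<le> Re z" "Re z \<le> Re s + 3" "\<bar>Im z - Im s\<bar> = U"
          have Iz: "Im z \<ge> H / 4" "Im z \<le> 2 * H" using z(3) H absI by (auto simp: Ims U_def abs_if split: if_splits)
          have "cmod (F z) \<le> B * Im z powr C\<^sub>1" using z p Iz H by (intro B) auto
          also have "\<dots> \<le> Bh" unfolding Bh_def using Iz H BC by (intro mult_left_mono powr_mono2) auto
          finally show "cmod (F z) \<le> Bh" .
        qed auto
        have t3: "exp (- real n) * exp (- (9 + 3 * real n)) / sqrt (2 * pi) * exp (9 + 3 * real n) * sqrt (2 * pi) = exp (- real n)"
          by (simp, simp flip: exp_add)
        have t2: "2 * (p + 3) * (Bh * exp ((p + 3)\<^sup>2 - U\<^sup>2 + 3 * real n) / U) \<le> exp (- real n)"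
        proof -
          have "(p + 3)\<^sup>2 \<le> (R + 3)\<^sup>2" using p by (intro power_mono) auto
          then have "2 * (p + 3) * (Bh * exp ((p + 3)\<^sup>2 - U\<^sup>2 + 3 * real n) / U) \<le> 2 * (R + 3) * (Bh * exp ((R + 3)\<^sup>2 - U\<^sup>2 + 3 * real n) / U)"
            using p R BC U by (intro mult_mono divide_right_mono) (auto simp: Bh_def)
          also have "\<dots> = ?hor k" by (simp add: Bh_def U_def H_def)
          finally show ?thesis using elim(2) by linarith
        qed
        have t1: "exp (p\<^sup>2 - real n * p) / p * integral {-U..U} (\<lambda>u. cmod (F (Complex \<sigma>\<^sub>0 (Im s + u))) * exp (- u\<^sup>2))
            \<le> exp (- \<delta> * real n) * (A\<^sub>1 * local_mean h k)"
        proof -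
          let ?G = "\<lambda>x. cmod (F (Complex \<sigma>\<^sub>0 x)) * exp (- (x - Im s)\<^sup>2)"
          let ?E = "\<lambda>x. cmod (F (Complex \<sigma>\<^sub>0 x)) * exp (- (x - real k * h)\<^sup>2 / 2)"
          have cG: "continuous_on {q..r} ?G" if "q \<ge> T\<^sub>0" for q r
            by (intro continuous_intros cont_line that)
          have cE: "continuous_on {q..r} ?E" if "q \<ge> T\<^sub>0" for q r
            by (intro continuous_intros cont_line that) auto
          have "integral {-U..U} (\<lambda>u. cmod (F (Complex \<sigma>\<^sub>0 (Im s + u))) * exp (- u\<^sup>2)) = integral {-U..U} (?G \<circ> ((+) (Im s)))"
            by (simp add: o_def)
          also have "\<dots> = integral {-U + Im s..U + Im s} ?G" by (rule integral_shift_Icc_real)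
          \<comment> \<open>The Gaussian centred at Im s is dominated by one of twice its variance
            centred at k h. The new centre is the same for all points of K, so one
            \<open>w k\<close> serves them all.\<close>
          also have "\<dots> \<le> integral {-U + Im s..U + Im s} (\<lambda>x. exp (R\<^sup>2) * ?E x)"
          proof (rule integral_le)
            show "?G integrable_on {-U + Im s..U + Im s}"
              using H absI by (intro integrable_continuous_real cG) (simp add: U_def Ims)
            show "(\<lambda>x. exp (R\<^sup>2) * ?E x) integrable_on {-U + Im s..U + Im s}"
              using H absI by (intro integrable_continuous_real continuous_on_mult_left cE) (simp add: U_def Ims)
            fix x
            have "(Im s0)\<^sup>2 \<le> R\<^sup>2" using absI R by (simp add: abs_le_square_iff[symmetric])
            moreover have "(x - H)\<^sup>2 \<le> 2 * (x - Im s)\<^sup>2 + 2 * (Im s0)\<^sup>2"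
              using sum_squares_bound[of "x - Im s" "Im s0"] unfolding Ims
              by (simp add: power2_eq_square algebra_simps)
            ultimately have "- (x - Im s)\<^sup>2 \<le> R\<^sup>2 + - (x - H)\<^sup>2 / 2" by simp
            then have "exp (- (x - Im s)\<^sup>2) \<le> exp (R\<^sup>2) * exp (- (x - H)\<^sup>2 / 2)" by (simp flip: exp_add)
            then show "?G x \<le> exp (R\<^sup>2) * ?E x" by (simp add: H_def mult.left_commute mult_left_mono)
          qed
          also have "\<dots> \<le> integral {H / 4..2 * H} (\<lambda>x. exp (R\<^sup>2) * ?E x)"
          proof (rule integral_subset_le)
            show "{- U + Im s..U + Im s} \<subseteq> {H / 4..2 * H}" using H absI by (auto simp: U_def Ims)
            show "(\<lambda>x. exp (R\<^sup>2) * ?E x) integrable_on {-U + Im s..U + Im s}"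
              using H absI by (intro integrable_continuous_real continuous_on_mult_left cE) (simp add: U_def Ims)
            show "(\<lambda>x. exp (R\<^sup>2) * ?E x) integrable_on {H / 4..2 * H}"
              using H absI by (intro integrable_continuous_real continuous_on_mult_left cE) simp
          qed auto
          also have "\<dots> = exp (R\<^sup>2) * local_mean h k"
            using H by (simp add: local_mean_def H_def)
          finally have i: "integral {-U..U} (\<lambda>u. cmod (F (Complex \<sigma>\<^sub>0 (Im s + u))) * exp (- u\<^sup>2)) \<le> exp (R\<^sup>2) * local_mean h k" .
          have p2: "p\<^sup>2 \<le> R\<^sup>2" using p by (intro power_mono) auto
          have "\<delta> * real n \<le> real n * p" using \<delta> p by (subst mult.commute, intro mult_left_mono) auto
          with p2 have "p\<^sup>2 - real n * p \<le> R\<^sup>2 + - \<delta> * real n" by linarith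
          then have "exp (p\<^sup>2 - real n * p) \<le> exp (R\<^sup>2 + - \<delta> * real n)" by (simp only: exp_le_cancel_iff)
          then have "exp (p\<^sup>2 - real n * p) / p \<le> exp (R\<^sup>2 + - \<delta> * real n) / d"
            using p d(1) by (intro frac_le) auto
          then have "exp (p\<^sup>2 - real n * p) / p \<le> exp (- \<delta> * real n) * (exp (R\<^sup>2) / d)"
            by (simp only: exp_add) (simp add: mult.commute)
          moreover have "0 \<le> integral {-U..U} (\<lambda>u. cmod (F (Complex \<sigma>\<^sub>0 (Im s + u))) * exp (- u\<^sup>2))" (is "0 \<le> integral _ ?f")
            by (cases "?f integrable_on {-U..U}") (auto intro: integral_nonneg simp: not_integrable_integral)
          ultimately have "exp (p\<^sup>2 - real n * p) / p * integral {-U..U} ?f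
              \<le> exp (- \<delta> * real n) * (exp (R\<^sup>2) / d) * (exp (R\<^sup>2) * local_mean h k)"
            using i d(1) by (intro mult_mono) auto
          then show ?thesis by (simp add: A\<^sub>1_def mult.assoc)
        qed
        \<comment> \<open>The truncated kernel integrals are replaced by the full weights. The
          powers of m + \<alpha> are bounded by \<alpha>^(-R), as \<alpha> \<le> 1 and Re s \<le>
          R.\<close>
        have t4: "cmod ((\<Sum>m<M n. a m * complex_of_real (real m + \<alpha>) powr (- s) * ?I U m) - 2 * pi * dpoly \<alpha> (x n) (M n) s) \<le> exp (- real n)"
        proof -
          have dp: "2 * pi * dpoly \<alpha> (x n) (M n) s = (\<Sum>m<M n. a m * complex_of_real (real m + \<alpha>) powr (- s) * (2 * pi * ?W m))"
            unfolding dpoly_def sum_distrib_left by (intro sum.cong refl) (simp add: x_def)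
          have eq: "(\<Sum>m<M n. a m * complex_of_real (real m + \<alpha>) powr (- s) * ?I U m) - 2 * pi * dpoly \<alpha> (x n) (M n) s
            = (\<Sum>m<M n. a m * complex_of_real (real m + \<alpha>) powr (- s) * (?I U m - 2 * pi * ?W m))"
            by (simp only: dp right_diff_distrib sum_subtractf)
          have "cmod ((\<Sum>m<M n. a m * complex_of_real (real m + \<alpha>) powr (- s) * ?I U m) - 2 * pi * dpoly \<alpha> (x n) (M n) s)
            \<le> (\<Sum>m<M n. cmod (a m) * \<alpha> powr (- R) * cmod (?I U m - 2 * pi * ?W m))"
            unfolding eq
          proof (rule sum_norm_le)
            fix m
            have "(real m + \<alpha>) powr (- Re s) \<le> \<alpha> powr (- Re s)"
              using \<alpha> \<sigma>\<^sub>0 p Res by (intro powr_mono2') auto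
            also have "\<dots> \<le> \<alpha> powr (- R)" using \<alpha> p by (intro powr_mono') auto
            finally have "cmod (complex_of_real (real m + \<alpha>) powr (- s)) \<le> \<alpha> powr (- R)"
              using norm_shift_powr[OF \<alpha>(1), of m "-s"] by simp
            then show "cmod (a m * complex_of_real (real m + \<alpha>) powr (- s) * (?I U m - 2 * pi * ?W m))
              \<le> cmod (a m) * \<alpha> powr (- R) * cmod (?I U m - 2 * pi * ?W m)"
              unfolding norm_mult by (intro mult_right_mono mult_left_mono) auto
          qed
          also have "\<dots> = ?fin k" by (simp add: U_def H_def)
          finally show ?thesis using elim(3) by linarith
        qed
        have "\<delta> * real n \<le> 1 * real n" using \<delta> by (intro mult_right_mono) auto
        then have "exp (- real n) \<le> exp (- \<delta> * real n)" by simp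
        moreover have "cmod (complex_of_real (2 * pi) * F s - 2 * pi * dpoly \<alpha> (x n) (M n) s)
          \<le> cmod (complex_of_real (2 * pi) * F s - (\<Sum>m<M n. a m * complex_of_real (real m + \<alpha>) powr (- s) * ?I U m))
            + cmod ((\<Sum>m<M n. a m * complex_of_real (real m + \<alpha>) powr (- s) * ?I U m) - 2 * pi * dpoly \<alpha> (x n) (M n) s)"
          by (rule norm_diff_triangle_le[OF order.refl order.refl])
        ultimately have "cmod (complex_of_real (2 * pi) * F s - 2 * pi * dpoly \<alpha> (x n) (M n) s)
          \<le> exp (- \<delta> * real n) * (A\<^sub>1 * local_mean h k) + 3 * exp (- \<delta> * real n)"
          using est[unfolded t3] t1 t2 t4 by linarith
        also have "\<dots> = exp (- \<delta> * real n) * w k" by (simp add: w_def algebra_simps)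
        finally have "cmod (complex_of_real (2 * pi) * (F s - dpoly \<alpha> (x n) (M n) s)) \<le> exp (- \<delta> * real n) * w k"
          by (simp only: right_diff_distrib)
        then have "2 * pi * cmod (F s - dpoly \<alpha> (x n) (M n) s) \<le> exp (- \<delta> * real n) * w k"
          by (simp add: norm_mult)
        moreover have "1 * cmod (F s - dpoly \<alpha> (x n) (M n) s) \<le> 2 * pi * cmod (F s - dpoly \<alpha> (x n) (M n) s)"
          using pi_gt3 by (intro mult_right_mono) auto
        ultimately show "cmod (F (s0 + \<i> * of_nat k * of_real h) - dpoly \<alpha> (x n) (M n) (s0 + \<i> * of_nat k * of_real h)) \<le> exp (- \<delta> * real n) * w k"
          unfolding s_def by linarith
      qed
    qed
  qed
  have x0: "x n m = 0" if "m \<ge> M n" for n m using that by (simp add: x_def)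
  have c0: "2 * A\<^sub>1\<^sup>2 * C\<^sub>2 + 18 \<ge> 0" using C2 by simp
  show ?thesis by (rule that[OF x0 x_lim \<delta>(1) w0 c0 wsum main])
qed

end

subsection \<open>Dirichlet series over orthonormal systems\<close>

text \<open>Mean value inequality on the segment from x to y. For Re w \<ge> -1 the modulus of the
  derivative is a nonincreasing power, largest at the left end.\<close>

lemma powr_diff_bound:
  fixes x y :: real
  assumes x: "0 < x" "x \<le> y" and w: "Re w \<ge> - 1"
  shows "cmod (complex_of_real x powr (- w) - complex_of_real y powr (- w)) \<le> cmod w * x powr (- Re w - 1) * (y - x)"
proof -
  let ?S = "complex_of_real ` {x..y}"
  have S: "convex ?S" by (intro convex_linear_image linearI) (auto simp: scaleR_conv_of_real)
  have "cmod (complex_of_real x powr (- w) - complex_of_real y powr (- w))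
      \<le> (cmod w * x powr (- Re w - 1)) * cmod (complex_of_real x - complex_of_real y)"
  proof (rule field_differentiable_bound[OF S])
    fix z assume "z \<in> ?S"
    then obtain t where t: "z = of_real t" "x \<le> t" "t \<le> y" by auto
    show "((\<lambda>z. z powr (- w)) has_field_derivative (- w) * z powr (- w - 1)) (at z within ?S)"
      by (rule has_field_derivative_at_within, rule has_field_derivative_powr)
         (use t x in \<open>auto simp: complex_nonpos_Reals_iff\<close>)
    have "t powr (- Re w - 1) \<le> x powr (- Re w - 1)" using t x w by (intro powr_mono2') auto
    then show "cmod ((- w) * z powr (- w - 1)) \<le> cmod w * x powr (- Re w - 1)"
      using t x by (simp add: norm_mult norm_powr_real_powr mult_left_mono)
  qed (use x in auto)
  also have "cmod (complex_of_real x - complex_of_real y) = y - x"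
    using x by (simp flip: of_real_diff)
  finally show ?thesis .
qed

lemma sum_by_parts_diff:
  fixes y f :: "nat \<Rightarrow> complex"
  shows "(\<Sum>m<M. y m * f m) = (\<Sum>i<M. y i) * f M + (\<Sum>m<M. (\<Sum>i<Suc m. y i) * (f m - f (Suc m)))"
  by (induction M) (simp_all add: algebra_simps)

text \<open>Abel summation: the differences of (m + \<alpha>)^(-w) are of order m^(- Re w - 1), so
  partial sums of order m^\<epsilon> leave terms of order m^(-1 - \<eta>). C is chosen before y, B
  and w, and B enters linearly: one bound on the partial sums then controls the series at all points
  of a region, for every sample point.\<close>

lemma dirichlet_abel_bound:
  fixes \<alpha> \<epsilon> \<eta> R :: real
  assumes \<alpha>: "0 < \<alpha>" "\<alpha> \<le> 1" and \<epsilon>: "\<epsilon> > 0" and \<eta>: "\<eta> > 0"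
  shows "\<exists>C\<ge>0. \<forall>y B w. B \<ge> 0 \<and> (\<forall>k. cmod (\<Sum>i<k. y i) \<le> B * real k powr \<epsilon>) \<and> Re w \<ge> \<epsilon> + \<eta> \<and> cmod w \<le> R \<longrightarrow>
     summable (\<lambda>m. y m * complex_of_real (real m + \<alpha>) powr (- w)) \<and>
     cmod (\<Sum>m. y m * complex_of_real (real m + \<alpha>) powr (- w)) \<le> B * C"
proof -
  define g where "g = (\<lambda>m. \<bar>R\<bar> * \<alpha> powr (- (R + 1)) * (real m + 1) powr (- (1 + \<eta>)))"
  have sg: "summable g"
    unfolding g_def using \<eta> by (intro summable_mult summable_shift_powr) auto
  have g0: "g m \<ge> 0" for m by (simp add: g_def)
  have "summable (\<lambda>m. y m * complex_of_real (real m + \<alpha>) powr (- w)) \<and>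
     cmod (\<Sum>m. y m * complex_of_real (real m + \<alpha>) powr (- w)) \<le> B * suminf g"
    if B: "B \<ge> 0" and S: "\<And>k. cmod (\<Sum>i<k. y i) \<le> B * real k powr \<epsilon>"
      and w: "Re w \<ge> \<epsilon> + \<eta>" "cmod w \<le> R" for y B w
  proof -
    define f where "f = (\<lambda>m. complex_of_real (real m + \<alpha>) powr (- w))"
    have Rw: "Re w \<le> R" "R \<ge> 0" using w complex_Re_le_cmod[of w] order.trans[OF norm_ge_zero w(2)] by linarith+
    \<comment> \<open>By \<alpha> (m + 1) \<le> m + \<alpha> for \<alpha> \<le> 1, powers of m +
      \<alpha> are traded for powers of m + 1 at the cost of a factor free of m.\<close>
    have sc: "(real m + \<alpha>) powr (- r) \<le> \<alpha> powr (- (R + 1)) * (real m + 1) powr (- r)" if "0 \<le> r" "r \<le> R + 1" for m r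
    proof -
      have "\<alpha> * (real m + 1) \<le> real m + \<alpha>" using \<alpha> by (simp add: algebra_simps mult_left_le_one_le)
      then have "(real m + \<alpha>) powr (- r) \<le> (\<alpha> * (real m + 1)) powr (- r)"
        using \<alpha> that by (intro powr_mono2') auto
      also have "\<dots> = \<alpha> powr (- r) * (real m + 1) powr (- r)" using \<alpha> by (simp add: powr_mult)
      also have "\<dots> \<le> \<alpha> powr (- (R + 1)) * (real m + 1) powr (- r)"
        using \<alpha> that by (intro mult_right_mono powr_mono') auto
      finally show ?thesis .
    qed
    have term_le: "cmod ((\<Sum>i<Suc m. y i) * (f m - f (Suc m))) \<le> B * g m" for m
    proof -
      have "cmod (f m - f (Suc m)) \<le> cmod w * (real m + \<alpha>) powr (- Re w - 1) * (real (Suc m) + \<alpha> - (real m + \<alpha>))"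
        unfolding f_def using \<alpha> \<epsilon> \<eta> w by (intro powr_diff_bound) auto
      also have "\<dots> = cmod w * (real m + \<alpha>) powr (- (Re w + 1))"
      proof -
        have "- Re w - 1 = - (Re w + 1)" by simp
        then show ?thesis by (simp only:) simp
      qed
      also have "\<dots> \<le> R * (\<alpha> powr (- (R + 1)) * (real m + 1) powr (- (Re w + 1)))"
        using w Rw \<epsilon> \<eta> by (intro mult_mono sc) auto
      finally have 1: "cmod (f m - f (Suc m)) \<le> R * (\<alpha> powr (- (R + 1)) * (real m + 1) powr (- (Re w + 1)))" .
      have "cmod ((\<Sum>i<Suc m. y i) * (f m - f (Suc m))) \<le> (B * real (Suc m) powr \<epsilon>) * (R * (\<alpha> powr (- (R + 1)) * (real m + 1) powr (- (Re w + 1))))"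
        unfolding norm_mult using S[of "Suc m"] 1 B by (intro mult_mono) auto
      also have "\<dots> = B * (R * \<alpha> powr (- (R + 1)) * (real m + 1) powr (\<epsilon> + - (Re w + 1)))"
        by (simp only: powr_add) (simp add: mult_ac add_ac)
      also have "\<dots> \<le> B * (R * \<alpha> powr (- (R + 1)) * (real m + 1) powr (- (1 + \<eta>)))"
        using B Rw w by (intro mult_left_mono powr_mono) auto
      also have "\<dots> = B * g m" using Rw by (simp add: g_def)
      finally show ?thesis .
    qed
    have sB: "summable (\<lambda>m. B * g m)" using sg by (rule summable_mult)
    let ?h = "\<lambda>m. (\<Sum>i<Suc m. y i) * (f m - f (Suc m))"
    have sh: "summable ?h" by (rule summable_comparison_test'[OF sB]) (use term_le in auto)
    have "(\<lambda>M. (\<Sum>i<M. y i) * f M) \<longlonglongrightarrow> 0"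
    proof (rule Lim_null_comparison)
      show "\<forall>\<^sub>F M in sequentially. cmod ((\<Sum>i<M. y i) * f M) \<le> B * \<alpha> powr (- (R + 1)) * real M powr (- \<eta>)"
        using eventually_gt_at_top[of 0]
      proof eventually_elim
        case (elim M)
        have "cmod (f M) = (real M + \<alpha>) powr (- Re w)" using norm_shift_powr[OF \<alpha>(1), of M "- w"] by (simp add: f_def)
        also have "\<dots> \<le> real M powr (- Re w)" using elim \<alpha> w \<epsilon> \<eta> by (intro powr_mono2') auto
        also have "\<dots> \<le> 1 * real M powr (- (\<epsilon> + \<eta>))" using elim w by (simp add: powr_mono)
        also have "\<dots> \<le> \<alpha> powr (- (R + 1)) * real M powr (- (\<epsilon> + \<eta>))"
          using powr_mono'[of "- (R + 1)" 0 \<alpha>] \<alpha> Rw by (intro mult_right_mono) auto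
        finally have "cmod ((\<Sum>i<M. y i) * f M) \<le> (B * real M powr \<epsilon>) * (\<alpha> powr (- (R + 1)) * real M powr (- (\<epsilon> + \<eta>)))"
          unfolding norm_mult using S[of M] B by (intro mult_mono) auto
        also have "\<dots> = B * \<alpha> powr (- (R + 1)) * real M powr (\<epsilon> + - (\<epsilon> + \<eta>))"
          by (simp only: powr_add) (simp add: mult_ac)
        finally show ?case by simp
      qed
      have "(\<lambda>M. c * real M powr (- \<eta>)) \<longlonglongrightarrow> 0" for c using \<eta> by real_asymp
      then show "(\<lambda>M. B * \<alpha> powr (- (R + 1)) * real M powr (- \<eta>)) \<longlonglongrightarrow> 0" .
    qed
    from tendsto_add[OF this summable_LIMSEQ[OF sh]]
    have S: "(\<lambda>m. y m * f m) sums (\<Sum>m. ?h m)"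
      unfolding sums_def sum_by_parts_diff[of y f] by simp
    have "cmod (\<Sum>m. ?h m) \<le> (\<Sum>m. B * g m)"
      by (rule norm_suminf_le[OF term_le sB])
    then have "cmod (\<Sum>m. y m * f m) \<le> B * suminf g"
      unfolding sums_unique[OF S, symmetric] suminf_mult[OF sg] .
    with sums_summable[OF S] show ?thesis unfolding f_def by blast
  qed
  moreover have "suminf g \<ge> 0" by (rule suminf_nonneg[OF sg g0])
  ultimately show ?thesis by (intro exI[of _ "suminf g"]) blast
qed

text \<open>The sum over all dyadic subblocks of \<open>{s..<s + 2^r}\<close> that dominates every partial sum in the
  Rademacher--Menshov inequality.\<close>

fun dyadic_square :: "(nat \<Rightarrow> complex) \<Rightarrow> nat \<Rightarrow> nat \<Rightarrow> real" where
  "dyadic_square y 0 s = (cmod (y s))\<^sup>2"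
| "dyadic_square y (Suc r) s = (cmod (\<Sum>i<2 ^ Suc r. y (s + i)))\<^sup>2 + dyadic_square y r s + dyadic_square y r (s + 2 ^ r)"

lemma dyadic_square_nonneg: "dyadic_square y r s \<ge> 0"
  by (induction r arbitrary: s) auto

lemma block_le_dyadic_square: "(cmod (\<Sum>i<2 ^ r. y (s + i)))\<^sup>2 \<le> dyadic_square y r s"
  by (cases r) (auto simp: dyadic_square_nonneg simp del: power_Suc)

text \<open>A prefix of a block lies in its left half, or consists of the whole left half and a
  prefix of the right half. The factor r + 1 counts the dyadic pieces of the prefix.\<close>

lemma partial_sum_le_dyadic_square:
  "k \<le> 2 ^ r \<Longrightarrow> (cmod (\<Sum>i<k. y (s + i)))\<^sup>2 \<le> real (r + 1) * dyadic_square y r s"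
proof (induction r arbitrary: k s)
  case 0
  then have "k = 0 \<or> k = 1" by auto
  then show ?case by auto
next
  case (Suc r)
  show ?case
  proof (cases "k \<le> 2 ^ r")
    case True
    have "(cmod (\<Sum>i<k. y (s + i)))\<^sup>2 \<le> real (r + 1) * dyadic_square y r s" by (rule Suc.IH[OF True])
    also have "\<dots> \<le> real (Suc r + 1) * dyadic_square y (Suc r) s"
      by (intro mult_mono) (auto simp: dyadic_square_nonneg)
    finally show ?thesis .
  next
    case False
    define k' where "k' = k - 2 ^ r"
    have k: "k = 2 ^ r + k'" "k' \<le> 2 ^ r" using False Suc.prems by (auto simp: k'_def)
    define u where "u = cmod (\<Sum>i<2 ^ r. y (s + i))"
    define v where "v = cmod (\<Sum>i<k'. y (s + 2 ^ r + i))"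
    define q where "q = real (r + 1)"
    have q: "q > 0" by (simp add: q_def)
    have "(\<Sum>i<k. y (s + i)) = (\<Sum>i<2 ^ r. y (s + i)) + (\<Sum>i<k'. y (s + 2 ^ r + i))"
      unfolding k(1) lessThan_atLeast0
      using sum.atLeastLessThan_concat[of 0 "2 ^ r" "2 ^ r + k'" "\<lambda>i. y (s + i)"]
        sum.shift_bounds_nat_ivl[of "\<lambda>i. y (s + i)" 0 "2 ^ r" k'] by (simp add: add_ac)
    then have "cmod (\<Sum>i<k. y (s + i)) \<le> u + v" by (simp add: u_def v_def norm_triangle_ineq)
    then have "(cmod (\<Sum>i<k. y (s + i)))\<^sup>2 \<le> (u + v)\<^sup>2" by (intro power_mono) auto
    \<comment> \<open>Cauchy--Schwarz with weights 1 and q: the full half is a single block, while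
      the prefix of the other half has cost q = r + 1 by induction.\<close>
    also have "\<dots> \<le> (q + 1) * (u\<^sup>2 + v\<^sup>2 / q)"
    proof -
      have "0 \<le> (q * u - v)\<^sup>2 / q" using q by simp
      also have "\<dots> = (q + 1) * (u\<^sup>2 + v\<^sup>2 / q) - (u + v)\<^sup>2" using q by (simp add: power2_eq_square field_simps)
      finally show ?thesis by simp
    qed
    also have "\<dots> \<le> (q + 1) * (dyadic_square y r s + dyadic_square y r (s + 2 ^ r))"
    proof (intro mult_left_mono add_mono)
      show "u\<^sup>2 \<le> dyadic_square y r s" unfolding u_def by (rule block_le_dyadic_square)
      show "v\<^sup>2 / q \<le> dyadic_square y r (s + 2 ^ r)"
        using Suc.IH[OF k(2), of "s + 2 ^ r"] q by (simp add: v_def q_def field_simps)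
    qed (use q in auto)
    also have "\<dots> \<le> real (Suc r + 1) * dyadic_square y (Suc r) s"
      by (intro mult_mono) (auto simp: q_def dyadic_square_nonneg)
    finally show ?thesis .
  qed
qed

section \<open>The maximal inequality for unimodular orthonormal systems\<close>

locale orthonormal_system = prob_space M for M :: "'a measure" +
  fixes e :: "nat \<Rightarrow> 'a \<Rightarrow> complex"
  assumes e_measurable [measurable]: "\<And>m. e m \<in> borel_measurable M"
    and e_norm: "\<And>m \<omega>. \<omega> \<in> space M \<Longrightarrow> cmod (e m \<omega>) = 1"
    and e_orthogonal: "\<And>m m'. m \<noteq> m' \<Longrightarrow> (LINT \<omega>|M. e m \<omega> * cnj (e m' \<omega>)) = 0"
begin

lemma norm_square_sum:
  assumes "finite I"
  shows "integrable M (\<lambda>\<omega>. (cmod (\<Sum>i\<in>I. c i * e i \<omega>))\<^sup>2)"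
    and "(LINT \<omega>|M. (cmod (\<Sum>i\<in>I. c i * e i \<omega>))\<^sup>2) = (\<Sum>i\<in>I. (cmod (c i))\<^sup>2)"
proof -
  have [measurable]: "cnj \<in> borel_measurable borel"
    by (intro borel_measurable_continuous_onI continuous_intros)
  have ii: "integrable M (\<lambda>\<omega>. e i \<omega> * cnj (e j \<omega>))" for i j
    by (rule integrable_const_bound[where B = 1]) (auto simp: norm_mult e_norm)
  have one: "(LINT \<omega>|M. e i \<omega> * cnj (e j \<omega>)) = (if i = j then 1 else 0)" for i j
  proof (cases "i = j")
    case True
    have "(LINT \<omega>|M. e i \<omega> * cnj (e j \<omega>)) = (LINT \<omega>|M. 1)"
      by (intro Bochner_Integration.integral_cong) (auto simp: True complex_norm_square[symmetric] e_norm)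
    then show ?thesis using True by (simp add: prob_space)
  qed (simp add: e_orthogonal)
  have eq: "complex_of_real ((cmod (\<Sum>i\<in>I. c i * e i \<omega>))\<^sup>2) = (\<Sum>i\<in>I. \<Sum>j\<in>I. (c i * cnj (c j)) * (e i \<omega> * cnj (e j \<omega>)))" for \<omega>
    by (simp add: complex_norm_square sum_product mult_ac flip: of_real_power)
  have int: "integrable M (\<lambda>\<omega>. complex_of_real ((cmod (\<Sum>i\<in>I. c i * e i \<omega>))\<^sup>2))"
    unfolding eq by (intro Bochner_Integration.integrable_sum integrable_mult_right ii)
  from integrable_Re[OF this] show "integrable M (\<lambda>\<omega>. (cmod (\<Sum>i\<in>I. c i * e i \<omega>))\<^sup>2)"
    by (simp only: Re_complex_of_real)
  have "complex_of_real (LINT \<omega>|M. (cmod (\<Sum>i\<in>I. c i * e i \<omega>))\<^sup>2) = (LINT \<omega>|M. complex_of_real ((cmod (\<Sum>i\<in>I. c i * e i \<omega>))\<^sup>2))"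
    by (rule integral_complex_of_real[symmetric])
  also have "\<dots> = (\<Sum>i\<in>I. \<Sum>j\<in>I. (c i * cnj (c j)) * (if i = j then 1 else 0))"
    unfolding eq by (simp add: Bochner_Integration.integral_sum Bochner_Integration.integrable_sum ii one)
  also have "\<dots> = complex_of_real (\<Sum>i\<in>I. (cmod (c i))\<^sup>2)"
    using assms by (simp add: if_distrib flip: complex_norm_square cong: if_cong)
  finally show "(LINT \<omega>|M. (cmod (\<Sum>i\<in>I. c i * e i \<omega>))\<^sup>2) = (\<Sum>i\<in>I. (cmod (c i))\<^sup>2)"
    using of_real_eq_iff by blast
qed

lemma block_square:
  shows "integrable M (\<lambda>\<omega>. (cmod (\<Sum>i<N. c (s + i) * e (s + i) \<omega>))\<^sup>2)"
    and "(LINT \<omega>|M. (cmod (\<Sum>i<N. c (s + i) * e (s + i) \<omega>))\<^sup>2) = (\<Sum>i<N. (cmod (c (s + i)))\<^sup>2)"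
proof -
  have *: "(\<Sum>i\<in>(+) s ` {..<N}. f i) = (\<Sum>i<N. f (s + i))" for f :: "nat \<Rightarrow> 'c::comm_monoid_add"
    by (subst sum.reindex) auto
  show "integrable M (\<lambda>\<omega>. (cmod (\<Sum>i<N. c (s + i) * e (s + i) \<omega>))\<^sup>2)"
    using norm_square_sum(1)[of "(+) s ` {..<N}" c] by (simp add: *)
  show "(LINT \<omega>|M. (cmod (\<Sum>i<N. c (s + i) * e (s + i) \<omega>))\<^sup>2) = (\<Sum>i<N. (cmod (c (s + i)))\<^sup>2)"
    using norm_square_sum(2)[of "(+) s ` {..<N}" c] by (simp add: *)
qed

text \<open>On each of the r + 1 dyadic levels the blocks partition the index range, and
  orthogonality gives the full sum of squares once per level.\<close>

lemma dyadic_square_integral: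
  "integrable M (\<lambda>\<omega>. dyadic_square (\<lambda>m. c m * e m \<omega>) r s) \<and>
   (LINT \<omega>|M. dyadic_square (\<lambda>m. c m * e m \<omega>) r s) = real (r + 1) * (\<Sum>i<2 ^ r. (cmod (c (s + i)))\<^sup>2)"
proof (induction r arbitrary: s)
  case 0
  show ?case using block_square[of c s 1] by simp
next
  case (Suc r)
  have "(\<Sum>i<2 ^ Suc r. (cmod (c (s + i)))\<^sup>2) = (\<Sum>i<2 ^ r. (cmod (c (s + i)))\<^sup>2) + (\<Sum>i<2 ^ r. (cmod (c (s + 2 ^ r + i)))\<^sup>2)"
    unfolding lessThan_atLeast0
    using sum.atLeastLessThan_concat[of 0 "2 ^ r" "2 ^ Suc r" "\<lambda>i. (cmod (c (s + i)))\<^sup>2"]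
        sum.shift_bounds_nat_ivl[of "\<lambda>i. (cmod (c (s + i)))\<^sup>2" 0 "2 ^ r" "2 ^ r"] by (simp add: add_ac mult_2)
  then show ?case
    using Suc.IH[of s] Suc.IH[of "s + 2 ^ r"] block_square[of c s "2 ^ Suc r"]
    by (simp add: algebra_simps del: power_Suc)
qed

lemma dyadic_square_measurable [measurable]:
  "(\<lambda>\<omega>. dyadic_square (\<lambda>m. c m * e m \<omega>) r s) \<in> borel_measurable M"
  using dyadic_square_integral by blast

text \<open>For k \<le> 2^r the square of the partial sum is at most r + 1 times the dyadic square,
  whose mean is at most r + 1 times the sum of squares. The weights exp (- q r) = 2^(- 2 \<epsilon>
  r) make the factors (r + 1)^2 summable over all r. W takes values in the extended reals because
  this series may diverge at some points.\<close>

lemma maximal_inequality: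
  assumes \<epsilon>: "\<epsilon> > 0"
  shows "\<exists>C\<ge>0. \<forall>c. summable (\<lambda>m. (cmod (c m))\<^sup>2) \<longrightarrow>
    (\<exists>W. W \<in> borel_measurable M \<and> (\<integral>\<^sup>+\<omega>. W \<omega> \<partial>M) \<le> ennreal (C * (\<Sum>m. (cmod (c m))\<^sup>2)) \<and>
      (\<forall>\<omega>\<in>space M. \<forall>k. ennreal ((cmod (\<Sum>i<k. c i * e i \<omega>))\<^sup>2) \<le> W \<omega> * ennreal (real k powr (2 * \<epsilon>))))"
proof -
  define q where "q = 2 * \<epsilon> * ln 2"
  have q: "q > 0" using \<epsilon> by (simp add: q_def)
  define g where "g = (\<lambda>r::nat. (real (r + 1))\<^sup>2 * exp (- q * real r))"
  have sg: "summable g"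
  proof (rule summable_comparison_test_bigo)
    show "summable (\<lambda>r. norm (real r powr (- 2)))" by (simp add: summable_real_powr_iff)
    show "g \<in> O(\<lambda>r. real r powr (- 2))" unfolding g_def using q by real_asymp
  qed
  have g0: "g r \<ge> 0" for r by (simp add: g_def)
  define C where "C = 2 powr (2 * \<epsilon>) * suminf g"
  have C0: "C \<ge> 0" unfolding C_def using suminf_nonneg[OF sg g0] by simp
  have "\<exists>W. W \<in> borel_measurable M \<and> (\<integral>\<^sup>+\<omega>. W \<omega> \<partial>M) \<le> ennreal (C * (\<Sum>m. (cmod (c m))\<^sup>2)) \<and>
      (\<forall>\<omega>\<in>space M. \<forall>k. ennreal ((cmod (\<Sum>i<k. c i * e i \<omega>))\<^sup>2) \<le> W \<omega> * ennreal (real k powr (2 * \<epsilon>)))"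
    if c: "summable (\<lambda>m. (cmod (c m))\<^sup>2)" for c
  proof -
    define D where "D = (\<Sum>m. (cmod (c m))\<^sup>2)"
    have D0: "D \<ge> 0" unfolding D_def by (rule suminf_nonneg[OF c]) simp
    define d where "d = (\<lambda>r \<omega>. dyadic_square (\<lambda>m. c m * e m \<omega>) r 0)"
    have d0: "d r \<omega> \<ge> 0" for r \<omega> by (simp add: d_def dyadic_square_nonneg)
    have [measurable]: "d r \<in> borel_measurable M" for r unfolding d_def by measurable
    let ?u = "\<lambda>r \<omega>. 2 powr (2 * \<epsilon>) * exp (- q * real r) * (real (r + 1) * d r \<omega>)"
    define W where "W = (\<lambda>\<omega>. \<Sum>r. ennreal (?u r \<omega>))"
    have Wm: "W \<in> borel_measurable M" unfolding W_def by measurable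
    have "(\<integral>\<^sup>+\<omega>. W \<omega> \<partial>M) = (\<Sum>r. \<integral>\<^sup>+\<omega>. ennreal (?u r \<omega>) \<partial>M)"
      unfolding W_def by (rule nn_integral_suminf) measurable
    also have "\<dots> \<le> (\<Sum>r. ennreal (2 powr (2 * \<epsilon>) * g r * D))"
    proof (intro suminf_le summableI)
      fix r
      have I: "integrable M (d r)" "(LINT \<omega>|M. d r \<omega>) = real (r + 1) * (\<Sum>i<2 ^ r. (cmod (c i))\<^sup>2)"
        using dyadic_square_integral[of c r 0] by (auto simp: d_def)
      have "(\<integral>\<^sup>+\<omega>. ennreal (?u r \<omega>) \<partial>M) = ennreal (LINT \<omega>|M. ?u r \<omega>)"
        by (intro nn_integral_eq_integral integrable_mult_right I) (auto simp: d0)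
      also have "(LINT \<omega>|M. ?u r \<omega>) = 2 powr (2 * \<epsilon>) * exp (- q * real r) * (real (r + 1) * (real (r + 1) * (\<Sum>i<2 ^ r. (cmod (c i))\<^sup>2)))"
        using I by simp
      also have "\<dots> \<le> 2 powr (2 * \<epsilon>) * exp (- q * real r) * (real (r + 1) * (real (r + 1) * D))"
        unfolding D_def by (intro mult_left_mono sum_le_suminf c) auto
      also have "\<dots> = 2 powr (2 * \<epsilon>) * g r * D" by (simp add: g_def power2_eq_square mult_ac)
      finally show "(\<integral>\<^sup>+\<omega>. ennreal (?u r \<omega>) \<partial>M) \<le> ennreal (2 powr (2 * \<epsilon>) * g r * D)"
        by (simp add: ennreal_leI)
    qed
    also have "\<dots> = ennreal (\<Sum>r. 2 powr (2 * \<epsilon>) * g r * D)"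
      by (rule suminf_ennreal2) (use g0 D0 sg in \<open>auto intro!: summable_mult summable_mult2\<close>)
    also have "(\<Sum>r. 2 powr (2 * \<epsilon>) * g r * D) = C * D"
      unfolding C_def suminf_mult[OF sg, symmetric]
      by (rule suminf_mult2[symmetric]) (intro summable_mult sg)
    finally have 1: "(\<integral>\<^sup>+\<omega>. W \<omega> \<partial>M) \<le> ennreal (C * D)" .
    have 2: "ennreal ((cmod (\<Sum>i<k. c i * e i \<omega>))\<^sup>2) \<le> W \<omega> * ennreal (real k powr (2 * \<epsilon>))" if "\<omega> \<in> space M" for \<omega> k
    proof (cases "k = 0")
      case False
      \<comment> \<open>Minimality gives 2^r \<le> 2 k, so undoing the weight exp (- q r) costs only
        the factor (2 k)^(2 \<epsilon>).\<close>
      define r where "r = (LEAST r. k \<le> 2 ^ r)"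
      have kr: "k \<le> 2 ^ r" unfolding r_def by (rule LeastI[of _ k]) (simp add: less_imp_le)
      have r2: "2 ^ r \<le> 2 * real k"
      proof (cases r)
        case 0 then show ?thesis using False by simp
      next
        case (Suc r')
        have "\<not> k \<le> 2 ^ r'" unfolding r_def by (rule not_less_Least) (use Suc in \<open>simp add: r_def\<close>)
        then have "2 ^ r' \<le> k" by simp
        then have "real (2 ^ r') \<le> real k" by (rule of_nat_mono)
        then show ?thesis by (simp add: Suc)
      qed
      have "exp (q * real r) = (2 ^ r) powr (2 * \<epsilon>)"
        by (simp add: powr_def q_def ln_realpow mult_ac)
      also have "\<dots> \<le> (2 * real k) powr (2 * \<epsilon>)" using r2 \<epsilon> by (intro powr_mono2) auto
      also have "\<dots> = 2 powr (2 * \<epsilon>) * real k powr (2 * \<epsilon>)" by (simp add: powr_mult)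
      finally have e: "exp (q * real r) \<le> 2 powr (2 * \<epsilon>) * real k powr (2 * \<epsilon>)" .
      have "(cmod (\<Sum>i<k. c i * e i \<omega>))\<^sup>2 \<le> real (r + 1) * d r \<omega>"
        using partial_sum_le_dyadic_square[OF kr, of "\<lambda>m. c m * e m \<omega>" 0] by (simp add: d_def)
      also have "\<dots> = exp (- q * real r) * exp (q * real r) * (real (r + 1) * d r \<omega>)"
        by (simp flip: exp_add)
      also have "\<dots> \<le> exp (- q * real r) * (2 powr (2 * \<epsilon>) * real k powr (2 * \<epsilon>)) * (real (r + 1) * d r \<omega>)"
        by (intro mult_right_mono mult_left_mono e) (auto simp: d0)
      also have "\<dots> = ?u r \<omega> * real k powr (2 * \<epsilon>)" by (simp add: mult_ac)
      finally have "ennreal ((cmod (\<Sum>i<k. c i * e i \<omega>))\<^sup>2) \<le> ennreal (?u r \<omega>) * ennreal (real k powr (2 * \<epsilon>))"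
        by (subst ennreal_mult[symmetric]) (auto simp: d0 intro: ennreal_leI)
      also have "ennreal (?u r \<omega>) \<le> W \<omega>"
        unfolding W_def using sum_le_suminf[of "\<lambda>r. ennreal (?u r \<omega>)" "{r}"] by (simp add: summableI)
      finally show ?thesis by (auto simp: mult_right_mono)
    qed simp
    show ?thesis using Wm 1 2 unfolding D_def by blast
  qed
  then show ?thesis using C0 by blast
qed

text \<open>With c m = d m (m + \<alpha>)^(-\<sigma>) the maximal inequality bounds all partial sums
  of c m e m by a power k^\<epsilon>, where \<epsilon> = \<eta> / 2. The Abel bound at w = s -
  \<sigma>, of real part at least 2 \<epsilon>, then applies pointwise, so one W serves all s in the
  region.\<close>

theorem random_series_bound:
  assumes \<alpha>: "0 < \<alpha>" "\<alpha> \<le> 1" and \<eta>: "\<eta> > 0"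
  shows "\<exists>C\<ge>0. \<forall>d. summable (\<lambda>m. (cmod (d m))\<^sup>2 * (real m + \<alpha>) powr (- 2 * \<sigma>)) \<longrightarrow>
    (\<exists>W. W \<in> borel_measurable M \<and>
      (\<integral>\<^sup>+\<omega>. W \<omega> \<partial>M) \<le> ennreal (C * (\<Sum>m. (cmod (d m))\<^sup>2 * (real m + \<alpha>) powr (- 2 * \<sigma>))) \<and>
      (\<forall>\<omega>\<in>space M. W \<omega> < \<infinity> \<longrightarrow> (\<forall>s. Re s \<ge> \<sigma> + \<eta> \<and> cmod s \<le> R \<longrightarrow>
         summable (\<lambda>m. d m * e m \<omega> * complex_of_real (real m + \<alpha>) powr (- s)) \<and>
         ennreal ((cmod (\<Sum>m. d m * e m \<omega> * complex_of_real (real m + \<alpha>) powr (- s)))\<^sup>2) \<le> W \<omega>)))"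
proof -
  define \<epsilon> where "\<epsilon> = \<eta> / 2"
  have \<epsilon>: "\<epsilon> > 0" using \<eta> by (simp add: \<epsilon>_def)
  obtain C1 where C1: "C1 \<ge> 0" "\<forall>c. summable (\<lambda>m. (cmod (c m))\<^sup>2) \<longrightarrow>
    (\<exists>W. W \<in> borel_measurable M \<and> (\<integral>\<^sup>+\<omega>. W \<omega> \<partial>M) \<le> ennreal (C1 * (\<Sum>m. (cmod (c m))\<^sup>2)) \<and>
      (\<forall>\<omega>\<in>space M. \<forall>k. ennreal ((cmod (\<Sum>i<k. c i * e i \<omega>))\<^sup>2) \<le> W \<omega> * ennreal (real k powr (2 * \<epsilon>))))"
    using maximal_inequality[OF \<epsilon>] by (elim exE conjE) (rule that)
  obtain C2 where C2: "C2 \<ge> 0" "\<forall>y B w. B \<ge> 0 \<and> (\<forall>k. cmod (\<Sum>i<k. y i) \<le> B * real k powr \<epsilon>) \<and> Re w \<ge> \<epsilon> + \<epsilon> \<and> cmod w \<le> R + \<bar>\<sigma>\<bar> \<longrightarrow>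
     summable (\<lambda>m. y m * complex_of_real (real m + \<alpha>) powr (- w)) \<and>
     cmod (\<Sum>m. y m * complex_of_real (real m + \<alpha>) powr (- w)) \<le> B * C2"
    using dirichlet_abel_bound[OF \<alpha> \<epsilon> \<epsilon>, of "R + \<bar>\<sigma>\<bar>"] by (elim exE conjE) (rule that)
  have "\<exists>W. W \<in> borel_measurable M \<and>
      (\<integral>\<^sup>+\<omega>. W \<omega> \<partial>M) \<le> ennreal ((C2 + 1)\<^sup>2 * C1 * (\<Sum>m. (cmod (d m))\<^sup>2 * (real m + \<alpha>) powr (- 2 * \<sigma>))) \<and>
      (\<forall>\<omega>\<in>space M. W \<omega> < \<infinity> \<longrightarrow> (\<forall>s. Re s \<ge> \<sigma> + \<eta> \<and> cmod s \<le> R \<longrightarrow>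
         summable (\<lambda>m. d m * e m \<omega> * complex_of_real (real m + \<alpha>) powr (- s)) \<and>
         ennreal ((cmod (\<Sum>m. d m * e m \<omega> * complex_of_real (real m + \<alpha>) powr (- s)))\<^sup>2) \<le> W \<omega>))"
    if d: "summable (\<lambda>m. (cmod (d m))\<^sup>2 * (real m + \<alpha>) powr (- 2 * \<sigma>))" for d
  proof -
    define c where "c = (\<lambda>m. d m * complex_of_real (real m + \<alpha>) powr (- of_real \<sigma>))"
    have c2: "(cmod (c m))\<^sup>2 = (cmod (d m))\<^sup>2 * (real m + \<alpha>) powr (- 2 * \<sigma>)" for m
    proof -
      have "((real m + \<alpha>) powr (- \<sigma>))\<^sup>2 = (real m + \<alpha>) powr (- 2 * \<sigma>)"
        using \<alpha> by (simp add: power2_eq_square flip: powr_add)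
      then show ?thesis unfolding c_def norm_mult power_mult_distrib
        using norm_shift_powr[OF \<alpha>(1), of m "- of_real \<sigma>"] by simp
    qed
    have "summable (\<lambda>m. (cmod (c m))\<^sup>2)" unfolding c2 by (rule d)
    from C1(2)[rule_format, OF this] obtain W where W: "W \<in> borel_measurable M" "(\<integral>\<^sup>+\<omega>. W \<omega> \<partial>M) \<le> ennreal (C1 * (\<Sum>m. (cmod (c m))\<^sup>2))"
      "\<And>\<omega> k. \<omega> \<in> space M \<Longrightarrow> ennreal ((cmod (\<Sum>i<k. c i * e i \<omega>))\<^sup>2) \<le> W \<omega> * ennreal (real k powr (2 * \<epsilon>))"
      by blast
    \<comment> \<open>The constant is C2 + 1 and not C2, so that finiteness of W' forces that of W
      even if C2 = 0.\<close>
    define W' where "W' = (\<lambda>\<omega>. ennreal ((C2 + 1)\<^sup>2) * W \<omega>)"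
    have m: "W' \<in> borel_measurable M" unfolding W'_def using W(1) by measurable
    have "(\<integral>\<^sup>+\<omega>. W' \<omega> \<partial>M) = ennreal ((C2 + 1)\<^sup>2) * (\<integral>\<^sup>+\<omega>. W \<omega> \<partial>M)"
      unfolding W'_def by (rule nn_integral_cmult[OF W(1)])
    also have "\<dots> \<le> ennreal ((C2 + 1)\<^sup>2) * ennreal (C1 * (\<Sum>m. (cmod (c m))\<^sup>2))"
      by (intro mult_left_mono W(2)) simp
    also have "\<dots> = ennreal ((C2 + 1)\<^sup>2 * C1 * (\<Sum>m. (cmod (c m))\<^sup>2))"
      using C1(1) d by (subst ennreal_mult[symmetric]) (auto simp: mult.assoc c2 intro!: suminf_nonneg mult_nonneg_nonneg)
    finally have i: "(\<integral>\<^sup>+\<omega>. W' \<omega> \<partial>M) \<le> ennreal ((C2 + 1)\<^sup>2 * C1 * (\<Sum>m. (cmod (d m))\<^sup>2 * (real m + \<alpha>) powr (- 2 * \<sigma>)))"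
      unfolding c2 .
    have b: "summable (\<lambda>m. d m * e m \<omega> * complex_of_real (real m + \<alpha>) powr (- s)) \<and>
         ennreal ((cmod (\<Sum>m. d m * e m \<omega> * complex_of_real (real m + \<alpha>) powr (- s)))\<^sup>2) \<le> W' \<omega>"
      if \<omega>: "\<omega> \<in> space M" "W' \<omega> < \<infinity>" and s: "Re s \<ge> \<sigma> + \<eta>" "cmod s \<le> R" for \<omega> s
    proof -
      have "W \<omega> \<noteq> \<top>"
      proof
        assume "W \<omega> = \<top>"
        then have "W' \<omega> = \<top>" using C2(1) by (simp add: W'_def ennreal_mult_top)
        then show False using \<omega>(2) by simp
      qed
      then obtain v where v: "W \<omega> = ennreal v" "v \<ge> 0" by (cases "W \<omega>") auto
      define B where "B = sqrt v"
      have B: "B \<ge> 0" "B\<^sup>2 = v" using v by (auto simp: B_def)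
      have bd: "cmod (\<Sum>i<k. c i * e i \<omega>) \<le> B * real k powr \<epsilon>" for k
      proof (rule power2_le_imp_le)
        have "ennreal ((cmod (\<Sum>i<k. c i * e i \<omega>))\<^sup>2) \<le> ennreal (v * real k powr (2 * \<epsilon>))"
          using W(3)[OF \<omega>(1), of k] v by (simp add: ennreal_mult)
        then have "(cmod (\<Sum>i<k. c i * e i \<omega>))\<^sup>2 \<le> v * real k powr (2 * \<epsilon>)"
          using v by (subst (asm) ennreal_le_iff) auto
        also have "\<dots> = (B * real k powr \<epsilon>)\<^sup>2"
        proof -
          have "real k powr (2 * \<epsilon>) = (real k powr \<epsilon>)\<^sup>2" by (simp only: mult_2 powr_add power2_eq_square)
          then show ?thesis using B(2) by (simp only: power_mult_distrib)
        qed
        finally show "(cmod (\<Sum>i<k. c i * e i \<omega>))\<^sup>2 \<le> (B * real k powr \<epsilon>)\<^sup>2" .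
      qed (use B in auto)
      define w where "w = s - of_real \<sigma>"
      have w: "Re w \<ge> \<epsilon> + \<epsilon>" "cmod w \<le> R + \<bar>\<sigma>\<bar>"
        using s norm_triangle_ineq4[of s "of_real \<sigma>"] by (auto simp: w_def \<epsilon>_def)
      have eq: "c m * e m \<omega> * complex_of_real (real m + \<alpha>) powr (- w) = d m * e m \<omega> * complex_of_real (real m + \<alpha>) powr (- s)" for m
      proof -
        have "complex_of_real (real m + \<alpha>) powr (- s) = complex_of_real (real m + \<alpha>) powr (- of_real \<sigma> + - w)"
          by (simp add: w_def)
        then show ?thesis by (simp only: powr_add c_def mult_ac)
      qed
      have "summable (\<lambda>m. d m * e m \<omega> * complex_of_real (real m + \<alpha>) powr (- s)) \<and>
         cmod (\<Sum>m. d m * e m \<omega> * complex_of_real (real m + \<alpha>) powr (- s)) \<le> B * C2"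
        using C2(2)[rule_format, OF conjI[OF B(1) conjI[OF allI[OF bd] conjI[OF w]]]] unfolding eq .
      moreover have "ennreal ((B * C2)\<^sup>2) \<le> W' \<omega>"
      proof -
        have "(B * C2)\<^sup>2 \<le> (C2 + 1)\<^sup>2 * v"
        proof -
          have "C2\<^sup>2 \<le> (C2 + 1)\<^sup>2" using C2(1) by (intro power_mono) auto
          from mult_right_mono[OF this v(2)] show ?thesis
            unfolding power_mult_distrib B(2) by (simp add: mult.commute)
        qed
        then show ?thesis unfolding W'_def v(1) using v(2) by (simp add: ennreal_leI flip: ennreal_mult)
      qed
      moreover have "ennreal (x\<^sup>2) \<le> ennreal ((B * C2)\<^sup>2)" if "0 \<le> x" "x \<le> B * C2" for x
        using that by (intro ennreal_leI power_mono)
      ultimately show ?thesis by (meson norm_ge_zero order.trans)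
    qed
    show ?thesis using m i b by blast
  qed
  moreover have "(C2 + 1)\<^sup>2 * C1 \<ge> 0" using C1 by simp
  ultimately show ?thesis by blast
qed

end

subsection \<open>Haar measure on the tori\<close>

abbreviation circle_algebra :: "complex measure" where
  "circle_algebra \<equiv> restrict_space borel (sphere 0 1)"

lemma space_circle_algebra: "space circle_algebra = sphere 0 1"
  by (simp add: space_restrict_space)

lemma circle_algebra_to_borel: "(\<lambda>x. x) \<in> circle_algebra \<rightarrow>\<^sub>M borel"
  by (rule measurable_restrict_space1) simp

lemma topspace_torus: "topspace (torus I) = (\<Pi>\<^sub>E i\<in>I. sphere 0 1)"
  by (simp add: torus_def)

text \<open>Open sets of the torus are traces of open sets of the full function space, where Borel
  and product sigma-fields are known to agree. Coordinates outside I are left unconstrained.\<close>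

lemma openin_torus_extend:
  fixes U :: "('i \<Rightarrow> complex) set"
  assumes U: "openin (torus I) U"
  obtains V where "open V" "U = V \<inter> (\<Pi>\<^sub>E i\<in>I. sphere 0 1)"
proof -
  define \<V> where "\<V> = {Pi\<^sub>E UNIV Y |Y. (\<forall>i. open (Y i)) \<and> finite {i. Y i \<noteq> UNIV} \<and> Pi\<^sub>E UNIV Y \<inter> (\<Pi>\<^sub>E i\<in>I. sphere 0 1) \<subseteq> U}"
  have "open (\<Union>\<V>)"
    unfolding \<V>_def by (intro open_Union) (auto intro!: open_PiE)
  moreover have "U = \<Union>\<V> \<inter> (\<Pi>\<^sub>E i\<in>I. sphere 0 1)"
  proof
    show "\<Union>\<V> \<inter> (\<Pi>\<^sub>E i\<in>I. sphere 0 1) \<subseteq> U" unfolding \<V>_def by blast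
    show "U \<subseteq> \<Union>\<V> \<inter> (\<Pi>\<^sub>E i\<in>I. sphere 0 1)"
    proof
      fix x assume x: "x \<in> U"
      have xS: "x \<in> (\<Pi>\<^sub>E i\<in>I. sphere 0 1)" using openin_subset[OF U] x by (auto simp: topspace_torus)
      have "\<exists>Z. finite {i \<in> I. Z i \<noteq> sphere 0 1} \<and> (\<forall>i\<in>I. openin (top_of_set (sphere 0 1)) (Z i)) \<and>
        x \<in> Pi\<^sub>E I Z \<and> Pi\<^sub>E I Z \<subseteq> U"
        using bspec[OF U[unfolded torus_def openin_product_topology_alt] x] by (simp only: topspace_euclidean_subtopology)
      then obtain Z where Z: "finite {i \<in> I. Z i \<noteq> sphere 0 1}" "\<forall>i\<in>I. openin (top_of_set (sphere 0 1)) (Z i)"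
        "x \<in> Pi\<^sub>E I Z" "Pi\<^sub>E I Z \<subseteq> U"
        by (elim exE conjE) (rule that)
      have "\<forall>i\<in>I. \<exists>T. open T \<and> Z i = sphere 0 1 \<inter> T" using Z(2) by (simp add: openin_open)
      then obtain T where T: "\<And>i. i \<in> I \<Longrightarrow> open (T i)" "\<And>i. i \<in> I \<Longrightarrow> Z i = sphere 0 1 \<inter> T i" by metis
      define Y where "Y = (\<lambda>i. if i \<in> I \<and> Z i \<noteq> sphere 0 1 then T i else UNIV)"
      have Yo: "open (Y i)" for i using T by (simp add: Y_def)
      have fin: "finite {i. Y i \<noteq> UNIV}" by (rule finite_subset[OF _ Z(1)]) (auto simp: Y_def)
      have ZY: "Z i = sphere 0 1 \<inter> Y i" if "i \<in> I" for i
      proof (cases "Z i = sphere 0 1")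
        case False
        then have "Y i = T i" using that by (simp add: Y_def)
        then show ?thesis using T(2)[OF that] by (simp only:)
      qed (simp add: Y_def)
      have sub: "Pi\<^sub>E UNIV Y \<inter> (\<Pi>\<^sub>E i\<in>I. sphere 0 1) \<subseteq> U"
      proof
        fix y assume y: "y \<in> Pi\<^sub>E UNIV Y \<inter> (\<Pi>\<^sub>E i\<in>I. sphere 0 1)"
        have "y \<in> Pi\<^sub>E I Z"
        proof (rule PiE_I)
          fix i assume i: "i \<in> I"
          have "y i \<in> Y i" using y by (auto simp: PiE_iff)
          moreover have "y i \<in> sphere 0 1" using y i by (auto simp: PiE_iff)
          ultimately show "y i \<in> Z i" using ZY[OF i] by blast
        next
          fix i assume "i \<notin> I" then show "y i = undefined" using y by (auto simp: PiE_iff extensional_def)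
        qed
        then show "y \<in> U" using Z(4) by blast
      qed
      have "x \<in> Pi\<^sub>E UNIV Y"
      proof (rule PiE_I)
        fix i show "x i \<in> Y i"
        proof (cases "i \<in> I")
          case True then have "x i \<in> Z i" using Z(3) by (auto simp: PiE_iff)
          then show ?thesis using ZY[OF True] by blast
        qed (simp add: Y_def)
      qed simp
      moreover have "Pi\<^sub>E UNIV Y \<in> \<V>" unfolding \<V>_def using Yo fin sub by blast
      ultimately show "x \<in> \<Union>\<V> \<inter> (\<Pi>\<^sub>E i\<in>I. sphere 0 1)" using xS by blast
    qed
  qed
  ultimately show ?thesis by (rule that)
qed

text \<open>That open sets belong to the product field rests on the countability of the index type;
  the converse inclusion is the continuity of the coordinates.\<close>

lemma sets_borel_torus:
  fixes I :: "'i::countable set"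
  shows "sets (borel_of (torus I)) = sets (Pi\<^sub>M I (\<lambda>_. circle_algebra))"
proof
  let ?P = "Pi\<^sub>M I (\<lambda>_. circle_algebra)"
  have sp: "space ?P = (\<Pi>\<^sub>E i\<in>I. sphere 0 1)" by (simp add: space_PiM space_circle_algebra)
  show "sets (borel_of (torus I)) \<subseteq> sets ?P"
  proof -
    have idm: "(\<lambda>x. x) \<in> ?P \<rightarrow>\<^sub>M Pi\<^sub>M UNIV (\<lambda>_::'i. borel :: complex measure)"
    proof (rule measurable_PiM_single')
      fix i :: 'i
      show "(\<lambda>x. x i) \<in> ?P \<rightarrow>\<^sub>M borel"
      proof (cases "i \<in> I")
        case True
        show ?thesis
          by (rule measurable_compose[OF measurable_component_singleton[OF True] circle_algebra_to_borel])
      next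
        case False
        have "(\<lambda>x. x i) \<in> ?P \<rightarrow>\<^sub>M borel \<longleftrightarrow> (\<lambda>x. undefined) \<in> ?P \<rightarrow>\<^sub>M (borel :: complex measure)"
          by (rule measurable_cong) (use False in \<open>auto simp: sp PiE_iff extensional_def\<close>)
        then show ?thesis by simp
      qed
    qed auto
    have "U \<in> sets ?P" if "openin (torus I) U" for U
    proof -
      from that obtain V where V: "open V" "U = V \<inter> (\<Pi>\<^sub>E i\<in>I. sphere 0 1)" by (rule openin_torus_extend)
      have "V \<in> sets (Pi\<^sub>M UNIV (\<lambda>_::'i. borel :: complex measure))"
        unfolding sets_PiM_equal_borel using V(1) by simp
      from measurable_sets[OF idm this] show ?thesis unfolding sp V(2) by simp
    qed
    then have "{U. openin (torus I) U} \<subseteq> sets ?P" by blast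
    from sets.sigma_sets_subset[OF this] show ?thesis by (simp add: sets_borel_of sp topspace_torus)
  qed
  show "sets ?P \<subseteq> sets (borel_of (torus I))"
  proof
    fix A assume A: "A \<in> sets ?P"
    have "(\<lambda>x. x) \<in> borel_of (torus I) \<rightarrow>\<^sub>M ?P"
    proof (rule measurable_PiM_single')
      fix i assume i: "i \<in> I"
      show "(\<lambda>x. x i) \<in> borel_of (torus I) \<rightarrow>\<^sub>M circle_algebra"
      proof (rule measurable_restrict_space2)
        show "(\<lambda>x. x i) \<in> space (borel_of (torus I)) \<rightarrow> sphere 0 1" using i by (auto simp: topspace_torus PiE_iff)
        show "(\<lambda>x. x i) \<in> borel_measurable (borel_of (torus I))"
        proof (rule borel_measurableI)
          fix T :: "complex set" assume T: "open T"
          have "continuous_map (torus I) (top_of_set (sphere 0 1)) (\<lambda>x. x i)"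
            unfolding torus_def by (rule continuous_map_product_coordinates[OF i])
          then have "continuous_map (torus I) euclidean (\<lambda>x. x i)"
            by (simp add: continuous_map_in_subtopology)
          from openin_continuous_map_preimage[OF this, of T] T
          have "openin (torus I) ((\<lambda>x. x i) -` T \<inter> space (borel_of (torus I)))"
            by (simp add: vimage_def Int_def conj_commute)
          then show "(\<lambda>x. x i) -` T \<inter> space (borel_of (torus I)) \<in> sets (borel_of (torus I))"
            unfolding sets_borel_of by blast
        qed
      qed
    qed (auto simp: topspace_torus space_circle_algebra)
    from measurable_sets[OF this A] sets.sets_into_space[OF A]
    show "A \<in> sets (borel_of (torus I))" by (simp add: sp topspace_torus Int_absorb2)
  qed
qed

section \<open>The invariant measure on the circle\<close>

definition circle_measure :: "complex measure" where
  "circle_measure = distr (uniform_measure lborel {0..<1::real}) circle_algebra (\<lambda>t. cis (2 * pi * t))"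

lemma cis_measurable: "(\<lambda>t. cis (2 * pi * t)) \<in> borel \<rightarrow>\<^sub>M circle_algebra"
  by (rule measurable_restrict_space2)
     (auto intro!: borel_measurable_continuous_onI continuous_intros)

lemma prob_space_circle_measure: "prob_space circle_measure"
proof -
  interpret U: prob_space "uniform_measure lborel {0..<1::real}"
    by (rule prob_space_uniform_measure) auto
  show ?thesis unfolding circle_measure_def
    by (rule U.prob_space_distr) (use cis_measurable in \<open>simp add: measurable_def\<close>)
qed

lemma sets_circle_measure: "sets circle_measure = sets circle_algebra"
  by (simp add: circle_measure_def)

lemma space_circle_measure: "space circle_measure = sphere 0 1"
  by (simp add: circle_measure_def space_circle_algebra)

lemma emeasure_circle_measure:
  assumes "A \<in> sets circle_algebra"
  shows "emeasure circle_measure A = emeasure lborel ({0..<1} \<inter> (\<lambda>t. cis (2 * pi * t)) -` A)"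
proof -
  have m: "(\<lambda>t. cis (2 * pi * t)) \<in> uniform_measure lborel {0..<1::real} \<rightarrow>\<^sub>M circle_algebra"
    using cis_measurable by (simp add: measurable_def)
  have B: "(\<lambda>t. cis (2 * pi * t)) -` A \<in> sets lborel"
    using measurable_sets[OF cis_measurable assms] by simp
  show ?thesis
    unfolding circle_measure_def by (subst emeasure_distr[OF m assms]) (use B in \<open>simp add: divide_ennreal_def\<close>)
qed

lemma emeasure_lborel_translate:
  assumes "X \<in> sets borel"
  shows "emeasure lborel ((+) c -` X :: real set) = emeasure lborel X"
proof -
  have "emeasure lborel X = emeasure (distr lborel borel ((+) c)) X" by (simp add: lborel_distr_plus)
  also have "\<dots> = emeasure lborel ((+) c -` X)" using assms by (subst emeasure_distr) auto
  finally show ?thesis by simp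
qed

text \<open>In the angle a rotation is a translation by \<theta> in [0, 1). The part of the
  translated interval beyond 1 is moved back by one period.\<close>

lemma circle_measure_rotate:
  assumes z: "z \<in> sphere 0 1" and A: "A \<in> sets circle_algebra"
  shows "emeasure circle_measure ((\<lambda>x. z * x) -` A \<inter> sphere 0 1) = emeasure circle_measure A"
proof -
  define \<theta> where "\<theta> = frac (Arg z / (2 * pi))"
  have th: "0 \<le> \<theta>" "\<theta> < 1" by (auto simp: \<theta>_def frac_lt_1)
  have "2 * pi * \<theta> = Arg z + 2 * pi * of_int (- \<lfloor>Arg z / (2 * pi)\<rfloor>)" by (simp add: \<theta>_def frac_def right_diff_distrib)
  then have "cis (2 * pi * \<theta>) = cis (Arg z) * cis (2 * pi * of_int (- \<lfloor>Arg z / (2 * pi)\<rfloor>))"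
    by (simp only: cis_mult)
  also have "cis (2 * pi * of_int (- \<lfloor>Arg z / (2 * pi)\<rfloor>)) = 1" by (rule cis_multiple_2pi) simp
  also have "cis (Arg z) * 1 = z"
  proof -
    have "z \<noteq> 0" using z by auto
    then show ?thesis using z by (simp add: cis_Arg sgn_div_norm)
  qed
  finally have zc: "z = cis (2 * pi * \<theta>)" ..
  define B where "B = (\<lambda>t. cis (2 * pi * t)) -` A"
  have Bm: "B \<in> sets borel" using measurable_sets[OF cis_measurable A] by (simp add: B_def)
  have zt: "z * cis (2 * pi * t) = cis (2 * pi * (\<theta> + t))" for t by (simp add: zc cis_mult algebra_simps)
  have rot: "(\<lambda>x. z * x) -` A \<inter> sphere 0 1 \<in> sets circle_algebra"
  proof -
    have "(\<lambda>x. z * x) \<in> circle_algebra \<rightarrow>\<^sub>M circle_algebra"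
      by (rule measurable_restrict_space2)
         (use z in \<open>auto simp: space_circle_algebra norm_mult intro!: measurable_restrict_space1\<close>)
    from measurable_sets[OF this A] show ?thesis by (simp add: space_circle_algebra)
  qed
  have per: "1 + t \<in> B \<longleftrightarrow> t \<in> B" for t
  proof -
    have "cis (2 * pi * (1 + t)) = cis (2 * pi) * cis (2 * pi * t)" by (simp add: cis_mult algebra_simps)
    then show ?thesis by (simp add: B_def cis_2pi)
  qed
  have "emeasure circle_measure ((\<lambda>x. z * x) -` A \<inter> sphere 0 1) = emeasure lborel ({0..<1} \<inter> (+) \<theta> -` B)"
    unfolding emeasure_circle_measure[OF rot]
    by (rule arg_cong[where f = "emeasure lborel"]) (auto simp: B_def zt)
  moreover have "{0..<1} \<inter> (+) \<theta> -` B = (+) \<theta> -` ({\<theta>..<1 + \<theta>} \<inter> B)" by (auto simp: add.commute)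
  moreover have "emeasure lborel ((+) \<theta> -` ({\<theta>..<1 + \<theta>} \<inter> B)) = emeasure lborel ({\<theta>..<1 + \<theta>} \<inter> B)"
    using Bm by (intro emeasure_lborel_translate) auto
  moreover have "{\<theta>..<1 + \<theta>} \<inter> B = ({\<theta>..<1} \<inter> B) \<union> ({1..<1 + \<theta>} \<inter> B)" using th by auto
  moreover have "emeasure lborel (({\<theta>..<1} \<inter> B) \<union> ({1..<1 + \<theta>} \<inter> B)) = emeasure lborel ({\<theta>..<1} \<inter> B) + emeasure lborel ({1..<1 + \<theta>} \<inter> B)"
    using Bm by (intro plus_emeasure[symmetric]) auto
  moreover have "emeasure lborel ((+) 1 -` ({1..<1 + \<theta>} \<inter> B)) = emeasure lborel ({1..<1 + \<theta>} \<inter> B)"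
    using Bm by (intro emeasure_lborel_translate) auto
  moreover have "(+) 1 -` ({1..<1 + \<theta>} \<inter> B) = {0..<\<theta>} \<inter> B" by (auto simp: per)
  moreover have "emeasure lborel ({\<theta>..<1} \<inter> B) + emeasure lborel ({0..<\<theta>} \<inter> B) = emeasure lborel (({\<theta>..<1} \<inter> B) \<union> ({0..<\<theta>} \<inter> B))"
    using Bm by (intro plus_emeasure) auto
  moreover have "({\<theta>..<1} \<inter> B) \<union> ({0..<\<theta>} \<inter> B) = {0..<1} \<inter> B" using th by auto
  moreover have "emeasure circle_measure A = emeasure lborel ({0..<1} \<inter> B)"
    unfolding emeasure_circle_measure[OF A] B_def ..
  ultimately show ?thesis by (simp only:)
qed

section \<open>Invariance, uniqueness and existence of the Haar measure on a torus\<close>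

definition torus_conj :: "'i set \<Rightarrow> ('i \<Rightarrow> complex) \<Rightarrow> 'i \<Rightarrow> complex" where
  "torus_conj I \<omega> = (\<lambda>i\<in>I. cnj (\<omega> i))"

lemma torus_mult_closed: "\<omega> \<in> topspace (torus I) \<Longrightarrow> x \<in> topspace (torus I) \<Longrightarrow> torus_mult I \<omega> x \<in> topspace (torus I)"
  by (auto simp: topspace_torus torus_mult_def PiE_iff norm_mult)

lemma torus_conj_closed: "\<omega> \<in> topspace (torus I) \<Longrightarrow> torus_conj I \<omega> \<in> topspace (torus I)"
  by (auto simp: topspace_torus torus_conj_def PiE_iff)

lemma torus_mult_conj:
  assumes "\<omega> \<in> topspace (torus I)" "x \<in> topspace (torus I)"
  shows "torus_mult I \<omega> (torus_mult I (torus_conj I \<omega>) x) = x"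
    and "torus_mult I (torus_conj I \<omega>) (torus_mult I \<omega> x) = x"
proof -
  have 1: "\<omega> i * cnj (\<omega> i) = 1" if "i \<in> I" for i
    using assms(1) that by (simp add: topspace_torus PiE_iff complex_norm_square[symmetric])
  have 2: "\<omega> i * (cnj (\<omega> i) * x i) = x i" "cnj (\<omega> i) * (\<omega> i * x i) = x i" if "i \<in> I" for i
    using 1[OF that] by (metis mult.assoc mult.commute mult_1)+
  have 3: "x i = undefined" if "i \<notin> I" for i
    using assms(2) that by (simp add: topspace_torus PiE_iff extensional_def)
  show "torus_mult I \<omega> (torus_mult I (torus_conj I \<omega>) x) = x"
    by (rule ext) (simp add: torus_mult_def torus_conj_def 2 3)
  show "torus_mult I (torus_conj I \<omega>) (torus_mult I \<omega> x) = x"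
    by (rule ext) (simp add: torus_mult_def torus_conj_def 2 3)
qed

text \<open>Rotation by the conjugate inverts rotation by \<omega>. The images in which
  \<open>is_prob_haar\<close> states invariance thus become preimages, and preimages fit
  push-forward measures.\<close>

lemma torus_mult_image:
  assumes w: "\<omega> \<in> topspace (torus I)" and A: "A \<subseteq> topspace (torus I)"
  shows "torus_mult I (torus_conj I \<omega>) ` A = torus_mult I \<omega> -` A \<inter> topspace (torus I)"
proof
  show "torus_mult I (torus_conj I \<omega>) ` A \<subseteq> torus_mult I \<omega> -` A \<inter> topspace (torus I)"
  proof
    fix y assume "y \<in> torus_mult I (torus_conj I \<omega>) ` A"
    then obtain x where x: "x \<in> A" "y = torus_mult I (torus_conj I \<omega>) x" by (rule imageE)
    have xt: "x \<in> topspace (torus I)" using A x(1) by (rule subsetD)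
    show "y \<in> torus_mult I \<omega> -` A \<inter> topspace (torus I)"
      using x torus_mult_conj(1)[OF w xt] torus_mult_closed[OF torus_conj_closed[OF w] xt] by simp
  qed
  show "torus_mult I \<omega> -` A \<inter> topspace (torus I) \<subseteq> torus_mult I (torus_conj I \<omega>) ` A"
  proof
    fix y assume y: "y \<in> torus_mult I \<omega> -` A \<inter> topspace (torus I)"
    then have "y = torus_mult I (torus_conj I \<omega>) (torus_mult I \<omega> y)" using torus_mult_conj(2)[OF w, of y] by simp
    moreover have "torus_mult I \<omega> y \<in> A" using y by simp
    ultimately show "y \<in> torus_mult I (torus_conj I \<omega>) ` A" by (rule image_eqI)
  qed
qed

lemma torus_conj_conj: "\<omega> \<in> topspace (torus I) \<Longrightarrow> torus_conj I (torus_conj I \<omega>) = \<omega>"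
  by (rule ext) (simp add: torus_conj_def topspace_torus PiE_iff extensional_def)

lemma torus_mult_measurable_pair:
  assumes M: "sets M = sets (Pi\<^sub>M I (\<lambda>_. circle_algebra))" and N: "sets N = sets (Pi\<^sub>M I (\<lambda>_. circle_algebra))"
  shows "(\<lambda>p. torus_mult I (fst p) (snd p)) \<in> M \<Otimes>\<^sub>M N \<rightarrow>\<^sub>M Pi\<^sub>M I (\<lambda>_. circle_algebra)"
  unfolding torus_mult_def
proof (rule measurable_restrict)
  fix i assume i: "i \<in> I"
  have c: "(\<lambda>x. x i) \<in> Pi\<^sub>M I (\<lambda>_. circle_algebra) \<rightarrow>\<^sub>M circle_algebra"
    by (rule measurable_component_singleton[OF i])
  have cM: "(\<lambda>x. x i) \<in> M \<rightarrow>\<^sub>M circle_algebra" using c measurable_cong_sets[OF M refl] by blast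
  have cN: "(\<lambda>x. x i) \<in> N \<rightarrow>\<^sub>M circle_algebra" using c measurable_cong_sets[OF N refl] by blast
  have 1: "(\<lambda>p. fst p i) \<in> M \<Otimes>\<^sub>M N \<rightarrow>\<^sub>M circle_algebra"
    by (rule measurable_compose[OF measurable_fst cM])
  have 2: "(\<lambda>p. snd p i) \<in> M \<Otimes>\<^sub>M N \<rightarrow>\<^sub>M circle_algebra"
    by (rule measurable_compose[OF measurable_snd cN])
  note b = measurable_compose[OF 1 circle_algebra_to_borel] measurable_compose[OF 2 circle_algebra_to_borel]
  show "(\<lambda>p. fst p i * snd p i) \<in> M \<Otimes>\<^sub>M N \<rightarrow>\<^sub>M circle_algebra"
  proof (rule measurable_restrict_space2)
    show "(\<lambda>p. fst p i * snd p i) \<in> space (M \<Otimes>\<^sub>M N) \<rightarrow> sphere 0 1"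
      using measurable_space[OF 1] measurable_space[OF 2] by (auto simp: space_circle_algebra norm_mult)
    show "(\<lambda>p. fst p i * snd p i) \<in> borel_measurable (M \<Otimes>\<^sub>M N)"
      by (rule borel_measurable_times[OF b])
  qed
qed

lemma torus_mult_measurable:
  assumes M: "sets M = sets (Pi\<^sub>M I (\<lambda>_. circle_algebra))" and w: "\<omega> \<in> topspace (torus I)"
  shows "torus_mult I \<omega> \<in> M \<rightarrow>\<^sub>M Pi\<^sub>M I (\<lambda>_. circle_algebra)"
proof -
  have "\<omega> \<in> space (Pi\<^sub>M I (\<lambda>_. circle_algebra))"
    using w by (simp add: space_PiM space_circle_algebra topspace_torus)
  from measurable_compose[OF measurable_Pair1'[OF this] torus_mult_measurable_pair[OF refl M]]
  show ?thesis by simp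
qed

text \<open>Invariance is recast as equality with a push-forward, the form to which the
  transformation rules for integrals apply.\<close>

lemma is_prob_haarD:
  fixes I :: "'i::countable set"
  assumes "is_prob_haar I M"
  shows "prob_space M" "space M = topspace (torus I)" "sets M = sets (Pi\<^sub>M I (\<lambda>_. circle_algebra))"
    and "\<And>\<omega>. \<omega> \<in> topspace (torus I) \<Longrightarrow> distr M M (torus_mult I \<omega>) = M"
proof -
  show "prob_space M" and sp: "space M = topspace (torus I)"
    using assms unfolding is_prob_haar_def by blast+
  show st: "sets M = sets (Pi\<^sub>M I (\<lambda>_. circle_algebra))"
    using assms unfolding is_prob_haar_def sets_borel_torus by blast
  fix \<omega> assume w: "\<omega> \<in> topspace (torus I)"
  show "distr M M (torus_mult I \<omega>) = M"
  proof (rule measure_eqI)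
    fix A assume "A \<in> sets (distr M M (torus_mult I \<omega>))"
    then have A: "A \<in> sets M" by simp
    have "torus_mult I \<omega> \<in> M \<rightarrow>\<^sub>M M"
      using torus_mult_measurable[OF st w] measurable_cong_sets[OF refl st] by blast
    then have "emeasure (distr M M (torus_mult I \<omega>)) A = emeasure M (torus_mult I \<omega> -` A \<inter> space M)"
      using A by (rule emeasure_distr)
    also have "torus_mult I \<omega> -` A \<inter> space M = torus_mult I (torus_conj I \<omega>) ` A"
      unfolding sp using torus_mult_image[OF w] sets.sets_into_space[OF A] by (simp add: sp)
    also have "emeasure M (torus_mult I (torus_conj I \<omega>) ` A) = emeasure M A"
      using assms A torus_conj_closed[OF w] unfolding is_prob_haar_def by blast
    finally show "emeasure (distr M M (torus_mult I \<omega>)) A = emeasure M A" .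
  qed simp
qed

text \<open>Fubini for \<open>(x, y) \<mapsto> x y\<close> under the product of the two measures.\<close>

lemma is_prob_haar_unique:
  fixes I :: "'i::countable set"
  assumes M: "is_prob_haar I M" and N: "is_prob_haar I N"
  shows "M = N"
proof (rule measure_eqI)
  note m = is_prob_haarD[OF M] and n = is_prob_haarD[OF N]
  interpret M: prob_space M by (rule m)
  interpret N: prob_space N by (rule n)
  interpret P: pair_sigma_finite M N ..
  show "sets M = sets N" by (simp add: m n)
  fix A assume A: "A \<in> sets M"
  then have AN: "A \<in> sets N" by (simp add: m n)
  have AP: "A \<in> sets (Pi\<^sub>M I (\<lambda>_. circle_algebra))" using A by (simp add: m)
  let ?f = "\<lambda>x y. indicator A (torus_mult I x y) :: ennreal"
  have mult_M: "torus_mult I x \<in> M \<rightarrow>\<^sub>M M" if "x \<in> topspace (torus I)" for x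
    using torus_mult_measurable[OF m(3) that] measurable_cong_sets[OF refl m(3)] by blast
  have mult_N: "torus_mult I x \<in> N \<rightarrow>\<^sub>M N" if "x \<in> topspace (torus I)" for x
    using torus_mult_measurable[OF n(3) that] measurable_cong_sets[OF refl n(3)] by blast
  have comm: "torus_mult I x y = torus_mult I y x" for x y by (simp add: torus_mult_def mult.commute)
  have iM: "(\<integral>\<^sup>+ x. ?f y x \<partial>M) = emeasure M A" if "y \<in> topspace (torus I)" for y
  proof -
    have "(\<integral>\<^sup>+ x. ?f y x \<partial>M) = (\<integral>\<^sup>+ x. indicator A x \<partial>distr M M (torus_mult I y))"
      using A by (intro nn_integral_distr[symmetric] mult_M[OF that]) auto
    then show ?thesis using A by (simp add: m(4)[OF that])
  qed
  have iN: "(\<integral>\<^sup>+ y. ?f x y \<partial>N) = emeasure N A" if "x \<in> topspace (torus I)" for x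
  proof -
    have "(\<integral>\<^sup>+ y. ?f x y \<partial>N) = (\<integral>\<^sup>+ y. indicator A y \<partial>distr N N (torus_mult I x))"
      using AN by (intro nn_integral_distr[symmetric] mult_N[OF that]) auto
    then show ?thesis using AN by (simp add: n(4)[OF that])
  qed
  have meas: "(\<lambda>(x, y). ?f x y) \<in> borel_measurable (M \<Otimes>\<^sub>M N)"
  proof -
    have "(\<lambda>p. indicator A (torus_mult I (fst p) (snd p)) :: ennreal) \<in> borel_measurable (M \<Otimes>\<^sub>M N)"
      by (rule measurable_compose[OF torus_mult_measurable_pair[OF m(3) n(3)]]) (use AP in simp)
    then show ?thesis by (simp add: case_prod_unfold)
  qed
  have "(\<integral>\<^sup>+ y. (\<integral>\<^sup>+ x. ?f x y \<partial>M) \<partial>N) = (\<integral>\<^sup>+ x. (\<integral>\<^sup>+ y. ?f x y \<partial>N) \<partial>M)"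
    by (rule P.Fubini'[OF meas])
  moreover have "(\<integral>\<^sup>+ y. (\<integral>\<^sup>+ x. ?f x y \<partial>M) \<partial>N) = (\<integral>\<^sup>+ y. emeasure M A \<partial>N)"
    by (rule nn_integral_cong) (use iM comm n(2) in simp)
  moreover have "(\<integral>\<^sup>+ x. (\<integral>\<^sup>+ y. ?f x y \<partial>N) \<partial>M) = (\<integral>\<^sup>+ x. emeasure N A \<partial>M)"
    by (rule nn_integral_cong) (use iN m(2) in simp)
  ultimately show "emeasure M A = emeasure N A"
    by (simp add: M.emeasure_space_1 N.emeasure_space_1)
qed

text \<open>A product measure is determined by cylinders over finitely many coordinates, and on a
  cylinder the rotation acts factor by factor, where \<open>circle_measure_rotate\<close>
  applies.\<close>

lemma is_prob_haar_product:
  fixes I :: "'i::countable set"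
  shows "is_prob_haar I (Pi\<^sub>M I (\<lambda>_. circle_measure))"
proof -
  let ?M = "Pi\<^sub>M I (\<lambda>_. circle_measure)"
  interpret product_prob_space "\<lambda>_::'i. circle_measure" I
    by (rule product_prob_spaceI) (rule prob_space_circle_measure)
  have st: "sets ?M = sets (Pi\<^sub>M I (\<lambda>_. circle_algebra))"
    by (rule sets_PiM_cong) (simp_all add: sets_circle_measure)
  have sp: "space ?M = topspace (torus I)" by (simp add: space_PiM space_circle_measure topspace_torus)
  have inv: "distr ?M ?M (torus_mult I \<omega>) = ?M" if w: "\<omega> \<in> topspace (torus I)" for \<omega>
  proof (rule PiM_eq)
    show "sets (distr ?M ?M (torus_mult I \<omega>)) = sets ?M" by simp
    fix J F assume J: "finite J" "J \<subseteq> I" and F: "\<And>j. j \<in> J \<Longrightarrow> F j \<in> sets circle_measure"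
    have mm: "torus_mult I \<omega> \<in> ?M \<rightarrow>\<^sub>M ?M"
      using torus_mult_measurable[OF st w] measurable_cong_sets[OF refl st] by blast
    define G where "G = (\<lambda>j. (\<lambda>x. \<omega> j * x) -` F j \<inter> sphere 0 1)"
    have wS: "\<omega> j \<in> sphere 0 1" if "j \<in> J" for j using w J(2) that by (auto simp: topspace_torus PiE_iff)
    have G: "G j \<in> sets circle_measure" if "j \<in> J" for j
    proof -
      have "(\<lambda>x. \<omega> j * x) \<in> circle_algebra \<rightarrow>\<^sub>M circle_algebra"
        by (rule measurable_restrict_space2)
           (use wS[OF that] in \<open>auto simp: space_circle_algebra norm_mult intro!: measurable_restrict_space1\<close>)
      from measurable_sets[OF this F[OF that, unfolded sets_circle_measure]] show ?thesis
        by (simp add: G_def space_circle_algebra sets_circle_measure)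
    qed
    have E: "prod_emb I (\<lambda>_. circle_measure) J (Pi\<^sub>E J F) \<in> sets ?M"
      using J F by (intro sets_PiM_I) auto
    have "torus_mult I \<omega> -` prod_emb I (\<lambda>_. circle_measure) J (Pi\<^sub>E J F) \<inter> space ?M
      = prod_emb I (\<lambda>_. circle_measure) J (Pi\<^sub>E J G)" (is "?l = ?r")
    proof (rule set_eqI)
      fix x
      show "x \<in> ?l \<longleftrightarrow> x \<in> ?r"
      proof (cases "x \<in> topspace (torus I)")
        case True
        have 1: "torus_mult I \<omega> x \<in> topspace (torus I)" by (rule torus_mult_closed[OF w True])
        have 2: "x j \<in> sphere 0 1" if "j \<in> J" for j using True J(2) that by (auto simp: topspace_torus PiE_iff)
        have "x \<in> ?l \<longleftrightarrow> (\<forall>j\<in>J. torus_mult I \<omega> x j \<in> F j)"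
          using True 1 by (auto simp: prod_emb_def sp[symmetric] space_PiM restrict_PiE_iff)
        also have "\<dots> \<longleftrightarrow> (\<forall>j\<in>J. x j \<in> G j)"
          using 2 J(2) by (intro ball_cong refl) (auto simp: G_def torus_mult_def)
        also have "\<dots> \<longleftrightarrow> x \<in> ?r"
          using True by (auto simp: prod_emb_def sp[symmetric] space_PiM restrict_PiE_iff)
        finally show ?thesis .
      next
        case False
        then have "x \<notin> space ?M" by (simp add: sp)
        then show ?thesis by (auto simp: prod_emb_def space_PiM)
      qed
    qed
    then have "emeasure (distr ?M ?M (torus_mult I \<omega>)) (prod_emb I (\<lambda>_. circle_measure) J (Pi\<^sub>E J F))
      = emeasure ?M (prod_emb I (\<lambda>_. circle_measure) J (Pi\<^sub>E J G))"
      using emeasure_distr[OF mm E] by simp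
    also have "\<dots> = (\<Prod>j\<in>J. emeasure circle_measure (G j))"
      using J G by (intro emeasure_PiM_emb) auto
    also have "\<dots> = (\<Prod>j\<in>J. emeasure circle_measure (F j))"
      using circle_measure_rotate[OF wS] F by (intro prod.cong refl) (auto simp: G_def sets_circle_measure)
    finally show "emeasure (distr ?M ?M (torus_mult I \<omega>)) (prod_emb I (\<lambda>_. circle_measure) J (Pi\<^sub>E J F))
      = (\<Prod>j\<in>J. emeasure circle_measure (F j))" .
  qed
  have "emeasure ?M (torus_mult I \<omega> ` A) = emeasure ?M A" if w: "\<omega> \<in> topspace (torus I)" and A: "A \<in> sets ?M" for \<omega> A
  proof -
    have c: "torus_conj I \<omega> \<in> topspace (torus I)" by (rule torus_conj_closed[OF w])
    have mm: "torus_mult I (torus_conj I \<omega>) \<in> ?M \<rightarrow>\<^sub>M ?M"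
      using torus_mult_measurable[OF st c] measurable_cong_sets[OF refl st] by blast
    have "torus_mult I \<omega> ` A = torus_mult I (torus_conj I \<omega>) -` A \<inter> space ?M"
      using torus_mult_image[OF c, of A] sets.sets_into_space[OF A] by (simp add: torus_conj_conj[OF w] sp)
    then have "emeasure ?M (torus_mult I \<omega> ` A) = emeasure (distr ?M ?M (torus_mult I (torus_conj I \<omega>))) A"
      using emeasure_distr[OF mm A] by simp
    then show ?thesis by (simp add: inv[OF c])
  qed
  then show ?thesis
    unfolding is_prob_haar_def using sp st sets_borel_torus[of I]
    by (auto intro!: prob_space_PiM prob_space_circle_measure)
qed

text \<open>Existence by the product measure and uniqueness justify the definite description; from
  here on only the defining properties of the Haar measure enter.\<close>

lemma is_prob_haar_haar_torus:
  fixes I :: "'i::countable set"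
  shows "is_prob_haar I (haar_torus I)"
  unfolding haar_torus_def
  by (rule theI[of _ "Pi\<^sub>M I (\<lambda>_. circle_measure)"])
     (auto intro: is_prob_haar_product is_prob_haar_unique)

lemmas haar_torus = is_prob_haarD[OF is_prob_haar_haar_torus]

subsection \<open>Characters of the torus\<close>

type_synonym freq = "nat \<Rightarrow> int"

definition torus_Omega :: "((nat \<Rightarrow> complex) \<times> (nat \<Rightarrow> complex)) set" where
  "torus_Omega = topspace (torus {p. prime p}) \<times> topspace (torus UNIV)"

text \<open>Pairs of finitely supported integer exponents, the first supported on the primes: they
  index the characters of \<Omega>. Off the primes a point of the first torus is
  \<open>undefined\<close>, so no exponent may sit there.\<close>

definition admissible :: "freq \<Rightarrow> freq \<Rightarrow> bool" where
  "admissible u v \<longleftrightarrow> finite {p. u p \<noteq> 0} \<and> finite {m. v m \<noteq> 0} \<and> (\<forall>p. u p \<noteq> 0 \<longrightarrow> prime p)"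

definition torus_char :: "freq \<Rightarrow> freq \<Rightarrow> (nat \<Rightarrow> complex) \<times> (nat \<Rightarrow> complex) \<Rightarrow> complex" where
  "torus_char u v \<omega> = (\<Prod>p\<in>{p. u p \<noteq> 0}. fst \<omega> p powi u p) * (\<Prod>m\<in>{m. v m \<noteq> 0}. snd \<omega> m powi v m)"

definition Omega_mult where
  "Omega_mult x y = (torus_mult {p. prime p} (fst x) (fst y), torus_mult UNIV (snd x) (snd y))"

lemma torus_OmegaD:
  assumes "\<omega> \<in> torus_Omega"
  shows "prime p \<Longrightarrow> cmod (fst \<omega> p) = 1" "cmod (snd \<omega> m) = 1"
    and "prime p \<Longrightarrow> fst \<omega> p \<noteq> 0" "snd \<omega> m \<noteq> 0"
proof -
  have 1: "prime p \<Longrightarrow> cmod (fst \<omega> p) = 1" for p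
    using assms by (auto simp: torus_Omega_def topspace_torus PiE_iff)
  have 2: "cmod (snd \<omega> m) = 1" for m
    using assms by (auto simp: torus_Omega_def topspace_torus PiE_iff)
  show "prime p \<Longrightarrow> cmod (fst \<omega> p) = 1" "cmod (snd \<omega> m) = 1" by (fact 1, fact 2)
  show "prime p \<Longrightarrow> fst \<omega> p \<noteq> 0" using 1[of p] by auto
  show "snd \<omega> m \<noteq> 0" using 2[of m] by auto
qed

text \<open>Supports can shrink by cancellation when exponents are added; evaluation over a common
  finite superset makes different characters comparable.\<close>

lemma torus_char_eq:
  assumes "finite P" "finite Q" "{p. u p \<noteq> 0} \<subseteq> P" "{m. v m \<noteq> 0} \<subseteq> Q"
  shows "torus_char u v \<omega> = (\<Prod>p\<in>P. fst \<omega> p powi u p) * (\<Prod>m\<in>Q. snd \<omega> m powi v m)"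
  unfolding torus_char_def using assms by (intro arg_cong2[where f = "(*)"] prod.mono_neutral_left) auto

lemma torus_char_norm:
  assumes "\<omega> \<in> torus_Omega" "admissible u v"
  shows "cmod (torus_char u v \<omega>) = 1"
  unfolding torus_char_def norm_mult prod_norm[symmetric] norm_power_int
  using assms by (auto simp: torus_OmegaD admissible_def)

lemma admissible_add: "admissible u v \<Longrightarrow> admissible u' v' \<Longrightarrow> admissible (\<lambda>p. u p + u' p) (\<lambda>m. v m + v' m)"
  unfolding admissible_def
  by (auto intro: finite_subset[of _ "{p. u p \<noteq> 0} \<union> {p. u' p \<noteq> 0}"] finite_subset[of _ "{p. v p \<noteq> 0} \<union> {p. v' p \<noteq> 0}"])
     (metis add.right_neutral add.left_neutral)

lemma admissible_minus: "admissible u v \<Longrightarrow> admissible (\<lambda>p. - u p) (\<lambda>m. - v m)"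
  unfolding admissible_def by simp

lemma torus_char_add:
  assumes w: "\<omega> \<in> torus_Omega" and a: "admissible u v" "admissible u' v'"
  shows "torus_char (\<lambda>p. u p + u' p) (\<lambda>m. v m + v' m) \<omega> = torus_char u v \<omega> * torus_char u' v' \<omega>"
proof -
  define P where "P = {p. u p \<noteq> 0} \<union> {p. u' p \<noteq> 0}"
  define Q where "Q = {p. v p \<noteq> 0} \<union> {p. v' p \<noteq> 0}"
  have fin: "finite P" "finite Q" using a by (auto simp: P_def Q_def admissible_def)
  have prm: "prime p" if "p \<in> P" for p using a that by (auto simp: P_def admissible_def)
  have 1: "torus_char (\<lambda>p. u p + u' p) (\<lambda>m. v m + v' m) \<omega> = (\<Prod>p\<in>P. fst \<omega> p powi (u p + u' p)) * (\<Prod>m\<in>Q. snd \<omega> m powi (v m + v' m))"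
    by (rule torus_char_eq[OF fin]) (auto simp: P_def Q_def)
  have 2: "torus_char u v \<omega> = (\<Prod>p\<in>P. fst \<omega> p powi u p) * (\<Prod>m\<in>Q. snd \<omega> m powi v m)"
    by (rule torus_char_eq[OF fin]) (auto simp: P_def Q_def)
  have 3: "torus_char u' v' \<omega> = (\<Prod>p\<in>P. fst \<omega> p powi u' p) * (\<Prod>m\<in>Q. snd \<omega> m powi v' m)"
    by (rule torus_char_eq[OF fin]) (auto simp: P_def Q_def)
  have 4: "(\<Prod>p\<in>P. fst \<omega> p powi (u p + u' p)) = (\<Prod>p\<in>P. fst \<omega> p powi u p * fst \<omega> p powi u' p)"
    by (rule prod.cong) (use torus_OmegaD(3)[OF w] prm in \<open>auto simp: power_int_add\<close>)
  have 5: "(\<Prod>m\<in>Q. snd \<omega> m powi (v m + v' m)) = (\<Prod>m\<in>Q. snd \<omega> m powi v m * snd \<omega> m powi v' m)"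
    by (rule prod.cong) (use torus_OmegaD(4)[OF w] in \<open>auto simp: power_int_add\<close>)
  show ?thesis unfolding 1 2 3 4 5 prod.distrib by (simp only: mult_ac)
qed

lemma torus_char_minus:
  assumes w: "\<omega> \<in> torus_Omega" and a: "admissible u v"
  shows "torus_char (\<lambda>p. - u p) (\<lambda>m. - v m) \<omega> = cnj (torus_char u v \<omega>)"
proof -
  have inv: "inverse z = cnj z" if "cmod z = 1" for z
    using that by (simp add: inverse_eq_divide divide_eq_eq complex_norm_square[symmetric] mult.commute field_simps)
  have 1: "(\<Prod>p\<in>{p. u p \<noteq> 0}. fst \<omega> p powi (- u p)) = (\<Prod>p\<in>{p. u p \<noteq> 0}. cnj (fst \<omega> p) powi u p)"
  proof (rule prod.cong[OF refl])
    fix p assume "p \<in> {p. u p \<noteq> 0}"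
    then have "prime p" using a by (auto simp: admissible_def)
    then show "fst \<omega> p powi (- u p) = cnj (fst \<omega> p) powi u p"
      using inv[OF torus_OmegaD(1)[OF w]] by (simp add: power_int_minus power_int_inverse[symmetric])
  qed
  have 2: "(\<Prod>m\<in>{m. v m \<noteq> 0}. snd \<omega> m powi (- v m)) = (\<Prod>m\<in>{m. v m \<noteq> 0}. cnj (snd \<omega> m) powi v m)"
    using inv[OF torus_OmegaD(2)[OF w]] by (simp add: power_int_minus power_int_inverse[symmetric])
  show ?thesis unfolding torus_char_def using 1 2 by (simp add: complex_cnj_power_int)
qed

lemma torus_char_mult:
  assumes a: "admissible u v"
  shows "torus_char u v (Omega_mult x y) = torus_char u v x * torus_char u v y"
proof -
  have "(\<Prod>p\<in>{p. u p \<noteq> 0}. fst (Omega_mult x y) p powi u p) = (\<Prod>p\<in>{p. u p \<noteq> 0}. fst x p powi u p * fst y p powi u p)"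
    by (rule prod.cong) (use a in \<open>auto simp: admissible_def Omega_mult_def torus_mult_def power_int_mult_distrib\<close>)
  moreover have "(\<Prod>m\<in>{m. v m \<noteq> 0}. snd (Omega_mult x y) m powi v m) = (\<Prod>m\<in>{m. v m \<noteq> 0}. snd x m powi v m * snd y m powi v m)"
    by (rule prod.cong) (auto simp: Omega_mult_def torus_mult_def power_int_mult_distrib)
  ultimately show ?thesis unfolding torus_char_def by (simp only: prod.distrib mult_ac)
qed

lemma torus_char_zero [simp]: "torus_char (\<lambda>_. 0) (\<lambda>_. 0) \<omega> = 1"
  by (simp add: torus_char_def)

lemma torus_char_continuous:
  assumes "admissible u v"
  shows "continuous_on torus_Omega (torus_char u v)"
proof -
  have f: "continuous_on torus_Omega (\<lambda>\<omega>. fst \<omega> p)" for p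
    by (rule continuous_on_compose2[OF continuous_on_product_coordinates continuous_on_fst[OF continuous_on_id]]) auto
  have s: "continuous_on torus_Omega (\<lambda>\<omega>. snd \<omega> p)" for p
    by (rule continuous_on_compose2[OF continuous_on_product_coordinates continuous_on_snd[OF continuous_on_id]]) auto
  show ?thesis unfolding torus_char_def[abs_def]
    using assms torus_OmegaD(3,4)
    by (intro continuous_on_mult continuous_on_prod continuous_on_power_int f s) (auto simp: admissible_def)
qed

section \<open>Integrals of characters\<close>

lemma prob_space_haar_Omega: "prob_space haar_Omega"
proof -
  interpret A: prob_space "haar_torus {p::nat. prime p}" by (rule haar_torus)
  interpret B: prob_space "haar_torus (UNIV::nat set)" by (rule haar_torus)
  interpret P: pair_prob_space "haar_torus {p::nat. prime p}" "haar_torus (UNIV::nat set)" ..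
  show ?thesis unfolding haar_Omega_def by (rule P.prob_space_axioms)
qed

lemma space_haar_Omega: "space haar_Omega = torus_Omega"
  by (simp add: haar_Omega_def space_pair_measure torus_Omega_def haar_torus(2))

lemma haar_coordinates:
  shows "prime p \<Longrightarrow> (\<lambda>\<omega>. fst \<omega> p) \<in> borel_measurable haar_Omega"
    and "(\<lambda>\<omega>. snd \<omega> m) \<in> borel_measurable haar_Omega"
proof -
  have c: "(\<lambda>x. x i) \<in> borel_measurable (haar_torus I)" if "i \<in> I" for i :: nat and I
  proof -
    have "(\<lambda>x. x i) \<in> haar_torus I \<rightarrow>\<^sub>M circle_algebra"
      using measurable_component_singleton[OF that] measurable_cong_sets[OF haar_torus(3) refl] by blast
    then show ?thesis by (rule measurable_compose[OF _ circle_algebra_to_borel])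
  qed
  show "prime p \<Longrightarrow> (\<lambda>\<omega>. fst \<omega> p) \<in> borel_measurable haar_Omega"
    unfolding haar_Omega_def by (rule measurable_compose[OF measurable_fst c]) simp
  show "(\<lambda>\<omega>. snd \<omega> m) \<in> borel_measurable haar_Omega"
    unfolding haar_Omega_def by (rule measurable_compose[OF measurable_snd c]) simp
qed

lemma power_int_measurable:
  assumes "f \<in> borel_measurable M"
  shows "(\<lambda>x. f x powi n :: complex) \<in> borel_measurable M"
proof (cases "n \<ge> 0")
  case True
  have "(\<lambda>x. f x ^ nat n) \<in> borel_measurable M" using assms by measurable
  then show ?thesis using True by (simp add: power_int_def)
next
  case False
  have "(\<lambda>x. inverse (f x) ^ nat (- n)) \<in> borel_measurable M" using assms by measurable
  then show ?thesis using False by (simp add: power_int_def)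
qed

lemma torus_char_measurable:
  assumes "admissible u v"
  shows "torus_char u v \<in> borel_measurable haar_Omega"
  unfolding torus_char_def[abs_def]
  using assms by (intro borel_measurable_times borel_measurable_prod power_int_measurable haar_coordinates)
    (auto simp: admissible_def)

lemma torus_char_integrable:
  assumes "admissible u v"
  shows "integrable haar_Omega (torus_char u v)"
proof -
  interpret prob_space haar_Omega by (rule prob_space_haar_Omega)
  show ?thesis
    by (rule integrable_const_bound[where B = 1])
       (use assms in \<open>auto simp: torus_char_measurable space_haar_Omega torus_char_norm\<close>)
qed

lemma haar_Omega_invariant:
  assumes "x \<in> torus_Omega"
  shows "distr haar_Omega haar_Omega (Omega_mult x) = haar_Omega"
    and "Omega_mult x \<in> haar_Omega \<rightarrow>\<^sub>M haar_Omega"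
proof -
  let ?A = "haar_torus {p::nat. prime p}" and ?B = "haar_torus (UNIV::nat set)"
  have x: "fst x \<in> topspace (torus {p. prime p})" "snd x \<in> topspace (torus UNIV)"
    using assms by (auto simp: torus_Omega_def)
  have mA: "torus_mult {p. prime p} (fst x) \<in> ?A \<rightarrow>\<^sub>M ?A"
    using torus_mult_measurable[OF haar_torus(3) x(1)] measurable_cong_sets[OF refl haar_torus(3)] by blast
  have mB: "torus_mult UNIV (snd x) \<in> ?B \<rightarrow>\<^sub>M ?B"
    using torus_mult_measurable[OF haar_torus(3) x(2)] measurable_cong_sets[OF refl haar_torus(3)] by blast
  have eq: "Omega_mult x = (\<lambda>(a, b). (torus_mult {p. prime p} (fst x) a, torus_mult UNIV (snd x) b))"
    by (auto simp: Omega_mult_def)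
  interpret B: prob_space ?B by (rule haar_torus)
  have "distr ?A ?A (torus_mult {p. prime p} (fst x)) \<Otimes>\<^sub>M distr ?B ?B (torus_mult UNIV (snd x)) =
      distr (?A \<Otimes>\<^sub>M ?B) (?A \<Otimes>\<^sub>M ?B) (Omega_mult x)"
    unfolding eq
    by (rule pair_measure_distr[OF mA mB]) (simp add: haar_torus(4)[OF x(2)] B.sigma_finite_measure_axioms)
  then show "distr haar_Omega haar_Omega (Omega_mult x) = haar_Omega"
    by (simp add: haar_Omega_def haar_torus(4)[OF x(1)] haar_torus(4)[OF x(2)])
  show "Omega_mult x \<in> haar_Omega \<rightarrow>\<^sub>M haar_Omega"
    unfolding eq haar_Omega_def case_prod_unfold
    by (intro measurable_Pair measurable_compose[OF measurable_fst mA] measurable_compose[OF measurable_snd mB])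
qed

text \<open>Invariance under a point x at which a nontrivial character takes the value -1 shows that
  the integral equals its own negative.\<close>

lemma torus_char_integral:
  assumes a: "admissible u v"
  shows "(LINT \<omega>|haar_Omega. torus_char u v \<omega>) = (if (\<forall>p. u p = 0) \<and> (\<forall>m. v m = 0) then 1 else 0)"
proof (cases "(\<forall>p. u p = 0) \<and> (\<forall>m. v m = 0)")
  case True
  interpret prob_space haar_Omega by (rule prob_space_haar_Omega)
  have "u = (\<lambda>_. 0)" "v = (\<lambda>_. 0)" using True by auto
  then show ?thesis by (simp add: prob_space)
next
  case False
  \<comment> \<open>One coordinate is cis (pi / n), where n is the exponent of the character there,
    so its power is -1; all other coordinates are 1. \<open>LEAST\<close> picks that coordinate from
    the support, and the second torus is used only if all exponents on the first are 0.\<close>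
  define x where "x = ((\<lambda>p\<in>{p. prime p}. if u p \<noteq> 0 \<and> p = (LEAST p. u p \<noteq> 0) then cis (pi / of_int (u p)) else 1) :: nat \<Rightarrow> complex,
     (\<lambda>m. if (\<forall>p. u p = 0) \<and> v m \<noteq> 0 \<and> m = (LEAST m. v m \<noteq> 0) then cis (pi / of_int (v m)) else 1) :: nat \<Rightarrow> complex)"
  have x: "x \<in> torus_Omega"
    by (auto simp: x_def torus_Omega_def topspace_torus PiE_iff)
  have "torus_char u v x = -1"
  proof (cases "\<exists>p. u p \<noteq> 0")
    case True
    define p where "p = (LEAST p. u p \<noteq> 0)"
    have p: "u p \<noteq> 0" unfolding p_def using True by (rule LeastI_ex)
    have "(\<Prod>q\<in>{q. u q \<noteq> 0}. fst x q powi u q) = (\<Prod>q\<in>{q. u q \<noteq> 0}. if q = p then -1 else 1)"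
    proof (rule prod.cong[OF refl])
      fix q assume q: "q \<in> {q. u q \<noteq> 0}"
      then have "prime q" using a by (auto simp: admissible_def)
      then show "fst x q powi u q = (if q = p then -1 else 1)"
        using q by (auto simp: x_def p_def[symmetric] cis_power_int)
    qed
    also have "\<dots> = -1" using p a by (subst prod.delta) (auto simp: admissible_def)
    finally have 1: "(\<Prod>q\<in>{q. u q \<noteq> 0}. fst x q powi u q) = -1" .
    have 2: "(\<Prod>m\<in>{m. v m \<noteq> 0}. snd x m powi v m) = 1"
      by (rule prod.neutral) (use p in \<open>auto simp: x_def\<close>)
    show ?thesis unfolding torus_char_def 1 2 by simp
  next
    case u0: False
    then have ex: "\<exists>m. v m \<noteq> 0" using False by auto
    define m where "m = (LEAST m. v m \<noteq> 0)"
    have m: "v m \<noteq> 0" unfolding m_def using ex by (rule LeastI_ex)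
    have "(\<Prod>q\<in>{q. v q \<noteq> 0}. snd x q powi v q) = (\<Prod>q\<in>{q. v q \<noteq> 0}. if q = m then -1 else 1)"
      by (rule prod.cong[OF refl]) (use u0 in \<open>auto simp: x_def m_def[symmetric] cis_power_int\<close>)
    also have "\<dots> = -1" using m a by (subst prod.delta) (auto simp: admissible_def)
    finally have 1: "(\<Prod>q\<in>{q. v q \<noteq> 0}. snd x q powi v q) = -1" .
    have 2: "(\<Prod>m\<in>{m. u m \<noteq> 0}. fst x m powi u m) = 1"
      by (rule prod.neutral) (use u0 in auto)
    show ?thesis unfolding torus_char_def 1 2 by simp
  qed
  then have neg: "torus_char u v (Omega_mult x \<omega>) = - torus_char u v \<omega>" for \<omega>
    by (simp add: torus_char_mult[OF a])
  have "(LINT \<omega>|haar_Omega. torus_char u v \<omega>) = (LINT \<omega>|distr haar_Omega haar_Omega (Omega_mult x). torus_char u v \<omega>)"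
    by (simp only: haar_Omega_invariant(1)[OF x])
  also have "\<dots> = (LINT \<omega>|haar_Omega. torus_char u v (Omega_mult x \<omega>))"
    by (rule integral_distr[OF haar_Omega_invariant(2)[OF x] torus_char_measurable[OF a]])
  also have "\<dots> = - (LINT \<omega>|haar_Omega. torus_char u v \<omega>)" by (simp add: neg)
  finally have "(LINT \<omega>|haar_Omega. torus_char u v \<omega>) = 0" by (simp add: equal_neg_zero)
  then show ?thesis using False by simp
qed

subsection \<open>Equidistribution of the shifts\<close>

text \<open>The k-th power of a fixed element of the torus. The sign is that of p^(- i k h):
  rotating the coefficients by this point amounts to shifting the argument upwards.\<close>

definition shift_point :: "real \<Rightarrow> real \<Rightarrow> real \<Rightarrow> nat \<Rightarrow> (nat \<Rightarrow> complex) \<times> (nat \<Rightarrow> complex)" where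
  "shift_point \<alpha> h\<^sub>1 h\<^sub>2 k =
     ((\<lambda>p\<in>{p. prime p}. cis (- (real k * (h\<^sub>1 * ln (real p))))), (\<lambda>m. cis (- (real k * (h\<^sub>2 * ln (real m + \<alpha>))))))"

lemma shift_point_in: "shift_point \<alpha> h\<^sub>1 h\<^sub>2 k \<in> torus_Omega"
  by (auto simp: shift_point_def torus_Omega_def topspace_torus PiE_iff)

definition char_freq :: "real \<Rightarrow> real \<Rightarrow> real \<Rightarrow> freq \<Rightarrow> freq \<Rightarrow> real" where
  "char_freq \<alpha> h\<^sub>1 h\<^sub>2 u v = (\<Sum>p\<in>{p. u p \<noteq> 0}. of_int (u p) * (h\<^sub>1 * ln (real p)))
      + (\<Sum>m\<in>{m. v m \<noteq> 0}. of_int (v m) * (h\<^sub>2 * ln (real m + \<alpha>)))"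

lemma prod_cis: "(\<Prod>i\<in>A. cis (f i)) = cis (\<Sum>i\<in>A. f i)"
  by (induction A rule: infinite_finite_induct) (auto simp: cis_mult)

lemma torus_char_shift:
  assumes a: "admissible u v"
  shows "torus_char u v (shift_point \<alpha> h\<^sub>1 h\<^sub>2 k) = cis (- char_freq \<alpha> h\<^sub>1 h\<^sub>2 u v) ^ k"
proof -
  have 1: "(\<Prod>p\<in>{p. u p \<noteq> 0}. fst (shift_point \<alpha> h\<^sub>1 h\<^sub>2 k) p powi u p) = (\<Prod>p\<in>{p. u p \<noteq> 0}. cis (- real k * (of_int (u p) * (h\<^sub>1 * ln (real p)))))"
    by (rule prod.cong) (use a in \<open>auto simp: admissible_def shift_point_def cis_power_int mult_ac\<close>)
  have 2: "(\<Prod>m\<in>{m. v m \<noteq> 0}. snd (shift_point \<alpha> h\<^sub>1 h\<^sub>2 k) m powi v m) = (\<Prod>m\<in>{m. v m \<noteq> 0}. cis (- real k * (of_int (v m) * (h\<^sub>2 * ln (real m + \<alpha>)))))"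
    by (rule prod.cong) (auto simp: shift_point_def cis_power_int mult_ac)
  show ?thesis
    unfolding torus_char_def 1 2 prod_cis cis_mult char_freq_def Complex.DeMoivre
    by (simp only: sum_distrib_left[symmetric]) (simp add: algebra_simps)
qed

text \<open>Independence speaks of the set of values. Injectivity of v transports coefficients from
  indices to values, so that a vanishing finite combination becomes a linear relation in that
  set.\<close>

lemma rat_independentD:
  assumes ind: "rat_independent_family I v" and J: "finite J" "J \<subseteq> I"
    and sum0: "(\<Sum>i\<in>J. of_rat (q i) * v i) = (0::real)" and i: "i \<in> J"
  shows "q i = 0"
proof (rule ccontr)
  assume q: "q i \<noteq> 0"
  have inj: "inj_on v J" using ind J(2) unfolding rat_independent_family_def by (auto intro: inj_on_subset)
  have m: "module (\<lambda>(q::rat) (x::real). of_rat q * x)"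
    by (unfold_locales) (auto simp: algebra_simps of_rat_add of_rat_mult)
  have "module.dependent (\<lambda>(q::rat) (x::real). of_rat q * x) (v ` I)"
    unfolding module.dependent_explicit[OF m]
  proof (intro exI conjI)
    show "finite (v ` J)" "v ` J \<subseteq> v ` I" using J by auto
    show "(\<Sum>x\<in>v ` J. of_rat (q (inv_into J v x)) * x) = 0"
      using sum0 by (simp add: sum.reindex[OF inj] inv_into_f_f[OF inj])
    have "q (inv_into J v (v i)) \<noteq> 0" using q by (simp only: inv_into_f_f[OF inj i] not_False_eq_True)
    then show "\<exists>x\<in>v ` J. q (inv_into J v x) \<noteq> 0" using imageI[OF i] by (rule bexI)
  qed
  then show False using ind unfolding rat_independent_family_def by blast
qed

text \<open>If the character is 1 at the first shift point, its frequency is 2 pi n for an integer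
  n. This is a rational relation in which pi has the coefficient - 2 n, the place where the element
  pi of the family enters.\<close>

lemma char_freq_nonperiodic:
  assumes ind: "rat_independent_family L_indices (L_elem \<alpha> h\<^sub>1 h\<^sub>2)" and a: "admissible u v"
    and one: "cis (- char_freq \<alpha> h\<^sub>1 h\<^sub>2 u v) = 1"
  shows "u p = 0" "v m = 0"
proof -
  have "cos (char_freq \<alpha> h\<^sub>1 h\<^sub>2 u v) = 1" using one by (simp add: complex_eq_iff)
  then obtain n :: int where n: "char_freq \<alpha> h\<^sub>1 h\<^sub>2 u v = of_int n * 2 * pi" unfolding cos_one_2pi_int by blast
  define q :: "L_index \<Rightarrow> rat" where
    "q = (\<lambda>i. case i of Log_prime p \<Rightarrow> of_int (u p) | Log_shift m \<Rightarrow> of_int (v m) | Pi_elem \<Rightarrow> of_int (- 2 * n))"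
  define U where "U = {p. u p \<noteq> 0}"
  define V where "V = {m. v m \<noteq> 0}"
  define J where "J = Log_prime ` U \<union> Log_shift ` V \<union> {Pi_elem}"
  have fin: "finite U" "finite V" using a by (auto simp: U_def V_def admissible_def)
  have J: "finite J" "J \<subseteq> L_indices" using fin a by (auto simp: J_def L_indices_def U_def admissible_def)
  let ?f = "\<lambda>i. of_rat (q i) * L_elem \<alpha> h\<^sub>1 h\<^sub>2 i"
  have "sum ?f J = sum ?f (Log_prime ` U \<union> Log_shift ` V) + sum ?f {Pi_elem}"
    unfolding J_def using fin by (intro sum.union_disjoint) auto
  also have "sum ?f (Log_prime ` U \<union> Log_shift ` V) = sum ?f (Log_prime ` U) + sum ?f (Log_shift ` V)"
    using fin by (intro sum.union_disjoint) auto
  also have "sum ?f (Log_prime ` U) = (\<Sum>p\<in>U. of_int (u p) * (h\<^sub>1 * ln (real p)))"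
    by (subst sum.reindex) (auto simp: q_def inj_on_def)
  also have "sum ?f (Log_shift ` V) = (\<Sum>m\<in>V. of_int (v m) * (h\<^sub>2 * ln (real m + \<alpha>)))"
    by (subst sum.reindex) (auto simp: q_def inj_on_def)
  also have "sum ?f {Pi_elem} = - (of_int n * 2 * pi)" by (simp add: q_def of_rat_minus of_rat_mult)
  finally have "sum ?f J = 0" using n by (simp add: char_freq_def U_def V_def)
  note D = rat_independentD[OF ind J this]
  show "u p = 0"
  proof (rule ccontr)
    assume "u p \<noteq> 0"
    then have "Log_prime p \<in> J" by (auto simp: J_def U_def)
    from D[OF this] \<open>u p \<noteq> 0\<close> show False by (simp add: q_def)
  qed
  show "v m = 0"
  proof (rule ccontr)
    assume "v m \<noteq> 0"
    then have "Log_shift m \<in> J" by (auto simp: J_def V_def)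
    from D[OF this] \<open>v m \<noteq> 0\<close> show False by (simp add: q_def)
  qed
qed

lemma geometric_average:
  fixes z :: complex
  assumes z: "cmod z = 1" "z \<noteq> 1"
  shows "(\<lambda>N. (\<Sum>k\<le>N. z ^ k) / of_nat (N + 1)) \<longlonglongrightarrow> 0"
proof (rule Lim_null_comparison)
  show "\<forall>\<^sub>F N in sequentially. cmod ((\<Sum>k\<le>N. z ^ k) / of_nat (N + 1)) \<le> 2 / cmod (z - 1) / real (N + 1)"
  proof (intro always_eventually allI)
    fix N
    have "(\<Sum>k\<le>N. z ^ k) = (z ^ Suc N - 1) / (z - 1)"
      using geometric_sum[OF z(2), of "Suc N"] by (simp add: lessThan_Suc_atMost)
    moreover have "cmod (z ^ Suc N - 1) \<le> 2"
      using norm_triangle_ineq4[of "z ^ Suc N" 1] z(1) by (simp add: norm_power norm_mult)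
    ultimately have "cmod (\<Sum>k\<le>N. z ^ k) \<le> 2 / cmod (z - 1)"
      by (simp add: norm_divide divide_right_mono)
    then show "cmod ((\<Sum>k\<le>N. z ^ k) / of_nat (N + 1)) \<le> 2 / cmod (z - 1) / real (N + 1)"
      by (simp only: norm_divide norm_of_nat) (rule divide_right_mono, auto)
  qed
  show "(\<lambda>N. 2 / cmod (z - 1) / real (N + 1)) \<longlonglongrightarrow> 0"
    by real_asymp
qed

text \<open>Products and conjugates of such functions are again of this form only up to equality on
  \<open>torus_Omega\<close>, since the laws for exponents rely on non-zero and unimodular
  coordinates. The closure lemmas are therefore existence statements.\<close>

inductive trig_poly :: "((nat \<Rightarrow> complex) \<times> (nat \<Rightarrow> complex) \<Rightarrow> complex) \<Rightarrow> bool" where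
  trig_char: "admissible u v \<Longrightarrow> trig_poly (\<lambda>\<omega>. c * torus_char u v \<omega>)"
| trig_add: "trig_poly f \<Longrightarrow> trig_poly g \<Longrightarrow> trig_poly (\<lambda>\<omega>. f \<omega> + g \<omega>)"

lemma trig_poly_mult_char:
  assumes "trig_poly g" and a: "admissible u v"
  shows "\<exists>k. trig_poly k \<and> (\<forall>\<omega>\<in>torus_Omega. k \<omega> = c * torus_char u v \<omega> * g \<omega>)"
  using assms(1)
proof induction
  case (trig_char u' v' c')
  show ?case
    by (intro exI[of _ "\<lambda>\<omega>. (c * c') * torus_char (\<lambda>p. u p + u' p) (\<lambda>m. v m + v' m) \<omega>"] conjI trig_poly.trig_char
        admissible_add a trig_char ballI) (simp add: torus_char_add[OF _ a trig_char])
next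
  case (trig_add f g)
  then obtain k1 k2 where "trig_poly k1" "\<forall>\<omega>\<in>torus_Omega. k1 \<omega> = c * torus_char u v \<omega> * f \<omega>"
    "trig_poly k2" "\<forall>\<omega>\<in>torus_Omega. k2 \<omega> = c * torus_char u v \<omega> * g \<omega>" by blast
  then show ?case
    by (intro exI[of _ "\<lambda>\<omega>. k1 \<omega> + k2 \<omega>"] conjI trig_poly.trig_add) (auto simp: distrib_left)
qed

lemma trig_poly_mult:
  assumes "trig_poly f" "trig_poly g"
  shows "\<exists>k. trig_poly k \<and> (\<forall>\<omega>\<in>torus_Omega. k \<omega> = f \<omega> * g \<omega>)"
  using assms(1)
proof induction
  case (trig_char u v c)
  show ?case by (rule trig_poly_mult_char[OF assms(2) trig_char])
next
  case (trig_add f f')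
  then obtain k1 k2 where "trig_poly k1" "\<forall>\<omega>\<in>torus_Omega. k1 \<omega> = f \<omega> * g \<omega>"
    "trig_poly k2" "\<forall>\<omega>\<in>torus_Omega. k2 \<omega> = f' \<omega> * g \<omega>" by blast
  then show ?case
    by (intro exI[of _ "\<lambda>\<omega>. k1 \<omega> + k2 \<omega>"] conjI trig_poly.trig_add) (auto simp: distrib_right)
qed

lemma trig_poly_continuous: "trig_poly f \<Longrightarrow> continuous_on torus_Omega f"
  by (induction rule: trig_poly.induct) (auto intro!: continuous_intros torus_char_continuous)

lemma trig_poly_integrable: "trig_poly f \<Longrightarrow> integrable haar_Omega f"
  by (induction rule: trig_poly.induct) (auto intro!: integrable_mult_right torus_char_integrable)

text \<open>Along the shifts a character runs through a geometric progression; its ratio differs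
  from 1 unless the character is trivial, where mean and integral are both 1.\<close>

lemma trig_poly_average:
  assumes ind: "rat_independent_family L_indices (L_elem \<alpha> h\<^sub>1 h\<^sub>2)" and "trig_poly f"
  shows "(\<lambda>N. (\<Sum>k\<le>N. f (shift_point \<alpha> h\<^sub>1 h\<^sub>2 k)) / of_nat (N + 1)) \<longlonglongrightarrow> (LINT \<omega>|haar_Omega. f \<omega>)"
  using assms(2)
proof induction
  case (trig_char u v c)
  let ?z = "cis (- char_freq \<alpha> h\<^sub>1 h\<^sub>2 u v)"
  have "(\<lambda>N. (\<Sum>k\<le>N. ?z ^ k) / of_nat (N + 1)) \<longlonglongrightarrow> (if (\<forall>p. u p = 0) \<and> (\<forall>m. v m = 0) then 1 else 0)"
  proof (cases "(\<forall>p. u p = 0) \<and> (\<forall>m. v m = 0)")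
    case True
    then have "?z = 1" by (simp add: char_freq_def)
    then have "(\<lambda>N. (\<Sum>k\<le>N. ?z ^ k) / of_nat (N + 1)) = (\<lambda>N. 1)" by (auto simp del: of_nat_Suc)
    then show ?thesis using True by simp
  next
    case False
    then have "?z \<noteq> 1" using char_freq_nonperiodic[OF ind trig_char] by blast
    then show ?thesis using geometric_average[of ?z] False by auto
  qed
  from tendsto_mult_left[OF this, of c] show ?case
    using trig_char by (simp add: torus_char_shift torus_char_integral sum_distrib_left[symmetric])
next
  case (trig_add f g)
  from tendsto_add[OF trig_add.IH] show ?case
    using trig_poly_integrable trig_add.hyps by (simp add: sum.distrib add_divide_distrib)
qed

section \<open>Uniform approximation by trigonometric polynomials\<close>

lemma compact_torus_Omega: "compact torus_Omega"
proof -
  have c: "compact (\<Pi>\<^sub>E i\<in>I. sphere 0 1 :: complex set)" for I :: "nat set"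
  proof -
    \<comment> \<open>Being \<open>undefined\<close> off I is a product condition with singleton
      factors, so the torus is a product of compact sets over all indices.\<close>
    have eq: "(\<Pi>\<^sub>E i\<in>I. sphere 0 1 :: complex set) = Pi\<^sub>E UNIV (\<lambda>i. if i \<in> I then sphere 0 1 else {undefined})"
      by (auto simp: PiE_iff extensional_def split: if_splits)
    have "compactin (product_topology (\<lambda>_. euclidean) UNIV) (Pi\<^sub>E (UNIV::nat set) (\<lambda>i. if i \<in> I then sphere 0 1 else {undefined::complex}))"
      unfolding compactin_PiE by auto
    then show ?thesis unfolding eq euclidean_product_topology by simp
  qed
  show ?thesis unfolding torus_Omega_def topspace_torus by (intro compact_Times c)
qed

lemma trig_poly_coordinate:
  shows "prime p \<Longrightarrow> trig_poly (\<lambda>\<omega>. c * fst \<omega> p)" "trig_poly (\<lambda>\<omega>. c * snd \<omega> m)"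
proof -
  assume p: "prime p"
  have "trig_poly (\<lambda>\<omega>. c * torus_char (\<lambda>q. if q = p then 1 else 0) (\<lambda>_. 0) \<omega>)"
    by (rule trig_char) (use p in \<open>auto simp: admissible_def\<close>)
  moreover have "{q. (if q = p then 1 else 0 :: int) \<noteq> 0} = {p}" by auto
  ultimately show "trig_poly (\<lambda>\<omega>. c * fst \<omega> p)" by (simp add: torus_char_def)
next
  have "trig_poly (\<lambda>\<omega>. c * torus_char (\<lambda>_. 0) (\<lambda>q. if q = m then 1 else 0) \<omega>)"
    by (rule trig_char) (auto simp: admissible_def)
  moreover have "{q. (if q = m then 1 else 0 :: int) \<noteq> 0} = {m}" by auto
  ultimately show "trig_poly (\<lambda>\<omega>. c * snd \<omega> m)" by (simp add: torus_char_def)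
qed

lemma trig_poly_cnj: "trig_poly f \<Longrightarrow> \<exists>k. trig_poly k \<and> (\<forall>\<omega>\<in>torus_Omega. k \<omega> = cnj (f \<omega>))"
proof (induction rule: trig_poly.induct)
  case (trig_char u v c)
  show ?case
    by (intro exI[of _ "\<lambda>\<omega>. cnj c * torus_char (\<lambda>p. - u p) (\<lambda>m. - v m) \<omega>"] conjI trig_poly.trig_char admissible_minus trig_char ballI)
       (simp add: torus_char_minus[OF _ trig_char])
next
  case (trig_add f g)
  then obtain k1 k2 where "trig_poly k1" "\<forall>\<omega>\<in>torus_Omega. k1 \<omega> = cnj (f \<omega>)"
    "trig_poly k2" "\<forall>\<omega>\<in>torus_Omega. k2 \<omega> = cnj (g \<omega>)" by blast
  then show ?case by (intro exI[of _ "\<lambda>\<omega>. k1 \<omega> + k2 \<omega>"] conjI trig_poly.trig_add) auto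
qed

lemma trig_poly_Re: "trig_poly f \<Longrightarrow> \<exists>k. trig_poly k \<and> (\<forall>\<omega>\<in>torus_Omega. k \<omega> = of_real (Re (f \<omega>)))"
proof -
  assume f: "trig_poly f"
  obtain g where g: "trig_poly g" "\<forall>\<omega>\<in>torus_Omega. g \<omega> = cnj (f \<omega>)" using trig_poly_cnj[OF f] by blast
  have h: "trig_poly (\<lambda>\<omega>. (1 / 2) * torus_char (\<lambda>_. 0) (\<lambda>_. 0) \<omega>)" by (rule trig_char) (simp add: admissible_def)
  obtain k where k: "trig_poly k" "\<forall>\<omega>\<in>torus_Omega. k \<omega> = (1 / 2) * torus_char (\<lambda>_. 0) (\<lambda>_. 0) \<omega> * (f \<omega> + g \<omega>)"
    using trig_poly_mult[OF h trig_add[OF f g(1)]] by blast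
  have "k \<omega> = of_real (Re (f \<omega>))" if "\<omega> \<in> torus_Omega" for \<omega>
    using k(2) g(2) that by (simp add: complex_eq_iff)
  then show ?thesis using k(1) by blast
qed

text \<open>Stone--Weierstrass is applied to a ring of real functions: those which agree on the
  torus with some trigonometric polynomial, whatever their values elsewhere.\<close>

definition real_trig :: "((nat \<Rightarrow> complex) \<times> (nat \<Rightarrow> complex) \<Rightarrow> real) set" where
  "real_trig = {h. \<exists>f. trig_poly f \<and> (\<forall>\<omega>\<in>torus_Omega. f \<omega> = of_real (h \<omega>))}"

lemma real_trig_Re: "trig_poly f \<Longrightarrow> (\<lambda>\<omega>. Re (f \<omega>)) \<in> real_trig"
  unfolding real_trig_def using trig_poly_Re by blast

lemma real_trig_ring: "function_ring_on real_trig torus_Omega"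
proof
  show "compact torus_Omega" by (rule compact_torus_Omega)
next
  fix h assume "h \<in> real_trig"
  then obtain f where f: "trig_poly f" "\<forall>\<omega>\<in>torus_Omega. f \<omega> = of_real (h \<omega>)" by (auto simp: real_trig_def)
  have "continuous_on torus_Omega (\<lambda>\<omega>. Re (f \<omega>))" by (intro continuous_intros trig_poly_continuous f(1))
  then show "continuous_on torus_Omega h"
    by (rule continuous_on_eq) (use f(2) in simp)
next
  fix h h' assume "h \<in> real_trig" "h' \<in> real_trig"
  then obtain f f' where f: "trig_poly f" "\<forall>\<omega>\<in>torus_Omega. f \<omega> = of_real (h \<omega>)"
    and f': "trig_poly f'" "\<forall>\<omega>\<in>torus_Omega. f' \<omega> = of_real (h' \<omega>)" by (auto simp: real_trig_def)
  show "(\<lambda>\<omega>. h \<omega> + h' \<omega>) \<in> real_trig"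
    unfolding real_trig_def using trig_add[OF f(1) f'(1)] f(2) f'(2) by (intro CollectI exI conjI) auto
  obtain k where k: "trig_poly k" "\<forall>\<omega>\<in>torus_Omega. k \<omega> = f \<omega> * f' \<omega>" using trig_poly_mult[OF f(1) f'(1)] by blast
  show "(\<lambda>\<omega>. h \<omega> * h' \<omega>) \<in> real_trig"
    unfolding real_trig_def using k f(2) f'(2) by (intro CollectI exI[of _ k] conjI) auto
next
  fix c :: real
  have "trig_poly (\<lambda>\<omega>. of_real c * torus_char (\<lambda>_. 0) (\<lambda>_. 0) \<omega>)" by (rule trig_char) (simp add: admissible_def)
  then show "(\<lambda>_. c) \<in> real_trig" unfolding real_trig_def by (intro CollectI exI conjI) auto
next
  fix x y assume xy: "x \<in> torus_Omega" "y \<in> torus_Omega" "x \<noteq> y"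
  \<comment> \<open>Some coordinate f separates the two points. As Re (- i f) = Im f, the real and
    the imaginary part of f both yield ring elements, and one of them separates.\<close>
  have "\<exists>f. trig_poly (\<lambda>\<omega>. 1 * f \<omega>) \<and> trig_poly (\<lambda>\<omega>. (- \<i>) * f \<omega>) \<and> f x \<noteq> f y"
  proof (cases "\<exists>m. snd x m \<noteq> snd y m")
    case True
    then obtain m where "snd x m \<noteq> snd y m" by blast
    then show ?thesis by (intro exI[of _ "\<lambda>\<omega>. snd \<omega> m"] conjI trig_poly_coordinate)
  next
    case False
    then have "snd x = snd y" by auto
    then have "fst x \<noteq> fst y" using xy(3) by (simp add: prod_eq_iff)
    then obtain p where p: "fst x p \<noteq> fst y p" by auto
    have "prime p"
    proof (rule ccontr)
      assume "\<not> prime p"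
      then have "fst x p = undefined" "fst y p = undefined"
        using xy(1,2) by (auto simp: torus_Omega_def topspace_torus PiE_iff extensional_def)
      then show False using p by simp
    qed
    then show ?thesis using p by (intro exI[of _ "\<lambda>\<omega>. fst \<omega> p"] conjI trig_poly_coordinate)
  qed
  then obtain f where f: "trig_poly (\<lambda>\<omega>. 1 * f \<omega>)" "trig_poly (\<lambda>\<omega>. (- \<i>) * f \<omega>)" "f x \<noteq> f y" by blast
  show "\<exists>h\<in>real_trig. h x \<noteq> h y"
  proof (cases "Re (f x) = Re (f y)")
    case True
    then have "Re ((- \<i>) * f x) \<noteq> Re ((- \<i>) * f y)" using f(3) by (simp add: complex_eq_iff)
    then show ?thesis by (rule bexI[OF _ real_trig_Re[OF f(2)]])
  next
    case False
    then have "Re (1 * f x) \<noteq> Re (1 * f y)" by simp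
    then show ?thesis by (rule bexI[OF _ real_trig_Re[OF f(1)]])
  qed
qed

lemma real_trig_average:
  assumes ind: "rat_independent_family L_indices (L_elem \<alpha> h\<^sub>1 h\<^sub>2)" and h: "h \<in> real_trig"
  shows "integrable haar_Omega h"
    and "(\<lambda>N. (\<Sum>k\<le>N. h (shift_point \<alpha> h\<^sub>1 h\<^sub>2 k)) / real (N + 1)) \<longlonglongrightarrow> (LINT \<omega>|haar_Omega. h \<omega>)"
proof -
  obtain f where f: "trig_poly f" "\<forall>\<omega>\<in>torus_Omega. f \<omega> = of_real (h \<omega>)" using h by (auto simp: real_trig_def)
  have "integrable haar_Omega (\<lambda>\<omega>. Re (f \<omega>))" using trig_poly_integrable[OF f(1)] by (rule integrable_Re)
  moreover have "integrable haar_Omega (\<lambda>\<omega>. Re (f \<omega>)) \<longleftrightarrow> integrable haar_Omega h"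
    by (rule Bochner_Integration.integrable_cong) (use f(2) in \<open>auto simp: space_haar_Omega\<close>)
  ultimately show I: "integrable haar_Omega h" by blast
  have "(LINT \<omega>|haar_Omega. f \<omega>) = (LINT \<omega>|haar_Omega. complex_of_real (h \<omega>))"
    by (rule Bochner_Integration.integral_cong) (use f(2) in \<open>auto simp: space_haar_Omega\<close>)
  then have i: "(LINT \<omega>|haar_Omega. f \<omega>) = complex_of_real (LINT \<omega>|haar_Omega. h \<omega>)" by simp
  have s: "f (shift_point \<alpha> h\<^sub>1 h\<^sub>2 k) = of_real (h (shift_point \<alpha> h\<^sub>1 h\<^sub>2 k))" for k
    using f(2) shift_point_in by blast
  have "(\<lambda>N. complex_of_real ((\<Sum>k\<le>N. h (shift_point \<alpha> h\<^sub>1 h\<^sub>2 k)) / real (N + 1))) \<longlonglongrightarrow> complex_of_real (LINT \<omega>|haar_Omega. h \<omega>)"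
    using trig_poly_average[OF ind f(1)] unfolding i s by simp
  then show "(\<lambda>N. (\<Sum>k\<le>N. h (shift_point \<alpha> h\<^sub>1 h\<^sub>2 k)) / real (N + 1)) \<longlonglongrightarrow> (LINT \<omega>|haar_Omega. h \<omega>)"
    by (simp only: tendsto_of_real_iff)
qed

text \<open>Uniform approximation by an element of \<open>real_trig\<close>, with one third of the
  error each for the averages, the limit and the integral.\<close>

theorem equidistribution:
  assumes ind: "rat_independent_family L_indices (L_elem \<alpha> h\<^sub>1 h\<^sub>2)" and h: "continuous_on torus_Omega h"
  shows "integrable haar_Omega h"
    and "(\<lambda>N. (\<Sum>k\<le>N. h (shift_point \<alpha> h\<^sub>1 h\<^sub>2 k)) / real (N + 1)) \<longlonglongrightarrow> (LINT \<omega>|haar_Omega. h \<omega>)"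
proof -
  interpret prob_space haar_Omega by (rule prob_space_haar_Omega)
  have ap: "\<exists>g\<in>real_trig. \<forall>x\<in>torus_Omega. \<bar>h x - g x\<bar> < e" if "e > 0" for e
    by (rule function_ring_on.Stone_Weierstrass_basic[OF real_trig_ring h that])
  have "\<exists>g. g \<in> real_trig \<and> (\<forall>x\<in>torus_Omega. \<bar>h x - g x\<bar> < inverse (real (Suc n)))" for n
    using ap[of "inverse (real (Suc n))"] by auto
  then obtain g where g: "\<And>n. g n \<in> real_trig" "\<And>n x. x \<in> torus_Omega \<Longrightarrow> \<bar>h x - g n x\<bar> < inverse (real (Suc n))"
    by metis
  \<comment> \<open>Measurability for the product sigma-field of the two Haar measures comes from a
    pointwise limit of trigonometric polynomials.\<close>
  have hm: "h \<in> borel_measurable haar_Omega"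
  proof (rule borel_measurable_LIMSEQ_real)
    show "g n \<in> borel_measurable haar_Omega" for n using real_trig_average(1)[OF ind g(1)] by simp
    fix x assume "x \<in> space haar_Omega"
    then have x: "x \<in> torus_Omega" by (simp add: space_haar_Omega)
    have "(\<lambda>n. h x - g n x) \<longlonglongrightarrow> 0"
      by (rule Lim_null_comparison[OF _ LIMSEQ_inverse_real_of_nat])
         (use g(2)[OF x] in \<open>auto intro!: always_eventually less_imp_le\<close>)
    from tendsto_diff[OF tendsto_const[of "h x"] this] show "(\<lambda>n. g n x) \<longlonglongrightarrow> h x" by simp
  qed
  have "bounded (h ` torus_Omega)"
    by (rule compact_imp_bounded[OF compact_continuous_image[OF h compact_torus_Omega]])
  then obtain B where B: "\<And>x. x \<in> torus_Omega \<Longrightarrow> \<bar>h x\<bar> \<le> B" unfolding bounded_iff by auto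
  show hi: "integrable haar_Omega h"
    by (rule integrable_const_bound[where B = B, OF _ hm]) (use B in \<open>auto simp: space_haar_Omega\<close>)
  show "(\<lambda>N. (\<Sum>k\<le>N. h (shift_point \<alpha> h\<^sub>1 h\<^sub>2 k)) / real (N + 1)) \<longlonglongrightarrow> (LINT \<omega>|haar_Omega. h \<omega>)"
  proof (rule LIMSEQ_I)
    fix r :: real assume r: "r > 0"
    obtain q where q: "q \<in> real_trig" "\<And>x. x \<in> torus_Omega \<Longrightarrow> \<bar>h x - q x\<bar> < r / 3" using ap[of "r / 3"] r by auto
    let ?P = "\<lambda>k. shift_point \<alpha> h\<^sub>1 h\<^sub>2 k"
    obtain N0 where N0: "\<And>N. N \<ge> N0 \<Longrightarrow> \<bar>(\<Sum>k\<le>N. q (?P k)) / real (N + 1) - (LINT \<omega>|haar_Omega. q \<omega>)\<bar> < r / 3"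
      using LIMSEQ_D[OF real_trig_average(2)[OF ind q(1)], of "r / 3"] r by auto
    have i: "\<bar>(LINT \<omega>|haar_Omega. h \<omega>) - (LINT \<omega>|haar_Omega. q \<omega>)\<bar> \<le> r / 3"
    proof -
      have "\<bar>LINT \<omega>|haar_Omega. h \<omega> - q \<omega>\<bar> \<le> (LINT \<omega>|haar_Omega. r / 3)"
        by (rule integral_abs_bound[THEN order.trans], rule integral_mono)
           (use q(2) hi real_trig_average(1)[OF ind q(1)] in \<open>auto simp: space_haar_Omega intro: less_imp_le\<close>)
      then show ?thesis using hi real_trig_average(1)[OF ind q(1)] by (simp add: prob_space)
    qed
    have a: "\<bar>(\<Sum>k\<le>N. h (?P k)) / real (N + 1) - (\<Sum>k\<le>N. q (?P k)) / real (N + 1)\<bar> \<le> r / 3" for N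
    proof -
      have "\<bar>(\<Sum>k\<le>N. h (?P k) - q (?P k))\<bar> \<le> (\<Sum>k\<le>N. r / 3)"
        by (rule order.trans[OF sum_abs sum_mono]) (rule less_imp_le[OF q(2)[OF shift_point_in]])
      also have "\<dots> = r / 3 * real (N + 1)" by simp
      finally have "\<bar>(\<Sum>k\<le>N. h (?P k) - q (?P k))\<bar> / real (N + 1) \<le> r / 3"
        by (subst pos_divide_le_eq) auto
      then show ?thesis by (simp add: sum_subtractf diff_divide_distrib[symmetric] abs_divide)
    qed
    show "\<exists>N0. \<forall>N\<ge>N0. norm ((\<Sum>k\<le>N. h (?P k)) / real (N + 1) - (LINT \<omega>|haar_Omega. h \<omega>)) < r"
    proof (intro exI allI impI)
      fix N assume N: "N \<ge> N0"
      show "norm ((\<Sum>k\<le>N. h (?P k)) / real (N + 1) - (LINT \<omega>|haar_Omega. h \<omega>)) < r"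
        using N0[OF N] i a[of N] unfolding real_norm_def by linarith
    qed
  qed
qed

subsection \<open>Shifts of Dirichlet polynomials\<close>

text \<open>The multiplicity of a composite divisor can also be positive, hence the case
  distinction.\<close>

definition prime_exponents :: "nat \<Rightarrow> freq" where
  "prime_exponents n = (\<lambda>p. if prime p then int (multiplicity p n) else 0)"

lemma prime_exponents_support: "n > 0 \<Longrightarrow> {p. prime_exponents n p \<noteq> 0} = prime_factors n"
  by (auto simp: prime_exponents_def prime_factors_multiplicity)

lemma admissible_prime_exponents: "n > 0 \<Longrightarrow> admissible (prime_exponents n) (\<lambda>_. 0)"
  unfolding admissible_def by (auto simp: prime_exponents_support) (auto simp: prime_exponents_def split: if_splits)

lemma admissible_single: "admissible (\<lambda>_. 0) (\<lambda>j. if j = m then 1 else 0)"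
  by (simp add: admissible_def)

lemma omega_ext_eq_char:
  assumes "n > 0"
  shows "omega_ext (fst \<omega>) n = torus_char (prime_exponents n) (\<lambda>_. 0) \<omega>"
  unfolding torus_char_def prime_exponents_support[OF assms] omega_ext_def
  by (auto intro!: prod.cong simp: prime_exponents_def prime_factors_multiplicity)

lemma snd_eq_char: "snd \<omega> m = torus_char (\<lambda>_. 0) (\<lambda>j. if j = m then 1 else 0) \<omega>"
proof -
  have "{j. (if j = m then 1 else 0 :: int) \<noteq> 0} = {m}" by auto
  then show ?thesis by (simp add: torus_char_def)
qed

text \<open>One character times the conjugate of another is the character of the difference of
  exponents, which is nontrivial when they differ.\<close>

lemma orthonormal_chars:
  assumes adm: "\<And>m. admissible (U m) (V m)" and e: "\<And>m \<omega>. e m \<omega> = torus_char (U m) (V m) \<omega>"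
    and ne: "\<And>m m'. m \<noteq> m' \<Longrightarrow> U m \<noteq> U m' \<or> V m \<noteq> V m'"
  shows "orthonormal_system haar_Omega e"
proof -
  interpret prob_space haar_Omega by (rule prob_space_haar_Omega)
  have ee: "e m = torus_char (U m) (V m)" for m by (rule ext) (rule e)
  show ?thesis
  proof
    show "e m \<in> borel_measurable haar_Omega" for m unfolding ee by (rule torus_char_measurable[OF adm])
    show "cmod (e m \<omega>) = 1" if "\<omega> \<in> space haar_Omega" for m \<omega>
      using that unfolding ee space_haar_Omega by (rule torus_char_norm[OF _ adm])
    fix m m' :: nat assume mm: "m \<noteq> m'"
    have "(LINT \<omega>|haar_Omega. e m \<omega> * cnj (e m' \<omega>)) = (LINT \<omega>|haar_Omega. torus_char (\<lambda>p. U m p + - U m' p) (\<lambda>p. V m p + - V m' p) \<omega>)"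
      by (rule Bochner_Integration.integral_cong[OF refl])
         (simp only: ee space_haar_Omega torus_char_add[OF _ adm admissible_minus[OF adm]] torus_char_minus[OF _ adm])
    also have "\<dots> = 0"
    proof -
      have "\<not> ((\<forall>p. U m p + - U m' p = 0) \<and> (\<forall>p. V m p + - V m' p = 0))" using ne[OF mm] by auto
      then show ?thesis unfolding torus_char_integral[OF admissible_add[OF adm admissible_minus[OF adm]]] by simp
    qed
    finally show "(LINT \<omega>|haar_Omega. e m \<omega> * cnj (e m' \<omega>)) = 0" .
  qed
qed

lemma prime_exponents_inj:
  assumes "m > 0" "n > 0" "prime_exponents m = prime_exponents n"
  shows "m = n"
proof (rule multiplicity_eq_nat)
  show "m > 0" "n > 0" by fact+
  fix p :: nat assume "prime p"
  then show "multiplicity p m = multiplicity p n" using fun_cong[OF assms(3), of p] by (simp add: prime_exponents_def)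
qed

text \<open>Orthogonality is unique factorisation: different integers have different exponent
  vectors, hence different characters.\<close>

lemma orthonormal_omega_ext: "orthonormal_system haar_Omega (\<lambda>m \<omega>. omega_ext (fst \<omega>) (Suc m))"
  by (rule orthonormal_chars[where U = "\<lambda>m. prime_exponents (Suc m)" and V = "\<lambda>_ _. 0"])
     (auto simp: omega_ext_eq_char admissible_prime_exponents dest: prime_exponents_inj[rotated 2])

lemma orthonormal_snd: "orthonormal_system haar_Omega (\<lambda>m \<omega>. snd \<omega> m)"
proof (rule orthonormal_chars[where U = "\<lambda>_ _. 0" and V = "\<lambda>m j. if j = m then 1 else 0"])
  fix m m' :: nat assume mm: "m \<noteq> m'"
  have "(\<lambda>j. if j = m then 1 else 0 :: int) m \<noteq> (\<lambda>j. if j = m' then 1 else 0) m" using mm by simp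
  then show "(\<lambda>_. 0 :: int) \<noteq> (\<lambda>_. 0) \<or> (\<lambda>j. if j = m then 1 else 0 :: int) \<noteq> (\<lambda>j. if j = m' then 1 else 0)" by metis
qed (simp_all only: admissible_single snd_eq_char)

lemma char_freq_prime_exponents:
  assumes "n > 0"
  shows "char_freq \<alpha> h\<^sub>1 h\<^sub>2 (prime_exponents n) (\<lambda>_. 0) = h\<^sub>1 * ln (real n)"
proof -
  have "real n = (\<Prod>p\<in>prime_factors n. real p ^ multiplicity p n)"
    by (subst prime_factorization_nat[OF assms]) (simp only: of_nat_prod of_nat_power)
  then have "ln (real n) = ln (\<Prod>p\<in>prime_factors n. real p ^ multiplicity p n)" by (rule arg_cong)
  also have "\<dots> = (\<Sum>p\<in>prime_factors n. ln (real p ^ multiplicity p n))"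
    by (rule ln_prod) (auto dest: in_prime_factors_imp_prime prime_gt_0_nat)
  also have "\<dots> = (\<Sum>p\<in>prime_factors n. real (multiplicity p n) * ln (real p))"
    by (rule sum.cong) (auto simp: ln_realpow dest: in_prime_factors_imp_prime prime_gt_0_nat)
  finally have "ln (real n) = (\<Sum>p\<in>prime_factors n. real (multiplicity p n) * ln (real p))" .
  then show ?thesis
    unfolding char_freq_def prime_exponents_support[OF assms]
    by (auto simp: sum_distrib_left prime_exponents_def prime_factors_multiplicity mult_ac intro!: sum.cong)
qed

lemma char_freq_single: "char_freq \<alpha> h\<^sub>1 h\<^sub>2 (\<lambda>_. 0) (\<lambda>j. if j = m then 1 else 0) = h\<^sub>2 * ln (real m + \<alpha>)"
proof -
  have "{j. (if j = m then 1 else 0 :: int) \<noteq> 0} = {m}" by auto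
  then show ?thesis by (simp add: char_freq_def)
qed

lemma omega_ext_shift: "omega_ext (fst (shift_point \<alpha> h\<^sub>1 h\<^sub>2 k)) (Suc m) = cis (- (h\<^sub>1 * ln (real m + 1))) ^ k"
  using torus_char_shift[OF admissible_prime_exponents[of "Suc m"], of \<alpha> h\<^sub>1 h\<^sub>2 k]
  by (simp add: omega_ext_eq_char char_freq_prime_exponents add.commute)

lemma snd_shift: "snd (shift_point \<alpha> h\<^sub>1 h\<^sub>2 k) m = cis (- (h\<^sub>2 * ln (real m + \<alpha>))) ^ k"
  using torus_char_shift[OF admissible_single, of m \<alpha> h\<^sub>1 h\<^sub>2 k] unfolding snd_eq_char[symmetric] char_freq_single .

text \<open>Equal values would make the character of the difference of exponents equal to 1 at the
  shift point k = 1, and hence trivial.\<close>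

lemma char_shift_neq:
  assumes ind: "rat_independent_family L_indices (L_elem \<alpha> h\<^sub>1 h\<^sub>2)"
    and a: "admissible u v" "admissible u' v'" and ne: "u \<noteq> u' \<or> v \<noteq> v'"
  shows "cis (- char_freq \<alpha> h\<^sub>1 h\<^sub>2 u v) \<noteq> cis (- char_freq \<alpha> h\<^sub>1 h\<^sub>2 u' v')"
proof
  assume eq: "cis (- char_freq \<alpha> h\<^sub>1 h\<^sub>2 u v) = cis (- char_freq \<alpha> h\<^sub>1 h\<^sub>2 u' v')"
  let ?P = "shift_point \<alpha> h\<^sub>1 h\<^sub>2 1"
  have ad: "admissible (\<lambda>p. u p + - u' p) (\<lambda>m. v m + - v' m)"
    by (rule admissible_add[OF a(1) admissible_minus[OF a(2)]])
  have "cis (- char_freq \<alpha> h\<^sub>1 h\<^sub>2 (\<lambda>p. u p + - u' p) (\<lambda>m. v m + - v' m)) = torus_char (\<lambda>p. u p + - u' p) (\<lambda>m. v m + - v' m) ?P"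
    using torus_char_shift[OF ad, of \<alpha> h\<^sub>1 h\<^sub>2 1] by simp
  also have "\<dots> = torus_char u v ?P * cnj (torus_char u' v' ?P)"
    by (simp only: torus_char_add[OF shift_point_in a(1) admissible_minus[OF a(2)]] torus_char_minus[OF shift_point_in a(2)])
  also have "\<dots> = 1"
    by (simp add: torus_char_shift[OF a(1)] torus_char_shift[OF a(2)] eq complex_norm_square[symmetric])
  finally have one: "cis (- char_freq \<alpha> h\<^sub>1 h\<^sub>2 (\<lambda>p. u p + - u' p) (\<lambda>m. v m + - v' m)) = 1" .
  have "u p = u' p" for p using char_freq_nonperiodic(1)[OF ind ad one, of p] by simp
  moreover have "v p = v' p" for p using char_freq_nonperiodic(2)[OF ind ad one, of p] by simp
  ultimately show False using ne by blast
qed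

text \<open>Needed for Parseval along the shifts: the numbers (m + 1)^(- i h) must be distinct, i.e.
  the frequencies must differ modulo 2 pi and not merely as reals.\<close>

lemma log_shift_neq_1:
  assumes "rat_independent_family L_indices (L_elem \<alpha> h\<^sub>1 h\<^sub>2)" "m \<noteq> m'"
  shows "cis (- (h\<^sub>1 * ln (real m + 1))) \<noteq> cis (- (h\<^sub>1 * ln (real m' + 1)))"
proof -
  have "prime_exponents (Suc m) \<noteq> prime_exponents (Suc m')"
    using prime_exponents_inj[of "Suc m" "Suc m'"] assms(2) by auto
  then show ?thesis
    using char_shift_neq[OF assms(1) admissible_prime_exponents[of "Suc m"] admissible_prime_exponents[of "Suc m'"]]
    by (simp add: char_freq_prime_exponents add.commute)
qed

lemma log_shift_neq_2:
  assumes "rat_independent_family L_indices (L_elem \<alpha> h\<^sub>1 h\<^sub>2)" "m \<noteq> m'"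
  shows "cis (- (h\<^sub>2 * ln (real m + \<alpha>))) \<noteq> cis (- (h\<^sub>2 * ln (real m' + \<alpha>)))"
proof -
  have "(\<lambda>j. if j = m then 1 else 0 :: int) m \<noteq> (\<lambda>j. if j = m' then 1 else 0) m" using assms(2) by simp
  then have "(\<lambda>j. if j = m then 1 else 0 :: int) \<noteq> (\<lambda>j. if j = m' then 1 else 0)" by metis
  then show ?thesis
    using char_shift_neq[OF assms(1) admissible_single admissible_single] by (simp add: char_freq_single)
qed

lemma shift_powr:
  assumes "\<alpha> > 0"
  shows "complex_of_real (real m + \<alpha>) powr (- (s + \<i> * of_nat k * of_real h))
    = complex_of_real (real m + \<alpha>) powr (- s) * cis (- (h * ln (real m + \<alpha>))) ^ k"
proof -
  have pos: "real m + \<alpha> > 0" using assms by simp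
  have c: "cis (- (h * ln (real m + \<alpha>))) ^ k = exp (- (\<i> * of_nat k * of_real h * of_real (ln (real m + \<alpha>))))"
  proof -
    have "cis (- (h * ln (real m + \<alpha>))) ^ k = cis (real k * (- (h * ln (real m + \<alpha>))))" by (rule Complex.DeMoivre)
    then show ?thesis by (simp add: cis_conv_exp mult_ac)
  qed
  show ?thesis
    unfolding c using pos by (simp add: powr_def Ln_of_real algebra_simps flip: exp_add del: of_real_add)
qed

lemma dpoly_shift:
  assumes "\<alpha> > 0"
  shows "dpoly \<alpha> x M (s + \<i> * of_nat k * of_real h) =
    (\<Sum>m<M. x m * complex_of_real (real m + \<alpha>) powr (- s) * cis (- (h * ln (real m + \<alpha>))) ^ k)"
  unfolding dpoly_def shift_powr[OF assms] by (simp only: mult.assoc)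

text \<open>Parseval for exponential polynomials sampled at the integers: after expansion of the
  square each cross term is a geometric average whose ratio z m / z m' differs from 1.\<close>

lemma exponential_mean_square:
  fixes y z :: "nat \<Rightarrow> complex"
  assumes z: "\<And>m. cmod (z m) = 1" "\<And>m m'. m \<noteq> m' \<Longrightarrow> z m \<noteq> z m'"
  shows "(\<lambda>N. (\<Sum>k\<le>N. (cmod (\<Sum>m<M. y m * z m ^ k))\<^sup>2) / real (N + 1)) \<longlonglongrightarrow> (\<Sum>m<M. (cmod (y m))\<^sup>2)"
proof -
  have zz: "z m * cnj (z m) = 1" for m using z(1)[of m] by (simp add: complex_norm_square[symmetric])
  have lim: "(\<lambda>N. (\<Sum>k\<le>N. (z m * cnj (z m')) ^ k) / of_nat (N + 1)) \<longlonglongrightarrow> (if m = m' then 1 else 0)" for m m'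
  proof (cases "m = m'")
    case True
    have "(\<lambda>N. (\<Sum>k\<le>N. (z m * cnj (z m')) ^ k) / of_nat (N + 1)) = (\<lambda>N. 1 :: complex)"
      by (rule ext) (simp add: True zz del: of_nat_Suc)
    then show ?thesis using True by simp
  next
    case False
    have "z m * cnj (z m') \<noteq> 1"
    proof
      assume "z m * cnj (z m') = 1"
      then have "z m * (cnj (z m') * z m') = z m'" by (simp only: mult.assoc[symmetric] mult_1)
      then have "z m = z m'" using zz[of m'] by (simp add: mult.commute)
      then show False using z(2)[OF False] by simp
    qed
    then show ?thesis using False z(1) by (simp only: if_False) (rule geometric_average, auto simp: norm_mult)
  qed
  have eq: "complex_of_real ((\<Sum>k\<le>N. (cmod (\<Sum>m<M. y m * z m ^ k))\<^sup>2) / real (N + 1)) =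
     (\<Sum>m<M. \<Sum>m'<M. (y m * cnj (y m')) * ((\<Sum>k\<le>N. (z m * cnj (z m')) ^ k) / of_nat (N + 1)))" for N
  proof -
    have "complex_of_real ((cmod (\<Sum>m<M. y m * z m ^ k))\<^sup>2) = (\<Sum>m<M. \<Sum>m'<M. (y m * cnj (y m')) * (z m * cnj (z m')) ^ k)" for k
      unfolding complex_norm_square cnj_sum sum_product
      by (intro sum.cong refl) (simp add: power_mult_distrib mult_ac)
    then have "complex_of_real (\<Sum>k\<le>N. (cmod (\<Sum>m<M. y m * z m ^ k))\<^sup>2)
       = (\<Sum>k\<le>N. \<Sum>m<M. \<Sum>m'<M. (y m * cnj (y m')) * (z m * cnj (z m')) ^ k)" by (simp only: of_real_sum)
    also have "\<dots> = (\<Sum>m<M. \<Sum>k\<le>N. \<Sum>m'<M. (y m * cnj (y m')) * (z m * cnj (z m')) ^ k)" by (rule sum.swap)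
    also have "\<dots> = (\<Sum>m<M. \<Sum>m'<M. \<Sum>k\<le>N. (y m * cnj (y m')) * (z m * cnj (z m')) ^ k)"
      by (rule sum.cong[OF refl]) (rule sum.swap)
    finally have 1: "complex_of_real (\<Sum>k\<le>N. (cmod (\<Sum>m<M. y m * z m ^ k))\<^sup>2) =
       (\<Sum>m<M. \<Sum>m'<M. (y m * cnj (y m')) * (\<Sum>k\<le>N. (z m * cnj (z m')) ^ k))" by (simp only: sum_distrib_left)
    show ?thesis
      by (simp only: of_real_divide 1 of_real_of_nat_eq times_divide_eq_right sum_divide_distrib[symmetric])
  qed
  have "(\<lambda>N. complex_of_real ((\<Sum>k\<le>N. (cmod (\<Sum>m<M. y m * z m ^ k))\<^sup>2) / real (N + 1)))
     \<longlonglongrightarrow> (\<Sum>m<M. \<Sum>m'<M. (y m * cnj (y m')) * (if m = m' then 1 else 0))"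
    unfolding eq by (intro tendsto_sum tendsto_mult_left lim)
  also have "(\<Sum>m<M. \<Sum>m'<M. (y m * cnj (y m')) * (if m = m' then 1 else 0)) = complex_of_real (\<Sum>m<M. (cmod (y m))\<^sup>2)"
    by (simp add: if_distrib flip: complex_norm_square cong: if_cong)
  finally show ?thesis by (simp only: tendsto_of_real_iff)
qed

context mean_strip
begin

text \<open>The coefficient bounds come from the approximation itself: by Parseval, differences of two
  approximants are small in mean square along the shifts of one real point, added to \<open>K\<close> for this purpose.\<close>

theorem mean_approximation:
  assumes h: "h > 0" and K: "bounded K" and d: "d > 0" "\<And>s. s \<in> K \<Longrightarrow> Re s \<ge> \<sigma>\<^sub>0 + d"
    and nonper: "\<And>m m'. m \<noteq> m' \<Longrightarrow> cis (- (h * ln (real m + \<alpha>))) \<noteq> cis (- (h * ln (real m' + \<alpha>)))"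
  obtains x :: "nat \<Rightarrow> nat \<Rightarrow> complex" and M :: "nat \<Rightarrow> nat" and w :: "nat \<Rightarrow> real" and \<delta> C :: real
  where "\<And>n m. m \<ge> M n \<Longrightarrow> x n m = 0"
    "\<delta> > 0" "\<And>k. w k \<ge> 0" "C \<ge> 0" "\<And>N. (\<Sum>k\<le>N. (w k)\<^sup>2) \<le> C * real (N + 1)"
    "\<And>n. \<forall>\<^sub>F k in sequentially. \<forall>s\<in>K.
       cmod (F (s + \<i> * of_nat k * of_real h) - dpoly \<alpha> (x n) (M n) (s + \<i> * of_nat k * of_real h)) \<le> exp (- \<delta> * real n) * w k"
    "\<And>n. summable (\<lambda>m. (cmod (a m - x n m))\<^sup>2 * (real m + \<alpha>) powr (- 2 * (\<sigma>\<^sub>0 + d)))"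
    "\<And>n. (\<Sum>m. (cmod (a m - x n m))\<^sup>2 * (real m + \<alpha>) powr (- 2 * (\<sigma>\<^sub>0 + d))) \<le> C * exp (- 2 * \<delta> * real n)"
proof -
  define \<sigma> where "\<sigma> = \<sigma>\<^sub>0 + d"
  define s0 where "s0 = complex_of_real \<sigma>"
  have K': "bounded (insert s0 K)" using K by simp
  have d': "\<And>s. s \<in> insert s0 K \<Longrightarrow> Re s \<ge> \<sigma>\<^sub>0 + d" using d(2) by (auto simp: s0_def \<sigma>_def)
  obtain x M w \<delta> C where
    x0: "\<And>n m. m \<ge> M n \<Longrightarrow> x n m = 0" and xl: "\<And>m. (\<lambda>n. x n m) \<longlonglongrightarrow> a m" and
    \<delta>: "\<delta> > 0" and w: "\<And>k. w k \<ge> (0::real)" and C: "C \<ge> 0" "\<And>N. (\<Sum>k\<le>N. (w k)\<^sup>2) \<le> C * real (N + 1)" and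
    ap: "\<And>n. \<forall>\<^sub>F k in sequentially. \<forall>s\<in>insert s0 K.
       cmod (F (s + \<i> * of_nat k * of_real h) - dpoly \<alpha> (x n) (M n) (s + \<i> * of_nat k * of_real h)) \<le> exp (- \<delta> * real n) * w k"
    by (rule approximants[OF h K' d(1) d'], assumption) (rule that)
  define z where "z = (\<lambda>m. cis (- (h * ln (real m + \<alpha>))))"
  define l where "l = (\<lambda>m. (real m + \<alpha>) powr (- 2 * \<sigma>))"
  have l0: "l m \<ge> 0" for m by (simp add: l_def)
  have lsq: "(cmod (complex_of_real (real m + \<alpha>) powr (- s0)))\<^sup>2 = l m" for m
    using norm_shift_powr[OF \<alpha>(1), of m "- s0"] by (simp add: l_def s0_def power2_eq_square flip: powr_add)
  have fin: "(\<Sum>m<L. (cmod (x n m - x n' m))\<^sup>2 * l m) \<le> C * (exp (- \<delta> * real n) + exp (- \<delta> * real n'))\<^sup>2" for n n' L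
  proof -
    define M' where "M' = max L (max (M n) (M n'))"
    define E where "E = exp (- \<delta> * real n) + exp (- \<delta> * real n')"
    define y where "y = (\<lambda>m. (x n m - x n' m) * complex_of_real (real m + \<alpha>) powr (- s0))"
    let ?s = "\<lambda>k. s0 + \<i> * of_nat k * of_real h"
    let ?D = "\<lambda>k. dpoly \<alpha> (x n) (M n) (?s k) - dpoly \<alpha> (x n') (M n') (?s k)"
    have ext: "dpoly \<alpha> (x n) (M n) s = dpoly \<alpha> (x n) M' s" if "M n \<le> M'" for n s
      unfolding dpoly_def by (rule sum.mono_neutral_left) (use that x0 in auto)
    have De: "?D k = (\<Sum>m<M'. y m * z m ^ k)" for k
    proof -
      have "?D k = dpoly \<alpha> (x n) M' (?s k) - dpoly \<alpha> (x n') M' (?s k)"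
        using ext[of n "?s k"] ext[of n' "?s k"] by (simp add: M'_def)
      also have "\<dots> = (\<Sum>m<M'. y m * z m ^ k)"
        unfolding dpoly_shift[OF \<alpha>(1)] sum_subtractf[symmetric] y_def z_def by (simp add: left_diff_distrib)
      finally show ?thesis .
    qed
    have lim: "(\<lambda>N. (\<Sum>k\<le>N. (cmod (?D k))\<^sup>2) / real (N + 1)) \<longlonglongrightarrow> (\<Sum>m<M'. (cmod (y m))\<^sup>2)"
      unfolding De by (rule exponential_mean_square) (use nonper in \<open>auto simp: z_def\<close>)
    have ev: "\<forall>\<^sub>F k in sequentially. cmod (?D k) \<le> E * w k"
      using ap[of n] ap[of n']
    proof eventually_elim
      case (elim k)
      have "cmod (F (?s k) - dpoly \<alpha> (x n) (M n) (?s k)) \<le> exp (- \<delta> * real n) * w k"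
        "cmod (F (?s k) - dpoly \<alpha> (x n') (M n') (?s k)) \<le> exp (- \<delta> * real n') * w k"
        using elim by blast+
      moreover have "cmod (?D k) \<le> cmod (F (?s k) - dpoly \<alpha> (x n') (M n') (?s k)) + cmod (F (?s k) - dpoly \<alpha> (x n) (M n) (?s k))"
        using norm_triangle_ineq4[of "F (?s k) - dpoly \<alpha> (x n') (M n') (?s k)" "F (?s k) - dpoly \<alpha> (x n) (M n) (?s k)"] by simp
      ultimately show ?case unfolding E_def distrib_right by linarith
    qed
    then obtain k0 where k0: "\<And>k. k \<ge> k0 \<Longrightarrow> cmod (?D k) \<le> E * w k" unfolding eventually_sequentially by blast
    define B where "B = (\<Sum>k<k0. (cmod (?D k))\<^sup>2)"
    \<comment> \<open>The finitely many k at which the approximation is not yet valid are collected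
      in B, which disappears in the mean.\<close>
    have up: "(\<Sum>k\<le>N. (cmod (?D k))\<^sup>2) / real (N + 1) \<le> B / real (N + 1) + E\<^sup>2 * C" for N
    proof -
      have "(\<Sum>k\<le>N. (cmod (?D k))\<^sup>2) \<le> (\<Sum>k\<le>N. (if k < k0 then (cmod (?D k))\<^sup>2 else 0) + E\<^sup>2 * (w k)\<^sup>2)"
      proof (rule sum_mono)
        fix k
        show "(cmod (?D k))\<^sup>2 \<le> (if k < k0 then (cmod (?D k))\<^sup>2 else 0) + E\<^sup>2 * (w k)\<^sup>2"
        proof (cases "k < k0")
          case False
          then have "(cmod (?D k))\<^sup>2 \<le> (E * w k)\<^sup>2" using k0[of k] by (intro power_mono) auto
          then show ?thesis using False by (simp add: power_mult_distrib)
        qed simp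
      qed
      also have "\<dots> = (\<Sum>k\<le>N. (if k < k0 then (cmod (?D k))\<^sup>2 else 0)) + E\<^sup>2 * (\<Sum>k\<le>N. (w k)\<^sup>2)"
        by (simp only: sum.distrib sum_distrib_left)
      also have "(\<Sum>k\<le>N. (if k < k0 then (cmod (?D k))\<^sup>2 else 0)) \<le> B"
      proof -
        have "(\<Sum>k\<le>N. (if k < k0 then (cmod (?D k))\<^sup>2 else 0)) = (\<Sum>k\<in>{..N} \<inter> {..<k0}. (cmod (?D k))\<^sup>2)"
          by (subst sum.inter_restrict) auto
        also have "\<dots> \<le> B" unfolding B_def by (rule sum_mono2) auto
        finally show ?thesis .
      qed
      also have "E\<^sup>2 * (\<Sum>k\<le>N. (w k)\<^sup>2) \<le> E\<^sup>2 * (C * real (N + 1))" by (intro mult_left_mono C) simp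
      finally have "(\<Sum>k\<le>N. (cmod (?D k))\<^sup>2) \<le> B + E\<^sup>2 * (C * real (N + 1))" by simp
      then have "(\<Sum>k\<le>N. (cmod (?D k))\<^sup>2) / real (N + 1) \<le> (B + E\<^sup>2 * (C * real (N + 1))) / real (N + 1)"
        by (rule divide_right_mono) simp
      also have "\<dots> = B / real (N + 1) + E\<^sup>2 * C" by (simp add: add_divide_distrib)
      finally show ?thesis .
    qed
    have "(\<lambda>N. B / real (N + 1) + E\<^sup>2 * C) \<longlonglongrightarrow> E\<^sup>2 * C" by real_asymp
    from LIMSEQ_le[OF lim this] up have "(\<Sum>m<M'. (cmod (y m))\<^sup>2) \<le> E\<^sup>2 * C" by blast
    moreover have "(\<Sum>m<L. (cmod (x n m - x n' m))\<^sup>2 * l m) \<le> (\<Sum>m<M'. (cmod (x n m - x n' m))\<^sup>2 * l m)"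
      by (rule sum_mono2) (auto simp: M'_def l0)
    moreover have "(cmod (y m))\<^sup>2 = (cmod (x n m - x n' m))\<^sup>2 * l m" for m
      unfolding y_def norm_mult power_mult_distrib lsq ..
    ultimately show ?thesis unfolding E_def by (simp add: mult.commute)
  qed
  \<comment> \<open>With L fixed, n' tends to infinity: the second approximant has the coefficients
    of the series as limits, and its error vanishes.\<close>
  have fin2: "(\<Sum>m<L. (cmod (a m - x n m))\<^sup>2 * l m) \<le> C * exp (- 2 * \<delta> * real n)" for n L
  proof (rule LIMSEQ_le)
    show "(\<lambda>n'. \<Sum>m<L. (cmod (x n m - x n' m))\<^sup>2 * l m) \<longlonglongrightarrow> (\<Sum>m<L. (cmod (a m - x n m))\<^sup>2 * l m)"
      unfolding norm_minus_commute[of "a _" "x n _"] by (intro tendsto_intros xl)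
    have e: "(\<lambda>n'. exp (- \<delta> * real n')) \<longlonglongrightarrow> 0" using \<delta> by real_asymp
    have "(\<lambda>n'. C * (exp (- \<delta> * real n) + exp (- \<delta> * real n'))\<^sup>2) \<longlonglongrightarrow> C * (exp (- \<delta> * real n) + 0)\<^sup>2"
      by (intro tendsto_intros e)
    moreover have "(exp (- \<delta> * real n) + 0)\<^sup>2 = exp (- 2 * \<delta> * real n)" by (simp add: power2_eq_square flip: exp_add)
    ultimately show "(\<lambda>n'. C * (exp (- \<delta> * real n) + exp (- \<delta> * real n'))\<^sup>2) \<longlonglongrightarrow> C * exp (- 2 * \<delta> * real n)" by simp
    show "\<exists>N. \<forall>n'\<ge>N. (\<Sum>m<L. (cmod (x n m - x n' m))\<^sup>2 * l m) \<le> C * (exp (- \<delta> * real n) + exp (- \<delta> * real n'))\<^sup>2"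
      using fin by blast
  qed
  have sm: "summable (\<lambda>m. (cmod (a m - x n m))\<^sup>2 * l m)" for n
    by (rule summableI_nonneg_bounded[OF _ fin2]) (simp add: l0)
  have sb: "(\<Sum>m. (cmod (a m - x n m))\<^sup>2 * l m) \<le> C * exp (- 2 * \<delta> * real n)" for n
    by (rule suminf_le_const[OF sm fin2])
  have ap': "\<forall>\<^sub>F k in sequentially. \<forall>s\<in>K.
       cmod (F (s + \<i> * of_nat k * of_real h) - dpoly \<alpha> (x n) (M n) (s + \<i> * of_nat k * of_real h)) \<le> exp (- \<delta> * real n) * w k" for n
    using ap[of n] by eventually_elim blast
  show ?thesis
    by (rule that[OF x0 \<delta> w C ap' sm[unfolded l_def \<sigma>_def] sb[unfolded l_def \<sigma>_def]])
qed

end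

subsection \<open>Analytic continuation of the Hurwitz zeta-function\<close>

lemma holomorphic_on_series:
  fixes f :: "nat \<Rightarrow> complex \<Rightarrow> complex"
  assumes S: "open S" and f: "\<And>m. f m holomorphic_on S"
    and b: "\<And>x. x \<in> S \<Longrightarrow> \<exists>d>0. \<exists>g. cball x d \<subseteq> S \<and> summable g \<and> (\<forall>m. \<forall>z\<in>cball x d. cmod (f m z) \<le> g m)"
  shows "(\<lambda>z. \<Sum>m. f m z) holomorphic_on S"
proof (rule holomorphic_uniform_sequence[OF S, where f = "\<lambda>n z. \<Sum>m<n. f m z"])
  show "(\<lambda>z. \<Sum>m<n. f m z) holomorphic_on S" for n by (intro holomorphic_intros f)
  fix x assume "x \<in> S"
  from b[OF this] obtain d g where d: "d > 0" "cball x d \<subseteq> S" "summable g" "\<And>m z. z \<in> cball x d \<Longrightarrow> cmod (f m z) \<le> g m" by blast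
  have "uniform_limit (cball x d) (\<lambda>n z. \<Sum>m<n. f m z) (\<lambda>z. \<Sum>m. f m z) sequentially"
    by (rule Weierstrass_m_test) (use d in auto)
  then show "\<exists>d>0. cball x d \<subseteq> S \<and> uniform_limit (cball x d) (\<lambda>n z. \<Sum>m<n. f m z) (\<lambda>z. \<Sum>m. f m z) sequentially"
    using d by blast
qed

lemma shift_powr_le:
  fixes \<alpha> r P :: real
  assumes \<alpha>: "0 < \<alpha>" "\<alpha> \<le> 1" and r: "0 \<le> r" "r \<le> P"
  shows "(real m + \<alpha>) powr (- r) \<le> \<alpha> powr (- P) * (real m + 1) powr (- r)"
proof -
  have "\<alpha> * (real m + 1) \<le> real m + \<alpha>" using \<alpha> by (simp add: algebra_simps mult_left_le_one_le)
  then have "(real m + \<alpha>) powr (- r) \<le> (\<alpha> * (real m + 1)) powr (- r)"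
    using \<alpha> r by (intro powr_mono2') auto
  also have "\<dots> = \<alpha> powr (- r) * (real m + 1) powr (- r)" using \<alpha> by (simp add: powr_mult)
  also have "\<dots> \<le> \<alpha> powr (- P) * (real m + 1) powr (- r)"
    using \<alpha> r by (intro mult_right_mono powr_mono') auto
  finally show ?thesis .
qed

text \<open>The Taylor remainder of order K of (x + t)^w at t = 0. It is estimated for t in [0, 1];
  the argument is complex so that complex derivatives apply.\<close>

definition powr_remainder :: "nat \<Rightarrow> real \<Rightarrow> complex \<Rightarrow> complex \<Rightarrow> complex" where
  "powr_remainder K x w t = (of_real x + t) powr w - (\<Sum>k\<le>K. (w gchoose k) * t ^ k * of_real x powr (w - of_nat k))"

text \<open>Differentiation lowers the order and the exponent together, by the absorption law for
  binomial coefficients. This drives the induction for the size of the remainder.\<close>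

lemma powr_remainder_derivative:
  assumes x: "x > 0" and t: "t \<ge> 0"
  shows "(powr_remainder (Suc K) x w has_field_derivative w * powr_remainder K x (w - 1) (of_real t)) (at (of_real t))"
proof -
  have nz: "complex_of_real x + of_real t \<notin> \<real>\<^sub>\<le>\<^sub>0"
    using x t by (simp add: complex_nonpos_Reals_iff)
  have 1: "((\<lambda>t. (of_real x + t) powr w) has_field_derivative w * (of_real x + of_real t) powr (w - 1)) (at (of_real t))"
  proof -
    have "((\<lambda>z. z powr w) has_field_derivative w * (of_real x + of_real t) powr (w - 1)) (at (of_real x + of_real t))"
      by (rule has_field_derivative_powr[OF nz])
    moreover have "((\<lambda>t. of_real x + t) has_field_derivative 1) (at (complex_of_real t))"
      by (auto intro!: derivative_eq_intros)
    ultimately have "((\<lambda>t. (of_real x + t) powr w) has_field_derivative w * (of_real x + of_real t) powr (w - 1) * 1) (at (of_real t))"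
      by (rule DERIV_chain2[where f = "\<lambda>z. z powr w" and g = "\<lambda>t. of_real x + t"])
    then show ?thesis by simp
  qed
  have 2: "((\<lambda>t. \<Sum>k\<le>Suc K. (w gchoose k) * t ^ k * of_real x powr (w - of_nat k)) has_field_derivative
      (\<Sum>k\<le>Suc K. (w gchoose k) * (of_nat k * of_real t ^ (k - 1)) * of_real x powr (w - of_nat k))) (at (of_real t :: complex))"
    by (rule DERIV_sum) (auto intro!: derivative_eq_intros)
  have "(\<Sum>k\<le>Suc K. (w gchoose k) * (of_nat k * of_real t ^ (k - 1)) * of_real x powr (w - of_nat k))
     = (\<Sum>k\<le>K. (w gchoose Suc k) * (of_nat (Suc k) * of_real t ^ k) * of_real x powr (w - of_nat (Suc k)))"
    by (subst sum.atMost_Suc_shift) simp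
  also have "\<dots> = (\<Sum>k\<le>K. w * ((w - 1 gchoose k) * of_real t ^ k * of_real x powr (w - 1 - of_nat k)))"
  proof (rule sum.cong[OF refl])
    fix k
    have "of_nat (Suc k) * (w gchoose Suc k) = w * ((w - 1) gchoose k)" by (rule gbinomial_absorption)
    moreover have "w - of_nat (Suc k) = w - 1 - of_nat k" by simp
    ultimately show "(w gchoose Suc k) * (of_nat (Suc k) * of_real t ^ k) * of_real x powr (w - of_nat (Suc k))
       = w * ((w - 1 gchoose k) * of_real t ^ k * of_real x powr (w - 1 - of_nat k))"
      by (metis mult.assoc mult.commute)
  qed
  finally have 3: "(\<Sum>k\<le>Suc K. (w gchoose k) * (of_nat k * of_real t ^ (k - 1)) * of_real x powr (w - of_nat k))
    = w * (\<Sum>k\<le>K. (w - 1 gchoose k) * of_real t ^ k * of_real x powr (w - 1 - of_nat k))" by (simp only: sum_distrib_left)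
  show ?thesis
    using DERIV_diff[OF 1 2] unfolding 3 powr_remainder_def[abs_def] by (simp add: right_diff_distrib)
qed

text \<open>Induction on K: the remainder vanishes at t = 0, and its derivative is w times the
  remainder of lower order at exponent w - 1. The condition Re w \<le> K + 1 is inherited, and at K
  = 0 it makes the derivative largest at t = 0.\<close>

lemma powr_remainder_bound:
  assumes x: "x > 0"
  shows "0 \<le> t \<Longrightarrow> t \<le> 1 \<Longrightarrow> Re w \<le> real K + 1 \<Longrightarrow>
    cmod (powr_remainder K x w (of_real t)) \<le> (\<Prod>i\<le>K. cmod (w - of_nat i)) * x powr (Re w - real K - 1)"
proof (induction K arbitrary: w t)
  case 0
  have eq: "powr_remainder 0 x w (of_real t) = of_real (x + t) powr w - of_real x powr w" by (simp add: powr_remainder_def)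
  have "cmod (of_real x powr (- (- w)) - of_real (x + t) powr (- (- w))) \<le> cmod (- w) * x powr (- Re (- w) - 1) * (x + t - x)"
    using 0 x by (intro powr_diff_bound) auto
  also have "\<dots> \<le> cmod w * x powr (Re w - 1) * 1" using 0 by (intro mult_mono) auto
  finally show ?case unfolding eq by (simp add: norm_minus_commute)
next
  case (Suc K)
  let ?S = "complex_of_real ` {0..1}"
  let ?B = "cmod w * ((\<Prod>i\<le>K. cmod (w - 1 - of_nat i)) * x powr (Re (w - 1) - real K - 1))"
  have S: "convex ?S" by (intro convex_linear_image linearI) (auto simp: scaleR_conv_of_real)
  have z: "powr_remainder (Suc K) x w 0 = 0"
    unfolding powr_remainder_def by (subst sum.atMost_Suc_shift) simp
  have "cmod (powr_remainder (Suc K) x w (of_real t) - powr_remainder (Suc K) x w (of_real 0)) \<le> ?B * cmod (of_real t - of_real 0)"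
  proof (rule field_differentiable_bound[OF S])
    fix z assume "z \<in> ?S"
    then obtain u where u: "z = of_real u" "0 \<le> u" "u \<le> 1" by auto
    show "(powr_remainder (Suc K) x w has_field_derivative w * powr_remainder K x (w - 1) z) (at z within ?S)"
      unfolding u(1) by (rule has_field_derivative_at_within[OF powr_remainder_derivative[OF x u(2)]])
    show "cmod (w * powr_remainder K x (w - 1) z) \<le> ?B"
      unfolding norm_mult u(1) by (intro mult_left_mono Suc.IH u(2,3)) (use Suc.prems in auto)
  qed (use Suc.prems in auto)
  also have "\<dots> \<le> ?B * 1"
    using Suc.prems by (intro mult_left_mono mult_nonneg_nonneg prod_nonneg) auto
  also have "?B * 1 = (\<Prod>i\<le>Suc K. cmod (w - of_nat i)) * x powr (Re w - real (Suc K) - 1)"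
  proof -
    have e: "Re (w - 1) - real K - 1 = Re w - real (Suc K) - 1" by simp
    have p: "cmod (w - of_nat (Suc i)) = cmod (w - 1 - of_nat i)" for i by (simp add: algebra_simps)
    have "(\<Prod>i\<le>Suc K. cmod (w - of_nat i)) = cmod w * (\<Prod>i\<le>K. cmod (w - 1 - of_nat i))"
      unfolding prod.atMost_Suc_shift p by simp
    then show ?thesis unfolding e by simp
  qed
  finally show ?case by (simp add: z)
qed

text \<open>The terms are of order m^(- Re s - K), so the series converges for Re s > 1 - K: each
  further order carries the continuation one unit to the left.\<close>

definition hurwitz_remainder :: "nat \<Rightarrow> real \<Rightarrow> complex \<Rightarrow> complex" where
  "hurwitz_remainder K a s = (\<Sum>m. powr_remainder K (real m + a) (1 - s) 1)"

lemma hurwitz_remainder_term_bound: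
  assumes a: "0 < a" "a \<le> 1" and s: "Re s \<ge> \<sigma>" "cmod s \<le> R" and \<sigma>: "\<sigma> + real K > 1"
  shows "cmod (powr_remainder K (real m + a) (1 - s) 1)
    \<le> (\<Prod>i\<le>K. 1 + R + real i) * a powr (- (R + real K)) * (real m + 1) powr (- (\<sigma> + real K))"
proof -
  have R: "R \<ge> 0" "Re s \<le> R" using s order.trans[OF norm_ge_zero s(2)] complex_Re_le_cmod[of s] by linarith+
  have e: "Re (1 - s) - real K - 1 = - (Re s + real K)" by simp
  have "cmod (powr_remainder K (real m + a) (1 - s) (of_real 1)) \<le> (\<Prod>i\<le>K. cmod (1 - s - of_nat i)) * (real m + a) powr (Re (1 - s) - real K - 1)"
    using a s \<sigma> by (intro powr_remainder_bound) auto
  also have "\<dots> \<le> (\<Prod>i\<le>K. 1 + R + real i) * (a powr (- (R + real K)) * (real m + 1) powr (- (Re s + real K)))"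
    unfolding e
  proof (intro mult_mono prod_mono conjI)
    fix i
    have "cmod (1 - s - of_nat i) \<le> cmod 1 + cmod s + cmod (of_nat i)"
      using norm_triangle_ineq4[of "1 - s" "of_nat i"] norm_triangle_ineq4[of 1 s] by linarith
    then show "cmod (1 - s - of_nat i) \<le> 1 + R + real i" using s by simp
    show "(real m + a) powr - (Re s + real K) \<le> a powr (- (R + real K)) * (real m + 1) powr (- (Re s + real K))"
      using a s \<sigma> R by (intro shift_powr_le) auto
  qed (use R in \<open>auto intro!: prod_nonneg\<close>)
  also have "\<dots> \<le> (\<Prod>i\<le>K. 1 + R + real i) * (a powr (- (R + real K)) * (real m + 1) powr (- (\<sigma> + real K)))"
    using s R by (intro mult_left_mono powr_mono prod_nonneg) auto
  finally show ?thesis by (simp add: mult.assoc)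
qed

lemma hurwitz_remainder_summable:
  assumes a: "0 < a" "a \<le> 1" and s: "Re s + real K > 1"
  shows "summable (\<lambda>m. powr_remainder K (real m + a) (1 - s) 1)"
proof (rule summable_comparison_test')
  show "summable (\<lambda>m. (\<Prod>i\<le>K. 1 + cmod s + real i) * a powr (- (cmod s + real K)) * (real m + 1) powr (- (Re s + real K)))"
    using s by (intro summable_mult summable_shift_powr) auto
  show "norm (powr_remainder K (real m + a) (1 - s) 1)
    \<le> (\<Prod>i\<le>K. 1 + cmod s + real i) * a powr (- (cmod s + real K)) * (real m + 1) powr (- (Re s + real K))" for m
    by (rule hurwitz_remainder_term_bound[OF a]) (use s in auto)
qed

lemma holomorphic_gbinomial [holomorphic_intros]:
  assumes "f holomorphic_on S"
  shows "(\<lambda>s. f s gchoose k) holomorphic_on S"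
  unfolding gbinomial_prod_rev by (intro holomorphic_intros assms) auto

lemma hurwitz_remainder_holomorphic:
  assumes a: "0 < a" "a \<le> 1"
  shows "hurwitz_remainder K a holomorphic_on {s. Re s > 1 - real K}"
  unfolding hurwitz_remainder_def[abs_def]
proof (rule holomorphic_on_series)
  show "open {s. Re s > 1 - real K}" by (simp add: open_halfspace_Re_gt)
  have ne: "complex_of_real (real m + a) \<noteq> 0" "complex_of_real (real m + a) + 1 \<noteq> 0" for m
    using a by (simp_all add: complex_eq_iff)
  show "(\<lambda>s. powr_remainder K (real m + a) (1 - s) 1) holomorphic_on {s. Re s > 1 - real K}" for m
    unfolding powr_remainder_def using ne[of m] by (intro holomorphic_intros)
  fix x assume "x \<in> {s. Re s > 1 - real K}"
  define d where "d = (Re x - (1 - real K)) / 2"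
  have d: "d > 0" using \<open>x \<in> _\<close> by (simp add: d_def)
  have z: "Re z \<ge> 1 - real K + d \<and> cmod z \<le> cmod x + d" if "z \<in> cball x d" for z
  proof -
    have "cmod (z - x) \<le> d" using that by (simp add: dist_norm norm_minus_commute)
    moreover have "\<bar>Re (z - x)\<bar> \<le> cmod (z - x)" by (rule abs_Re_le_cmod)
    moreover have "cmod z \<le> cmod x + cmod (z - x)" using norm_triangle_ineq[of x "z - x"] by simp
    ultimately show ?thesis unfolding d_def by (simp add: field_simps abs_le_iff)
  qed
  let ?g = "\<lambda>m. (\<Prod>i\<le>K. 1 + (cmod x + d) + real i) * a powr (- ((cmod x + d) + real K)) * (real m + 1) powr (- ((1 - real K + d) + real K))"
  show "\<exists>d>0. \<exists>g. cball x d \<subseteq> {s. Re s > 1 - real K} \<and> summable g \<and> (\<forall>m. \<forall>z\<in>cball x d. cmod (powr_remainder K (real m + a) (1 - z) 1) \<le> g m)"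
  proof (intro exI[of _ d] exI[of _ ?g] conjI d allI ballI)
    show "cball x d \<subseteq> {s. Re s > 1 - real K}" using z d by fastforce
    show "summable ?g" using d by (intro summable_mult summable_shift_powr) auto
    show "cmod (powr_remainder K (real m + a) (1 - z) 1) \<le> ?g m" if "z \<in> cball x d" for m z
      by (rule hurwitz_remainder_term_bound[OF a]) (use z[OF that] d in auto)
  qed
qed

lemma hurwitz_summable:
  assumes a: "a > 0" and s: "Re s > 1"
  shows "summable (\<lambda>m. complex_of_real (real m + a) powr (- s))"
  by (rule summable_norm_cancel) (use summable_shift_powr[OF a s] norm_shift_powr[OF a, of _ "- s"] in simp)

lemma telescope_powr:
  assumes a: "a > 0" and s: "Re s > 1"
  shows "(\<lambda>m. complex_of_real (real m + a + 1) powr (1 - s) - complex_of_real (real m + a) powr (1 - s)) sums (- (of_real a powr (1 - s)))"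
proof -
  have "(\<lambda>m. complex_of_real (real m + a) powr (1 - s)) \<longlonglongrightarrow> 0"
  proof (rule tendsto_norm_zero_cancel)
    have "(\<lambda>m. (real m + a) powr r) \<longlonglongrightarrow> 0" if "r < 0" for r using that a by real_asymp
    from this[of "1 - Re s"] s show "(\<lambda>m. cmod (complex_of_real (real m + a) powr (1 - s))) \<longlonglongrightarrow> 0"
      using norm_shift_powr[OF a, of _ "1 - s"] by simp
  qed
  from telescope_sums[OF this] show ?thesis by (simp add: add_ac)
qed

text \<open>The power at m + a + 1 and the zeroth Taylor term telescope to - a^(1 - s); the Taylor
  term of order k + 1 sums to the zeta-value at s + k.\<close>

lemma hurwitz_remainder_identity:
  assumes a: "a > 0" and s: "Re s > 1"
  shows "hurwitz_remainder K a s = - (of_real a powr (1 - s))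
     - (\<Sum>k<K. (1 - s gchoose Suc k) * (\<Sum>m. complex_of_real (real m + a) powr (- (s + of_nat k))))"
proof -
  have eq: "powr_remainder K (real m + a) (1 - s) 1 = (complex_of_real (real m + a + 1) powr (1 - s) - complex_of_real (real m + a) powr (1 - s))
     - (\<Sum>k<K. (1 - s gchoose Suc k) * complex_of_real (real m + a) powr (- (s + of_nat k)))" for m
  proof -
    have "(\<Sum>k\<le>K. (1 - s gchoose k) * 1 ^ k * complex_of_real (real m + a) powr (1 - s - of_nat k))
      = complex_of_real (real m + a) powr (1 - s) + (\<Sum>k<K. (1 - s gchoose Suc k) * complex_of_real (real m + a) powr (- (s + of_nat k)))"
      unfolding lessThan_Suc_atMost[symmetric] sum.lessThan_Suc_shift by (simp add: algebra_simps)
    then show ?thesis unfolding powr_remainder_def by simp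
  qed
  have "(\<lambda>m. powr_remainder K (real m + a) (1 - s) 1) sums (- (of_real a powr (1 - s))
     - (\<Sum>k<K. (1 - s gchoose Suc k) * (\<Sum>m. complex_of_real (real m + a) powr (- (s + of_nat k)))))"
    unfolding eq using s
    by (intro sums_diff telescope_powr a s sums_sum sums_mult summable_sums hurwitz_summable) auto
  then show ?thesis unfolding hurwitz_remainder_def by (rule sums_unique[symmetric])
qed

text \<open>Taylor expansion of \<open>(m + a + 1)\<^bsup>1-s\<^esup> - (m + a)\<^bsup>1-s\<^esup>\<close>, summed over \<open>m\<close>, expresses
  \<open>(s - 1) \<zeta>(s, a)\<close> through its values at \<open>s + 1, s + 2, \<dots>\<close> and a remainder converging further to the left.\<close>

lemma hurwitz_continuation_step:
  assumes a: "0 < a" "a \<le> 1"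
  shows "\<exists>Z. Z holomorphic_on {s. Re s > 1 - real j} \<and>
    (\<forall>s. Re s > 1 \<longrightarrow> Z s = (s - 1) * (\<Sum>m. complex_of_real (real m + a) powr (- s)))"
proof (induction j)
  case 0
  have h: "(\<lambda>s. \<Sum>m. complex_of_real (real m + a) powr (- s)) holomorphic_on {s. Re s > 1}"
  proof (rule holomorphic_on_series)
    show "open {s. Re s > 1}" by (simp add: open_halfspace_Re_gt)
    have ne: "complex_of_real (real m + a) \<noteq> 0" for m using a by (simp add: complex_eq_iff)
    show "(\<lambda>s. complex_of_real (real m + a) powr (- s)) holomorphic_on {s. Re s > 1}" for m
      using ne[of m] by (intro holomorphic_intros)
    fix x assume x: "x \<in> {s. Re s > 1}"
    define d where "d = (Re x - 1) / 2"
    have d: "d > 0" using x by (simp add: d_def)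
    have z: "Re z \<ge> 1 + d \<and> cmod z \<le> cmod x + d" if "z \<in> cball x d" for z
    proof -
      have "cmod (z - x) \<le> d" using that by (simp add: dist_norm norm_minus_commute)
      moreover have "\<bar>Re (z - x)\<bar> \<le> cmod (z - x)" by (rule abs_Re_le_cmod)
      moreover have "cmod z \<le> cmod x + cmod (z - x)" using norm_triangle_ineq[of x "z - x"] by simp
      ultimately show ?thesis unfolding d_def by (simp add: field_simps abs_le_iff)
    qed
    let ?g = "\<lambda>m. a powr (- (cmod x + d)) * (real m + 1) powr (- (1 + d))"
    show "\<exists>d>0. \<exists>g. cball x d \<subseteq> {s. Re s > 1} \<and> summable g \<and> (\<forall>m. \<forall>z\<in>cball x d. cmod (complex_of_real (real m + a) powr (- z)) \<le> g m)"
    proof (intro exI[of _ d] exI[of _ ?g] conjI d allI ballI)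
      show "cball x d \<subseteq> {s. Re s > 1}" using z d by fastforce
      show "summable ?g" using d by (intro summable_mult summable_shift_powr) auto
      fix m z assume zb: "z \<in> cball x d"
      have "cmod (complex_of_real (real m + a) powr (- z)) = (real m + a) powr (- Re z)"
        using norm_shift_powr[OF a(1), of m "- z"] by simp
      also have "\<dots> \<le> a powr (- (cmod x + d)) * (real m + 1) powr (- Re z)"
        using z[OF zb] d complex_Re_le_cmod[of z] by (intro shift_powr_le a) auto
      also have "\<dots> \<le> a powr (- (cmod x + d)) * (real m + 1) powr (- (1 + d))"
        using z[OF zb] by (intro mult_left_mono powr_mono) auto
      finally show "cmod (complex_of_real (real m + a) powr (- z)) \<le> ?g m" .
    qed
  qed
  show ?case
    by (intro exI[of _ "\<lambda>s. (s - 1) * (\<Sum>m. complex_of_real (real m + a) powr (- s))"] conjI)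
       (use h in \<open>auto intro!: holomorphic_intros\<close>)
next
  case (Suc j)
  then obtain Z where Z: "Z holomorphic_on {s. Re s > 1 - real j}"
    "\<And>s. Re s > 1 \<Longrightarrow> Z s = (s - 1) * (\<Sum>m. complex_of_real (real m + a) powr (- s))" by blast
  \<comment> \<open>The identity for the remainder solved for (s - 1) \<zeta>(s, a); its summand k =
    0 is (1 - s) \<zeta>(s, a).\<close>
  define Z' where "Z' = (\<lambda>s. of_real a powr (1 - s) + hurwitz_remainder (Suc j) a s
     - (\<Sum>k<j. (1 - s gchoose Suc k) / of_nat (Suc (Suc k)) * Z (s + of_nat (Suc k))))"
  have "Z' holomorphic_on {s. Re s > 1 - real (Suc j)}"
  proof -
    have Zk: "(\<lambda>s. Z (s + of_nat (Suc k))) holomorphic_on {s. Re s > 1 - real (Suc j)}" for k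
      by (rule holomorphic_on_compose_gen[OF _ Z(1), unfolded o_def])
         (auto intro!: holomorphic_intros)
    have "complex_of_real a \<noteq> 0" using a by simp
    then show ?thesis
      unfolding Z'_def by (intro holomorphic_intros hurwitz_remainder_holomorphic a Zk) auto
  qed
  moreover have "Z' s = (s - 1) * (\<Sum>m. complex_of_real (real m + a) powr (- s))" if s: "Re s > 1" for s
  proof -
    let ?z = "\<lambda>k. \<Sum>m. complex_of_real (real m + a) powr (- (s + of_nat k))"
    \<comment> \<open>The binomial coefficient contains the factor s + k, which cancels the pole of
      the zeta-value at s + k + 1 and turns it into Z.\<close>
    have 1: "(1 - s gchoose Suc (Suc k)) * ?z (Suc k) = - ((1 - s gchoose Suc k) / of_nat (Suc (Suc k)) * Z (s + of_nat (Suc k)))" for k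
    proof -
      have "of_nat (Suc (Suc k)) * (1 - s gchoose Suc (Suc k)) = (1 - s - of_nat (Suc k)) * (1 - s gchoose Suc k)"
      proof -
        have "m * G' = (x - n) * G" if "x * G = n * G + m * G'" for m G' x n G :: complex
          using that by (simp add: left_diff_distrib)
        from this[OF gbinomial_mult_1] show ?thesis .
      qed
      then have "(1 - s gchoose Suc (Suc k)) = (1 - s - of_nat (Suc k)) * (1 - s gchoose Suc k) / of_nat (Suc (Suc k))"
        by (metis mult.commute nonzero_eq_divide_eq of_nat_neq_0)
      then have "(1 - s gchoose Suc (Suc k)) = (1 - s gchoose Suc k) / of_nat (Suc (Suc k)) * (1 - s - of_nat (Suc k))"
        by (simp add: mult.commute)
      moreover have "Z (s + of_nat (Suc k)) = (s + of_nat (Suc k) - 1) * ?z (Suc k)" using s by (intro Z(2)) simp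
      moreover have "1 - s - of_nat (Suc k) = - (s + of_nat (Suc k) - 1)" by simp
      ultimately show ?thesis by (simp only: mult.assoc mult_minus_left mult_minus_right)
    qed
    have "hurwitz_remainder (Suc j) a s = - (of_real a powr (1 - s)) - ((1 - s) * ?z 0 + (\<Sum>k<j. (1 - s gchoose Suc (Suc k)) * ?z (Suc k)))"
      unfolding hurwitz_remainder_identity[OF a(1) s] sum.lessThan_Suc_shift by simp
    then show ?thesis unfolding Z'_def 1 sum_negf by (simp add: algebra_simps)
  qed
  ultimately show ?case by blast
qed

subsection \<open>Mean squares\<close>

text \<open>The bump rises to the value 1 at c and falls afterwards. The intervals do not overlap,
  so the differences add up to at most the total variation; \<open>f1\<close> and \<open>f2\<close>
  are the rising and the falling part.\<close>

lemma gaussian_variation: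
  fixes p q :: "nat \<Rightarrow> real"
  assumes A: "A \<ge> 0" and pq: "\<And>n. p n \<le> q n" "\<And>n. q n \<le> p (Suc n)"
  shows "(\<Sum>n<M. \<bar>exp (- A * (p n - c)\<^sup>2) - exp (- A * (q n - c)\<^sup>2)\<bar>) \<le> 2"
proof -
  define f where "f = (\<lambda>v. exp (- A * (v - c)\<^sup>2))"
  define f1 where "f1 = (\<lambda>v. f (min v c))"
  define f2 where "f2 = (\<lambda>v. f (max v c))"
  have fc: "f c = 1" by (simp add: f_def)
  have f01: "0 \<le> f v" "f v \<le> 1" for v using A by (auto simp: f_def)
  have split: "f v = f1 v + f2 v - 1" for v
    by (cases "v \<le> c") (auto simp: f1_def f2_def min_def max_def fc)
  have m1: "f1 u \<le> f1 v" if "u \<le> v" for u v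
  proof -
    have "(min v c - c)\<^sup>2 \<le> (min u c - c)\<^sup>2" using that by (intro abs_le_square_iff[THEN iffD1]) auto
    then show ?thesis using A by (auto simp: f1_def f_def intro: mult_left_mono)
  qed
  have m2: "f2 v \<le> f2 u" if "u \<le> v" for u v
  proof -
    have "(max u c - c)\<^sup>2 \<le> (max v c - c)\<^sup>2" using that by (intro abs_le_square_iff[THEN iffD1]) auto
    then show ?thesis using A by (auto simp: f2_def f_def intro: mult_left_mono)
  qed
  have "(\<Sum>n<M. \<bar>f (p n) - f (q n)\<bar>) \<le> (f1 (p M) - f1 (p 0)) + (f2 (p 0) - f2 (p M))"
  proof (induction M)
    case (Suc M)
    have "\<bar>f (p M) - f (q M)\<bar> \<le> (f1 (q M) - f1 (p M)) + (f2 (p M) - f2 (q M))"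
      using m1[OF pq(1)[of M]] m2[OF pq(1)[of M]] unfolding split[of "p M"] split[of "q M"] by linarith
    also have "\<dots> \<le> (f1 (p (Suc M)) - f1 (p M)) + (f2 (p M) - f2 (p (Suc M)))"
      using m1[OF pq(2)[of M]] m2[OF pq(2)[of M]] by linarith
    finally show ?case using Suc.IH by simp
  qed simp
  also have "\<dots> \<le> 2"
    using f01[of "min (p M) c"] f01[of "min (p 0) c"] f01[of "max (p M) c"] f01[of "max (p 0) c"]
    unfolding f1_def f2_def by linarith
  finally show ?thesis unfolding f_def .
qed

text \<open>Closed form of the correlation of exp (- s u) and exp (- s v) for s = \<sigma> + i T x
  with x standard normal; see \<open>line_exp_integral\<close>.\<close>

definition gauss_corr :: "real \<Rightarrow> real \<Rightarrow> real \<Rightarrow> real \<Rightarrow> real" where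
  "gauss_corr \<sigma> T u v = exp (- \<sigma> * (u + v) - T\<^sup>2 * (u - v)\<^sup>2 / 2)"

text \<open>Completing the square in v shows, for fixed u, a Gaussian bump centred at u - \<sigma> /
  T^2.\<close>

lemma gauss_corr_eq:
  assumes T: "T \<noteq> 0"
  shows "gauss_corr \<sigma> T u v = exp (- 2 * \<sigma> * u + \<sigma>\<^sup>2 / (2 * T\<^sup>2)) * exp (- (T\<^sup>2 / 2) * (v - (u - \<sigma> / T\<^sup>2))\<^sup>2)"
proof -
  define r where "r = \<sigma> / T\<^sup>2"
  have r: "T\<^sup>2 * r = \<sigma>" using T by (simp add: r_def)
  have "(T\<^sup>2 / 2) * (v - (u - r))\<^sup>2 = T\<^sup>2 * (v - u)\<^sup>2 / 2 + (v - u) * (T\<^sup>2 * r) + (T\<^sup>2 * r) * r / 2"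
    by (simp add: power2_eq_square field_simps)
  also have "(T\<^sup>2 * r) * r / 2 = \<sigma>\<^sup>2 / (2 * T\<^sup>2)" unfolding r by (simp add: r_def power2_eq_square)
  finally have "(T\<^sup>2 / 2) * (v - (u - \<sigma> / T\<^sup>2))\<^sup>2 = T\<^sup>2 * (v - u)\<^sup>2 / 2 + (v - u) * \<sigma> + \<sigma>\<^sup>2 / (2 * T\<^sup>2)"
    unfolding r by (simp only: r_def)
  then have "- \<sigma> * (u + v) - T\<^sup>2 * (u - v)\<^sup>2 / 2 = (- 2 * \<sigma> * u + \<sigma>\<^sup>2 / (2 * T\<^sup>2)) + - (T\<^sup>2 / 2) * (v - (u - \<sigma> / T\<^sup>2))\<^sup>2"
    by (simp add: power2_commute[of u v] algebra_simps)
  then show ?thesis unfolding gauss_corr_def by (simp only: exp_add)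
qed

text \<open>For T \<ge> 1 the factor exp (\<sigma>^2 / (2 T^2)) is at most exp (\<sigma>^2 / 2), so
  the bound is uniform in T as well as in M.\<close>

lemma gauss_corr_variation:
  fixes p q :: "nat \<Rightarrow> real"
  assumes T: "T \<ge> 1" and pq: "\<And>n. p n \<le> q n" "\<And>n. q n \<le> p (Suc n)"
  shows "\<bar>\<Sum>n<M. gauss_corr \<sigma> T u (p n) - gauss_corr \<sigma> T u (q n)\<bar> \<le> 2 * exp (\<sigma>\<^sup>2 / 2) * exp (- 2 * \<sigma> * u)"
proof -
  define B where "B = exp (- 2 * \<sigma> * u + \<sigma>\<^sup>2 / (2 * T\<^sup>2))"
  define c where "c = u - \<sigma> / T\<^sup>2"
  have eq: "gauss_corr \<sigma> T u v = B * exp (- (T\<^sup>2 / 2) * (v - c)\<^sup>2)" for v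
    unfolding B_def c_def by (rule gauss_corr_eq) (use T in simp)
  have "\<bar>\<Sum>n<M. gauss_corr \<sigma> T u (p n) - gauss_corr \<sigma> T u (q n)\<bar> \<le> (\<Sum>n<M. \<bar>gauss_corr \<sigma> T u (p n) - gauss_corr \<sigma> T u (q n)\<bar>)"
    by (rule sum_abs)
  also have "\<dots> = B * (\<Sum>n<M. \<bar>exp (- (T\<^sup>2 / 2) * (p n - c)\<^sup>2) - exp (- (T\<^sup>2 / 2) * (q n - c)\<^sup>2)\<bar>)"
    unfolding eq sum_distrib_left by (intro sum.cong refl) (simp add: B_def abs_mult flip: right_diff_distrib)
  also have "\<dots> \<le> B * 2"
    by (intro mult_left_mono gaussian_variation pq) (auto simp: B_def)
  also have "B \<le> exp (- 2 * \<sigma> * u + \<sigma>\<^sup>2 / 2)"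
  proof -
    have "1 \<le> T\<^sup>2" using T by (simp add: one_le_power)
    then have "\<sigma>\<^sup>2 / (2 * T\<^sup>2) \<le> \<sigma>\<^sup>2 / (2 * 1)" by (intro divide_left_mono) auto
    then show ?thesis by (simp add: B_def)
  qed
  also have "exp (- 2 * \<sigma> * u + \<sigma>\<^sup>2 / 2) * 2 = 2 * exp (\<sigma>\<^sup>2 / 2) * exp (- 2 * \<sigma> * u)" by (simp only: exp_add mult_ac)
  finally show ?thesis by simp
qed

section \<open>Exponentials on a vertical line under the normal law\<close>

lemma std_normal_char: "(LINT x|std_normal_distribution. iexp (t * x)) = complex_of_real (exp (- t\<^sup>2 / 2))"
  using fun_cong[OF char_std_normal_distribution, of t] unfolding char_def .

definition line_exp :: "real \<Rightarrow> real \<Rightarrow> real \<Rightarrow> real \<Rightarrow> complex" where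
  "line_exp \<sigma> T v x = exp (- (Complex \<sigma> (T * x)) * of_real v)"

lemma line_exp_corr:
  "line_exp \<sigma> T u x * cnj (line_exp \<sigma> T v x) = complex_of_real (exp (- \<sigma> * (u + v))) * iexp ((T * (v - u)) * x)"
proof -
  have "- (Complex \<sigma> (T * x)) * of_real u + cnj (- (Complex \<sigma> (T * x)) * of_real v)
     = complex_of_real (- \<sigma> * (u + v)) + \<i> * complex_of_real (T * (v - u) * x)"
    by (simp add: complex_eq_iff algebra_simps)
  then show ?thesis unfolding line_exp_def exp_cnj exp_of_real[symmetric] by (simp only: exp_add[symmetric])
qed

lemma norm_line_exp: "cmod (line_exp \<sigma> T v x) = exp (- \<sigma> * v)"
  by (simp add: line_exp_def norm_exp_eq_Re)

lemma line_exp_measurable [measurable]: "line_exp \<sigma> T v \<in> borel_measurable borel"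
  unfolding line_exp_def by (intro borel_measurable_continuous_onI continuous_intros)

lemma line_exp_integral:
  "integrable std_normal_distribution (\<lambda>x. line_exp \<sigma> T u x * cnj (line_exp \<sigma> T v x))"
  "(LINT x|std_normal_distribution. line_exp \<sigma> T u x * cnj (line_exp \<sigma> T v x)) = complex_of_real (gauss_corr \<sigma> T u v)"
proof -
  interpret prob_space std_normal_distribution by (rule prob_space_normal_density) simp
  have [measurable]: "cnj \<in> borel_measurable borel"
    by (intro borel_measurable_continuous_onI continuous_intros)
  show "integrable std_normal_distribution (\<lambda>x. line_exp \<sigma> T u x * cnj (line_exp \<sigma> T v x))"
    by (rule integrable_const_bound[where B = "exp (- \<sigma> * u) * exp (- \<sigma> * v)"]) (auto simp: norm_mult norm_line_exp)
  have "(LINT x|std_normal_distribution. line_exp \<sigma> T u x * cnj (line_exp \<sigma> T v x))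
     = complex_of_real (exp (- \<sigma> * (u + v))) * (LINT x|std_normal_distribution. iexp ((T * (v - u)) * x))"
    unfolding line_exp_corr by simp
  also have "\<dots> = complex_of_real (exp (- \<sigma> * (u + v)) * exp (- (T * (v - u))\<^sup>2 / 2))"
    unfolding std_normal_char by simp
  also have "exp (- \<sigma> * (u + v)) * exp (- (T * (v - u))\<^sup>2 / 2) = gauss_corr \<sigma> T u v"
    unfolding gauss_corr_def exp_add[symmetric] by (simp add: power_mult_distrib power2_commute[of v u])
  finally show "(LINT x|std_normal_distribution. line_exp \<sigma> T u x * cnj (line_exp \<sigma> T v x)) = complex_of_real (gauss_corr \<sigma> T u v)" .
qed

text \<open>Under the Gaussian weight the correlation of two exponentials is, as a function of one frequency,
  a Gaussian bump of total variation at most 2, so the interlacing differences do not pile up.\<close>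

lemma line_difference_mean_square:
  fixes p q :: "nat \<Rightarrow> real"
  assumes T: "T \<ge> 1" and \<sigma>: "\<sigma> \<ge> 0" and pq: "\<And>n. p n \<le> q n" "\<And>n. q n \<le> p (Suc n)"
  shows "integrable std_normal_distribution (\<lambda>x. (cmod (\<Sum>m<M. line_exp \<sigma> T (p m) x - line_exp \<sigma> T (q m) x))\<^sup>2)"
    and "(LINT x|std_normal_distribution. (cmod (\<Sum>m<M. line_exp \<sigma> T (p m) x - line_exp \<sigma> T (q m) x))\<^sup>2)
      \<le> 4 * exp (\<sigma>\<^sup>2 / 2) * (\<Sum>m<M. exp (- 2 * \<sigma> * p m))"
proof -
  let ?e = "line_exp \<sigma> T" and ?N = std_normal_distribution
  let ?D = "\<lambda>x. \<Sum>m<M. ?e (p m) x - ?e (q m) x"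
  define S where "S = (\<lambda>u. \<Sum>n<M. gauss_corr \<sigma> T u (p n) - gauss_corr \<sigma> T u (q n))"
  note I = line_exp_integral[of \<sigma> T]
  have eq: "complex_of_real ((cmod (?D x))\<^sup>2) = (\<Sum>m<M. \<Sum>n<M. (?e (p m) x * cnj (?e (p n) x) - ?e (p m) x * cnj (?e (q n) x))
       - (?e (q m) x * cnj (?e (p n) x) - ?e (q m) x * cnj (?e (q n) x)))" for x
    unfolding complex_norm_square cnj_sum sum_product complex_cnj_diff
    by (intro sum.cong refl) (simp add: algebra_simps)
  have int: "integrable ?N (\<lambda>x. complex_of_real ((cmod (?D x))\<^sup>2))"
    unfolding eq by (intro Bochner_Integration.integrable_sum Bochner_Integration.integrable_diff I(1))
  from integrable_Re[OF this] show ii: "integrable ?N (\<lambda>x. (cmod (?D x))\<^sup>2)"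
    by (simp only: Re_complex_of_real)
  have "complex_of_real (LINT x|?N. (cmod (?D x))\<^sup>2) = (LINT x|?N. complex_of_real ((cmod (?D x))\<^sup>2))"
    by (rule integral_complex_of_real[symmetric])
  also have "\<dots> = (\<Sum>m<M. \<Sum>n<M. (complex_of_real (gauss_corr \<sigma> T (p m) (p n)) - complex_of_real (gauss_corr \<sigma> T (p m) (q n)))
       - (complex_of_real (gauss_corr \<sigma> T (q m) (p n)) - complex_of_real (gauss_corr \<sigma> T (q m) (q n))))"
    unfolding eq
    by (simp only: Bochner_Integration.integral_sum Bochner_Integration.integral_diff Bochner_Integration.integrable_sum Bochner_Integration.integrable_diff I)
  \<comment> \<open>Summing over n first leaves two variation sums for each m, one at p m and one at
    q m, in place of a double sum of moduli.\<close>
  also have "\<dots> = complex_of_real (\<Sum>m<M. S (p m) - S (q m))"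
    unfolding S_def sum_subtractf[symmetric] by simp
  finally have "(LINT x|?N. (cmod (?D x))\<^sup>2) = (\<Sum>m<M. S (p m) - S (q m))" by (simp only: of_real_eq_iff)
  also have "\<dots> \<le> (\<Sum>m<M. 2 * exp (\<sigma>\<^sup>2 / 2) * exp (- 2 * \<sigma> * p m) + 2 * exp (\<sigma>\<^sup>2 / 2) * exp (- 2 * \<sigma> * p m))"
  proof (rule sum_mono)
    fix m
    have "\<bar>S (p m)\<bar> \<le> 2 * exp (\<sigma>\<^sup>2 / 2) * exp (- 2 * \<sigma> * p m)"
      unfolding S_def by (rule gauss_corr_variation[where p = p and q = q, OF T pq])
    moreover have "\<bar>S (q m)\<bar> \<le> 2 * exp (\<sigma>\<^sup>2 / 2) * exp (- 2 * \<sigma> * q m)"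
      unfolding S_def by (rule gauss_corr_variation[where p = p and q = q, OF T pq])
    moreover have "2 * exp (\<sigma>\<^sup>2 / 2) * exp (- 2 * \<sigma> * q m) \<le> 2 * exp (\<sigma>\<^sup>2 / 2) * exp (- 2 * \<sigma> * p m)"
      using pq(1)[of m] \<sigma> by (simp add: mult_left_mono)
    ultimately show "S (p m) - S (q m) \<le> 2 * exp (\<sigma>\<^sup>2 / 2) * exp (- 2 * \<sigma> * p m) + 2 * exp (\<sigma>\<^sup>2 / 2) * exp (- 2 * \<sigma> * p m)"
      by linarith
  qed
  also have "\<dots> = 4 * exp (\<sigma>\<^sup>2 / 2) * (\<Sum>m<M. exp (- 2 * \<sigma> * p m))"
    unfolding sum_distrib_left by (intro sum.cong refl) simp
  finally show "(LINT x|?N. (cmod (?D x))\<^sup>2) \<le> 4 * exp (\<sigma>\<^sup>2 / 2) * (\<Sum>m<M. exp (- 2 * \<sigma> * p m))" .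
qed

text \<open>On [0, 1] the normal density is at least exp (- 1/2) / sqrt (2 pi), so the Gaussian
  weight dominates the plain integral.\<close>

lemma unit_interval_le_std_normal:
  fixes f :: "real \<Rightarrow> real"
  assumes c: "continuous_on UNIV f" and f: "\<And>x. f x \<ge> 0" and i: "integrable std_normal_distribution f"
  shows "integral {0..1} f \<le> exp (1 / 2) * sqrt (2 * pi) * (LINT x|std_normal_distribution. f x)"
proof -
  have fm: "f \<in> borel_measurable borel" by (rule borel_measurable_continuous_onI[OF c])
  have si: "set_integrable lborel {0..1} f"
    by (rule borel_integrable_atLeastAtMost') (rule continuous_on_subset[OF c], simp)
  have id: "integrable lborel (\<lambda>x. std_normal_density x *\<^sub>R f x)"
    using i fm by (subst (asm) integrable_density) auto
  have e: "(LINT x|std_normal_distribution. f x) = (LINT x|lborel. std_normal_density x *\<^sub>R f x)"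
    using fm by (intro integral_density) auto
  have "integral {0..1} f = (LINT x:{0..1}|lborel. f x)"
    using si by (rule set_borel_integral_eq_integral(2)[symmetric])
  also have "\<dots> \<le> (LINT x|lborel. exp (1 / 2) * sqrt (2 * pi) * (std_normal_density x *\<^sub>R f x))"
    unfolding set_lebesgue_integral_def
  proof (rule integral_mono)
    show "integrable lborel (\<lambda>x. indicat_real {0..1} x *\<^sub>R f x)" using si by (simp add: set_integrable_def)
    show "integrable lborel (\<lambda>x. exp (1 / 2) * sqrt (2 * pi) * (std_normal_density x *\<^sub>R f x))"
      by (rule integrable_mult_right[OF id])
    fix x :: real
    show "indicat_real {0..1} x *\<^sub>R f x \<le> exp (1 / 2) * sqrt (2 * pi) * (std_normal_density x *\<^sub>R f x)"
    proof (cases "x \<in> {0..1}")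
      case True
      then have "x\<^sup>2 \<le> 1" by (simp add: power_le_one)
      then have "1 \<le> exp (1 / 2) * exp (- x\<^sup>2 / 2)" by (simp flip: exp_add)
      also have "\<dots> = exp (1 / 2) * sqrt (2 * pi) * std_normal_density x" by (simp add: std_normal_density_def)
      finally have "1 * f x \<le> exp (1 / 2) * sqrt (2 * pi) * std_normal_density x * f x"
        by (rule mult_right_mono[OF _ f])
      then show ?thesis using True by simp
    qed (auto simp: f)
  qed
  also have "\<dots> = exp (1 / 2) * sqrt (2 * pi) * (LINT x|std_normal_distribution. f x)" unfolding e by simp
  finally show ?thesis .
qed

text \<open>Averaged over y in [0, 1] this is a partial sum of the remainder of order 1, divided by
  s - 1. Exponentials of logarithms are used because the frequencies ln (m + a) and ln (m + a + y)
  are what the mean square estimate sees.\<close>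

definition hurwitz_diff :: "real \<Rightarrow> nat \<Rightarrow> complex \<Rightarrow> real \<Rightarrow> complex" where
  "hurwitz_diff a M s y = (\<Sum>m<M. exp (- s * of_real (ln (real m + a))) - exp (- s * of_real (ln (real m + a + y))))"

text \<open>For y in [0, 1] the frequencies interlace, as m + a + y \<le> m + 1 + a; \<sigma> > 1/2
  makes the sum of squares converge.\<close>

lemma hurwitz_diff_mean_square:
  assumes a: "0 < a" "a \<le> 1" and T: "T \<ge> 1" and \<sigma>: "\<sigma> > 1 / 2" and y: "0 \<le> y" "y \<le> 1"
  shows "integral {0..1} (\<lambda>x. (cmod (hurwitz_diff a M (Complex \<sigma> (T * x)) y))\<^sup>2)
    \<le> exp (1 / 2) * sqrt (2 * pi) * (4 * exp (\<sigma>\<^sup>2 / 2) * (\<Sum>m. (real m + a) powr (- 2 * \<sigma>)))"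
proof -
  define p where "p = (\<lambda>m. ln (real m + a))"
  define q where "q = (\<lambda>m. ln (real m + a + y))"
  have pq: "p n \<le> q n" "q n \<le> p (Suc n)" for n using a y by (auto simp: p_def q_def)
  have D: "hurwitz_diff a M (Complex \<sigma> (T * x)) y = (\<Sum>m<M. line_exp \<sigma> T (p m) x - line_exp \<sigma> T (q m) x)" for x
    by (simp add: hurwitz_diff_def line_exp_def p_def q_def)
  have s: "summable (\<lambda>m. (real m + a) powr (- 2 * \<sigma>))" using summable_shift_powr[OF a(1), of "2 * \<sigma>"] \<sigma> by simp
  have "integral {0..1} (\<lambda>x. (cmod (hurwitz_diff a M (Complex \<sigma> (T * x)) y))\<^sup>2)
    \<le> exp (1 / 2) * sqrt (2 * pi) * (LINT x|std_normal_distribution. (cmod (hurwitz_diff a M (Complex \<sigma> (T * x)) y))\<^sup>2)"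
  proof (rule unit_interval_le_std_normal)
    show "continuous_on UNIV (\<lambda>x. (cmod (hurwitz_diff a M (Complex \<sigma> (T * x)) y))\<^sup>2)"
      unfolding hurwitz_diff_def by (intro continuous_intros)
    show "integrable std_normal_distribution (\<lambda>x. (cmod (hurwitz_diff a M (Complex \<sigma> (T * x)) y))\<^sup>2)"
      unfolding D by (rule line_difference_mean_square(1)[where p = p and q = q, OF T _ pq]) (use \<sigma> in simp)
  qed simp
  also have "(LINT x|std_normal_distribution. (cmod (hurwitz_diff a M (Complex \<sigma> (T * x)) y))\<^sup>2)
     \<le> 4 * exp (\<sigma>\<^sup>2 / 2) * (\<Sum>m<M. exp (- 2 * \<sigma> * p m))"
    unfolding D by (rule line_difference_mean_square(2)[where p = p and q = q, OF T _ pq]) (use \<sigma> in simp)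
  also have "(\<Sum>m<M. exp (- 2 * \<sigma> * p m)) = (\<Sum>m<M. (real m + a) powr (- 2 * \<sigma>))"
    using a by (intro sum.cong refl) (simp add: p_def powr_def)
  also have "\<dots> \<le> (\<Sum>m. (real m + a) powr (- 2 * \<sigma>))" by (rule sum_le_suminf[OF s]) auto
  finally show ?thesis by (simp add: mult_left_mono)
qed

text \<open>Divided by s - 1, the remainder of order 1 is the error made by replacing the integral
  of (x + y)^(-s) over [0, 1] by the value at its left end.\<close>

lemma powr_remainder_integral:
  assumes x: "x > 0" and s: "s \<noteq> 1"
  shows "powr_remainder 1 x (1 - s) 1 / (s - 1)
    = integral {0..1} (\<lambda>y. exp (- s * of_real (ln x)) - exp (- s * of_real (ln (x + y))))"
proof -
  have ex: "exp (- s * of_real (ln u)) = of_real u powr (- s)" if "u > 0" for u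
    using that by (simp add: powr_def Ln_of_real)
  have D: "((\<lambda>y. of_real (x + y) powr (1 - s) / (1 - s)) has_vector_derivative of_real (x + y) powr (- s)) (at y within {0..1})"
    if "y \<in> {0..1}" for y
  proof -
    have nz: "complex_of_real (x + y) \<notin> \<real>\<^sub>\<le>\<^sub>0" using x that by (simp add: complex_nonpos_Reals_iff)
    have "((\<lambda>z. z powr (1 - s) / (1 - s)) has_field_derivative (1 - s) * of_real (x + y) powr (1 - s - 1) / (1 - s)) (at (of_real (x + y)))"
      by (rule DERIV_cdivide[OF has_field_derivative_powr[OF nz]])
    then have 1: "((\<lambda>z. z powr (1 - s) / (1 - s)) has_field_derivative of_real (x + y) powr (- s)) (at (of_real (x + y)))"
      using s by simp
    have 2: "((\<lambda>y. complex_of_real (x + y)) has_vector_derivative 1) (at y within {0..1})"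
      by (auto intro!: derivative_eq_intros)
    from field_vector_diff_chain_within[OF 2, of "\<lambda>z. z powr (1 - s) / (1 - s)", OF has_field_derivative_at_within[OF 1]]
    show ?thesis by (simp add: o_def)
  qed
  have 1: "((\<lambda>y. of_real (x + y) powr (- s)) has_integral (of_real (x + 1) powr (1 - s) / (1 - s) - of_real (x + 0) powr (1 - s) / (1 - s))) {0..1}"
    by (rule fundamental_theorem_of_calculus[OF _ D]) auto
  have 2: "((\<lambda>y. of_real x powr (- s)) has_integral of_real x powr (- s)) {0..1::real}"
    using has_integral_const_real[of "complex_of_real x powr (- s)" 0 1] by simp
  have 3: "((\<lambda>y. exp (- s * of_real (ln x)) - exp (- s * of_real (ln (x + y)))) has_integral
     (of_real x powr (- s) - (of_real (x + 1) powr (1 - s) / (1 - s) - of_real (x + 0) powr (1 - s) / (1 - s)))) {0..1}"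
  proof (rule has_integral_eq[OF _ has_integral_diff[OF 2 1]])
    fix y :: real assume "y \<in> {0..1}"
    then show "of_real x powr (- s) - of_real (x + y) powr (- s) = exp (- s * of_real (ln x)) - exp (- s * of_real (ln (x + y)))"
      using ex[OF x] ex[of "x + y"] x by simp
  qed
  have r: "powr_remainder 1 x (1 - s) 1 = of_real (x + 1) powr (1 - s) - of_real x powr (1 - s) - (1 - s) * of_real x powr (- s)"
    by (simp add: powr_remainder_def)
  have alg: "(A - B - w * X) / (- w) = X - (A / w - B / w)" if "w \<noteq> 0" for A B w X :: complex
    using that by (simp add: field_simps)
  have w: "1 - s \<noteq> 0" "s - 1 = - (1 - s)" using s by auto
  have "powr_remainder 1 x (1 - s) 1 / (s - 1) = of_real x powr (- s) - (of_real (x + 1) powr (1 - s) / (1 - s) - of_real (x + 0) powr (1 - s) / (1 - s))"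
    unfolding r w(2) add_0_right by (rule alg[OF w(1)])
  then show ?thesis using integral_unique[OF 3] by simp
qed

text \<open>With t = T x the partial sums are averages of \<open>hurwitz_diff\<close> over y.
  Cauchy--Schwarz in y and an exchange of integrals reduce the mean square to fixed y, where the
  bound is free of T and M; dominated convergence then passes to the full series.\<close>

lemma hurwitz_remainder_mean_square:
  assumes a: "0 < a" "a \<le> 1" and \<sigma>: "1 / 2 < \<sigma>" "\<sigma> < 1"
  shows "\<exists>C. \<forall>T\<ge>1. integral {0..T} (\<lambda>t. (cmod (hurwitz_remainder 1 a (Complex \<sigma> t) / (Complex \<sigma> t - 1)))\<^sup>2) \<le> C * T"
proof (intro exI allI impI)
  fix T :: real assume T: "T \<ge> 1"
  define C where "C = exp (1 / 2) * sqrt (2 * pi) * (4 * exp (\<sigma>\<^sup>2 / 2) * (\<Sum>m. (real m + a) powr (- 2 * \<sigma>)))"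
  define s where "s = (\<lambda>x. Complex \<sigma> (T * x))"
  have s1: "s x \<noteq> 1" for x using \<sigma> by (auto simp: s_def complex_eq_iff)
  have Res: "Re (s x) = \<sigma>" for x by (simp add: s_def)
  define Q where "Q = (\<lambda>x. hurwitz_remainder 1 a (s x) / (s x - 1))"
  define QM where "QM = (\<lambda>M x. (\<Sum>m<M. powr_remainder 1 (real m + a) (1 - s x) 1) / (s x - 1))"
  have cD: "continuous_on (X \<times> {0..1}) (\<lambda>(x, y). hurwitz_diff a M (s x) y)" for M X
    unfolding hurwitz_diff_def s_def case_prod_unfold
    by (intro continuous_intros) (use a in \<open>auto simp: add_nonneg_eq_0_iff\<close>)
  have cD': "continuous_on {0..1} (\<lambda>y. hurwitz_diff a M (s x) y)" for M x
    using continuous_on_compose2[OF cD[where X = "{x}" and M = M]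
        continuous_on_Pair[OF continuous_on_const[of _ x] continuous_on_id], of "{0..1}"] by auto
  have QM: "QM M x = integral {0..1} (\<lambda>y. hurwitz_diff a M (s x) y)" for M x
  proof -
    have "QM M x = (\<Sum>m<M. powr_remainder 1 (real m + a) (1 - s x) 1 / (s x - 1))"
      by (simp add: QM_def sum_divide_distrib)
    also have "\<dots> = (\<Sum>m<M. integral {0..1} (\<lambda>y. exp (- s x * of_real (ln (real m + a))) - exp (- s x * of_real (ln (real m + a + y)))))"
      by (intro sum.cong refl powr_remainder_integral s1) (use a in auto)
    also have "\<dots> = integral {0..1} (\<lambda>y. \<Sum>m<M. exp (- s x * of_real (ln (real m + a))) - exp (- s x * of_real (ln (real m + a + y))))"
      by (rule integral_sum[symmetric])
         (use a in \<open>auto intro!: integrable_continuous_real continuous_intros simp: add_nonneg_eq_0_iff\<close>)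
    finally show ?thesis unfolding hurwitz_diff_def .
  qed
  have QM2: "(cmod (QM M x))\<^sup>2 \<le> integral {0..1} (\<lambda>y. (cmod (hurwitz_diff a M (s x) y))\<^sup>2)" for M x
  proof -
    let ?f = "\<lambda>y. cmod (hurwitz_diff a M (s x) y)"
    have cf: "continuous_on {0..1} ?f" by (intro continuous_intros cD')
    have "cmod (QM M x) \<le> integral {0..1} ?f"
      unfolding QM by (rule integral_norm_bound_integral)
        (use cD' cf in \<open>auto intro: integrable_continuous_real\<close>)
    then have "(cmod (QM M x))\<^sup>2 \<le> (integral {0..1} (\<lambda>y. ?f y * 1))\<^sup>2" by (intro power_mono) auto
    also have "\<dots> \<le> 1 * integral {0..1} (\<lambda>y. (?f y)\<^sup>2 * 1)"
      by (rule weighted_cauchy_schwarz[OF cf]) auto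
    finally show ?thesis by simp
  qed
  have QMc: "continuous_on {0..1} (QM M)" for M
    unfolding QM using integral_continuous_on_param[of "{0..1}" 0 1 "\<lambda>x y. hurwitz_diff a M (s x) y"] cD[where X = "{0..1}" and M = M] by simp
  have bound: "integral {0..1} (\<lambda>x. (cmod (QM M x))\<^sup>2) \<le> C" for M
  proof -
    have c2: "continuous_on (cbox (0, 0) (1, 1)) (\<lambda>(x, y). (cmod (hurwitz_diff a M (s x) y))\<^sup>2)"
    proof -
      have "continuous_on ({0..1} \<times> {0..1}) (\<lambda>p. (cmod ((\<lambda>(x, y). hurwitz_diff a M (s x) y) p))\<^sup>2)"
        by (intro continuous_on_power continuous_on_norm cD)
      then show ?thesis by (simp add: case_prod_unfold cbox_Pair_eq)
    qed
    have ci: "(\<lambda>x. integral {0..1} (\<lambda>y. (cmod (hurwitz_diff a M (s x) y))\<^sup>2)) integrable_on {0..1}"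
      using integral_continuous_on_param[of "{0..1}" 0 1 "\<lambda>x y. (cmod (hurwitz_diff a M (s x) y))\<^sup>2"] c2
      by (intro integrable_continuous_real) (simp add: cbox_Pair_eq)
    have ci': "(\<lambda>y. integral {0..1} (\<lambda>x. (cmod (hurwitz_diff a M (s x) y))\<^sup>2)) integrable_on {0..1}"
    proof -
      have "continuous_on ({0..1} \<times> {0..1}) (\<lambda>(y, x). (cmod (hurwitz_diff a M (s x) y))\<^sup>2)"
      proof -
        have sw: "continuous_on ({0..1} \<times> {0..1}) (\<lambda>p::real \<times> real. (snd p, fst p))"
          by (intro continuous_on_Pair continuous_on_snd continuous_on_fst continuous_on_id)
        have "continuous_on ({0..1} \<times> {0..1}) (\<lambda>p. hurwitz_diff a M (s (snd p)) (fst p))"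
          using continuous_on_compose2[OF cD[where X = "{0..1}" and M = M] sw] by (simp add: case_prod_unfold image_subset_iff)
        then show ?thesis unfolding case_prod_unfold by (intro continuous_on_power continuous_on_norm)
      qed
      then show ?thesis
        using integral_continuous_on_param[of "{0..1}" 0 1 "\<lambda>y x. (cmod (hurwitz_diff a M (s x) y))\<^sup>2"]
        by (intro integrable_continuous_real) simp
    qed
    have "integral {0..1} (\<lambda>x. (cmod (QM M x))\<^sup>2) \<le> integral {0..1} (\<lambda>x. integral {0..1} (\<lambda>y. (cmod (hurwitz_diff a M (s x) y))\<^sup>2))"
      by (rule integral_le[OF _ ci QM2]) (intro integrable_continuous_real continuous_intros QMc)
    also have "\<dots> = integral {0..1} (\<lambda>y. integral {0..1} (\<lambda>x. (cmod (hurwitz_diff a M (s x) y))\<^sup>2))"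
      using integral_swap_continuous[OF c2] by simp
    also have "\<dots> \<le> integral {0..1} (\<lambda>y::real. C)"
    proof (rule integral_le[OF ci'])
      show "integral {0..1} (\<lambda>x. (cmod (hurwitz_diff a M (s x) y))\<^sup>2) \<le> C" if "y \<in> {0..1}" for y
        unfolding C_def s_def by (rule hurwitz_diff_mean_square[OF a T \<sigma>(1)]) (use that in auto)
    qed auto
    finally show ?thesis by simp
  qed
  define R where "R = 1 + T"
  have sR: "cmod (s x) \<le> R" if "x \<in> {0..1}" for x
  proof -
    have "cmod (s x) \<le> \<bar>\<sigma>\<bar> + \<bar>T * x\<bar>" using cmod_le[of "s x"] by (simp add: s_def)
    moreover have "T * x \<le> T * 1" "0 \<le> T * x" using that T by (auto intro: mult_left_mono)
    ultimately show ?thesis using \<sigma> unfolding R_def by linarith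
  qed
  \<comment> \<open>This majorant depends on T through R. It serves dominated convergence as M grows
    and does not enter the constant C.\<close>
  define b where "b = (\<lambda>m::nat. (\<Prod>i\<le>1. 1 + R + real i) * a powr (- (R + real 1)) * (real m + 1) powr (- (\<sigma> + real 1)))"
  have sb: "summable b" unfolding b_def using \<sigma> by (intro summable_mult summable_shift_powr) auto
  have tb: "cmod (powr_remainder 1 (real m + a) (1 - s x) 1) \<le> b m" if "x \<in> {0..1}" for m x
    unfolding b_def by (rule hurwitz_remainder_term_bound[OF a _ sR[OF that]]) (use \<sigma> Res in auto)
  have b0: "b m \<ge> 0" for m using tb[of 0 m] order.trans[OF norm_ge_zero] by auto
  have lim: "(\<lambda>M. QM M x) \<longlonglongrightarrow> Q x" for x
  proof -
    have "summable (\<lambda>m. powr_remainder 1 (real m + a) (1 - s x) 1)"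
      by (rule hurwitz_remainder_summable[OF a]) (use \<sigma> Res in auto)
    then show ?thesis unfolding QM_def Q_def hurwitz_remainder_def
      by (intro tendsto_divide tendsto_const summable_LIMSEQ) (use s1 in auto)
  qed
  define B where "B = suminf b / (1 - \<sigma>)"
  have QB: "cmod (QM M x) \<le> B" if "x \<in> {0..1}" for M x
  proof -
    have "cmod (\<Sum>m<M. powr_remainder 1 (real m + a) (1 - s x) 1) \<le> (\<Sum>m<M. b m)"
      by (rule sum_norm_le) (rule tb[OF that])
    also have "\<dots> \<le> suminf b" by (rule sum_le_suminf[OF sb]) (auto simp: b0)
    finally have "cmod (\<Sum>m<M. powr_remainder 1 (real m + a) (1 - s x) 1) \<le> suminf b" .
    moreover have "1 - \<sigma> \<le> cmod (s x - 1)" using abs_Re_le_cmod[of "s x - 1"] \<sigma> Res[of x] by simp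
    ultimately show ?thesis unfolding QM_def B_def norm_divide using \<sigma> suminf_nonneg[OF sb b0]
      by (intro frac_le) auto
  qed
  have conv: "(\<lambda>M. integral {0..1} (\<lambda>x. (cmod (QM M x))\<^sup>2)) \<longlonglongrightarrow> integral {0..1} (\<lambda>x. (cmod (Q x))\<^sup>2)"
  proof (rule dominated_convergence(2))
    show "(\<lambda>x. (cmod (QM M x))\<^sup>2) integrable_on {0..1}" for M
      by (intro integrable_continuous_real continuous_intros QMc)
    show "(\<lambda>x. B\<^sup>2) integrable_on {0..1::real}" by auto
    show "norm ((cmod (QM M x))\<^sup>2) \<le> B\<^sup>2" if "x \<in> {0..1}" for M x
      using QB[OF that, of M] by (simp add: power_mono)
    show "(\<lambda>M. (cmod (QM M x))\<^sup>2) \<longlonglongrightarrow> (cmod (Q x))\<^sup>2" for x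
      by (intro tendsto_intros lim)
  qed
  have i01: "integral {0..1} (\<lambda>x. (cmod (Q x))\<^sup>2) \<le> C"
    by (rule LIMSEQ_le_const2[OF conv]) (use bound in blast)
  let ?g = "\<lambda>t. (cmod (hurwitz_remainder 1 a (Complex \<sigma> t) / (Complex \<sigma> t - 1)))\<^sup>2"
  have im: "(\<lambda>x. x / T) ` {0..T} = {0..1}"
  proof
    show "{0..1} \<subseteq> (\<lambda>x. x / T) ` {0..T}"
      using T by (auto intro!: image_eqI[of _ _ "T * _"] simp: mult_left_le)
  qed (use T in auto)
  have "integral {0..1} (\<lambda>x. (cmod (Q x))\<^sup>2) = 1 / T * integral {0..T} ?g"
    using integral_stretch_real[of T 0 T ?g] T unfolding im Q_def s_def by simp
  then have "1 / T * integral {0..T} ?g \<le> C" using i01 by simp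
  then show "integral {0..T} ?g \<le> (exp (1 / 2) * sqrt (2 * pi) * (4 * exp (\<sigma>\<^sup>2 / 2) * (\<Sum>m. (real m + a) powr (- 2 * \<sigma>)))) * T"
    using T unfolding C_def[symmetric] by (simp add: field_simps)
qed

subsection \<open>Periodic Hurwitz zeta-functions\<close>

text \<open>Continuations to different half-planes agree by the identity theorem and glue to an
  entire function. The third formula, on the right half-plane, is the source of the value at
  1.\<close>

lemma hurwitz_entire:
  assumes a: "0 < a" "a \<le> 1"
  obtains Z where "Z holomorphic_on UNIV"
    "\<And>s. Re s > 1 \<Longrightarrow> Z s = (s - 1) * (\<Sum>m. complex_of_real (real m + a) powr (- s))"
    "\<And>s. Re s > 0 \<Longrightarrow> Z s = of_real a powr (1 - s) + hurwitz_remainder 1 a s"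
proof -
  let ?H = "\<lambda>j::nat. {s. Re s > 1 - real j}"
  let ?S = "\<lambda>s. (s - 1) * (\<Sum>m. complex_of_real (real m + a) powr (- s))"
  have opH: "open {s. Re s > c}" and conH: "connected {s. Re s > c}" for c
    by (simp_all add: open_halfspace_Re_gt convex_connected convex_halfspace_Re_gt)
  have uniq: "f s = g s" if "f holomorphic_on {s. Re s > c}" "g holomorphic_on {s. Re s > c}" "c \<le> 1"
    "\<And>s. Re s > 1 \<Longrightarrow> f s = g s" "Re s > c" for f g :: "complex \<Rightarrow> complex" and c s
  proof (rule analytic_continuation_open[OF opH[of 1] opH[of c] _ conH[of c] _ that(1,2)])
    have "2 \<in> {s. Re s > 1}" by simp
    then show "{s. Re s > 1} \<noteq> {}" by blast
  qed (use that in auto)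
  have "\<exists>Zf. \<forall>j. Zf j holomorphic_on ?H j \<and> (\<forall>s. Re s > 1 \<longrightarrow> Zf j s = ?S s)"
    using hurwitz_continuation_step[OF a] by (intro choice allI)
  then obtain Zf where Zf: "\<And>j. Zf j holomorphic_on ?H j" "\<And>j s. Re s > 1 \<Longrightarrow> Zf j s = ?S s" by blast
  \<comment> \<open>With this index j, Re s \<ge> 2 - j, so s lies in the half-plane of the
    continuation chosen; a negative ceiling becomes j = 0, with half-plane Re s > 1.\<close>
  define Z where "Z = (\<lambda>s. Zf (nat \<lceil>2 - Re s\<rceil>) s)"
  have le: "Zf i s = Zf j s" if "i \<le> j" "Re s > 1 - real i" for i j s
  proof (rule uniq[of "Zf i" "1 - real i" "Zf j"])
    show "Zf j holomorphic_on ?H i" by (rule holomorphic_on_subset[OF Zf(1)]) (use that in auto)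
  qed (use Zf that in auto)
  have Zeq: "Z s = Zf j s" if "Re s > 1 - real j" for s j
  proof -
    define i where "i = nat \<lceil>2 - Re s\<rceil>"
    have "2 - Re s \<le> real i" unfolding i_def by (rule real_nat_ceiling_ge)
    then have i: "Re s > 1 - real i" by simp
    show ?thesis
    proof (cases "i \<le> j")
      case True then show ?thesis unfolding Z_def i_def[symmetric] using le[OF True i] by simp
    next
      case False then show ?thesis unfolding Z_def i_def[symmetric] using le[of j i, OF _ that] by simp
    qed
  qed
  have Zhol: "Z holomorphic_on ?H j" for j
    using Zf(1)[of j] by (rule holomorphic_transform) (simp add: Zeq)
  have "Z holomorphic_on UNIV"
  proof -
    have "Z field_differentiable at s" for s
    proof -
      obtain j :: nat where j: "1 - Re s < real j" using reals_Archimedean2 by blast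
      have "s \<in> ?H j" using j by simp
      then show ?thesis using Zhol[of j] opH[of "1 - real j"] by (simp add: holomorphic_on_open field_differentiable_def)
    qed
    then show ?thesis by (simp add: holomorphic_on_def)
  qed
  moreover have Z1: "Z s = ?S s" if "Re s > 1" for s using Zeq[of 0 s] Zf(2)[of s 0] that by simp
  moreover have "Z s = of_real a powr (1 - s) + hurwitz_remainder 1 a s" if s: "Re s > 0" for s
  proof (rule uniq[of Z 0 "\<lambda>s. of_real a powr (1 - s) + hurwitz_remainder 1 a s"])
    show "Z holomorphic_on {s. Re s > 0}" using Zhol[of 1] by simp
    have "complex_of_real a \<noteq> 0" using a by simp
    moreover have "hurwitz_remainder 1 a holomorphic_on {s. Re s > 0}" using hurwitz_remainder_holomorphic[OF a, of 1] by simp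
    ultimately show "(\<lambda>s. of_real a powr (1 - s) + hurwitz_remainder 1 a s) holomorphic_on {s. Re s > 0}"
      by (intro holomorphic_intros) auto
    fix s assume s: "Re s > 1"
    have "hurwitz_remainder 1 a s = - (of_real a powr (1 - s)) - (1 - s) * (\<Sum>m. complex_of_real (real m + a) powr (- s))"
      using hurwitz_remainder_identity[OF a(1) s, of 1] by simp
    then show "Z s = of_real a powr (1 - s) + hurwitz_remainder 1 a s" unfolding Z1[OF s] by (simp add: left_diff_distrib)
  qed (use s in auto)
  ultimately show ?thesis by (rule that)
qed

section \<open>Reduction of periodic coefficients to Hurwitz zeta-functions\<close>

lemma periodic_mod:
  fixes b :: "nat \<Rightarrow> complex"
  assumes "\<forall>m. b (m + l) = b m"
  shows "b (n * l + r) = b r"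
proof (induction n)
  case (Suc n)
  have "b (Suc n * l + r) = b ((n * l + r) + l)" by (simp add: add_ac)
  then show ?case using assms Suc by simp
qed simp

text \<open>Sorting by residues m = n l + r and writing n l + r + \<alpha> = l (n + (r + \<alpha>) /
  l) expresses the series through l Hurwitz zeta-functions.\<close>

lemma periodic_dirichlet_sums:
  assumes \<alpha>: "0 < \<alpha>" and l: "l > 0" and per: "\<forall>m. b (m + l) = b m" and s: "Re s > 1"
  shows "(\<lambda>m. b m * complex_of_real (real m + \<alpha>) powr (- s)) sums
    (of_nat l powr (- s) * (\<Sum>r<l. b r * (\<Sum>m. complex_of_real (real m + (real r + \<alpha>) / real l) powr (- s))))"
proof -
  let ?f = "\<lambda>m. b m * complex_of_real (real m + \<alpha>) powr (- s)"
  define B where "B = Max (cmod ` b ` {..<l})"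
  have B: "cmod (b m) \<le> B" for m
  proof -
    have "b m = b (m div l * l + m mod l)" by simp
    also have "\<dots> = b (m mod l)" by (rule periodic_mod[OF per])
    finally have "cmod (b m) \<in> cmod ` b ` {..<l}" using l by auto
    then show ?thesis unfolding B_def by (intro Max_ge) auto
  qed
  have "summable ?f"
  proof (rule summable_comparison_test')
    show "summable (\<lambda>m. B * (real m + \<alpha>) powr (- Re s))" using \<alpha> s by (intro summable_mult summable_shift_powr) auto
    show "norm (?f m) \<le> B * (real m + \<alpha>) powr (- Re s)" for m
      unfolding norm_mult using norm_shift_powr[OF \<alpha>, of m "- s"] B[of m] by (simp add: mult_right_mono)
  qed
  then have fs: "?f sums suminf ?f" by (rule summable_sums)
  have grp: "sum ?f {n * l..<n * l + l} = (\<Sum>r<l. of_nat l powr (- s) * (b r * complex_of_real (real n + (real r + \<alpha>) / real l) powr (- s)))" for n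
  proof -
    have "sum ?f {n * l..<n * l + l} = (\<Sum>r<l. ?f (n * l + r))"
      using sum.shift_bounds_nat_ivl[of ?f 0 "n * l" l] by (simp add: lessThan_atLeast0 add.commute)
    also have "\<dots> = (\<Sum>r<l. of_nat l powr (- s) * (b r * complex_of_real (real n + (real r + \<alpha>) / real l) powr (- s)))"
    proof (rule sum.cong[OF refl])
      fix r
      let ?x = "real n + (real r + \<alpha>) / real l"
      have "real (n * l + r) + \<alpha> = real l * ?x" using l by (simp add: field_simps)
      then have "complex_of_real (real (n * l + r) + \<alpha>) powr (- s) = (complex_of_real (real l) * complex_of_real ?x) powr (- s)" by simp
      also have "\<dots> = complex_of_real (real l) powr (- s) * complex_of_real ?x powr (- s)"
        by (rule powr_times_real) (use \<alpha> in auto)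
      finally have "complex_of_real (real (n * l + r) + \<alpha>) powr (- s) = of_nat l powr (- s) * complex_of_real ?x powr (- s)" by simp
      then show "?f (n * l + r) = of_nat l powr (- s) * (b r * complex_of_real ?x powr (- s))"
        using periodic_mod[OF per, of n r] by (simp only: mult_ac)
    qed
    finally show ?thesis .
  qed
  have "(\<lambda>n. sum ?f {n * l..<n * l + l}) sums suminf ?f" by (rule sums_group[OF fs l])
  moreover have "(\<lambda>n. sum ?f {n * l..<n * l + l}) sums (\<Sum>r<l. of_nat l powr (- s) * (b r * (\<Sum>m. complex_of_real (real m + (real r + \<alpha>) / real l) powr (- s))))"
    unfolding grp using \<alpha> l s
    by (intro sums_sum sums_mult summable_sums hurwitz_summable divide_pos_pos) auto
  ultimately have "suminf ?f = (\<Sum>r<l. of_nat l powr (- s) * (b r * (\<Sum>m. complex_of_real (real m + (real r + \<alpha>) / real l) powr (- s))))"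
    by (rule sums_unique2)
  then show ?thesis using fs by (simp add: sum_distrib_left)
qed

lemma min_period_properties:
  assumes "periodic_seq b"
  shows "min_period b > 0" "\<forall>m. b (m + min_period b) = b m"
proof -
  have "\<exists>l. l > 0 \<and> (\<forall>m. b (m + l) = b m)" using assms by (simp add: periodic_seq_def)
  from LeastI_ex[OF this] show "min_period b > 0" "\<forall>m. b (m + min_period b) = b m"
    unfolding min_period_def by blast+
qed

text \<open>Multiplied by s - 1 the combination of Hurwitz zeta-functions becomes the entire
  function G, with G 1 equal to the period mean. If that vanishes, the singularity of G / (s - 1) is
  removable.\<close>

lemma periodic_hurwitz_zeta_exists:
  assumes \<alpha>: "0 < \<alpha>" "\<alpha> \<le> 1" and b: "periodic_seq b"
  shows "\<exists>Z. Z holomorphic_on (if period_mean b = 0 then UNIV else - {1}) \<and>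
     (\<forall>s. Re s > 1 \<longrightarrow> (\<lambda>m. b m * of_real (real m + \<alpha>) powr (- s)) sums Z s)"
proof -
  define l where "l = min_period b"
  note l = min_period_properties[OF b, folded l_def]
  have ar: "0 < (real r + \<alpha>) / real l" "(real r + \<alpha>) / real l \<le> 1" if "r < l" for r
    using that \<alpha> by (auto simp: divide_le_eq_1)
  have "\<exists>Z. Z holomorphic_on UNIV \<and> (\<forall>s. Re s > 1 \<longrightarrow> Z s = (s - 1) * (\<Sum>m. complex_of_real (real m + (real r + \<alpha>) / real l) powr (- s)))
      \<and> Z 1 = 1" if r: "r < l" for r
  proof -
    obtain Z where Z: "Z holomorphic_on UNIV"
      "\<And>s. Re s > 1 \<Longrightarrow> Z s = (s - 1) * (\<Sum>m. complex_of_real (real m + (real r + \<alpha>) / real l) powr (- s))"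
      "\<And>s. Re s > 0 \<Longrightarrow> Z s = of_real ((real r + \<alpha>) / real l) powr (1 - s) + hurwitz_remainder 1 ((real r + \<alpha>) / real l) s"
      by (rule hurwitz_entire[OF ar[OF r]]) (rule that)
    have ne: "complex_of_real ((real r + \<alpha>) / real l) \<noteq> 0" using ar(1)[OF r] by (metis less_irrefl of_real_eq_0_iff)
    have nm: "complex_of_real (real m + (real r + \<alpha>) / real l) \<noteq> 0 \<and> complex_of_real (real m + (real r + \<alpha>) / real l) + 1 \<noteq> 0" for m
      using ar(1)[OF r] by (auto simp: complex_eq_iff simp del: of_real_add of_real_divide)
    \<comment> \<open>At s = 1 every remainder vanishes: the zeroth powers cancel and the linear
      term carries the factor 1 - s. Hence s - 1 times each Hurwitz zeta-function takes the value 1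
      there.\<close>
    have "powr_remainder 1 (real m + (real r + \<alpha>) / real l) (1 - 1) 1 = 0" for m
      using nm[of m] unfolding powr_remainder_def by (simp del: of_real_add of_real_divide)
    then have "Z 1 = 1" using Z(3)[of 1] ne by (simp add: hurwitz_remainder_def del: of_real_divide)
    then show ?thesis using Z(1,2) by blast
  qed
  then obtain Zr where Zr: "\<And>r. r < l \<Longrightarrow> Zr r holomorphic_on UNIV"
     "\<And>r s. r < l \<Longrightarrow> Re s > 1 \<Longrightarrow> Zr r s = (s - 1) * (\<Sum>m. complex_of_real (real m + (real r + \<alpha>) / real l) powr (- s))"
     "\<And>r. r < l \<Longrightarrow> Zr r 1 = 1" by metis
  define G where "G = (\<lambda>s. of_nat l powr (- s) * (\<Sum>r<l. b r * Zr r s))"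
  have Gh: "G holomorphic_on UNIV" unfolding G_def using l(1) by (intro holomorphic_intros Zr) auto
  have Gs: "(\<lambda>m. b m * of_real (real m + \<alpha>) powr (- s)) sums (G s / (s - 1))" if s: "Re s > 1" for s
  proof -
    have "s - 1 \<noteq> 0" using s by auto
    moreover have "G s = (s - 1) * (of_nat l powr (- s) * (\<Sum>r<l. b r * (\<Sum>m. complex_of_real (real m + (real r + \<alpha>) / real l) powr (- s))))"
      unfolding G_def using Zr(2)[OF _ s] by (simp add: sum_distrib_left mult_ac del: of_real_add of_real_divide)
    ultimately show ?thesis using periodic_dirichlet_sums[OF \<alpha>(1) l s] by simp
  qed
  show ?thesis
  proof (cases "period_mean b = 0")
    case True
    then have "(\<Sum>r<l. b r) = 0" using l(1) by (simp add: period_mean_def l_def)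
    then have G1: "G 1 = 0" unfolding G_def using Zr(3) by simp
    have "(\<lambda>z. if z = 1 then deriv G 1 else G z / (z - 1) - G 1 / (z - 1)) holomorphic_on UNIV"
      by (rule pole_theorem[OF Gh]) auto
    moreover have "(\<lambda>m. b m * of_real (real m + \<alpha>) powr (- s)) sums (if s = 1 then deriv G 1 else G s / (s - 1) - G 1 / (s - 1))" if "Re s > 1" for s
      using Gs[OF that] that by (auto simp: G1)
    ultimately show ?thesis using True by auto
  next
    case False
    have "(\<lambda>s. G s / (s - 1)) holomorphic_on - {1}"
      by (intro holomorphic_intros holomorphic_on_subset[OF Gh]) auto
    then show ?thesis using False Gs by auto
  qed
qed

lemma periodic_hurwitz_zeta:
  assumes \<alpha>: "0 < \<alpha>" "\<alpha> \<le> 1" and b: "periodic_seq b"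
  shows "periodic_hurwitz_zeta \<alpha> b holomorphic_on (if period_mean b = 0 then UNIV else - {1})"
    and "\<And>s. Re s > 1 \<Longrightarrow> (\<lambda>m. b m * of_real (real m + \<alpha>) powr (- s)) sums periodic_hurwitz_zeta \<alpha> b s"
  using someI_ex[OF periodic_hurwitz_zeta_exists[OF assms]] unfolding periodic_hurwitz_zeta_def by blast+

text \<open>The identity theorem, on the connected right half-plane without 1, makes the function
  obtained by choice explicit where the estimates are carried out.\<close>

lemma periodic_hurwitz_zeta_formula:
  assumes \<alpha>: "0 < \<alpha>" "\<alpha> \<le> 1" and b: "periodic_seq b" and l: "l > 0" "\<forall>m. b (m + l) = b m"
    and s: "Re s > 0" "s \<noteq> 1"
  shows "periodic_hurwitz_zeta \<alpha> b s = of_nat l powr (- s) * (\<Sum>r<l. b r *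
    ((of_real ((real r + \<alpha>) / real l) powr (1 - s) + hurwitz_remainder 1 ((real r + \<alpha>) / real l) s) / (s - 1)))"
proof -
  let ?a = "\<lambda>r. (real r + \<alpha>) / real l"
  let ?g = "\<lambda>s. of_nat l powr (- s) * (\<Sum>r<l. b r * ((of_real (?a r) powr (1 - s) + hurwitz_remainder 1 (?a r) s) / (s - 1)))"
  let ?U = "{s. Re s > 0} - {1}"
  have ar: "0 < ?a r" "?a r \<le> 1" if "r < l" for r
    using that \<alpha> by (auto simp: divide_le_eq_1)
  show ?thesis
  proof (rule analytic_continuation_open[where s = "{s. Re s > 1}" and s' = ?U and g = ?g])
    show "open {s. Re s > 1}" "open ?U" by (auto simp: open_halfspace_Re_gt intro!: open_Diff)
    have "2 \<in> {s. Re s > 1}" by simp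
    then show "{s. Re s > 1} \<noteq> {}" by blast
    show "connected ?U"
      by (rule connected_open_delete) (auto simp: open_halfspace_Re_gt convex_connected convex_halfspace_Re_gt)
    show "periodic_hurwitz_zeta \<alpha> b holomorphic_on ?U"
      by (rule holomorphic_on_subset[OF periodic_hurwitz_zeta(1)[OF \<alpha> b]]) auto
    have hr: "(\<lambda>s. hurwitz_remainder 1 (?a r) s) holomorphic_on ?U" if "r < l" for r
      by (rule holomorphic_on_subset[OF hurwitz_remainder_holomorphic[OF ar[OF that]]]) auto
    have ne: "complex_of_real (?a r) \<noteq> 0" if "r < l" for r using ar(1)[OF that] by (metis less_irrefl of_real_eq_0_iff)
    have hp: "(\<lambda>s. complex_of_real (?a r) powr (1 - s)) holomorphic_on ?U" if "r < l" for r
      using ne[OF that] by (intro holomorphic_intros)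
    show "?g holomorphic_on ?U"
      using l(1) by (intro holomorphic_intros hr hp) auto
    fix z assume "z \<in> {s. Re s > 1}"
    then have z: "Re z > 1" by simp
    have zr: "(of_real (?a r) powr (1 - z) + hurwitz_remainder 1 (?a r) z) / (z - 1) = (\<Sum>m. complex_of_real (real m + ?a r) powr (- z))" if "r < l" for r
    proof -
      have "hurwitz_remainder 1 (?a r) z = - (of_real (?a r) powr (1 - z)) - (1 - z) * (\<Sum>m. complex_of_real (real m + ?a r) powr (- z))"
        using hurwitz_remainder_identity[OF ar(1)[OF that] z, of 1] by simp
      moreover have "z - 1 \<noteq> 0" using z by auto
      ultimately show ?thesis by (simp add: field_simps del: of_real_add of_real_divide)
    qed
    have "?g z = of_nat l powr (- z) * (\<Sum>r<l. b r * (\<Sum>m. complex_of_real (real m + ?a r) powr (- z)))"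
      using zr by (simp del: of_real_add of_real_divide)
    with sums_unique2[OF periodic_hurwitz_zeta(2)[OF \<alpha> b z] periodic_dirichlet_sums[OF \<alpha>(1) l z]]
    show "periodic_hurwitz_zeta \<alpha> b z = ?g z" by (rule trans[OF _ sym])
  qed (use s in auto)
qed

text \<open>In each residue class P is elementary and bounded for Im s \<ge> 1, where |s - 1| \<ge>
  1; Q is the remainder divided by s - 1, of linear growth and with the mean square from
  \<open>hurwitz_remainder_mean_square\<close>. Height 1 suffices as starting height because a pole
  can only lie at 1.\<close>

lemma periodic_hurwitz_mean_strip:
  assumes \<alpha>: "0 < \<alpha>" "\<alpha> \<le> 1" and b: "periodic_seq b" and \<sigma>: "1 / 2 < \<sigma>" "\<sigma> < 1"
  shows "\<exists>A. mean_strip \<alpha> b (periodic_hurwitz_zeta \<alpha> b) \<sigma> 1 A"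
proof -
  define l where "l = min_period b"
  note l = min_period_properties[OF b, folded l_def]
  let ?a = "\<lambda>r. (real r + \<alpha>) / real l" and ?F = "periodic_hurwitz_zeta \<alpha> b"
  have ar: "0 < ?a r" "?a r \<le> 1" if "r < l" for r
    using that \<alpha> by (auto simp: divide_le_eq_1)
  define Q where "Q = (\<lambda>r s. hurwitz_remainder 1 (?a r) s / (s - 1))"
  define P where "P = (\<lambda>r s. complex_of_real (?a r) powr (1 - s) / (s - 1))"
  have F: "?F s = of_nat l powr (- s) * (\<Sum>r<l. b r * (P r s + Q r s))" if "Re s > 0" "s \<noteq> 1" for s
    unfolding periodic_hurwitz_zeta_formula[OF \<alpha> b l that] P_def Q_def by (simp only: add_divide_distrib)
  have lpow: "cmod (of_nat l powr (- s)) \<le> 1" if "Re s > 0" for s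
  proof -
    have "cmod (complex_of_real (real l) powr (- s)) = real l powr (- Re s)"
      using l(1) by (subst norm_powr_real_powr) auto
    also have "\<dots> \<le> 1" using powr_mono[of "- Re s" 0 "real l"] l(1) that by simp
    finally show ?thesis by simp
  qed
  have Fb: "cmod (?F s) \<le> (\<Sum>r<l. cmod (b r) * (cmod (P r s) + cmod (Q r s)))" if "Re s > 0" "s \<noteq> 1" for s
  proof -
    have "cmod (\<Sum>r<l. b r * (P r s + Q r s)) \<le> (\<Sum>r<l. cmod (b r) * (cmod (P r s) + cmod (Q r s)))"
      by (rule sum_norm_le) (simp add: norm_mult mult_left_mono norm_triangle_ineq)
    then have "cmod (of_nat l powr (- s)) * cmod (\<Sum>r<l. b r * (P r s + Q r s)) \<le> 1 * (\<Sum>r<l. cmod (b r) * (cmod (P r s) + cmod (Q r s)))"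
      by (intro mult_mono lpow that) auto
    then show ?thesis unfolding F[OF that] norm_mult by simp
  qed
  have im1: "1 \<le> cmod (s - 1)" if "Im s \<ge> 1" for s using abs_Im_le_cmod[of "s - 1"] that by simp
  have s1: "s \<noteq> 1" if "Im s \<ge> 1" for s using that by auto
  have Pb: "cmod (P r s) \<le> ?a r powr (- \<bar>R\<bar>)" if "r < l" "Im s \<ge> 1" "Re s \<le> R" for r s R
  proof -
    have "cmod (complex_of_real (?a r) powr (1 - s)) = ?a r powr (1 - Re s)"
      using ar(1)[OF that(1)] by (subst norm_powr_real_powr) auto
    also have "\<dots> \<le> ?a r powr (- \<bar>R\<bar>)" using ar[OF that(1)] that by (intro powr_mono') auto
    finally have "cmod (P r s) \<le> ?a r powr (- \<bar>R\<bar>) / 1"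
      unfolding P_def norm_divide using im1[OF that(2)] by (intro frac_le) auto
    then show ?thesis by simp
  qed
  show ?thesis
  proof -
    have growth: "\<exists>B C. \<forall>z. \<sigma> \<le> Re z \<and> Re z \<le> R \<and> Im z \<ge> 1 \<longrightarrow> cmod (?F z) \<le> B * Im z powr C" for R
    proof -
      define D where "D = (\<lambda>r. ?a r powr (- (\<bar>R\<bar> + 1)) * (\<Sum>m. (real m + 1) powr (- (\<sigma> + 1))))"
      have ss: "summable (\<lambda>m. (real m + 1) powr (- (\<sigma> + 1)))" using \<sigma> by (intro summable_shift_powr) auto
      have D0: "D r \<ge> 0" for r unfolding D_def by (intro mult_nonneg_nonneg suminf_nonneg ss) auto
      have Qb: "cmod (Q r z) \<le> (\<bar>R\<bar> + 1) * D r * Im z" if r: "r < l" and z: "\<sigma> \<le> Re z" "Re z \<le> R" "Im z \<ge> 1" for r z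
      proof -
        have t: "cmod (powr_remainder 1 (real m + ?a r) (1 - z) 1) \<le> cmod (z - 1) * cmod z * (?a r powr (- (\<bar>R\<bar> + 1)) * (real m + 1) powr (- (\<sigma> + 1)))" for m
        proof -
          have "cmod (powr_remainder 1 (real m + ?a r) (1 - z) (of_real 1)) \<le> (\<Prod>i\<le>1. cmod (1 - z - of_nat i)) * (real m + ?a r) powr (Re (1 - z) - real 1 - 1)"
            by (rule powr_remainder_bound) (use ar[OF r] z \<sigma> in auto)
          \<comment> \<open>For K = 1 the product in the remainder bound is |z - 1| |z|; division by
            z - 1 leaves linear growth.\<close>
          also have "(\<Prod>i\<le>1. cmod (1 - z - of_nat i)) = cmod (z - 1) * cmod z" by (simp add: norm_minus_commute)
          also have "Re (1 - z) - real 1 - 1 = - (Re z + 1)" by simp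
          also have "(real m + ?a r) powr (- (Re z + 1)) \<le> ?a r powr (- (\<bar>R\<bar> + 1)) * (real m + 1) powr (- (Re z + 1))"
            by (rule shift_powr_le) (use ar[OF r] z \<sigma> in auto)
          also have "\<dots> \<le> ?a r powr (- (\<bar>R\<bar> + 1)) * (real m + 1) powr (- (\<sigma> + 1))"
            using z by (intro mult_left_mono powr_mono) auto
          finally show ?thesis by (simp add: mult_left_mono)
        qed
        have "cmod (hurwitz_remainder 1 (?a r) z) \<le> (\<Sum>m. cmod (z - 1) * cmod z * (?a r powr (- (\<bar>R\<bar> + 1)) * (real m + 1) powr (- (\<sigma> + 1))))"
          unfolding hurwitz_remainder_def by (rule norm_suminf_le[OF t]) (intro summable_mult ss)
        also have "\<dots> = cmod (z - 1) * cmod z * D r"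
          unfolding D_def by (simp only: suminf_mult[OF ss] suminf_mult[OF summable_mult[OF ss]])
        finally have "cmod (Q r z) \<le> cmod (z - 1) * cmod z * D r / cmod (z - 1)"
          unfolding Q_def norm_divide by (rule divide_right_mono) simp
        also have "\<dots> = cmod z * D r" using s1[OF z(3)] by simp
        finally have q1: "cmod (Q r z) \<le> cmod z * D r" .
        have "cmod z \<le> (\<bar>R\<bar> + 1) * Im z"
        proof -
          have "cmod z \<le> \<bar>Re z\<bar> + \<bar>Im z\<bar>" by (rule cmod_le)
          also have "\<dots> \<le> \<bar>R\<bar> * 1 + Im z" using z \<sigma> by auto
          also have "\<dots> \<le> \<bar>R\<bar> * Im z + Im z" using z by (intro add_right_mono mult_left_mono) auto
          finally show ?thesis by (simp add: distrib_right)
        qed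
        from mult_right_mono[OF this D0[of r]] q1 show ?thesis by (simp add: mult_ac)
      qed
      define B where "B = (\<Sum>r<l. cmod (b r) * (?a r powr (- \<bar>R\<bar>) + (\<bar>R\<bar> + 1) * D r))"
      have "cmod (?F z) \<le> B * Im z powr 1" if z: "\<sigma> \<le> Re z" "Re z \<le> R" "Im z \<ge> 1" for z
      proof -
        have "cmod (?F z) \<le> (\<Sum>r<l. cmod (b r) * (cmod (P r z) + cmod (Q r z)))"
          using z \<sigma> by (intro Fb s1) auto
        also have "\<dots> \<le> (\<Sum>r<l. cmod (b r) * ((?a r powr (- \<bar>R\<bar>) + (\<bar>R\<bar> + 1) * D r) * Im z))"
        proof (intro sum_mono mult_left_mono)
          fix r assume "r \<in> {..<l}"
          then have r: "r < l" by simp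
          have "cmod (P r z) \<le> ?a r powr (- \<bar>R\<bar>) * 1" using Pb[OF r z(3,2)] by simp
          also have "\<dots> \<le> ?a r powr (- \<bar>R\<bar>) * Im z" using z by (intro mult_left_mono) auto
          finally show "cmod (P r z) + cmod (Q r z) \<le> (?a r powr (- \<bar>R\<bar>) + (\<bar>R\<bar> + 1) * D r) * Im z"
            using Qb[OF r z] by (simp add: distrib_right)
        qed auto
        also have "\<dots> = B * Im z powr 1" using z unfolding B_def sum_distrib_right by (simp add: mult.assoc)
        finally show ?thesis .
      qed
      then show ?thesis by blast
    qed
    have holo: "?F holomorphic_on {z. Re z \<ge> \<sigma> \<and> Im z \<ge> 1}"
      by (rule holomorphic_on_subset[OF periodic_hurwitz_zeta(1)[OF \<alpha> b]]) auto
    have "\<exists>C. \<forall>r<l. \<forall>T\<ge>1. integral {0..T} (\<lambda>t. (cmod (Q r (Complex \<sigma> t)))\<^sup>2) \<le> C r * T"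
    proof -
      have "\<forall>r. \<exists>C. r < l \<longrightarrow> (\<forall>T\<ge>1. integral {0..T} (\<lambda>t. (cmod (Q r (Complex \<sigma> t)))\<^sup>2) \<le> C * T)"
        using hurwitz_remainder_mean_square[OF ar \<sigma>] unfolding Q_def by blast
      then obtain C where "\<forall>r. r < l \<longrightarrow> (\<forall>T\<ge>1. integral {0..T} (\<lambda>t. (cmod (Q r (Complex \<sigma> t)))\<^sup>2) \<le> C r * T)"
        by (rule choice[THEN exE])
      then show ?thesis by blast
    qed
    then obtain C where C: "\<And>r T. r < l \<Longrightarrow> T \<ge> 1 \<Longrightarrow> integral {0..T} (\<lambda>t. (cmod (Q r (Complex \<sigma> t)))\<^sup>2) \<le> C r * T" by blast
    define p where "p = (\<lambda>r. (?a r powr (- \<bar>\<sigma>\<bar>))\<^sup>2)"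
    define A where "A = real l * (\<Sum>r<l. (cmod (b r))\<^sup>2 * (2 * p r + 2 * C r))"
    have ms: "integral {1..T} (\<lambda>t. (cmod (?F (Complex \<sigma> t)))\<^sup>2) \<le> A * T" if T: "T \<ge> 1" for T
    proof -
      have cF: "continuous_on {1..T} (\<lambda>t. ?F (Complex \<sigma> t))"
        by (rule continuous_on_compose2[OF holomorphic_on_imp_continuous_on[OF holo]]) (auto intro!: continuous_intros)
      have cQ: "continuous_on {0..T} (\<lambda>t. Q r (Complex \<sigma> t))" if r: "r < l" for r
      proof -
        have "hurwitz_remainder 1 (?a r) holomorphic_on {s. Re s > 0}" using hurwitz_remainder_holomorphic[OF ar[OF r], of 1] by simp
        then have "continuous_on {0..T} (\<lambda>t. hurwitz_remainder 1 (?a r) (Complex \<sigma> t))"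
          by (rule continuous_on_compose2[OF holomorphic_on_imp_continuous_on]) (use \<sigma> in \<open>auto intro!: continuous_intros\<close>)
        then show ?thesis unfolding Q_def using \<sigma> by (intro continuous_intros) (auto simp: complex_eq_iff)
      qed
      have iQ: "(\<lambda>t. (cmod (Q r (Complex \<sigma> t)))\<^sup>2) integrable_on {c..T}" if "r < l" "c \<ge> 0" for r c
        by (intro integrable_continuous_real continuous_intros continuous_on_subset[OF cQ[OF that(1)]]) (use that in auto)
      have pt: "(cmod (?F (Complex \<sigma> t)))\<^sup>2 \<le> real l * (\<Sum>r<l. (cmod (b r))\<^sup>2 * (2 * p r + 2 * (cmod (Q r (Complex \<sigma> t)))\<^sup>2))" if t: "t \<ge> 1" for t
      proof -
        let ?s = "Complex \<sigma> t"
        let ?u = "\<lambda>r. cmod (b r) * (cmod (P r ?s) + cmod (Q r ?s))"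
        have "cmod (?F ?s) \<le> (\<Sum>r<l. ?u r)" using t \<sigma> by (intro Fb s1) auto
        then have "(cmod (?F ?s))\<^sup>2 \<le> (\<Sum>r<l. ?u r)\<^sup>2" by (intro power_mono) auto
        also have "\<dots> \<le> real l * (\<Sum>r<l. (?u r)\<^sup>2)" using sum_squared_le_sum_of_squares[of ?u "{..<l}"] by (simp add: mult.commute)
        also have "\<dots> \<le> real l * (\<Sum>r<l. (cmod (b r))\<^sup>2 * (2 * p r + 2 * (cmod (Q r ?s))\<^sup>2))"
        proof (intro mult_left_mono sum_mono)
          fix r assume "r \<in> {..<l}"
          then have "cmod (P r ?s) \<le> ?a r powr (- \<bar>\<sigma>\<bar>)" using t by (intro Pb) auto
          then have "(cmod (P r ?s))\<^sup>2 \<le> p r" unfolding p_def by (intro power_mono) auto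
          moreover have "(cmod (P r ?s) + cmod (Q r ?s))\<^sup>2 \<le> 2 * (cmod (P r ?s))\<^sup>2 + 2 * (cmod (Q r ?s))\<^sup>2"
            using sum_squares_bound[of "cmod (P r ?s)" "cmod (Q r ?s)"] by (simp add: power2_sum)
          ultimately have "(cmod (P r ?s) + cmod (Q r ?s))\<^sup>2 \<le> 2 * p r + 2 * (cmod (Q r ?s))\<^sup>2" by linarith
          then show "(?u r)\<^sup>2 \<le> (cmod (b r))\<^sup>2 * (2 * p r + 2 * (cmod (Q r ?s))\<^sup>2)"
            by (simp only: power_mult_distrib) (rule mult_left_mono, auto)
        qed auto
        finally show ?thesis .
      qed
      have isum: "(\<lambda>t. \<Sum>r<l. (cmod (b r))\<^sup>2 * (2 * p r + 2 * (cmod (Q r (Complex \<sigma> t)))\<^sup>2)) integrable_on {1..T}"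
        by (intro integrable_sum integrable_continuous_real continuous_intros continuous_on_subset[OF cQ]) auto
      have "integral {1..T} (\<lambda>t. (cmod (?F (Complex \<sigma> t)))\<^sup>2) \<le> integral {1..T} (\<lambda>t. real l * (\<Sum>r<l. (cmod (b r))\<^sup>2 * (2 * p r + 2 * (cmod (Q r (Complex \<sigma> t)))\<^sup>2)))"
      proof (rule integral_le)
        show "(\<lambda>t. (cmod (?F (Complex \<sigma> t)))\<^sup>2) integrable_on {1..T}"
          by (intro integrable_continuous_real continuous_intros cF)
        show "(\<lambda>t. real l * (\<Sum>r<l. (cmod (b r))\<^sup>2 * (2 * p r + 2 * (cmod (Q r (Complex \<sigma> t)))\<^sup>2))) integrable_on {1..T}"
          using integrable_on_cmult_left[OF isum, of "real l"] by simp
      qed (use pt in auto)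
      also have "\<dots> = real l * (\<Sum>r<l. integral {1..T} (\<lambda>t. (cmod (b r))\<^sup>2 * (2 * p r + 2 * (cmod (Q r (Complex \<sigma> t)))\<^sup>2)))"
        by (subst integral_mult_right, subst integral_sum)
           (auto intro!: integrable_continuous_real continuous_intros continuous_on_subset[OF cQ])
      also have "\<dots> \<le> real l * (\<Sum>r<l. (cmod (b r))\<^sup>2 * (2 * p r + 2 * C r) * T)"
      proof (intro mult_left_mono sum_mono)
        fix r assume "r \<in> {..<l}"
        then have r: "r < l" by simp
        have "integral {1..T} (\<lambda>t. (cmod (b r))\<^sup>2 * (2 * p r + 2 * (cmod (Q r (Complex \<sigma> t)))\<^sup>2))
           = (cmod (b r))\<^sup>2 * (integral {1..T} (\<lambda>t. 2 * p r) + 2 * integral {1..T} (\<lambda>t. (cmod (Q r (Complex \<sigma> t)))\<^sup>2))"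
          by (subst integral_mult_right, subst Henstock_Kurzweil_Integration.integral_add)
             (use iQ[OF r, of 1] integrable_on_cmult_left[OF iQ[OF r, of 1], of 2] in auto)
        also have "\<dots> \<le> (cmod (b r))\<^sup>2 * (2 * p r * T + 2 * (C r * T))"
        proof (intro mult_left_mono add_mono)
          have "p r \<ge> 0" by (simp add: p_def)
          then show "integral {1..T} (\<lambda>t. 2 * p r) \<le> 2 * p r * T" using T by (simp add: algebra_simps)
          have "integral {1..T} (\<lambda>t. (cmod (Q r (Complex \<sigma> t)))\<^sup>2) \<le> integral {0..T} (\<lambda>t. (cmod (Q r (Complex \<sigma> t)))\<^sup>2)"
            by (rule integral_subset_le) (use iQ[OF r] in auto)
          then show "integral {1..T} (\<lambda>t. (cmod (Q r (Complex \<sigma> t)))\<^sup>2) \<le> C r * T" using C[OF r T] by linarith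
        qed auto
        also have "\<dots> = (cmod (b r))\<^sup>2 * (2 * p r + 2 * C r) * T" by (simp add: algebra_simps)
        finally show "integral {1..T} (\<lambda>t. (cmod (b r))\<^sup>2 * (2 * p r + 2 * (cmod (Q r (Complex \<sigma> t)))\<^sup>2)) \<le> (cmod (b r))\<^sup>2 * (2 * p r + 2 * C r) * T" .
      qed auto
      also have "\<dots> = A * T" by (simp add: A_def sum_distrib_right mult.assoc)
      finally show ?thesis .
    qed
    have "mean_strip \<alpha> b ?F \<sigma> 1 A"
    proof
      show "\<And>z. 1 < Re z \<Longrightarrow> (\<lambda>m. b m * complex_of_real (real m + \<alpha>) powr - z) sums ?F z"
        by (rule periodic_hurwitz_zeta(2)[OF \<alpha> b])
    qed (use \<alpha> \<sigma> holo growth ms in auto)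
    then show ?thesis by blast
  qed
qed

subsection \<open>Random holomorphic functions\<close>

text \<open>The Abel bound is applied to the coefficients with the first N removed: their partial
  sums are uniformly small by the Cauchy criterion, and the bound is linear in that size.\<close>

lemma dirichlet_uniform_limit:
  fixes \<alpha> \<eta> R :: real and y :: "nat \<Rightarrow> complex"
  assumes \<alpha>: "0 < \<alpha>" "\<alpha> \<le> 1" and \<eta>: "\<eta> > 0" and y: "summable y"
  shows "Re w \<ge> \<eta> \<Longrightarrow> summable (\<lambda>m. y m * complex_of_real (real m + \<alpha>) powr (- w))"
    and "uniform_limit {w. Re w \<ge> \<eta> \<and> cmod w \<le> R} (\<lambda>N w. \<Sum>m<N. y m * complex_of_real (real m + \<alpha>) powr (- w))
      (\<lambda>w. \<Sum>m. y m * complex_of_real (real m + \<alpha>) powr (- w)) sequentially"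
proof -
  define \<epsilon> where "\<epsilon> = \<eta> / 2"
  have \<epsilon>: "\<epsilon> > 0" using \<eta> by (simp add: \<epsilon>_def)
  let ?f = "\<lambda>w m. y m * complex_of_real (real m + \<alpha>) powr (- w)"
  define y' where "y' = (\<lambda>N m. if m < N then 0 else y m)"
  let ?g = "\<lambda>w N m. y' N m * complex_of_real (real m + \<alpha>) powr (- w)"
  have small: "\<exists>N0. \<forall>N\<ge>N0. \<forall>k. cmod (\<Sum>i<k. y' N i) \<le> e * real k powr \<epsilon>" if e: "e > 0" for e
  proof -
    obtain N0 where N0: "\<And>m n. m \<ge> N0 \<Longrightarrow> n \<ge> N0 \<Longrightarrow> cmod ((\<Sum>i<m. y i) - (\<Sum>i<n. y i)) < e"
      using summable_LIMSEQ[OF y, THEN LIMSEQ_imp_Cauchy, THEN CauchyD, OF e] by blast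
    have "cmod (\<Sum>i<k. y' N i) \<le> e * real k powr \<epsilon>" if N: "N \<ge> N0" for N k
    proof (cases "k \<le> N")
      case True
      then have "(\<Sum>i<k. y' N i) = 0" by (intro sum.neutral) (auto simp: y'_def)
      then show ?thesis using e by simp
    next
      case False
      then have k: "k \<ge> 1" "N \<le> k" by auto
      have "(\<Sum>i<k. y' N i) = (\<Sum>i<k. y i) - (\<Sum>i<N. y i)"
      proof -
        have "(\<Sum>i<k. y i) = (\<Sum>i<N. y i) + (\<Sum>i\<in>{N..<k}. y i)"
          using k(2) by (metis lessThan_atLeast0 le0 sum.atLeastLessThan_concat)
        moreover have "(\<Sum>i<k. y' N i) = (\<Sum>i\<in>{N..<k}. y i)"
          by (rule sum.mono_neutral_cong_right) (auto simp: y'_def)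
        ultimately show ?thesis by simp
      qed
      then have "cmod (\<Sum>i<k. y' N i) \<le> e" using N0[of k N] N k by (simp add: less_imp_le)
      also have "\<dots> \<le> e * real k powr \<epsilon>" using e k \<epsilon> by (simp add: ge_one_powr_ge_zero)
      finally show ?thesis .
    qed
    then show ?thesis by blast
  qed
  have split: "(\<lambda>m. ?f w m) sums ((\<Sum>m<N. ?f w m) + (\<Sum>m. ?g w N m))" if "summable (?g w N)" for w N
  proof -
    have "(\<lambda>m. if m \<in> {..<N} then ?f w m else 0) sums (\<Sum>m\<in>{..<N}. ?f w m)"
      by (rule sums_If_finite_set) simp
    from sums_add[OF this summable_sums[OF that]]
    have "(\<lambda>m. (if m \<in> {..<N} then ?f w m else 0) + ?g w N m) sums ((\<Sum>m<N. ?f w m) + (\<Sum>m. ?g w N m))" .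
    moreover have "(if m \<in> {..<N} then ?f w m else 0) + ?g w N m = ?f w m" for m by (simp add: y'_def)
    ultimately show ?thesis by (simp only:)
  qed
  show "summable (?f w)" if w: "Re w \<ge> \<eta>"
  proof -
    obtain C where C: "\<forall>y B w'. B \<ge> 0 \<and> (\<forall>k. cmod (\<Sum>i<k. y i) \<le> B * real k powr \<epsilon>) \<and> Re w' \<ge> \<epsilon> + \<epsilon> \<and> cmod w' \<le> cmod w \<longrightarrow>
       summable (\<lambda>m. y m * complex_of_real (real m + \<alpha>) powr (- w')) \<and>
       cmod (\<Sum>m. y m * complex_of_real (real m + \<alpha>) powr (- w')) \<le> B * C"
      using dirichlet_abel_bound[OF \<alpha> \<epsilon> \<epsilon>, of "cmod w"] by (elim exE conjE) (rule that)
    obtain N where N: "\<forall>k. cmod (\<Sum>i<k. y' N i) \<le> 1 * real k powr \<epsilon>" using small[of 1] by auto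
    have "(1::real) \<ge> 0 \<and> (\<forall>k. cmod (\<Sum>i<k. y' N i) \<le> 1 * real k powr \<epsilon>) \<and> Re w \<ge> \<epsilon> + \<epsilon> \<and> cmod w \<le> cmod w"
      using N w by (auto simp: \<epsilon>_def)
    from C[rule_format, OF this] have "summable (?g w N)" by blast
    from sums_summable[OF split[OF this]] show ?thesis .
  qed
  show "uniform_limit {w. Re w \<ge> \<eta> \<and> cmod w \<le> R} (\<lambda>N w. \<Sum>m<N. ?f w m) (\<lambda>w. \<Sum>m. ?f w m) sequentially"
  proof (rule uniform_limitI)
    fix e :: real assume e: "e > 0"
    obtain C where C0: "C \<ge> 0" and C: "\<forall>y B w'. B \<ge> 0 \<and> (\<forall>k. cmod (\<Sum>i<k. y i) \<le> B * real k powr \<epsilon>) \<and> Re w' \<ge> \<epsilon> + \<epsilon> \<and> cmod w' \<le> R \<longrightarrow>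
       summable (\<lambda>m. y m * complex_of_real (real m + \<alpha>) powr (- w')) \<and>
       cmod (\<Sum>m. y m * complex_of_real (real m + \<alpha>) powr (- w')) \<le> B * C"
      using dirichlet_abel_bound[OF \<alpha> \<epsilon> \<epsilon>, of R] by (elim exE conjE) (rule that)
    define B where "B = e / 2 / (C + 1)"
    have B: "B > 0" using e C0 by (simp add: B_def)
    have BC: "B * C < e"
    proof -
      have "B * C \<le> B * (C + 1)" using B by simp
      also have "\<dots> = e / 2"
      proof -
        have "C + 1 \<noteq> 0" using C0 by simp
        from nonzero_eq_divide_eq[OF this, THEN iffD1, OF B_def] show ?thesis .
      qed
      finally show ?thesis using e by simp
    qed
    obtain N0 where N0: "\<forall>N\<ge>N0. \<forall>k. cmod (\<Sum>i<k. y' N i) \<le> B * real k powr \<epsilon>" using small[OF B] by blast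
    show "\<forall>\<^sub>F N in sequentially. \<forall>w\<in>{w. Re w \<ge> \<eta> \<and> cmod w \<le> R}. dist (\<Sum>m<N. ?f w m) (\<Sum>m. ?f w m) < e"
      using eventually_ge_at_top[of N0]
    proof eventually_elim
      case (elim N)
      show ?case
      proof
        fix w assume w: "w \<in> {w. Re w \<ge> \<eta> \<and> cmod w \<le> R}"
        have "B \<ge> 0 \<and> (\<forall>k. cmod (\<Sum>i<k. y' N i) \<le> B * real k powr \<epsilon>) \<and> Re w \<ge> \<epsilon> + \<epsilon> \<and> cmod w \<le> R"
          using B N0 elim w by (auto simp: \<epsilon>_def)
        from C[rule_format, OF this] have s: "summable (?g w N)" and b: "cmod (\<Sum>m. ?g w N m) \<le> B * C" by auto
        have "(\<Sum>m. ?f w m) = (\<Sum>m<N. ?f w m) + (\<Sum>m. ?g w N m)" using sums_unique[OF split[OF s]] by simp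
        then have "dist (\<Sum>m<N. ?f w m) (\<Sum>m. ?f w m) = cmod (\<Sum>m. ?g w N m)" by (simp add: dist_norm)
        then show "dist (\<Sum>m<N. ?f w m) (\<Sum>m. ?f w m) < e" using b BC by simp
      qed
    qed
  qed
qed

lemma dirichlet_term_shift:
  assumes "\<alpha> > 0"
  shows "y m * complex_of_real (real m + \<alpha>) powr (- s) = (y m * complex_of_real (real m + \<alpha>) powr (- s')) * complex_of_real (real m + \<alpha>) powr (- (s - s'))"
proof -
  have "- s = - s' + - (s - s')" by simp
  then show ?thesis by (simp only: powr_add mult.assoc)
qed

lemma dirichlet_converges_right:
  assumes \<alpha>: "0 < \<alpha>" "\<alpha> \<le> 1" and s: "summable (\<lambda>m. y m * complex_of_real (real m + \<alpha>) powr (- s'))" "Re s' < Re s"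
  shows "summable (\<lambda>m. y m * complex_of_real (real m + \<alpha>) powr (- s))"
  unfolding dirichlet_term_shift[OF \<alpha>(1), of y _ s s']
  by (rule dirichlet_uniform_limit(1)[OF \<alpha> _ s(1), of "Re (s - s')"]) (use s in auto)

text \<open>Dirichlet series converge to the right of a point of convergence, so points of D are
  reached from points of D further left. Q is the whole plane for holomorphy and a countable dense
  set for measurability.\<close>

lemma point_left_in_open:
  assumes D: "open D" "s \<in> D" and Q: "\<And>X. open X \<Longrightarrow> X \<noteq> {} \<Longrightarrow> \<exists>d\<in>Q. d \<in> (X :: complex set)"
  obtains s' where "s' \<in> Q" "s' \<in> D" "Re s' < Re s"
proof -
  obtain r where r: "r > 0" "ball s r \<subseteq> D" using D by (meson open_contains_ball)
  have "open (ball s r \<inter> {z. Re z < Re s})" by (intro open_Int open_ball open_halfspace_Re_lt)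
  moreover have "s - of_real (r / 2) \<in> ball s r \<inter> {z. Re z < Re s}" using r by (simp add: dist_norm)
  then have "ball s r \<inter> {z. Re z < Re s} \<noteq> {}" by blast
  ultimately obtain s' where "s' \<in> Q" "s' \<in> ball s r \<inter> {z. Re z < Re s}" using Q by blast
  then show ?thesis using r(2) by (intro that[of s']) auto
qed

text \<open>Around x, a point s' of D further left gives uniform convergence on a disc, once (m +
  \<alpha>)^(-s') is moved into the coefficients.\<close>

lemma dirichlet_holomorphic:
  assumes \<alpha>: "0 < \<alpha>" "\<alpha> \<le> 1" and D: "open D"
    and s: "\<And>s. s \<in> D \<Longrightarrow> summable (\<lambda>m. y m * complex_of_real (real m + \<alpha>) powr (- s))"
  shows "(\<lambda>s. \<Sum>m. y m * complex_of_real (real m + \<alpha>) powr (- s)) holomorphic_on D"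
proof (rule holomorphic_uniform_sequence[OF D])
  have ne: "complex_of_real (real m + \<alpha>) \<noteq> 0" for m using \<alpha> by (simp add: complex_eq_iff)
  show "(\<lambda>s. \<Sum>m<N. y m * complex_of_real (real m + \<alpha>) powr (- s)) holomorphic_on D" for N
    using ne by (intro holomorphic_intros)
  fix x assume x: "x \<in> D"
  obtain s' where s': "s' \<in> D" "Re s' < Re x"
    using point_left_in_open[OF D x, of UNIV] by blast
  obtain r where r: "r > 0" "cball x r \<subseteq> D" using D x open_contains_cball by blast
  define d where "d = min r ((Re x - Re s') / 2)"
  have d: "d > 0" "d \<le> r" "d \<le> (Re x - Re s') / 2" using r s' by (auto simp: d_def min_def)
  define y' where "y' = (\<lambda>m. y m * complex_of_real (real m + \<alpha>) powr (- s'))"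
  define \<eta> where "\<eta> = (Re x - Re s') / 2"
  define R where "R = cmod (x - s') + d"
  let ?W = "{w. Re w \<ge> \<eta> \<and> cmod w \<le> R}"
  have u: "uniform_limit ?W (\<lambda>N w. \<Sum>m<N. y' m * complex_of_real (real m + \<alpha>) powr (- w))
      (\<lambda>w. \<Sum>m. y' m * complex_of_real (real m + \<alpha>) powr (- w)) sequentially"
    by (rule dirichlet_uniform_limit(2)[OF \<alpha>]) (use s' s[OF s'(1)] in \<open>auto simp: \<eta>_def y'_def\<close>)
  have W: "z - s' \<in> ?W" if "z \<in> cball x d" for z
  proof -
    have n: "cmod (z - x) \<le> d" using that by (simp add: dist_norm norm_minus_commute)
    have "\<bar>Re (z - x)\<bar> \<le> d" using n abs_Re_le_cmod[of "z - x"] by linarith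
    moreover have "cmod (z - s') \<le> cmod (x - s') + cmod (z - x)" using norm_triangle_ineq[of "x - s'" "z - x"] by simp
    ultimately show ?thesis using n d by (auto simp: \<eta>_def R_def abs_le_iff field_simps)
  qed
  have "uniform_limit (cball x d) (\<lambda>N z. \<Sum>m<N. y m * complex_of_real (real m + \<alpha>) powr (- z))
      (\<lambda>z. \<Sum>m. y m * complex_of_real (real m + \<alpha>) powr (- z)) sequentially"
  proof (rule uniform_limitI)
    fix e :: real assume "e > 0"
    from uniform_limitD[OF u this]
    show "\<forall>\<^sub>F N in sequentially. \<forall>z\<in>cball x d. dist (\<Sum>m<N. y m * complex_of_real (real m + \<alpha>) powr (- z)) (\<Sum>m. y m * complex_of_real (real m + \<alpha>) powr (- z)) < e"
    proof eventually_elim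
      case (elim N)
      show ?case
      proof
        fix z assume "z \<in> cball x d"
        from bspec[OF elim W[OF this]]
        show "dist (\<Sum>m<N. y m * complex_of_real (real m + \<alpha>) powr (- z)) (\<Sum>m. y m * complex_of_real (real m + \<alpha>) powr (- z)) < e"
          unfolding y'_def dirichlet_term_shift[OF \<alpha>(1), of y _ z s', symmetric] .
      qed
    qed
  qed
  then show "\<exists>d>0. cball x d \<subseteq> D \<and> uniform_limit (cball x d) (\<lambda>N z. \<Sum>m<N. y m * complex_of_real (real m + \<alpha>) powr (- z))
      (\<lambda>z. \<Sum>m. y m * complex_of_real (real m + \<alpha>) powr (- z)) sequentially"
    using d r by (intro exI[of _ d]) auto
qed

section \<open>Borel measurability from measurable point evaluations\<close>

type_synonym box_index = "complex \<times> real \<times> complex \<times> real"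

text \<open>Each index asks that g stay within q of the constant w on the ball with centre c and
  radius r. The condition is closed, so it can be tested on a dense set of points; with data from
  countable sets, countably many boxes exhaust any open set, although a box itself is not claimed to
  be open.\<close>

definition hol_box :: "complex set \<Rightarrow> box_index set \<Rightarrow> (complex \<Rightarrow> complex) set" where
  "hol_box D L = {g \<in> hol_space D. \<forall>(c, r, w, q)\<in>L. \<forall>z\<in>ball c r. dist (g z) w \<le> q}"

definition box_indices :: "complex set \<Rightarrow> complex set \<Rightarrow> box_index set" where
  "box_indices Q D = {(c, r, w, q). c \<in> Q \<and> r \<in> \<rat> \<and> w \<in> Q \<and> q \<in> \<rat> \<and> ball c r \<subseteq> D}"

lemma countable_box_indices: "countable Q \<Longrightarrow> countable (box_indices Q D)"
proof -
  assume Q: "countable Q"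
  have "box_indices Q D \<subseteq> Q \<times> \<rat> \<times> Q \<times> \<rat>" by (auto simp: box_indices_def)
  moreover have "countable (Q \<times> (\<rat> :: real set) \<times> Q \<times> (\<rat> :: real set))"
    by (intro countable_SIGMA Q countable_rat)
  ultimately show ?thesis by (rule countable_subset)
qed

text \<open>The compact set K is covered by finitely many balls on which f is nearly constant;
  closeness to these constants on the balls forces closeness to f on K.\<close>

lemma hol_box_neighbourhood:
  assumes D: "open D" and Q: "\<And>X. open X \<Longrightarrow> X \<noteq> {} \<Longrightarrow> \<exists>d\<in>Q. d \<in> (X :: complex set)"
    and U: "openin (hol_topology D) U" and f: "f \<in> U"
  shows "\<exists>L. finite L \<and> L \<subseteq> box_indices Q D \<and> f \<in> hol_box D L \<and> hol_box D L \<subseteq> U"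
proof -
  obtain K e where K: "compact K" "K \<subseteq> D" "e > 0" "{g \<in> hol_space D. \<forall>z\<in>K. dist (g z) (f z) < e} \<subseteq> U"
    using U f unfolding openin_hol_topology by blast
  have fH: "f \<in> hol_space D" using U f unfolding openin_hol_topology by blast
  have cf: "continuous_on D f" using fH by (auto simp: hol_space_def intro: holomorphic_on_imp_continuous_on)
  have "\<exists>i. i \<in> box_indices Q D \<and> x \<in> ball (fst i) (fst (snd i)) \<and>
     (\<forall>z\<in>ball (fst i) (fst (snd i)). dist (f z) (fst (snd (snd i))) \<le> snd (snd (snd i))) \<and> snd (snd (snd i)) < e / 2" if x: "x \<in> K" for x
  proof -
    have xD: "x \<in> D" using x K by blast
    obtain r1 where r1: "r1 > 0" "ball x r1 \<subseteq> D" using D xD by (meson open_contains_ball)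
    obtain r2 where r2: "r2 > 0" "\<And>z. z \<in> D \<Longrightarrow> dist z x < r2 \<Longrightarrow> dist (f z) (f x) < e / 4"
      using cf xD K(3) unfolding continuous_on_iff by (metis zero_less_divide_iff zero_less_numeral)
    \<comment> \<open>Oscillation e/4 of f and error e/8 of w leave q between 3e/8 and e/2, so a
      function within q of w is within e of f. A centre within \<delta>/4 of x and a radius between
      \<delta>/4 and \<delta>/2 keep x in the ball and the ball within \<delta> of x.\<close>
    define \<delta> where "\<delta> = min r1 r2"
    have \<delta>: "\<delta> > 0" using r1 r2 by (simp add: \<delta>_def)
    obtain c where c: "c \<in> Q" "dist x c < \<delta> / 4" using Q[of "ball x (\<delta> / 4)"] \<delta> by auto
    obtain r where r: "r \<in> \<rat>" "\<delta> / 4 < r" "r < \<delta> / 2" using Rats_dense_in_real[of "\<delta> / 4" "\<delta> / 2"] \<delta> by auto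
    obtain w where w: "w \<in> Q" "dist (f x) w < e / 8" using Q[of "ball (f x) (e / 8)"] K(3) by auto
    obtain q where q: "q \<in> \<rat>" "3 * e / 8 < q" "q < e / 2" using Rats_dense_in_real[of "3 * e / 8" "e / 2"] K(3) by auto
    have near: "dist z x < \<delta>" if "z \<in> ball c r" for z
    proof -
      have "dist z x \<le> dist c z + dist x c" using dist_triangle[of z x c] by (simp add: dist_commute add.commute)
      then show ?thesis using that c r \<delta> by simp
    qed
    have inD: "z \<in> D" if "z \<in> ball c r" for z
      using near[OF that] r1(2) by (auto simp: \<delta>_def dist_commute)
    have "dist (f z) w \<le> q" if "z \<in> ball c r" for z
    proof -
      have "dist (f z) (f x) < e / 4" using r2(2)[OF inD[OF that]] near[OF that] by (simp add: \<delta>_def)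
      then show ?thesis using dist_triangle[of "f z" w "f x"] w q by linarith
    qed
    then show ?thesis
      by (intro exI[of _ "(c, r, w, q)"]) (use c r w q inD in \<open>auto simp: box_indices_def dist_commute\<close>)
  qed
  then have "\<forall>x\<in>K. \<exists>i. i \<in> box_indices Q D \<and> x \<in> ball (fst i) (fst (snd i)) \<and>
     (\<forall>z\<in>ball (fst i) (fst (snd i)). dist (f z) (fst (snd (snd i))) \<le> snd (snd (snd i))) \<and> snd (snd (snd i)) < e / 2" by (rule ballI)
  from bchoice[OF this] obtain I where "\<forall>x\<in>K. I x \<in> box_indices Q D \<and> x \<in> ball (fst (I x)) (fst (snd (I x))) \<and>
     (\<forall>z\<in>ball (fst (I x)) (fst (snd (I x))). dist (f z) (fst (snd (snd (I x)))) \<le> snd (snd (snd (I x)))) \<and> snd (snd (snd (I x))) < e / 2" ..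
  then have I: "\<And>x. x \<in> K \<Longrightarrow> I x \<in> box_indices Q D" "\<And>x. x \<in> K \<Longrightarrow> x \<in> ball (fst (I x)) (fst (snd (I x)))"
     "\<And>x z. x \<in> K \<Longrightarrow> z \<in> ball (fst (I x)) (fst (snd (I x))) \<Longrightarrow> dist (f z) (fst (snd (snd (I x)))) \<le> snd (snd (snd (I x)))"
     "\<And>x. x \<in> K \<Longrightarrow> snd (snd (snd (I x))) < e / 2" by simp_all
  have cover: "K \<subseteq> (\<Union>x\<in>K. ball (fst (I x)) (fst (snd (I x))))" using I(2) by blast
  obtain K' where K': "K' \<subseteq> K" "finite K'" "K \<subseteq> (\<Union>x\<in>K'. ball (fst (I x)) (fst (snd (I x))))"
    by (rule compactE_image[OF K(1), of K "\<lambda>x. ball (fst (I x)) (fst (snd (I x)))", OF open_ball cover]) (rule that)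
  have "f \<in> hol_box D (I ` K')"
    unfolding hol_box_def using fH I(3) K'(1) by (auto simp: case_prod_unfold)
  moreover have "hol_box D (I ` K') \<subseteq> U"
  proof
    fix g assume g: "g \<in> hol_box D (I ` K')"
    have "dist (g z) (f z) < e" if z: "z \<in> K" for z
    proof -
      obtain x where x: "x \<in> K'" "z \<in> ball (fst (I x)) (fst (snd (I x)))" using K'(3) z by blast
      have "dist (g z) (fst (snd (snd (I x)))) \<le> snd (snd (snd (I x)))"
        using g x unfolding hol_box_def by (auto simp: case_prod_unfold)
      moreover have xK: "x \<in> K" using x K' by blast
      ultimately show ?thesis
        using I(3)[OF xK x(2)] I(4)[OF xK] dist_triangle2[of "g z" "f z" "fst (snd (snd (I x)))"] by linarith
    qed
    then show "g \<in> U" using K(4) g unfolding hol_box_def by blast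
  qed
  ultimately show ?thesis using K' I(1) by (intro exI[of _ "I ` K'"]) auto
qed

text \<open>By continuity a bound on a ball is equivalent to the bound at the dense points in it,
  which makes the event a countable intersection.\<close>

lemma hol_box_measurable:
  assumes Qc: "countable Q" and Q: "\<And>X. open X \<Longrightarrow> X \<noteq> {} \<Longrightarrow> \<exists>d\<in>Q. d \<in> (X :: complex set)"
    and L: "finite L" "L \<subseteq> box_indices Q D"
    and X: "\<And>\<omega>. \<omega> \<in> space M \<Longrightarrow> X \<omega> \<in> hol_space D" "\<And>z. z \<in> D \<Longrightarrow> (\<lambda>\<omega>. X \<omega> z) \<in> borel_measurable M"
  shows "{\<omega> \<in> space M. X \<omega> \<in> hol_box D L} \<in> sets M"
proof -
  have eq: "(\<forall>z\<in>ball c r. dist (X \<omega> z) w \<le> q) \<longleftrightarrow> (\<forall>z\<in>Q \<inter> ball c r. dist (X \<omega> z) w \<le> q)"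
    if w: "\<omega> \<in> space M" and b: "ball c r \<subseteq> D" for \<omega> c r w q
  proof
    assume *: "\<forall>z\<in>Q \<inter> ball c r. dist (X \<omega> z) w \<le> q"
    show "\<forall>z\<in>ball c r. dist (X \<omega> z) w \<le> q"
    proof (rule ccontr)
      assume "\<not> (\<forall>z\<in>ball c r. dist (X \<omega> z) w \<le> q)"
      then obtain z where z: "z \<in> ball c r" "dist (X \<omega> z) w > q" by auto
      have "continuous_on (ball c r) (X \<omega>)"
        using X(1)[OF w] b by (auto simp: hol_space_def intro: holomorphic_on_imp_continuous_on holomorphic_on_subset)
      then have "continuous_on (ball c r) (\<lambda>z. dist (X \<omega> z) w)" by (intro continuous_intros)
      then have "open (ball c r \<inter> (\<lambda>z. dist (X \<omega> z) w) -` {q<..})"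
        by (rule continuous_open_preimage) auto
      moreover have "z \<in> ball c r \<inter> (\<lambda>z. dist (X \<omega> z) w) -` {q<..}" using z by simp
      ultimately obtain d where "d \<in> Q" "d \<in> ball c r \<inter> (\<lambda>z. dist (X \<omega> z) w) -` {q<..}" using Q by blast
      then have "dist (X \<omega> d) w \<le> q" "q < dist (X \<omega> d) w" using * by auto
      then show False by simp
    qed
  qed auto
  have one: "{\<omega> \<in> space M. \<forall>z\<in>ball c r. dist (X \<omega> z) w \<le> q} \<in> sets M" if "(c, r, w, q) \<in> L" for c r w q
  proof -
    have b: "ball c r \<subseteq> D" using L(2) that by (auto simp: box_indices_def)
    have "{\<omega> \<in> space M. \<forall>z\<in>ball c r. dist (X \<omega> z) w \<le> q} = {\<omega> \<in> space M. \<forall>z\<in>Q \<inter> ball c r. dist (X \<omega> z) w \<le> q}"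
      using eq[OF _ b] by blast
    also have "\<dots> \<in> sets M"
    proof (rule sets.sets_Collect_countable_All')
      show "countable (Q \<inter> ball c r)" using Qc by blast
      fix z assume "z \<in> Q \<inter> ball c r"
      then have [measurable]: "(\<lambda>\<omega>. X \<omega> z) \<in> borel_measurable M" using X(2) b by blast
      show "{\<omega> \<in> space M. dist (X \<omega> z) w \<le> q} \<in> sets M" by measurable
    qed
    finally show ?thesis .
  qed
  have "{\<omega> \<in> space M. X \<omega> \<in> hol_box D L} = {\<omega> \<in> space M. \<forall>i\<in>L. \<forall>z\<in>ball (fst i) (fst (snd i)). dist (X \<omega> z) (fst (snd (snd i))) \<le> snd (snd (snd i))}"
    using X(1) unfolding hol_box_def by (auto simp: case_prod_unfold)
  also have "\<dots> \<in> sets M"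
    by (rule sets.sets_Collect_countable_All'[OF _ countable_finite[OF L(1)]]) (use one in auto)
  finally show ?thesis .
qed

text \<open>Every open set of the product is a countable union of products of boxes. Measurable
  point evaluations therefore suffice for the Borel field of locally uniform convergence.\<close>

lemma hol_pair_measurable:
  assumes D: "open D\<^sub>1" "open D\<^sub>2"
    and X: "\<And>\<omega>. \<omega> \<in> space M \<Longrightarrow> X \<omega> \<in> hol_space D\<^sub>1" "\<And>z. z \<in> D\<^sub>1 \<Longrightarrow> (\<lambda>\<omega>. X \<omega> z) \<in> borel_measurable M"
    and Y: "\<And>\<omega>. \<omega> \<in> space M \<Longrightarrow> Y \<omega> \<in> hol_space D\<^sub>2" "\<And>z. z \<in> D\<^sub>2 \<Longrightarrow> (\<lambda>\<omega>. Y \<omega> z) \<in> borel_measurable M"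
  shows "(\<lambda>\<omega>. (X \<omega>, Y \<omega>)) \<in> M \<rightarrow>\<^sub>M borel_of (H_prod D\<^sub>1 D\<^sub>2)"
proof -
  obtain Q :: "complex set" where Q: "countable Q" "\<And>X. open X \<Longrightarrow> X \<noteq> {} \<Longrightarrow> \<exists>d\<in>Q. d \<in> X"
    using countable_dense_setE by blast
  let ?B1 = "{L. L \<subseteq> box_indices Q D\<^sub>1 \<and> finite L}" and ?B2 = "{L. L \<subseteq> box_indices Q D\<^sub>2 \<and> finite L}"
  have cB: "countable ?B1" "countable ?B2"
    using countable_Collect_finite_subset[OF countable_box_indices[OF Q(1)]] by (simp_all add: conj_commute)
  show ?thesis
    unfolding borel_of_def
  proof (rule measurable_measure_of)
    show "{U. openin (H_prod D\<^sub>1 D\<^sub>2) U} \<subseteq> Pow (topspace (H_prod D\<^sub>1 D\<^sub>2))" by (auto dest: openin_subset)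
    show "(\<lambda>\<omega>. (X \<omega>, Y \<omega>)) \<in> space M \<rightarrow> topspace (H_prod D\<^sub>1 D\<^sub>2)" using X(1) Y(1) by (simp add: H_prod_def)
    fix W assume "W \<in> {U. openin (H_prod D\<^sub>1 D\<^sub>2) U}"
    then have W: "openin (prod_topology (hol_topology D\<^sub>1) (hol_topology D\<^sub>2)) W" by (simp add: H_prod_def)
    define P where "P = {p \<in> ?B1 \<times> ?B2. hol_box D\<^sub>1 (fst p) \<times> hol_box D\<^sub>2 (snd p) \<subseteq> W}"
    have cP: "countable P" unfolding P_def by (rule countable_subset[of _ "?B1 \<times> ?B2"]) (auto intro: countable_SIGMA cB)
    have Weq: "W = (\<Union>p\<in>P. hol_box D\<^sub>1 (fst p) \<times> hol_box D\<^sub>2 (snd p))"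
    proof
      show "(\<Union>p\<in>P. hol_box D\<^sub>1 (fst p) \<times> hol_box D\<^sub>2 (snd p)) \<subseteq> W" unfolding P_def by blast
      show "W \<subseteq> (\<Union>p\<in>P. hol_box D\<^sub>1 (fst p) \<times> hol_box D\<^sub>2 (snd p))"
      proof
        fix fg assume fg: "fg \<in> W"
        obtain f g where fg': "fg = (f, g)" by (cases fg)
        obtain U V where UV: "openin (hol_topology D\<^sub>1) U" "openin (hol_topology D\<^sub>2) V" "f \<in> U" "g \<in> V" "U \<times> V \<subseteq> W"
          using W[unfolded openin_prod_topology_alt, rule_format, OF fg[unfolded fg']] by (elim exE conjE) (rule that)
        obtain L1 where L1: "finite L1" "L1 \<subseteq> box_indices Q D\<^sub>1" "f \<in> hol_box D\<^sub>1 L1" "hol_box D\<^sub>1 L1 \<subseteq> U"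
          using hol_box_neighbourhood[OF D(1) Q(2) UV(1,3)] by blast
        obtain L2 where L2: "finite L2" "L2 \<subseteq> box_indices Q D\<^sub>2" "g \<in> hol_box D\<^sub>2 L2" "hol_box D\<^sub>2 L2 \<subseteq> V"
          using hol_box_neighbourhood[OF D(2) Q(2) UV(2,4)] by blast
        have "hol_box D\<^sub>1 L1 \<times> hol_box D\<^sub>2 L2 \<subseteq> W" using L1(4) L2(4) UV(5) by blast
        then have "(L1, L2) \<in> P" unfolding P_def using L1 L2 by simp
        then show "fg \<in> (\<Union>p\<in>P. hol_box D\<^sub>1 (fst p) \<times> hol_box D\<^sub>2 (snd p))" unfolding fg' using L1(3) L2(3) by force
      qed
    qed
    have "(\<lambda>\<omega>. (X \<omega>, Y \<omega>)) -` W \<inter> space M = (\<Union>p\<in>P. {\<omega> \<in> space M. X \<omega> \<in> hol_box D\<^sub>1 (fst p)} \<inter> {\<omega> \<in> space M. Y \<omega> \<in> hol_box D\<^sub>2 (snd p)})"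
      unfolding Weq by auto
    also have "\<dots> \<in> sets M"
    proof (rule sets.countable_UN'[OF cP], rule image_subsetI)
      fix p assume "p \<in> P"
      then have p: "finite (fst p)" "fst p \<subseteq> box_indices Q D\<^sub>1" "finite (snd p)" "snd p \<subseteq> box_indices Q D\<^sub>2"
        by (auto simp: P_def)
      show "{\<omega> \<in> space M. X \<omega> \<in> hol_box D\<^sub>1 (fst p)} \<inter> {\<omega> \<in> space M. Y \<omega> \<in> hol_box D\<^sub>2 (snd p)} \<in> sets M"
        by (rule sets.Int[OF hol_box_measurable[OF Q p(1,2) X] hol_box_measurable[OF Q p(3,4) Y]])
    qed
    finally show "(\<lambda>\<omega>. (X \<omega>, Y \<omega>)) -` W \<inter> space M \<in> sets M" .
  qed
qed

lemma continuous_map_measurable: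
  assumes "continuous_map T euclideanreal F"
  shows "F \<in> borel_measurable (borel_of T)"
proof (rule borel_measurableI)
  fix S :: "real set" assume "open S"
  then have "openin T {x \<in> topspace T. F x \<in> S}" using openin_continuous_map_preimage[OF assms] by simp
  moreover have "F -` S \<inter> space (borel_of T) = {x \<in> topspace T. F x \<in> S}" by auto
  ultimately show "F -` S \<inter> space (borel_of T) \<in> sets (borel_of T)" unfolding sets_borel_of by (simp add: sigma_sets.Basic)
qed

subsection \<open>Reduction to Lipschitz functionals\<close>

text \<open>Lipschitz for the seminorms uniform on two compact sets. An arbitrary bound d stands in
  for the supremum, so that empty compact sets need no separate treatment.\<close>

definition hol_lipschitz ::
  "complex set \<Rightarrow> complex set \<Rightarrow> complex set \<Rightarrow> complex set \<Rightarrow> real \<Rightarrow> ((complex \<Rightarrow> complex) \<times> (complex \<Rightarrow> complex) \<Rightarrow> real) \<Rightarrow> bool" where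
  "hol_lipschitz D\<^sub>1 D\<^sub>2 C\<^sub>1 C\<^sub>2 L G \<longleftrightarrow> compact C\<^sub>1 \<and> C\<^sub>1 \<subseteq> D\<^sub>1 \<and> compact C\<^sub>2 \<and> C\<^sub>2 \<subseteq> D\<^sub>2 \<and> L \<ge> 0 \<and>
     (\<forall>x\<in>hol_space D\<^sub>1 \<times> hol_space D\<^sub>2. \<forall>y\<in>hol_space D\<^sub>1 \<times> hol_space D\<^sub>2. \<forall>d\<ge>0.
        (\<forall>z\<in>C\<^sub>1. dist (fst x z) (fst y z) \<le> d) \<and> (\<forall>z\<in>C\<^sub>2. dist (snd x z) (snd y z) \<le> d) \<longrightarrow> \<bar>G x - G y\<bar> \<le> L * d)"

lemma hol_lipschitzD:
  assumes "hol_lipschitz D\<^sub>1 D\<^sub>2 C\<^sub>1 C\<^sub>2 L G" "x \<in> hol_space D\<^sub>1 \<times> hol_space D\<^sub>2" "y \<in> hol_space D\<^sub>1 \<times> hol_space D\<^sub>2" "d \<ge> 0"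
    "\<And>z. z \<in> C\<^sub>1 \<Longrightarrow> dist (fst x z) (fst y z) \<le> d" "\<And>z. z \<in> C\<^sub>2 \<Longrightarrow> dist (snd x z) (snd y z) \<le> d"
  shows "\<bar>G x - G y\<bar> \<le> L * d"
  using assms unfolding hol_lipschitz_def by blast

text \<open>The distance to f attains its maximum on the compact set K, which leaves a margin d
  below e around each member.\<close>

lemma openin_hol_ball:
  assumes K: "compact K" "K \<subseteq> D" and f: "f \<in> hol_space D"
  shows "openin (hol_topology D) {g \<in> hol_space D. \<forall>z\<in>K. dist (g z) (f z) < e}"
  unfolding openin_hol_topology
proof (intro conjI ballI)
  fix g assume "g \<in> {g \<in> hol_space D. \<forall>z\<in>K. dist (g z) (f z) < e}"
  then have g: "g \<in> hol_space D" "\<And>z. z \<in> K \<Longrightarrow> dist (g z) (f z) < e" by auto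
  have c: "continuous_on K u" if "u \<in> hol_space D" for u
    using that K(2) unfolding hol_space_def by (auto intro: holomorphic_on_imp_continuous_on holomorphic_on_subset)
  have "\<exists>d>0. \<forall>z\<in>K. dist (g z) (f z) + d \<le> e"
  proof (cases "K = {}")
    case False
    have "continuous_on K (\<lambda>z. dist (g z) (f z))" by (intro continuous_intros c g f)
    from continuous_attains_sup[OF K(1) False this] obtain x where x: "x \<in> K" "\<And>z. z \<in> K \<Longrightarrow> dist (g z) (f z) \<le> dist (g x) (f x)" by blast
    show ?thesis using g(2)[OF x(1)] x(2) by (intro exI[of _ "e - dist (g x) (f x)"]) auto
  qed (auto intro: exI[of _ 1])
  then obtain d where d: "d > 0" "\<And>z. z \<in> K \<Longrightarrow> dist (g z) (f z) + d \<le> e" by blast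
  show "\<exists>K' d. compact K' \<and> K' \<subseteq> D \<and> d > 0 \<and> {g' \<in> hol_space D. \<forall>z\<in>K'. dist (g' z) (g z) < d} \<subseteq> {g \<in> hol_space D. \<forall>z\<in>K. dist (g z) (f z) < e}"
  proof (intro exI conjI)
    show "{g' \<in> hol_space D. \<forall>z\<in>K. dist (g' z) (g z) < d} \<subseteq> {g \<in> hol_space D. \<forall>z\<in>K. dist (g z) (f z) < e}"
    proof safe
      fix g' z assume g': "\<forall>z\<in>K. dist (g' z) (g z) < d" and z: "z \<in> K"
      show "dist (g' z) (f z) < e"
        using g' z d(2)[OF z] dist_triangle[of "g' z" "f z" "g z"] by fastforce
    qed
  qed (use K d in auto)
qed auto

lemma hol_lipschitz_continuous_map:
  assumes G: "hol_lipschitz D\<^sub>1 D\<^sub>2 C\<^sub>1 C\<^sub>2 L G"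
  shows "continuous_map (H_prod D\<^sub>1 D\<^sub>2) euclideanreal G"
  unfolding continuous_map_def
proof (intro conjI allI impI)
  have C: "compact C\<^sub>1" "C\<^sub>1 \<subseteq> D\<^sub>1" "compact C\<^sub>2" "C\<^sub>2 \<subseteq> D\<^sub>2" "L \<ge> 0" using G unfolding hol_lipschitz_def by blast+
  fix U assume "openin euclideanreal U"
  then have U: "open U" by simp
  show "openin (H_prod D\<^sub>1 D\<^sub>2) {x \<in> topspace (H_prod D\<^sub>1 D\<^sub>2). G x \<in> U}"
    unfolding H_prod_def openin_prod_topology_alt
  proof (intro allI impI)
    fix f g assume fg: "(f, g) \<in> {x \<in> topspace (prod_topology (hol_topology D\<^sub>1) (hol_topology D\<^sub>2)). G x \<in> U}"
    then have fg': "f \<in> hol_space D\<^sub>1" "g \<in> hol_space D\<^sub>2" "G (f, g) \<in> U" by auto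
    obtain e where e: "e > 0" "\<And>y. \<bar>y - G (f, g)\<bar> < e \<Longrightarrow> y \<in> U"
      using U fg'(3) unfolding open_dist by (metis dist_real_def)
    define d where "d = e / (L + 1)"
    have d: "d > 0" using e C by (simp add: d_def)
    have Ld: "L * d < e"
    proof -
      have "(L + 1) * d = e" using C by (simp add: d_def)
      then show ?thesis using d by (simp add: distrib_right)
    qed
    let ?A = "{u \<in> hol_space D\<^sub>1. \<forall>z\<in>C\<^sub>1. dist (u z) (f z) < d}" and ?B = "{u \<in> hol_space D\<^sub>2. \<forall>z\<in>C\<^sub>2. dist (u z) (g z) < d}"
    have "?A \<times> ?B \<subseteq> {x \<in> topspace (prod_topology (hol_topology D\<^sub>1) (hol_topology D\<^sub>2)). G x \<in> U}"
    proof
      fix y assume y: "y \<in> ?A \<times> ?B"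
      have "\<bar>G y - G (f, g)\<bar> \<le> L * d"
        by (rule hol_lipschitzD[OF G]) (use y fg' d in \<open>auto intro: less_imp_le\<close>)
      then have "G y \<in> U" using Ld by (intro e(2)) simp
      then show "y \<in> {x \<in> topspace (prod_topology (hol_topology D\<^sub>1) (hol_topology D\<^sub>2)). G x \<in> U}" using y by auto
    qed
    moreover have "openin (hol_topology D\<^sub>1) ?A" "openin (hol_topology D\<^sub>2) ?B"
      by (rule openin_hol_ball[OF C(1,2) fg'(1)], rule openin_hol_ball[OF C(3,4) fg'(2)])
    moreover have "f \<in> ?A" "g \<in> ?B" using fg' d by auto
    ultimately show "\<exists>U' V. openin (hol_topology D\<^sub>1) U' \<and> openin (hol_topology D\<^sub>2) V \<and> f \<in> U' \<and> g \<in> V \<and>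
        U' \<times> V \<subseteq> {x \<in> topspace (prod_topology (hol_topology D\<^sub>1) (hol_topology D\<^sub>2)). G x \<in> U}"
      by (intro exI conjI)
  qed
qed auto

text \<open>Infimal convolution of \<open>F\<close> with \<open>j\<close> times the distance uniform on \<open>A\<close> and \<open>B\<close>.\<close>

definition inf_conv where
  "inf_conv D\<^sub>1 D\<^sub>2 A B j F x = Inf {F y + real j * d |y d. y \<in> hol_space D\<^sub>1 \<times> hol_space D\<^sub>2 \<and> d \<ge> 0 \<and>
     (\<forall>z\<in>A. dist (fst x z) (fst y z) \<le> d) \<and> (\<forall>z\<in>B. dist (snd x z) (snd y z) \<le> d)}"

lemma inf_conv_properties:
  fixes F :: "(complex \<Rightarrow> complex) \<times> (complex \<Rightarrow> complex) \<Rightarrow> real"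
  assumes F: "\<And>y. y \<in> hol_space D\<^sub>1 \<times> hol_space D\<^sub>2 \<Longrightarrow> \<bar>F y\<bar> \<le> M" and x: "x \<in> hol_space D\<^sub>1 \<times> hol_space D\<^sub>2"
  shows "- M \<le> inf_conv D\<^sub>1 D\<^sub>2 A B j F x" "inf_conv D\<^sub>1 D\<^sub>2 A B j F x \<le> F x"
    and "\<And>x' d. x' \<in> hol_space D\<^sub>1 \<times> hol_space D\<^sub>2 \<Longrightarrow> d \<ge> 0 \<Longrightarrow> (\<forall>z\<in>A. dist (fst x z) (fst x' z) \<le> d) \<Longrightarrow>
      (\<forall>z\<in>B. dist (snd x z) (snd x' z) \<le> d) \<Longrightarrow> inf_conv D\<^sub>1 D\<^sub>2 A B j F x \<le> inf_conv D\<^sub>1 D\<^sub>2 A B j F x' + real j * d"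
    and "\<And>c. (\<And>y d. y \<in> hol_space D\<^sub>1 \<times> hol_space D\<^sub>2 \<Longrightarrow> d \<ge> 0 \<Longrightarrow> (\<forall>z\<in>A. dist (fst x z) (fst y z) \<le> d) \<Longrightarrow>
      (\<forall>z\<in>B. dist (snd x z) (snd y z) \<le> d) \<Longrightarrow> c \<le> F y + real j * d) \<Longrightarrow> c \<le> inf_conv D\<^sub>1 D\<^sub>2 A B j F x"
proof -
  let ?S = "\<lambda>x. {F y + real j * d |y d. y \<in> hol_space D\<^sub>1 \<times> hol_space D\<^sub>2 \<and> d \<ge> 0 \<and>
     (\<forall>z\<in>A. dist (fst x z) (fst y z) \<le> d) \<and> (\<forall>z\<in>B. dist (snd x z) (snd y z) \<le> d)}"
  have mem: "F x + real j * 0 \<in> ?S x" if "x \<in> hol_space D\<^sub>1 \<times> hol_space D\<^sub>2" for x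
    using that by (intro CollectI exI[of _ x] exI[of _ 0]) simp
  have lb: "- M \<le> v" if "v \<in> ?S x" for v x
  proof -
    from that obtain y d where "v = F y + real j * d" "y \<in> hol_space D\<^sub>1 \<times> hol_space D\<^sub>2" "d \<ge> 0" by blast
    then show ?thesis using F[of y] by (simp add: abs_le_iff add_increasing2)
  qed
  have bdd: "bdd_below (?S x)" for x by (rule bdd_belowI[of _ "- M"]) (rule lb)
  have ne: "?S x \<noteq> {}" if "x \<in> hol_space D\<^sub>1 \<times> hol_space D\<^sub>2" for x using mem[OF that] by blast
  show "- M \<le> inf_conv D\<^sub>1 D\<^sub>2 A B j F x"
    unfolding inf_conv_def by (rule cInf_greatest[OF ne[OF x] lb])
  show "inf_conv D\<^sub>1 D\<^sub>2 A B j F x \<le> F x"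
    unfolding inf_conv_def using cInf_lower[OF mem[OF x] bdd] by simp
  show "c \<le> inf_conv D\<^sub>1 D\<^sub>2 A B j F x" if "\<And>y d. y \<in> hol_space D\<^sub>1 \<times> hol_space D\<^sub>2 \<Longrightarrow> d \<ge> 0 \<Longrightarrow> (\<forall>z\<in>A. dist (fst x z) (fst y z) \<le> d) \<Longrightarrow>
      (\<forall>z\<in>B. dist (snd x z) (snd y z) \<le> d) \<Longrightarrow> c \<le> F y + real j * d" for c
    unfolding inf_conv_def
  proof (rule cInf_greatest[OF ne[OF x]])
    fix v assume "v \<in> ?S x"
    then obtain y d where "v = F y + real j * d" "y \<in> hol_space D\<^sub>1 \<times> hol_space D\<^sub>2" "d \<ge> 0"
      "\<forall>z\<in>A. dist (fst x z) (fst y z) \<le> d" "\<forall>z\<in>B. dist (snd x z) (snd y z) \<le> d" by blast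
    then show "c \<le> v" using that[of y d] by simp
  qed
  show "inf_conv D\<^sub>1 D\<^sub>2 A B j F x \<le> inf_conv D\<^sub>1 D\<^sub>2 A B j F x' + real j * d"
    if x': "x' \<in> hol_space D\<^sub>1 \<times> hol_space D\<^sub>2" and d: "d \<ge> 0" "\<forall>z\<in>A. dist (fst x z) (fst x' z) \<le> d"
      "\<forall>z\<in>B. dist (snd x z) (snd x' z) \<le> d" for x' d
  proof -
    have "inf_conv D\<^sub>1 D\<^sub>2 A B j F x - real j * d \<le> inf_conv D\<^sub>1 D\<^sub>2 A B j F x'"
      unfolding inf_conv_def[of _ _ _ _ _ _ x']
    proof (rule cInf_greatest[OF ne[OF x']])
      fix v assume "v \<in> ?S x'"
      then obtain y d' where y: "v = F y + real j * d'" "y \<in> hol_space D\<^sub>1 \<times> hol_space D\<^sub>2" "d' \<ge> 0"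
        "\<forall>z\<in>A. dist (fst x' z) (fst y z) \<le> d'" "\<forall>z\<in>B. dist (snd x' z) (snd y z) \<le> d'" by blast
      have 1: "dist (fst x z) (fst y z) \<le> d + d'" if "z \<in> A" for z
        by (rule order.trans[OF dist_triangle[of "fst x z" "fst y z" "fst x' z"] add_mono[OF bspec[OF d(2) that] bspec[OF y(4) that]]])
      have 2: "dist (snd x z) (snd y z) \<le> d + d'" if "z \<in> B" for z
        by (rule order.trans[OF dist_triangle[of "snd x z" "snd y z" "snd x' z"] add_mono[OF bspec[OF d(3) that] bspec[OF y(5) that]]])
      have "F y + real j * (d + d') \<in> ?S x"
        by (intro CollectI exI[of _ y] exI[of _ "d + d'"] conjI refl) (use y 1 2 d in auto)
      from cInf_lower[OF this bdd] have "inf_conv D\<^sub>1 D\<^sub>2 A B j F x \<le> F y + real j * (d + d')" unfolding inf_conv_def .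
      then show "inf_conv D\<^sub>1 D\<^sub>2 A B j F x - real j * d \<le> v" unfolding y(1) by (simp add: distrib_left)
    qed
    then show ?thesis by simp
  qed
qed

lemma inf_conv_lipschitz:
  assumes F: "\<And>y. y \<in> hol_space D\<^sub>1 \<times> hol_space D\<^sub>2 \<Longrightarrow> \<bar>F y\<bar> \<le> M"
    and C: "compact A" "A \<subseteq> D\<^sub>1" "compact B" "B \<subseteq> D\<^sub>2"
  shows "hol_lipschitz D\<^sub>1 D\<^sub>2 A B (real j) (inf_conv D\<^sub>1 D\<^sub>2 A B j F)"
  unfolding hol_lipschitz_def
proof (intro conjI C ballI allI impI)
  fix x y d assume x: "x \<in> hol_space D\<^sub>1 \<times> hol_space D\<^sub>2" and y: "y \<in> hol_space D\<^sub>1 \<times> hol_space D\<^sub>2" and d: "(0::real) \<le> d"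
    and xy: "(\<forall>z\<in>A. dist (fst x z) (fst y z) \<le> d) \<and> (\<forall>z\<in>B. dist (snd x z) (snd y z) \<le> d)"
  have "inf_conv D\<^sub>1 D\<^sub>2 A B j F x \<le> inf_conv D\<^sub>1 D\<^sub>2 A B j F y + real j * d"
    by (rule inf_conv_properties(3)[OF F x y d]) (use xy in auto)
  moreover have "inf_conv D\<^sub>1 D\<^sub>2 A B j F y \<le> inf_conv D\<^sub>1 D\<^sub>2 A B j F x + real j * d"
    by (rule inf_conv_properties(3)[OF F y x d]) (use xy in \<open>auto simp: dist_commute\<close>)
  ultimately show "\<bar>inf_conv D\<^sub>1 D\<^sub>2 A B j F x - inf_conv D\<^sub>1 D\<^sub>2 A B j F y\<bar> \<le> real j * d" by linarith
qed simp

text \<open>A competitor at distance below \<eta> lies in a neighbourhood where F exceeds F x - r/2;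
  for a farther one the penalty reaches 2 M, the most by which values of F can differ. The compact
  sets must eventually contain those defining the neighbourhood, hence the exhaustion.\<close>

lemma inf_conv_tendsto:
  assumes F: "\<And>y. y \<in> hol_space D\<^sub>1 \<times> hol_space D\<^sub>2 \<Longrightarrow> \<bar>F y\<bar> \<le> M"
    and cont: "continuous_map (H_prod D\<^sub>1 D\<^sub>2) euclideanreal F"
    and A: "\<And>K. compact K \<Longrightarrow> K \<subseteq> D\<^sub>1 \<Longrightarrow> \<exists>N. \<forall>n\<ge>N. K \<subseteq> A n"
    and B: "\<And>K. compact K \<Longrightarrow> K \<subseteq> D\<^sub>2 \<Longrightarrow> \<exists>N. \<forall>n\<ge>N. K \<subseteq> B n"
    and x: "x \<in> hol_space D\<^sub>1 \<times> hol_space D\<^sub>2"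
  shows "(\<lambda>j. inf_conv D\<^sub>1 D\<^sub>2 (A j) (B j) j F x) \<longlonglongrightarrow> F x"
proof (rule LIMSEQ_I)
  fix r :: real assume r: "r > 0"
  obtain f g where fg: "x = (f, g)" by (cases x)
  have "openin (prod_topology (hol_topology D\<^sub>1) (hol_topology D\<^sub>2)) {y \<in> topspace (H_prod D\<^sub>1 D\<^sub>2). F y \<in> {F x - r / 2<..}}"
    using openin_continuous_map_preimage[OF cont, of "{F x - r / 2<..}"] by (simp add: H_prod_def)
  moreover have "(f, g) \<in> {y \<in> topspace (H_prod D\<^sub>1 D\<^sub>2). F y \<in> {F x - r / 2<..}}" using x r by (simp add: H_prod_def fg)
  ultimately obtain U V where UV: "openin (hol_topology D\<^sub>1) U" "openin (hol_topology D\<^sub>2) V" "f \<in> U" "g \<in> V"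
    "U \<times> V \<subseteq> {y \<in> topspace (H_prod D\<^sub>1 D\<^sub>2). F y \<in> {F x - r / 2<..}}"
    unfolding openin_prod_topology_alt by meson
  obtain K1 e1 where K1: "compact K1" "K1 \<subseteq> D\<^sub>1" "e1 > 0" "{u \<in> hol_space D\<^sub>1. \<forall>z\<in>K1. dist (u z) (f z) < e1} \<subseteq> U"
    using UV(1,3) unfolding openin_hol_topology by blast
  obtain K2 e2 where K2: "compact K2" "K2 \<subseteq> D\<^sub>2" "e2 > 0" "{u \<in> hol_space D\<^sub>2. \<forall>z\<in>K2. dist (u z) (g z) < e2} \<subseteq> V"
    using UV(2,4) unfolding openin_hol_topology by blast
  obtain N1 where N1: "\<And>n. n \<ge> N1 \<Longrightarrow> K1 \<subseteq> A n" using A[OF K1(1,2)] by blast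
  obtain N2 where N2: "\<And>n. n \<ge> N2 \<Longrightarrow> K2 \<subseteq> B n" using B[OF K2(1,2)] by blast
  define \<eta> where "\<eta> = min e1 e2"
  have \<eta>: "\<eta> > 0" using K1 K2 by (simp add: \<eta>_def)
  obtain N3 :: nat where N3: "2 * M / \<eta> \<le> real N3" using real_arch_simple by blast
  show "\<exists>N. \<forall>j\<ge>N. norm (inf_conv D\<^sub>1 D\<^sub>2 (A j) (B j) j F x - F x) < r"
  proof (intro exI allI impI)
    fix j assume j: "j \<ge> max N1 (max N2 N3)"
    have "F x - r / 2 \<le> inf_conv D\<^sub>1 D\<^sub>2 (A j) (B j) j F x"
    proof (rule inf_conv_properties(4)[OF F x])
      fix y d assume y: "y \<in> hol_space D\<^sub>1 \<times> hol_space D\<^sub>2" and d: "d \<ge> 0"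
        and dA: "\<forall>z\<in>A j. dist (fst x z) (fst y z) \<le> d" and dB: "\<forall>z\<in>B j. dist (snd x z) (snd y z) \<le> d"
      show "F x - r / 2 \<le> F y + real j * d"
      proof (cases "d < \<eta>")
        case True
        have "fst y \<in> U"
        proof (rule subsetD[OF K1(4)], intro CollectI conjI ballI)
          fix z assume z: "z \<in> K1"
          then have "z \<in> A j" using N1[of j] j by auto
          from bspec[OF dA this] show "dist (fst y z) (f z) < e1" using True by (simp add: \<eta>_def fg dist_commute)
        qed (use y in auto)
        moreover have "snd y \<in> V"
        proof (rule subsetD[OF K2(4)], intro CollectI conjI ballI)
          fix z assume z: "z \<in> K2"
          then have "z \<in> B j" using N2[of j] j by auto
          from bspec[OF dB this] show "dist (snd y z) (g z) < e2" using True by (simp add: \<eta>_def fg dist_commute)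
        qed (use y in auto)
        ultimately have "y \<in> U \<times> V" by (simp add: mem_Times_iff)
        with UV(5) have "F y > F x - r / 2" by blast
        then show ?thesis using d by (simp add: add_increasing2 less_imp_le)
      next
        case False
        have "2 * M \<le> real N3 * \<eta>" using N3 \<eta> by (simp add: pos_divide_le_eq)
        also have "\<dots> \<le> real j * d" using j False \<eta> by (intro mult_mono) auto
        finally have "2 * M \<le> real j * d" .
        then show ?thesis using F[OF x] F[OF y] r by linarith
      qed
    qed
    moreover have "inf_conv D\<^sub>1 D\<^sub>2 (A j) (B j) j F x \<le> F x" by (rule inf_conv_properties(2)[OF F x])
    ultimately show "norm (inf_conv D\<^sub>1 D\<^sub>2 (A j) (B j) j F x - F x) < r" using r by simp
  qed
qed

section \<open>From Lipschitz functionals to bounded continuous ones\<close>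

lemma compact_exhaustion:
  assumes "open (D :: complex set)"
  shows "\<exists>A. (\<forall>n::nat. compact (A n) \<and> A n \<subseteq> D) \<and> (\<forall>K. compact K \<and> K \<subseteq> D \<longrightarrow> (\<exists>N. \<forall>n\<ge>N. K \<subseteq> A n))"
proof (rule open_Union_compact_subsets[OF assms])
  fix C :: "nat \<Rightarrow> complex set"
  assume "\<And>n. compact (C n)" "\<And>n. C n \<subseteq> D" "\<And>K. compact K \<Longrightarrow> K \<subseteq> D \<Longrightarrow> \<exists>N. \<forall>n\<ge>N. K \<subseteq> C n"
  then show ?thesis by (intro exI[of _ C]) simp
qed

text \<open>The Lipschitz minorants lie below F, so their averages bound those of F from below; by
  dominated convergence one of them has its integral within r/2 of that of F.\<close>

lemma portmanteau_lower:
  assumes D: "open D\<^sub>1" "open D\<^sub>2" and P: "prob_space P"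
    and Z: "Z \<in> P \<rightarrow>\<^sub>M borel_of (H_prod D\<^sub>1 D\<^sub>2)" and X: "\<And>k::nat. X k \<in> hol_space D\<^sub>1 \<times> hol_space D\<^sub>2"
    and lip: "\<And>C\<^sub>1 C\<^sub>2 L G B. hol_lipschitz D\<^sub>1 D\<^sub>2 C\<^sub>1 C\<^sub>2 L G \<Longrightarrow> (\<And>y. y \<in> hol_space D\<^sub>1 \<times> hol_space D\<^sub>2 \<Longrightarrow> \<bar>G y\<bar> \<le> B) \<Longrightarrow>
        (\<lambda>N. (\<Sum>k\<le>N. G (X k)) / real (N + 1)) \<longlonglongrightarrow> (LINT \<omega>|P. G (Z \<omega>))"
    and F: "\<And>y. y \<in> hol_space D\<^sub>1 \<times> hol_space D\<^sub>2 \<Longrightarrow> \<bar>F y\<bar> \<le> M" and cont: "continuous_map (H_prod D\<^sub>1 D\<^sub>2) euclideanreal F"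
    and r: "r > 0"
  shows "\<forall>\<^sub>F N in sequentially. (\<Sum>k\<le>N. F (X k)) / real (N + 1) > (LINT \<omega>|P. F (Z \<omega>)) - r"
proof -
  interpret prob_space P by fact
  obtain A where A': "(\<forall>n::nat. compact (A n) \<and> A n \<subseteq> D\<^sub>1) \<and> (\<forall>K. compact K \<and> K \<subseteq> D\<^sub>1 \<longrightarrow> (\<exists>N. \<forall>n\<ge>N. K \<subseteq> A n))"
    using compact_exhaustion[OF D(1)] by blast
  then have A: "\<And>n. compact (A n)" "\<And>n. A n \<subseteq> D\<^sub>1" "\<And>K. compact K \<Longrightarrow> K \<subseteq> D\<^sub>1 \<Longrightarrow> \<exists>N. \<forall>n\<ge>N. K \<subseteq> A n"
    by auto
  obtain B where B': "(\<forall>n::nat. compact (B n) \<and> B n \<subseteq> D\<^sub>2) \<and> (\<forall>K. compact K \<and> K \<subseteq> D\<^sub>2 \<longrightarrow> (\<exists>N. \<forall>n\<ge>N. K \<subseteq> B n))"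
    using compact_exhaustion[OF D(2)] by blast
  then have B: "\<And>n. compact (B n)" "\<And>n. B n \<subseteq> D\<^sub>2" "\<And>K. compact K \<Longrightarrow> K \<subseteq> D\<^sub>2 \<Longrightarrow> \<exists>N. \<forall>n\<ge>N. K \<subseteq> B n"
    by auto
  let ?G = "\<lambda>j. inf_conv D\<^sub>1 D\<^sub>2 (A j) (B j) j F"
  have lipG: "hol_lipschitz D\<^sub>1 D\<^sub>2 (A j) (B j) (real j) (?G j)" for j
    by (rule inf_conv_lipschitz[OF F A(1,2) B(1,2)])
  have bG: "\<bar>?G j y\<bar> \<le> M" if "y \<in> hol_space D\<^sub>1 \<times> hol_space D\<^sub>2" for j y
  proof -
    have "- M \<le> ?G j y" by (rule inf_conv_properties(1)[OF F that])
    moreover have "?G j y \<le> F y" by (rule inf_conv_properties(2)[OF F that])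
    ultimately show ?thesis using F[OF that] by linarith
  qed
  have Zsp: "Z \<omega> \<in> hol_space D\<^sub>1 \<times> hol_space D\<^sub>2" if "\<omega> \<in> space P" for \<omega>
    using measurable_space[OF Z that] by (simp add: H_prod_def)
  have "(\<lambda>j. LINT \<omega>|P. ?G j (Z \<omega>)) \<longlonglongrightarrow> (LINT \<omega>|P. F (Z \<omega>))"
  proof (rule integral_dominated_convergence[where w = "\<lambda>_. M"])
    show "(\<lambda>\<omega>. F (Z \<omega>)) \<in> borel_measurable P" by (rule measurable_compose[OF Z continuous_map_measurable[OF cont]])
    show "(\<lambda>\<omega>. ?G j (Z \<omega>)) \<in> borel_measurable P" for j
      by (rule measurable_compose[OF Z continuous_map_measurable[OF hol_lipschitz_continuous_map[OF lipG]]])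
    show "AE \<omega> in P. (\<lambda>j. ?G j (Z \<omega>)) \<longlonglongrightarrow> F (Z \<omega>)"
      by (rule AE_I2, rule inf_conv_tendsto[OF F cont A(3) B(3) Zsp])
    show "AE \<omega> in P. norm (?G j (Z \<omega>)) \<le> M" for j
      by (rule AE_I2) (use bG[OF Zsp] in simp)
  qed simp
  from LIMSEQ_D[OF this, of "r / 2"] r obtain j where j: "norm ((LINT \<omega>|P. ?G j (Z \<omega>)) - (LINT \<omega>|P. F (Z \<omega>))) < r / 2" by auto
  have "(\<lambda>N. (\<Sum>k\<le>N. ?G j (X k)) / real (N + 1)) \<longlonglongrightarrow> (LINT \<omega>|P. ?G j (Z \<omega>))"
    by (rule lip[OF lipG bG])
  then have "\<forall>\<^sub>F N in sequentially. (\<Sum>k\<le>N. ?G j (X k)) / real (N + 1) > (LINT \<omega>|P. ?G j (Z \<omega>)) - r / 2"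
    by (rule order_tendstoD) (use r in simp)
  then show ?thesis
  proof eventually_elim
    case (elim N)
    have "(\<Sum>k\<le>N. ?G j (X k)) / real (N + 1) \<le> (\<Sum>k\<le>N. F (X k)) / real (N + 1)"
      by (intro divide_right_mono sum_mono inf_conv_properties(2)[OF F X]) auto
    then show ?case using elim j by (simp only: real_norm_def abs_less_iff) linarith
  qed
qed

text \<open>The one-sided bound is used for F and for - F.\<close>

lemma portmanteau:
  assumes D: "open D\<^sub>1" "open D\<^sub>2" and P: "prob_space P"
    and Z: "Z \<in> P \<rightarrow>\<^sub>M borel_of (H_prod D\<^sub>1 D\<^sub>2)" and X: "\<And>k::nat. X k \<in> hol_space D\<^sub>1 \<times> hol_space D\<^sub>2"
    and lip: "\<And>C\<^sub>1 C\<^sub>2 L G B. hol_lipschitz D\<^sub>1 D\<^sub>2 C\<^sub>1 C\<^sub>2 L G \<Longrightarrow> (\<And>y. y \<in> hol_space D\<^sub>1 \<times> hol_space D\<^sub>2 \<Longrightarrow> \<bar>G y\<bar> \<le> B) \<Longrightarrow>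
        (\<lambda>N. (\<Sum>k\<le>N. G (X k)) / real (N + 1)) \<longlonglongrightarrow> (LINT \<omega>|P. G (Z \<omega>))"
    and F: "\<And>y. y \<in> hol_space D\<^sub>1 \<times> hol_space D\<^sub>2 \<Longrightarrow> \<bar>F y\<bar> \<le> M" and cont: "continuous_map (H_prod D\<^sub>1 D\<^sub>2) euclideanreal F"
  shows "(\<lambda>N. (\<Sum>k\<le>N. F (X k)) / real (N + 1)) \<longlonglongrightarrow> (LINT \<omega>|P. F (Z \<omega>))"
proof (rule order_tendstoI)
  fix a assume a: "a < (LINT \<omega>|P. F (Z \<omega>))"
  have "\<forall>\<^sub>F N in sequentially. (\<Sum>k\<le>N. F (X k)) / real (N + 1) > (LINT \<omega>|P. F (Z \<omega>)) - ((LINT \<omega>|P. F (Z \<omega>)) - a)"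
    by (rule portmanteau_lower[OF D P Z X lip _ cont]) (use F a in auto)
  then show "\<forall>\<^sub>F N in sequentially. a < (\<Sum>k\<le>N. F (X k)) / real (N + 1)" by simp
next
  fix a assume a: "a > (LINT \<omega>|P. F (Z \<omega>))"
  have c: "continuous_map (H_prod D\<^sub>1 D\<^sub>2) euclideanreal (\<lambda>x. - F x)" using cont by (intro continuous_intros)
  have "\<forall>\<^sub>F N in sequentially. (\<Sum>k\<le>N. - F (X k)) / real (N + 1) > (LINT \<omega>|P. - F (Z \<omega>)) - (a - (LINT \<omega>|P. F (Z \<omega>)))"
    by (rule portmanteau_lower[OF D P Z X lip _ c]) (use F a in auto)
  then show "\<forall>\<^sub>F N in sequentially. (\<Sum>k\<le>N. F (X k)) / real (N + 1) < a"
    by eventually_elim (simp add: sum_negf)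
qed

subsection \<open>Random Dirichlet series\<close>

text \<open>An exchange of limits: for each \<epsilon> there is a comparison sequence with known
  mean whose error is small in mean from k0 on. The finitely many earlier terms are bounded by B,
  chosen independently of \<epsilon>.\<close>

lemma cesaro_limit_approx:
  fixes g :: "nat \<Rightarrow> real" and I :: real
  assumes "\<And>\<epsilon>. \<epsilon> > 0 \<Longrightarrow> \<exists>f J u k0. (\<lambda>N. (\<Sum>k\<le>N. f k) / real (N + 1)) \<longlonglongrightarrow> J \<and> \<bar>J - I\<bar> \<le> \<epsilon> \<and>
      (\<forall>k\<ge>k0. \<bar>g k - f k\<bar> \<le> u k) \<and> (\<forall>k::nat. u k \<ge> 0) \<and> (\<forall>N. (\<Sum>k\<le>N. u k) \<le> \<epsilon> * real (N + 1)) \<and> (\<forall>k. \<bar>g k - f k\<bar> \<le> B)"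
  shows "(\<lambda>N. (\<Sum>k\<le>N. g k) / real (N + 1)) \<longlonglongrightarrow> I"
proof (rule LIMSEQ_I)
  fix r :: real assume r: "r > 0"
  \<comment> \<open>One fifth each for the average of f, for J, for the errors u and for the initial
    terms; the total stays below r.\<close>
  have r5: "r / 5 > 0" using r by simp
  obtain f J u k0 where f: "(\<lambda>N. (\<Sum>k\<le>N. f k) / real (N + 1)) \<longlonglongrightarrow> J" and J: "\<bar>J - I\<bar> \<le> r / 5"
    and u: "\<forall>k\<ge>k0. \<bar>g k - f k\<bar> \<le> u k" "\<forall>k::nat. u k \<ge> 0" "\<forall>N. (\<Sum>k\<le>N. u k) \<le> r / 5 * real (N + 1)"
    and B: "\<forall>k. \<bar>g k - f k\<bar> \<le> B"
    using assms[OF r5] by (elim exE conjE) (rule that)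
  have B0: "B \<ge> 0" using order.trans[OF abs_ge_zero B[rule_format, of 0]] .
  obtain N1 where N1: "\<And>N. N \<ge> N1 \<Longrightarrow> norm ((\<Sum>k\<le>N. f k) / real (N + 1) - J) < r / 5"
    using LIMSEQ_D[OF f, of "r / 5"] r by auto
  obtain N2 :: nat where N2: "B * real k0 / (r / 5) \<le> real N2" using real_arch_simple by blast
  show "\<exists>N0. \<forall>N\<ge>N0. norm ((\<Sum>k\<le>N. g k) / real (N + 1) - I) < r"
  proof (intro exI allI impI)
    fix N assume N: "N \<ge> max N1 N2"
    have "\<bar>(\<Sum>k\<le>N. g k) - (\<Sum>k\<le>N. f k)\<bar> \<le> (\<Sum>k\<le>N. \<bar>g k - f k\<bar>)"
      unfolding sum_subtractf[symmetric] by (rule sum_abs)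
    also have "\<dots> \<le> (\<Sum>k\<le>N. (if k \<in> {..<k0} then B else 0) + u k)"
      using u(1,2) B B0 by (intro sum_mono) (auto simp: not_less add_increasing2)
    also have "\<dots> = (\<Sum>k\<in>{..N} \<inter> {..<k0}. B) + (\<Sum>k\<le>N. u k)"
      unfolding sum.distrib by (subst sum.inter_restrict) simp_all
    also have "\<dots> \<le> B * real k0 + r / 5 * real (N + 1)"
    proof (rule add_mono[OF _ u(3)[rule_format]])
      have "real (card ({..N} \<inter> {..<k0})) \<le> real k0" using card_mono[of "{..<k0}" "{..N} \<inter> {..<k0}"] by simp
      from mult_right_mono[OF this B0] show "(\<Sum>k\<in>{..N} \<inter> {..<k0}. B) \<le> B * real k0" by (simp add: mult.commute)
    qed
    also have "B * real k0 \<le> r / 5 * real N2" using N2 r by (simp add: field_simps)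
    also have "r / 5 * real N2 \<le> r / 5 * real (N + 1)" using N r by (intro mult_left_mono) auto
    finally have "\<bar>(\<Sum>k\<le>N. g k) - (\<Sum>k\<le>N. f k)\<bar> \<le> 2 * r / 5 * real (N + 1)" by simp
    then have "\<bar>((\<Sum>k\<le>N. g k) - (\<Sum>k\<le>N. f k)) / real (N + 1)\<bar> \<le> 2 * r / 5"
      by (simp add: abs_divide pos_divide_le_eq)
    then have "\<bar>(\<Sum>k\<le>N. g k) / real (N + 1) - (\<Sum>k\<le>N. f k) / real (N + 1)\<bar> \<le> 2 * r / 5"
      by (simp only: diff_divide_distrib)
    with N1[of N] N J r show "norm ((\<Sum>k\<le>N. g k) / real (N + 1) - I) < r" unfolding real_norm_def by linarith
  qed
qed

text \<open>The strip may depend on the compact set: for the zeta-function mean squares are supplied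
  on lines of real part above 1/2, so the left edge must be placed between 1/2 and K. For \<phi> one
  strip serves every K.\<close>

locale random_dirichlet = orthonormal_system P e for P :: "'a measure" and e +
  fixes \<alpha> h :: real and a :: "nat \<Rightarrow> complex" and F :: "complex \<Rightarrow> complex" and D :: "complex set"
  assumes \<alpha>: "0 < \<alpha>" "\<alpha> \<le> 1" and h: "h > 0" and D: "open D"
    and strips: "\<And>K. compact K \<Longrightarrow> K \<subseteq> D \<Longrightarrow> \<exists>\<sigma>\<^sub>0 T\<^sub>0 A d. mean_strip \<alpha> a F \<sigma>\<^sub>0 T\<^sub>0 A \<and> d > 0 \<and> (\<forall>s\<in>K. Re s \<ge> \<sigma>\<^sub>0 + d)"
    and nonper: "\<And>m m'. m \<noteq> m' \<Longrightarrow> cis (- (h * ln (real m + \<alpha>))) \<noteq> cis (- (h * ln (real m' + \<alpha>)))"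
begin

abbreviation random_term :: "'a \<Rightarrow> nat \<Rightarrow> complex \<Rightarrow> complex" where
  "random_term \<omega> m s \<equiv> a m * e m \<omega> * complex_of_real (real m + \<alpha>) powr (- s)"

text \<open>V = (t + W / t) / 2 majorises the square root of W and has its mean controlled by that
  of W; t is left free, to be matched to the size of the error. The finite polynomial is split off,
  so convergence of the difference series gives that of the random series.\<close>

lemma random_tail:
  assumes x0: "\<And>m. m \<ge> M \<Longrightarrow> x m = 0"
    and t: "t > 0" and C1: "C1 \<ge> 0" and W: "W \<in> borel_measurable P" "(\<integral>\<^sup>+\<omega>. W \<omega> \<partial>P) \<le> ennreal C1"
    and bound: "\<And>\<omega> s. \<omega> \<in> space P \<Longrightarrow> W \<omega> < \<infinity> \<Longrightarrow> s \<in> C \<Longrightarrow>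
       summable (\<lambda>m. (a m - x m) * e m \<omega> * complex_of_real (real m + \<alpha>) powr (- s)) \<and>
       ennreal ((cmod (\<Sum>m. (a m - x m) * e m \<omega> * complex_of_real (real m + \<alpha>) powr (- s)))\<^sup>2) \<le> W \<omega>"
  shows "\<exists>V. integrable P V \<and> (LINT \<omega>|P. V \<omega>) \<le> (t + C1 / t) / 2 \<and> (\<forall>\<omega>. V \<omega> \<ge> 0) \<and>
     (AE \<omega> in P. \<forall>s\<in>C. summable (\<lambda>m. random_term \<omega> m s) \<and>
        cmod ((\<Sum>m. random_term \<omega> m s) - dpoly \<alpha> (\<lambda>m. x m * e m \<omega>) M s) \<le> V \<omega>)"
proof (intro exI conjI allI)
  define W' where "W' = (\<lambda>\<omega>. enn2real (W \<omega>))"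
  define V where "V = (\<lambda>\<omega>. (t + W' \<omega> / t) / 2)"
  have W'm: "W' \<in> borel_measurable P" unfolding W'_def using W(1) by measurable
  have nn: "(\<integral>\<^sup>+\<omega>. ennreal (W' \<omega>) \<partial>P) \<le> ennreal C1"
  proof -
    have "(\<integral>\<^sup>+\<omega>. ennreal (W' \<omega>) \<partial>P) \<le> (\<integral>\<^sup>+\<omega>. W \<omega> \<partial>P)"
      by (rule nn_integral_mono) (simp add: W'_def ennreal_enn2real_if)
    with W(2) show ?thesis by (rule order.trans[rotated])
  qed
  have W'i: "integrable P W'"
  proof (rule integrableI_nonneg[OF W'm])
    show "AE \<omega> in P. 0 \<le> W' \<omega>" by (simp add: W'_def)
    show "(\<integral>\<^sup>+\<omega>. ennreal (W' \<omega>) \<partial>P) < \<infinity>" using nn by (rule order.strict_trans1) (simp add: ennreal_less_top)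
  qed
  have W'le: "(LINT \<omega>|P. W' \<omega>) \<le> C1"
  proof -
    have "(LINT \<omega>|P. W' \<omega>) = enn2real (\<integral>\<^sup>+\<omega>. ennreal (W' \<omega>) \<partial>P)"
      by (rule integral_eq_nn_integral[OF W'm]) (simp add: W'_def)
    also have "\<dots> \<le> C1" by (rule enn2real_leI[OF C1 nn])
    finally show ?thesis .
  qed
  show "integrable P V" unfolding V_def using W'i by auto
  have "(LINT \<omega>|P. V \<omega>) = (t + (LINT \<omega>|P. W' \<omega>) / t) / 2"
    unfolding V_def using W'i by (simp add: prob_space)
  also have "\<dots> \<le> (t + C1 / t) / 2" using W'le t by (intro divide_right_mono add_left_mono) auto
  finally show "(LINT \<omega>|P. V \<omega>) \<le> (t + C1 / t) / 2" .
  show "V \<omega> \<ge> 0" for \<omega> using t by (simp add: V_def W'_def)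
  have fin: "AE \<omega> in P. W \<omega> \<noteq> \<infinity>"
  proof (rule nn_integral_PInf_AE[OF W(1)])
    show "(\<integral>\<^sup>+\<omega>. W \<omega> \<partial>P) \<noteq> \<infinity>" using W(2) by (auto simp: top_unique)
  qed
  show "AE \<omega> in P. \<forall>s\<in>C. summable (\<lambda>m. random_term \<omega> m s) \<and>
        cmod ((\<Sum>m. random_term \<omega> m s) - dpoly \<alpha> (\<lambda>m. x m * e m \<omega>) M s) \<le> V \<omega>"
    using fin AE_space
  proof (eventually_elim, intro ballI)
    fix \<omega> s assume W\<omega>: "W \<omega> \<noteq> \<infinity>" and \<omega>: "\<omega> \<in> space P" and s: "s \<in> C"
    let ?p = "\<lambda>m. complex_of_real (real m + \<alpha>) powr (- s)"
    have Wf: "W \<omega> < \<infinity>" using W\<omega> by (simp add: top.not_eq_extremum)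
    from bound[OF \<omega> Wf s]
    have sm: "summable (\<lambda>m. (a m - x m) * e m \<omega> * ?p m)"
      and le: "ennreal ((cmod (\<Sum>m. (a m - x m) * e m \<omega> * ?p m))\<^sup>2) \<le> W \<omega>" by auto
    have "(\<lambda>m. x m * e m \<omega> * ?p m) sums (\<Sum>m<M. x m * e m \<omega> * ?p m)"
      by (rule sums_finite) (auto simp: x0 not_less)
    then have "(\<lambda>m. x m * e m \<omega> * ?p m) sums dpoly \<alpha> (\<lambda>m. x m * e m \<omega>) M s" unfolding dpoly_def .
    from sums_add[OF summable_sums[OF sm] this]
    have S: "(\<lambda>m. random_term \<omega> m s) sums ((\<Sum>m. (a m - x m) * e m \<omega> * ?p m) + dpoly \<alpha> (\<lambda>m. x m * e m \<omega>) M s)"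
      by (simp add: algebra_simps)
    let ?c = "cmod (\<Sum>m. (a m - x m) * e m \<omega> * ?p m)"
    have "ennreal (?c\<^sup>2) \<le> ennreal (W' \<omega>)" using le Wf by (simp add: W'_def ennreal_enn2real_if)
    then have c: "?c\<^sup>2 \<le> W' \<omega>" by (simp add: W'_def ennreal_le_iff)
    have "2 * t * ?c \<le> t\<^sup>2 + ?c\<^sup>2" by (rule sum_squares_bound)
    then have "2 * t * ?c \<le> t\<^sup>2 + W' \<omega>" using c by linarith
    then have "?c \<le> V \<omega>" using t unfolding V_def by (simp add: field_simps power2_eq_square)
    then show "summable (\<lambda>m. random_term \<omega> m s) \<and> cmod ((\<Sum>m. random_term \<omega> m s) - dpoly \<alpha> (\<lambda>m. x m * e m \<omega>) M s) \<le> V \<omega>"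
      unfolding sums_unique[OF S, symmetric] add_diff_cancel_right' using sums_summable[OF S] by blast
  qed
qed

text \<open>One family of polynomials approximates both the shifts, with errors \<open>w\<close>,
  and the random series, with errors \<open>V n\<close>; in mean both errors are of order exp (-
  \<delta> n).\<close>

lemma random_approximation:
  assumes C: "compact C" "C \<subseteq> D"
  shows "\<exists>x M w V \<delta> K. \<delta> > 0 \<and> (\<forall>k. w k \<ge> 0) \<and> K \<ge> 0 \<and> (\<forall>N. (\<Sum>k\<le>N. w k) \<le> K * real (N + 1)) \<and>
     (\<forall>n. \<forall>\<^sub>F k in sequentially. \<forall>s\<in>C. cmod (F (s + \<i> * of_nat k * of_real h) -
        dpoly \<alpha> (x n) (M n) (s + \<i> * of_nat k * of_real h)) \<le> exp (- \<delta> * real n) * w k) \<and>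
     (\<forall>n. integrable P (V n) \<and> (LINT \<omega>|P. V n \<omega>) \<le> K * exp (- \<delta> * real n) \<and> (\<forall>\<omega>. V n \<omega> \<ge> 0) \<and>
       (AE \<omega> in P. \<forall>s\<in>C. summable (\<lambda>m. random_term \<omega> m s) \<and>
         cmod ((\<Sum>m. random_term \<omega> m s) - dpoly \<alpha> (\<lambda>m. x n m * e m \<omega>) (M n) s) \<le> V n \<omega>))"
proof -
  obtain \<sigma>\<^sub>0 T\<^sub>0 A d where str: "mean_strip \<alpha> a F \<sigma>\<^sub>0 T\<^sub>0 A" and d: "d > 0" "\<forall>s\<in>C. Re s \<ge> \<sigma>\<^sub>0 + d"
    using strips[OF C] by (elim exE conjE) (rule that)
  interpret S: mean_strip \<alpha> a F \<sigma>\<^sub>0 T\<^sub>0 A by (rule str)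
  obtain R where R: "\<And>s. s \<in> C \<Longrightarrow> cmod s \<le> R" using compact_imp_bounded[OF C(1)] unfolding bounded_iff by blast
  \<comment> \<open>The distance d to the left edge is halved: coefficients are compared at real
    part \<open>\<sigma>\<^sub>0 + d / 2\<close>, and the other half is the room that the bound for
    random series needs.\<close>
  have d2: "d / 2 > 0" using d by simp
  have dC: "\<And>s. s \<in> C \<Longrightarrow> \<sigma>\<^sub>0 + d / 2 \<le> Re s"
  proof -
    fix s assume "s \<in> C" with d(2) have "\<sigma>\<^sub>0 + d \<le> Re s" by blast
    then show "\<sigma>\<^sub>0 + d / 2 \<le> Re s" using d(1) by simp
  qed
  define \<sigma> where "\<sigma> = \<sigma>\<^sub>0 + d / 2"
  obtain x M w \<delta> K where x0: "\<And>n m. m \<ge> M n \<Longrightarrow> x n m = 0" and \<delta>: "\<delta> > 0" and w: "\<And>k. w k \<ge> 0" and K: "K \<ge> 0"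
    and wK: "\<And>N. (\<Sum>k\<le>N. (w k)\<^sup>2) \<le> K * real (N + 1)"
    and ap: "\<And>n. \<forall>\<^sub>F k in sequentially. \<forall>s\<in>C. cmod (F (s + \<i> * of_nat k * of_real h) -
        dpoly \<alpha> (x n) (M n) (s + \<i> * of_nat k * of_real h)) \<le> exp (- \<delta> * real n) * w k"
    and sm: "\<And>n. summable (\<lambda>m. (cmod (a m - x n m))\<^sup>2 * (real m + \<alpha>) powr (- 2 * (\<sigma>\<^sub>0 + d / 2)))"
    and sle: "\<And>n. (\<Sum>m. (cmod (a m - x n m))\<^sup>2 * (real m + \<alpha>) powr (- 2 * (\<sigma>\<^sub>0 + d / 2))) \<le> K * exp (- 2 * \<delta> * real n)"
    by (rule S.mean_approximation[OF h compact_imp_bounded[OF C(1)] d2 dC nonper], assumption, assumption) (rule that)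
  obtain C1 where C1: "C1 \<ge> 0" and rs: "\<forall>d'. summable (\<lambda>m. (cmod (d' m))\<^sup>2 * (real m + \<alpha>) powr (- 2 * \<sigma>)) \<longrightarrow>
    (\<exists>W. W \<in> borel_measurable P \<and>
      (\<integral>\<^sup>+\<omega>. W \<omega> \<partial>P) \<le> ennreal (C1 * (\<Sum>m. (cmod (d' m))\<^sup>2 * (real m + \<alpha>) powr (- 2 * \<sigma>))) \<and>
      (\<forall>\<omega>\<in>space P. W \<omega> < \<infinity> \<longrightarrow> (\<forall>s. Re s \<ge> \<sigma> + d / 2 \<and> cmod s \<le> R \<longrightarrow>
         summable (\<lambda>m. d' m * e m \<omega> * complex_of_real (real m + \<alpha>) powr (- s)) \<and>
         ennreal ((cmod (\<Sum>m. d' m * e m \<omega> * complex_of_real (real m + \<alpha>) powr (- s)))\<^sup>2) \<le> W \<omega>)))"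
    using random_series_bound[OF \<alpha> d2, of \<sigma> R] by (elim exE conjE) (rule that)
  define K' where "K' = (1 + K + C1 * K)"
  have "\<exists>V. integrable P V \<and> (LINT \<omega>|P. V \<omega>) \<le> K' * exp (- \<delta> * real n) \<and> (\<forall>\<omega>. V \<omega> \<ge> 0) \<and>
       (AE \<omega> in P. \<forall>s\<in>C. summable (\<lambda>m. random_term \<omega> m s) \<and>
         cmod ((\<Sum>m. random_term \<omega> m s) - dpoly \<alpha> (\<lambda>m. x n m * e m \<omega>) (M n) s) \<le> V \<omega>)" for n
  proof -
    \<comment> \<open>The coefficient error is of order t^2 in mean square, so this t balances the
      two terms of V.\<close>
    define t where "t = exp (- \<delta> * real n)"
    have t: "t > 0" by (simp add: t_def)
    have t2: "exp (- 2 * \<delta> * real n) = t * t" unfolding t_def mult_exp_exp by (simp add: algebra_simps)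
    obtain W where W: "W \<in> borel_measurable P" "(\<integral>\<^sup>+\<omega>. W \<omega> \<partial>P) \<le> ennreal (C1 * (\<Sum>m. (cmod (a m - x n m))\<^sup>2 * (real m + \<alpha>) powr (- 2 * \<sigma>)))"
      and Wb: "\<forall>\<omega>\<in>space P. W \<omega> < \<infinity> \<longrightarrow> (\<forall>s. Re s \<ge> \<sigma> + d / 2 \<and> cmod s \<le> R \<longrightarrow>
         summable (\<lambda>m. (a m - x n m) * e m \<omega> * complex_of_real (real m + \<alpha>) powr (- s)) \<and>
         ennreal ((cmod (\<Sum>m. (a m - x n m) * e m \<omega> * complex_of_real (real m + \<alpha>) powr (- s)))\<^sup>2) \<le> W \<omega>)"
      using rs[rule_format, OF sm[of n, folded \<sigma>_def]] by (elim exE conjE) (rule that)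
    have "C1 * (\<Sum>m. (cmod (a m - x n m))\<^sup>2 * (real m + \<alpha>) powr (- 2 * \<sigma>)) \<le> C1 * (K * (t * t))"
      using mult_left_mono[OF sle[of n] C1] unfolding t2 \<sigma>_def .
    from order.trans[OF W(2) ennreal_leI[OF this]] have W2: "(\<integral>\<^sup>+\<omega>. W \<omega> \<partial>P) \<le> ennreal (C1 * (K * (t * t)))" .
    have C1': "C1 * (K * (t * t)) \<ge> 0" using C1 K by simp
    have b: "summable (\<lambda>m. (a m - x n m) * e m \<omega> * complex_of_real (real m + \<alpha>) powr (- s)) \<and>
         ennreal ((cmod (\<Sum>m. (a m - x n m) * e m \<omega> * complex_of_real (real m + \<alpha>) powr (- s)))\<^sup>2) \<le> W \<omega>"
      if "\<omega> \<in> space P" "W \<omega> < \<infinity>" "s \<in> C" for \<omega> s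
    proof -
      have "Re s \<ge> \<sigma> + d / 2 \<and> cmod s \<le> R" using d(2) R that(3) by (auto simp: \<sigma>_def)
      from Wb[rule_format, OF that(1,2) this] show ?thesis .
    qed
    have "(t + C1 * (K * (t * t)) / t) / 2 \<le> K' * t"
    proof -
      have "(t + C1 * (K * (t * t)) / t) / 2 = (1 + C1 * K) / 2 * t" using t by (simp add: field_simps)
      also have "\<dots> \<le> K' * t" using t C1 K by (intro mult_right_mono) (auto simp: K'_def add_increasing)
      finally show ?thesis .
    qed
    note le = this
    have "\<exists>V. integrable P V \<and> (LINT \<omega>|P. V \<omega>) \<le> (t + C1 * (K * (t * t)) / t) / 2 \<and> (\<forall>\<omega>. V \<omega> \<ge> 0) \<and>
       (AE \<omega> in P. \<forall>s\<in>C. summable (\<lambda>m. random_term \<omega> m s) \<and>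
         cmod ((\<Sum>m. random_term \<omega> m s) - dpoly \<alpha> (\<lambda>m. x n m * e m \<omega>) (M n) s) \<le> V \<omega>)"
      by (rule random_tail[OF x0 t C1' W(1) W2 b])
    then obtain V where V: "integrable P V" "(LINT \<omega>|P. V \<omega>) \<le> (t + C1 * (K * (t * t)) / t) / 2" "\<forall>\<omega>. V \<omega> \<ge> 0"
      "AE \<omega> in P. \<forall>s\<in>C. summable (\<lambda>m. random_term \<omega> m s) \<and>
         cmod ((\<Sum>m. random_term \<omega> m s) - dpoly \<alpha> (\<lambda>m. x n m * e m \<omega>) (M n) s) \<le> V \<omega>"
      by (elim exE conjE) (rule that)
    show ?thesis unfolding t_def[symmetric]
      by (intro exI[of _ V] conjI V(1) order.trans[OF V(2) le] V(3) V(4))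
  qed
  from choice[OF allI[OF this]] obtain V where V: "\<forall>n. integrable P (V n) \<and> (LINT \<omega>|P. V n \<omega>) \<le> K' * exp (- \<delta> * real n) \<and> (\<forall>\<omega>. V n \<omega> \<ge> 0) \<and>
       (AE \<omega> in P. \<forall>s\<in>C. summable (\<lambda>m. random_term \<omega> m s) \<and>
         cmod ((\<Sum>m. random_term \<omega> m s) - dpoly \<alpha> (\<lambda>m. x n m * e m \<omega>) (M n) s) \<le> V n \<omega>)" ..
  have wK': "(\<Sum>k\<le>N. w k) \<le> K' * real (N + 1)" for N
  proof -
    \<comment> \<open>The Lipschitz estimate involves first powers of w, while the mean bound is for
      squares.\<close>
    have "(\<Sum>k\<le>N. w k) \<le> (\<Sum>k\<le>N. 1 + (w k)\<^sup>2)"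
    proof (rule sum_mono)
      fix k show "w k \<le> 1 + (w k)\<^sup>2" using sum_squares_bound[of 1 "w k"] w[of k] by simp
    qed
    also have "\<dots> \<le> (1 + K) * real (N + 1)" using wK[of N] by (simp add: sum.distrib algebra_simps)
    also have "\<dots> \<le> K' * real (N + 1)" using C1 K by (intro mult_right_mono) (auto simp: K'_def)
    finally show ?thesis .
  qed
  have "K' \<ge> 0" using K C1 by (simp add: K'_def)
  then show ?thesis
    by (intro exI[of _ x] exI[of _ M] exI[of _ w] exI[of _ V] exI[of _ \<delta>] exI[of _ K'] conjI \<delta> V allI w wK' ap)
qed

text \<open>The approximation with n = 0 already yields convergence on a compact set; a countable
  exhaustion of D combines the null sets.\<close>

lemma random_series_converges: "AE \<omega> in P. \<forall>s\<in>D. summable (\<lambda>m. random_term \<omega> m s)"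
proof -
  obtain A where A: "(\<forall>n::nat. compact (A n) \<and> A n \<subseteq> D) \<and> (\<forall>K. compact K \<and> K \<subseteq> D \<longrightarrow> (\<exists>N. \<forall>n\<ge>N. K \<subseteq> A n))"
    using compact_exhaustion[OF D] by blast
  have "AE \<omega> in P. \<forall>s\<in>A n. summable (\<lambda>m. random_term \<omega> m s)" for n
  proof -
    have An: "compact (A n)" "A n \<subseteq> D" using A by auto
    obtain x M V where "AE \<omega> in P. \<forall>s\<in>A n. summable (\<lambda>m. random_term \<omega> m s) \<and>
         cmod ((\<Sum>m. random_term \<omega> m s) - dpoly \<alpha> (\<lambda>m. x (0::nat) m * e m \<omega>) (M 0) s) \<le> V 0 \<omega>"
      using random_approximation[OF An] by (elim exE conjE) (erule allE[where x = 0], elim conjE, rule that)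
    then show ?thesis by eventually_elim blast
  qed
  then have "AE \<omega> in P. \<forall>n. \<forall>s\<in>A n. summable (\<lambda>m. random_term \<omega> m s)" unfolding AE_all_countable by blast
  then show ?thesis
  proof eventually_elim
    case (elim \<omega>)
    show ?case
    proof
      fix s assume "s \<in> D"
      then obtain N where "\<forall>n\<ge>N. {s} \<subseteq> A n" using conjunct2[OF A, rule_format, of "{s}"] by auto
      then show "summable (\<lambda>m. random_term \<omega> m s)" using elim by auto
    qed
  qed
qed

abbreviation random_elem :: "'a \<Rightarrow> complex \<Rightarrow> complex" where
  "random_elem \<omega> \<equiv> series_elem D (\<lambda>m s. random_term \<omega> m s)"

lemma random_elem_hol_space: "random_elem \<omega> \<in> hol_space D"
proof (cases "\<forall>s\<in>D. summable (\<lambda>m. random_term \<omega> m s)")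
  case True
  have "(\<lambda>s. \<Sum>m. random_term \<omega> m s) holomorphic_on D"
    using True by (intro dirichlet_holomorphic[OF \<alpha> D, where y = "\<lambda>m. a m * e m \<omega>"]) auto
  then have "(\<lambda>s\<in>D. \<Sum>m. random_term \<omega> m s) holomorphic_on D"
    by (rule holomorphic_transform) simp
  then show ?thesis using True by (simp add: series_elem_def hol_space_def)
next
  case False
  have "(\<lambda>s\<in>D. 0) holomorphic_on D" by (rule holomorphic_transform[OF holomorphic_on_const[of 0]]) simp
  then show ?thesis unfolding series_elem_def if_not_P[OF False] by (simp add: hol_space_def)
qed

text \<open>Convergence propagates to the right, so convergence on all of D is equivalent to
  convergence at countably many dense points; the event deciding between the series and the default
  0 is therefore measurable.\<close>

lemma random_elem_measurable:
  assumes z: "z \<in> D"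
  shows "(\<lambda>\<omega>. random_elem \<omega> z) \<in> borel_measurable P"
proof -
  have tm: "(\<lambda>\<omega>. random_term \<omega> m s) \<in> borel_measurable P" for m s by measurable
  obtain Q :: "complex set" where Q: "countable Q" "\<And>X. open X \<Longrightarrow> X \<noteq> {} \<Longrightarrow> \<exists>d\<in>Q. d \<in> X"
    using countable_dense_setE by blast
  have "(\<forall>s\<in>D. summable (\<lambda>m. random_term \<omega> m s)) \<longleftrightarrow> (\<forall>s\<in>Q \<inter> D. summable (\<lambda>m. random_term \<omega> m s))" for \<omega>
  proof (intro iffI ballI)
    fix s assume *: "\<forall>s\<in>Q \<inter> D. summable (\<lambda>m. random_term \<omega> m s)" and s: "s \<in> D"
    obtain s' where s': "s' \<in> Q" "s' \<in> D" "Re s' < Re s" by (rule point_left_in_open[OF D s Q(2)], assumption, assumption) (rule that)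
    have "summable (\<lambda>m. random_term \<omega> m s')" by (rule bspec[OF *]) (simp add: s')
    from dirichlet_converges_right[OF \<alpha>, where y = "\<lambda>m. a m * e m \<omega>", OF this s'(3)]
    show "summable (\<lambda>m. random_term \<omega> m s)" .
  qed blast
  then have "{\<omega> \<in> space P. \<forall>s\<in>D. summable (\<lambda>m. random_term \<omega> m s)} = {\<omega> \<in> space P. \<forall>s\<in>Q \<inter> D. summable (\<lambda>m. random_term \<omega> m s)}"
    by blast
  also have "\<dots> \<in> sets P"
  proof (rule sets.sets_Collect_countable_All'[of "Q \<inter> D"])
    show "countable (Q \<inter> D)" using Q(1) by (rule countable_subset[rotated]) auto
    fix s
    have "{\<omega> \<in> space P. summable (\<lambda>m. random_term \<omega> m s)} = {\<omega> \<in> space P. Cauchy (\<lambda>n. \<Sum>m<n. random_term \<omega> m s)}"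
      by (simp only: summable_iff_convergent Cauchy_convergent_iff)
    also have "\<dots> \<in> sets P" by (rule sets_Collect_Cauchy) (use tm in measurable)
    finally show "{\<omega> \<in> space P. summable (\<lambda>m. random_term \<omega> m s)} \<in> sets P" .
  qed
  finally have E: "{\<omega> \<in> space P. \<forall>s\<in>D. summable (\<lambda>m. random_term \<omega> m s)} \<in> sets P" .
  have "(\<lambda>\<omega>. if \<forall>s\<in>D. summable (\<lambda>m. random_term \<omega> m s) then \<Sum>m. random_term \<omega> m z else 0) \<in> borel_measurable P"
    by (rule measurable_If[OF borel_measurable_suminf[OF tm] borel_measurable_const E])
  moreover have "random_elem \<omega> z = (if \<forall>s\<in>D. summable (\<lambda>m. random_term \<omega> m s) then \<Sum>m. random_term \<omega> m z else 0)" for \<omega>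
    using z by (simp add: series_elem_def)
  ultimately show ?thesis by (simp only:)
qed

end

section \<open>Functionals of Dirichlet polynomials as functions on the torus\<close>

lemma shift_powr_bounded:
  assumes \<alpha>: "0 < \<alpha>" and C: "compact C"
  shows "\<exists>B\<ge>0. \<forall>s\<in>C. cmod (complex_of_real (real m + \<alpha>) powr (- s)) \<le> B"
proof -
  have ne: "complex_of_real (real m + \<alpha>) \<noteq> 0" using \<alpha> by (simp add: complex_eq_iff)
  have "(\<lambda>s. complex_of_real (real m + \<alpha>) powr (- s)) holomorphic_on C" using ne by (intro holomorphic_intros)
  then have "compact ((\<lambda>s. complex_of_real (real m + \<alpha>) powr (- s)) ` C)"
    by (intro compact_continuous_image C holomorphic_on_imp_continuous_on)
  then have "bounded ((\<lambda>s. complex_of_real (real m + \<alpha>) powr (- s)) ` C)" by (rule compact_imp_bounded)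
  then obtain B where B: "\<And>s. s \<in> C \<Longrightarrow> cmod (complex_of_real (real m + \<alpha>) powr (- s)) \<le> B" unfolding bounded_iff by blast
  show ?thesis using B by (intro exI[of _ "max B 0"]) (auto intro: max.coboundedI1)
qed

lemma dpoly_lipschitz:
  assumes \<alpha>: "0 < \<alpha>" and C: "compact C"
  shows "\<exists>B. (\<forall>m. B m \<ge> 0) \<and> (\<forall>u v. \<forall>s\<in>C. dist (dpoly \<alpha> (\<lambda>m. x m * u m) M s) (dpoly \<alpha> (\<lambda>m. x m * v m) M s)
    \<le> (\<Sum>m<M. B m * dist (u m) (v m)))"
proof -
  obtain B where B: "\<forall>m. B m \<ge> 0 \<and> (\<forall>s\<in>C. cmod (complex_of_real (real m + \<alpha>) powr (- s)) \<le> B m)"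
  proof -
    have "\<forall>m. \<exists>B. B \<ge> 0 \<and> (\<forall>s\<in>C. cmod (complex_of_real (real m + \<alpha>) powr (- s)) \<le> B)"
      by (intro allI shift_powr_bounded[OF \<alpha> C])
    from choice[OF this] show ?thesis using that by (elim exE)
  qed
  have "dist (dpoly \<alpha> (\<lambda>m. x m * u m) M s) (dpoly \<alpha> (\<lambda>m. x m * v m) M s) \<le> (\<Sum>m<M. cmod (x m) * B m * dist (u m) (v m))"
    if s: "s \<in> C" for u v s
  proof -
    have "dpoly \<alpha> (\<lambda>m. x m * u m) M s - dpoly \<alpha> (\<lambda>m. x m * v m) M s =
        (\<Sum>m<M. x m * complex_of_real (real m + \<alpha>) powr (- s) * (u m - v m))"
      unfolding dpoly_def sum_subtractf[symmetric] by (rule sum.cong[OF refl]) (simp only: algebra_simps)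
    then have "dist (dpoly \<alpha> (\<lambda>m. x m * u m) M s) (dpoly \<alpha> (\<lambda>m. x m * v m) M s) =
        cmod (\<Sum>m<M. x m * complex_of_real (real m + \<alpha>) powr (- s) * (u m - v m))" by (simp only: dist_norm)
    also have "\<dots> \<le> (\<Sum>m<M. cmod (x m * complex_of_real (real m + \<alpha>) powr (- s) * (u m - v m)))" by (rule norm_sum)
    also have "\<dots> \<le> (\<Sum>m<M. cmod (x m) * B m * dist (u m) (v m))"
    proof (rule sum_mono)
      fix m
      have "cmod (complex_of_real (real m + \<alpha>) powr (- s)) \<le> B m" using B s by blast
      then show "cmod (x m * complex_of_real (real m + \<alpha>) powr (- s) * (u m - v m)) \<le> cmod (x m) * B m * dist (u m) (v m)"
        unfolding norm_mult dist_norm by (intro mult_right_mono mult_left_mono) auto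
    qed
    finally show ?thesis .
  qed
  then show ?thesis using B by (intro exI[of _ "\<lambda>m. cmod (x m) * B m"]) simp
qed

definition dpoly_elem :: "complex set \<Rightarrow> real \<Rightarrow> (nat \<Rightarrow> complex) \<Rightarrow> nat \<Rightarrow> complex \<Rightarrow> complex" where
  "dpoly_elem D \<alpha> x M = restrict (dpoly \<alpha> x M) D"

lemma dpoly_elem_hol_space: "\<alpha> > 0 \<Longrightarrow> dpoly_elem D \<alpha> x M \<in> hol_space D"
proof -
  assume \<alpha>: "\<alpha> > 0"
  have ne: "complex_of_real (real m + \<alpha>) \<noteq> 0" for m using \<alpha> by (simp add: complex_eq_iff)
  have "dpoly \<alpha> x M holomorphic_on D" unfolding dpoly_def using ne by (intro holomorphic_intros)
  then have "dpoly_elem D \<alpha> x M holomorphic_on D" unfolding dpoly_elem_def by (rule holomorphic_transform) simp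
  then show ?thesis by (simp add: hol_space_def dpoly_elem_def)
qed

text \<open>Only finitely many functions e m enter, and a Lipschitz functional changes by at most a
  finite weighted sum of their distances. This continuity opens the way to equidistribution.\<close>

lemma dpoly_lipschitz_continuous:
  fixes T :: "'a :: metric_space set"
  assumes G: "hol_lipschitz D\<^sub>1 D\<^sub>2 C\<^sub>1 C\<^sub>2 L G" and \<alpha>: "\<alpha>\<^sub>1 > 0" "\<alpha>\<^sub>2 > 0"
    and e: "\<And>m. continuous_on T (e\<^sub>1 m)" "\<And>m. continuous_on T (e\<^sub>2 m)"
  shows "continuous_on T (\<lambda>\<omega>. G (dpoly_elem D\<^sub>1 \<alpha>\<^sub>1 (\<lambda>m. x\<^sub>1 m * e\<^sub>1 m \<omega>) M\<^sub>1, dpoly_elem D\<^sub>2 \<alpha>\<^sub>2 (\<lambda>m. x\<^sub>2 m * e\<^sub>2 m \<omega>) M\<^sub>2))"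
    (is "continuous_on T ?g")
proof -
  have C: "compact C\<^sub>1" "C\<^sub>1 \<subseteq> D\<^sub>1" "compact C\<^sub>2" "C\<^sub>2 \<subseteq> D\<^sub>2" using G unfolding hol_lipschitz_def by blast+
  obtain B1 where B1: "\<forall>m. B1 m \<ge> 0" "\<forall>u v. \<forall>s\<in>C\<^sub>1. dist (dpoly \<alpha>\<^sub>1 (\<lambda>m. x\<^sub>1 m * u m) M\<^sub>1 s) (dpoly \<alpha>\<^sub>1 (\<lambda>m. x\<^sub>1 m * v m) M\<^sub>1 s)
    \<le> (\<Sum>m<M\<^sub>1. B1 m * dist (u m) (v m))"
    using dpoly_lipschitz[OF \<alpha>(1) C(1), where x = x\<^sub>1 and M = M\<^sub>1] by (elim exE conjE) (rule that)
  obtain B2 where B2: "\<forall>m. B2 m \<ge> 0" "\<forall>u v. \<forall>s\<in>C\<^sub>2. dist (dpoly \<alpha>\<^sub>2 (\<lambda>m. x\<^sub>2 m * u m) M\<^sub>2 s) (dpoly \<alpha>\<^sub>2 (\<lambda>m. x\<^sub>2 m * v m) M\<^sub>2 s)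
    \<le> (\<Sum>m<M\<^sub>2. B2 m * dist (u m) (v m))"
    using dpoly_lipschitz[OF \<alpha>(2) C(3), where x = x\<^sub>2 and M = M\<^sub>2] by (elim exE conjE) (rule that)
  define q where "q = (\<lambda>\<omega> \<omega>'. (\<Sum>m<M\<^sub>1. B1 m * dist (e\<^sub>1 m \<omega>) (e\<^sub>1 m \<omega>')) + (\<Sum>m<M\<^sub>2. B2 m * dist (e\<^sub>2 m \<omega>) (e\<^sub>2 m \<omega>')))"
  have q1: "0 \<le> (\<Sum>m<M\<^sub>1. B1 m * dist (e\<^sub>1 m \<omega>) (e\<^sub>1 m \<omega>'))" for \<omega> \<omega>' using B1(1) by (intro sum_nonneg) simp
  have q2: "0 \<le> (\<Sum>m<M\<^sub>2. B2 m * dist (e\<^sub>2 m \<omega>) (e\<^sub>2 m \<omega>'))" for \<omega> \<omega>' using B2(1) by (intro sum_nonneg) simp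
  have lip: "\<bar>?g \<omega> - ?g \<omega>'\<bar> \<le> L * q \<omega> \<omega>'" for \<omega> \<omega>'
  proof (rule hol_lipschitzD[OF G])
    show "q \<omega> \<omega>' \<ge> 0" unfolding q_def by (intro add_nonneg_nonneg q1 q2)
    fix z assume z: "z \<in> C\<^sub>1"
    have "dist (dpoly \<alpha>\<^sub>1 (\<lambda>m. x\<^sub>1 m * e\<^sub>1 m \<omega>) M\<^sub>1 z) (dpoly \<alpha>\<^sub>1 (\<lambda>m. x\<^sub>1 m * e\<^sub>1 m \<omega>') M\<^sub>1 z) \<le> q \<omega> \<omega>'"
      unfolding q_def by (rule add_increasing2[OF q2 B1(2)[rule_format, OF z, of "\<lambda>m. e\<^sub>1 m \<omega>" "\<lambda>m. e\<^sub>1 m \<omega>'"]])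
    moreover have "z \<in> D\<^sub>1" using z C by blast
    ultimately show "dist (fst (dpoly_elem D\<^sub>1 \<alpha>\<^sub>1 (\<lambda>m. x\<^sub>1 m * e\<^sub>1 m \<omega>) M\<^sub>1, dpoly_elem D\<^sub>2 \<alpha>\<^sub>2 (\<lambda>m. x\<^sub>2 m * e\<^sub>2 m \<omega>) M\<^sub>2) z)
       (fst (dpoly_elem D\<^sub>1 \<alpha>\<^sub>1 (\<lambda>m. x\<^sub>1 m * e\<^sub>1 m \<omega>') M\<^sub>1, dpoly_elem D\<^sub>2 \<alpha>\<^sub>2 (\<lambda>m. x\<^sub>2 m * e\<^sub>2 m \<omega>') M\<^sub>2) z) \<le> q \<omega> \<omega>'"
      by (simp only: fst_conv dpoly_elem_def restrict_apply if_True)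
  next
    fix z assume z: "z \<in> C\<^sub>2"
    have "dist (dpoly \<alpha>\<^sub>2 (\<lambda>m. x\<^sub>2 m * e\<^sub>2 m \<omega>) M\<^sub>2 z) (dpoly \<alpha>\<^sub>2 (\<lambda>m. x\<^sub>2 m * e\<^sub>2 m \<omega>') M\<^sub>2 z) \<le> q \<omega> \<omega>'"
      unfolding q_def by (rule add_increasing[OF q1 B2(2)[rule_format, OF z, of "\<lambda>m. e\<^sub>2 m \<omega>" "\<lambda>m. e\<^sub>2 m \<omega>'"]])
    moreover have "z \<in> D\<^sub>2" using z C by blast
    ultimately show "dist (snd (dpoly_elem D\<^sub>1 \<alpha>\<^sub>1 (\<lambda>m. x\<^sub>1 m * e\<^sub>1 m \<omega>) M\<^sub>1, dpoly_elem D\<^sub>2 \<alpha>\<^sub>2 (\<lambda>m. x\<^sub>2 m * e\<^sub>2 m \<omega>) M\<^sub>2) z)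
       (snd (dpoly_elem D\<^sub>1 \<alpha>\<^sub>1 (\<lambda>m. x\<^sub>1 m * e\<^sub>1 m \<omega>') M\<^sub>1, dpoly_elem D\<^sub>2 \<alpha>\<^sub>2 (\<lambda>m. x\<^sub>2 m * e\<^sub>2 m \<omega>') M\<^sub>2) z) \<le> q \<omega> \<omega>'"
      by (simp only: snd_conv dpoly_elem_def restrict_apply if_True)
  qed (auto intro: dpoly_elem_hol_space \<alpha>)
  show ?thesis
    unfolding continuous_on_def
  proof
    fix \<omega>' assume \<omega>': "\<omega>' \<in> T"
    have "continuous_on T (\<lambda>\<omega>. L * q \<omega> \<omega>')" unfolding q_def by (intro continuous_intros e)
    then have "((\<lambda>\<omega>. L * q \<omega> \<omega>') \<longlongrightarrow> L * q \<omega>' \<omega>') (at \<omega>' within T)" using \<omega>' by (simp add: continuous_on_def)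
    then have lim: "((\<lambda>\<omega>. L * q \<omega> \<omega>') \<longlongrightarrow> 0) (at \<omega>' within T)" by (simp add: q_def)
    have "((\<lambda>\<omega>. ?g \<omega> - ?g \<omega>') \<longlongrightarrow> 0) (at \<omega>' within T)"
      by (rule Lim_null_comparison[OF always_eventually[OF allI] lim]) (simp only: real_norm_def lip)
    then show "(?g \<longlongrightarrow> ?g \<omega>') (at \<omega>' within T)" by (rule LIM_zero_cancel)
  qed
qed

text \<open>Three replacements: the functions by polynomials along the shifts, the average over
  shifts by an integral through equidistribution, and the polynomials by the random series.\<close>

lemma lipschitz_average:
  assumes ind: "rat_independent_family L_indices (L_elem \<alpha> h\<^sub>1 h\<^sub>2)"
    and R1: "random_dirichlet haar_Omega e\<^sub>1 \<alpha>\<^sub>1 h\<^sub>1 a\<^sub>1 F\<^sub>1 D\<^sub>1" and R2: "random_dirichlet haar_Omega e\<^sub>2 \<alpha>\<^sub>2 h\<^sub>2 a\<^sub>2 F\<^sub>2 D\<^sub>2"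
    and cont: "\<And>m. continuous_on torus_Omega (e\<^sub>1 m)" "\<And>m. continuous_on torus_Omega (e\<^sub>2 m)"
    and e1: "\<And>m k. e\<^sub>1 m (shift_point \<alpha> h\<^sub>1 h\<^sub>2 k) = cis (- (h\<^sub>1 * ln (real m + \<alpha>\<^sub>1))) ^ k"
    and e2: "\<And>m k. e\<^sub>2 m (shift_point \<alpha> h\<^sub>1 h\<^sub>2 k) = cis (- (h\<^sub>2 * ln (real m + \<alpha>\<^sub>2))) ^ k"
    and G: "hol_lipschitz D\<^sub>1 D\<^sub>2 C\<^sub>1 C\<^sub>2 L G" and B: "\<And>y. y \<in> hol_space D\<^sub>1 \<times> hol_space D\<^sub>2 \<Longrightarrow> \<bar>G y\<bar> \<le> B"
    and X: "\<And>k. X k \<in> hol_space D\<^sub>1 \<times> hol_space D\<^sub>2"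
    and X1: "\<And>k s. s \<in> D\<^sub>1 \<Longrightarrow> fst (X k) s = F\<^sub>1 (s + \<i> * of_nat k * of_real h\<^sub>1)"
    and X2: "\<And>k s. s \<in> D\<^sub>2 \<Longrightarrow> snd (X k) s = F\<^sub>2 (s + \<i> * of_nat k * of_real h\<^sub>2)"
    and Z: "\<And>\<omega>. Z \<omega> = (series_elem D\<^sub>1 (\<lambda>m s. a\<^sub>1 m * e\<^sub>1 m \<omega> * complex_of_real (real m + \<alpha>\<^sub>1) powr (- s)),
       series_elem D\<^sub>2 (\<lambda>m s. a\<^sub>2 m * e\<^sub>2 m \<omega> * complex_of_real (real m + \<alpha>\<^sub>2) powr (- s)))"
    and Zm: "Z \<in> haar_Omega \<rightarrow>\<^sub>M borel_of (H_prod D\<^sub>1 D\<^sub>2)"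
  shows "(\<lambda>N. (\<Sum>k\<le>N. G (X k)) / real (N + 1)) \<longlonglongrightarrow> (LINT \<omega>|haar_Omega. G (Z \<omega>))"
proof -
  interpret R1: random_dirichlet haar_Omega e\<^sub>1 \<alpha>\<^sub>1 h\<^sub>1 a\<^sub>1 F\<^sub>1 D\<^sub>1 by fact
  interpret R2: random_dirichlet haar_Omega e\<^sub>2 \<alpha>\<^sub>2 h\<^sub>2 a\<^sub>2 F\<^sub>2 D\<^sub>2 by fact
  have C: "compact C\<^sub>1" "C\<^sub>1 \<subseteq> D\<^sub>1" "compact C\<^sub>2" "C\<^sub>2 \<subseteq> D\<^sub>2" and L: "L \<ge> 0" using G unfolding hol_lipschitz_def by blast+
  obtain x1 M1 w1 V1 \<delta>1 K1 where \<delta>1: "\<delta>1 > 0" and w1: "\<forall>k. w1 k \<ge> 0" "K1 \<ge> 0" "\<forall>N. (\<Sum>k\<le>N. w1 k) \<le> K1 * real (N + 1)"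
    and ap1: "\<forall>n. \<forall>\<^sub>F k in sequentially. \<forall>s\<in>C\<^sub>1. cmod (F\<^sub>1 (s + \<i> * of_nat k * of_real h\<^sub>1) -
        dpoly \<alpha>\<^sub>1 (x1 n) (M1 n) (s + \<i> * of_nat k * of_real h\<^sub>1)) \<le> exp (- \<delta>1 * real n) * w1 k"
    and V1: "\<forall>n. integrable haar_Omega (V1 n) \<and> (LINT \<omega>|haar_Omega. V1 n \<omega>) \<le> K1 * exp (- \<delta>1 * real n) \<and> (\<forall>\<omega>. V1 n \<omega> \<ge> 0) \<and>
       (AE \<omega> in haar_Omega. \<forall>s\<in>C\<^sub>1. summable (\<lambda>m. R1.random_term \<omega> m s) \<and>
         cmod ((\<Sum>m. R1.random_term \<omega> m s) - dpoly \<alpha>\<^sub>1 (\<lambda>m. x1 n m * e\<^sub>1 m \<omega>) (M1 n) s) \<le> V1 n \<omega>)"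
    using R1.random_approximation[OF C(1,2)] by (elim exE conjE) (rule that)
  obtain x2 M2 w2 V2 \<delta>2 K2 where \<delta>2: "\<delta>2 > 0" and w2: "\<forall>k. w2 k \<ge> 0" "K2 \<ge> 0" "\<forall>N. (\<Sum>k\<le>N. w2 k) \<le> K2 * real (N + 1)"
    and ap2: "\<forall>n. \<forall>\<^sub>F k in sequentially. \<forall>s\<in>C\<^sub>2. cmod (F\<^sub>2 (s + \<i> * of_nat k * of_real h\<^sub>2) -
        dpoly \<alpha>\<^sub>2 (x2 n) (M2 n) (s + \<i> * of_nat k * of_real h\<^sub>2)) \<le> exp (- \<delta>2 * real n) * w2 k"
    and V2: "\<forall>n. integrable haar_Omega (V2 n) \<and> (LINT \<omega>|haar_Omega. V2 n \<omega>) \<le> K2 * exp (- \<delta>2 * real n) \<and> (\<forall>\<omega>. V2 n \<omega> \<ge> 0) \<and>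
       (AE \<omega> in haar_Omega. \<forall>s\<in>C\<^sub>2. summable (\<lambda>m. R2.random_term \<omega> m s) \<and>
         cmod ((\<Sum>m. R2.random_term \<omega> m s) - dpoly \<alpha>\<^sub>2 (\<lambda>m. x2 n m * e\<^sub>2 m \<omega>) (M2 n) s) \<le> V2 n \<omega>)"
    using R2.random_approximation[OF C(3,4)] by (elim exE conjE) (rule that)
  define P where "P = (\<lambda>n \<omega>. (dpoly_elem D\<^sub>1 \<alpha>\<^sub>1 (\<lambda>m. x1 n m * e\<^sub>1 m \<omega>) (M1 n), dpoly_elem D\<^sub>2 \<alpha>\<^sub>2 (\<lambda>m. x2 n m * e\<^sub>2 m \<omega>) (M2 n)))"
  have PH: "P n \<omega> \<in> hol_space D\<^sub>1 \<times> hol_space D\<^sub>2" for n \<omega>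
    unfolding P_def using R1.\<alpha> R2.\<alpha> by (intro SigmaI dpoly_elem_hol_space)
  have ZH: "Z \<omega> \<in> hol_space D\<^sub>1 \<times> hol_space D\<^sub>2" for \<omega>
    unfolding Z by (intro SigmaI R1.random_elem_hol_space R2.random_elem_hol_space)
  have cP: "continuous_on torus_Omega (\<lambda>\<omega>. G (P n \<omega>))" for n
    unfolding P_def by (rule dpoly_lipschitz_continuous[OF G R1.\<alpha>(1) R2.\<alpha>(1) cont])
  \<comment> \<open>One quantity bounds both replacements at level n: the error of the integrals
    and, through the sums of \<open>w1\<close> and \<open>w2\<close>, the mean error of the
    averages.\<close>
  define E where "E = (\<lambda>n. L * (K1 * exp (- \<delta>1 * real n) + K2 * exp (- \<delta>2 * real n)))"
  have Elim: "E \<longlonglongrightarrow> 0" 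
  proof -
    have ex: "(\<lambda>n. exp (- \<delta> * real n)) \<longlonglongrightarrow> 0" if "\<delta> > 0" for \<delta> :: real using that by real_asymp
    have "E \<longlonglongrightarrow> L * (K1 * 0 + K2 * 0)" unfolding E_def by (intro tendsto_intros ex \<delta>1 \<delta>2)
    then show ?thesis by simp
  qed
  \<comment> \<open>At a shift point the rotated coefficients reproduce the polynomial at the
    shifted argument, which links the shifts to the torus.\<close>
  have dP1: "s \<in> D\<^sub>1 \<Longrightarrow> fst (P n (shift_point \<alpha> h\<^sub>1 h\<^sub>2 k)) s = dpoly \<alpha>\<^sub>1 (x1 n) (M1 n) (s + \<i> * of_nat k * of_real h\<^sub>1)" for n k s
    unfolding P_def dpoly_shift[OF R1.\<alpha>(1)] by (simp add: dpoly_elem_def dpoly_def e1 mult_ac)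
  have dP2: "s \<in> D\<^sub>2 \<Longrightarrow> snd (P n (shift_point \<alpha> h\<^sub>1 h\<^sub>2 k)) s = dpoly \<alpha>\<^sub>2 (x2 n) (M2 n) (s + \<i> * of_nat k * of_real h\<^sub>2)" for n k s
    unfolding P_def dpoly_shift[OF R2.\<alpha>(1)] by (simp add: dpoly_elem_def dpoly_def e2 mult_ac)
  have GZ: "integrable haar_Omega (\<lambda>\<omega>. G (Z \<omega>))"
    by (rule R1.integrable_const_bound[where B = B])
       (use B[OF ZH] measurable_compose[OF Zm continuous_map_measurable[OF hol_lipschitz_continuous_map[OF G]]] in auto)
  have Idiff: "\<bar>(LINT \<omega>|haar_Omega. G (P n \<omega>)) - (LINT \<omega>|haar_Omega. G (Z \<omega>))\<bar> \<le> E n" for n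
  proof -
    note v1 = spec[OF V1, of n] and v2 = spec[OF V2, of n]
    have V: "integrable haar_Omega (V1 n)" "integrable haar_Omega (V2 n)" "\<forall>\<omega>. V1 n \<omega> \<ge> 0" "\<forall>\<omega>. V2 n \<omega> \<ge> 0"
      "(LINT \<omega>|haar_Omega. V1 n \<omega>) \<le> K1 * exp (- \<delta>1 * real n)" "(LINT \<omega>|haar_Omega. V2 n \<omega>) \<le> K2 * exp (- \<delta>2 * real n)"
      by (rule conjunct1[OF v1] conjunct1[OF v2] conjunct1[OF conjunct2[OF conjunct2[OF v1]]] conjunct1[OF conjunct2[OF conjunct2[OF v2]]]
        conjunct1[OF conjunct2[OF v1]] conjunct1[OF conjunct2[OF v2]])+
    have GP: "integrable haar_Omega (\<lambda>\<omega>. G (P n \<omega>))" by (rule equidistribution(1)[OF ind cP])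
    have AE1: "AE \<omega> in haar_Omega. \<forall>s\<in>C\<^sub>1. summable (\<lambda>m. R1.random_term \<omega> m s) \<and>
         cmod ((\<Sum>m. R1.random_term \<omega> m s) - dpoly \<alpha>\<^sub>1 (\<lambda>m. x1 n m * e\<^sub>1 m \<omega>) (M1 n) s) \<le> V1 n \<omega>"
      by (rule conjunct2[OF conjunct2[OF conjunct2[OF v1]]])
    have AE2: "AE \<omega> in haar_Omega. \<forall>s\<in>C\<^sub>2. summable (\<lambda>m. R2.random_term \<omega> m s) \<and>
         cmod ((\<Sum>m. R2.random_term \<omega> m s) - dpoly \<alpha>\<^sub>2 (\<lambda>m. x2 n m * e\<^sub>2 m \<omega>) (M2 n) s) \<le> V2 n \<omega>"
      by (rule conjunct2[OF conjunct2[OF conjunct2[OF v2]]])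
    have "AE \<omega> in haar_Omega. \<bar>G (P n \<omega>) - G (Z \<omega>)\<bar> \<le> L * (V1 n \<omega> + V2 n \<omega>)"
      using AE1 AE2 R1.random_series_converges R2.random_series_converges
    proof eventually_elim
      case (elim \<omega>)
      have Zs: "fst (Z \<omega>) = (\<lambda>s\<in>D\<^sub>1. \<Sum>m. R1.random_term \<omega> m s)" "snd (Z \<omega>) = (\<lambda>s\<in>D\<^sub>2. \<Sum>m. R2.random_term \<omega> m s)"
        unfolding Z fst_conv snd_conv series_elem_def by (rule if_P[OF elim(3)] if_P[OF elim(4)])+
      show ?case
      proof (rule hol_lipschitzD[OF G PH ZH])
        show "V1 n \<omega> + V2 n \<omega> \<ge> 0" by (intro add_nonneg_nonneg V(3,4)[rule_format])
        show "dist (fst (P n \<omega>) z) (fst (Z \<omega>) z) \<le> V1 n \<omega> + V2 n \<omega>" if z: "z \<in> C\<^sub>1" for z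
        proof -
          have zD: "z \<in> D\<^sub>1" using z C by blast
          have "fst (P n \<omega>) z = dpoly \<alpha>\<^sub>1 (\<lambda>m. x1 n m * e\<^sub>1 m \<omega>) (M1 n) z" using zD by (simp add: P_def dpoly_elem_def)
          moreover have "fst (Z \<omega>) z = (\<Sum>m. R1.random_term \<omega> m z)" unfolding Zs using zD by simp
          ultimately have "dist (fst (P n \<omega>) z) (fst (Z \<omega>) z) \<le> V1 n \<omega>"
            using conjunct2[OF bspec[OF elim(1) z]] by (simp only: dist_norm norm_minus_commute)
          then show ?thesis using V(4)[rule_format, of \<omega>] by linarith
        qed
        show "dist (snd (P n \<omega>) z) (snd (Z \<omega>) z) \<le> V1 n \<omega> + V2 n \<omega>" if z: "z \<in> C\<^sub>2" for z
        proof -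
          have zD: "z \<in> D\<^sub>2" using z C by blast
          have "snd (P n \<omega>) z = dpoly \<alpha>\<^sub>2 (\<lambda>m. x2 n m * e\<^sub>2 m \<omega>) (M2 n) z" using zD by (simp add: P_def dpoly_elem_def)
          moreover have "snd (Z \<omega>) z = (\<Sum>m. R2.random_term \<omega> m z)" unfolding Zs using zD by simp
          ultimately have "dist (snd (P n \<omega>) z) (snd (Z \<omega>) z) \<le> V2 n \<omega>"
            using conjunct2[OF bspec[OF elim(2) z]] by (simp only: dist_norm norm_minus_commute)
          then show ?thesis using V(3)[rule_format, of \<omega>] by linarith
        qed
      qed
    qed
    then have "(LINT \<omega>|haar_Omega. \<bar>G (P n \<omega>) - G (Z \<omega>)\<bar>) \<le> (LINT \<omega>|haar_Omega. L * (V1 n \<omega> + V2 n \<omega>))"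
      by (intro integral_mono_AE) (use GP GZ V in auto)
    moreover have "\<bar>LINT \<omega>|haar_Omega. G (P n \<omega>) - G (Z \<omega>)\<bar> \<le> (LINT \<omega>|haar_Omega. \<bar>G (P n \<omega>) - G (Z \<omega>)\<bar>)"
      by (rule integral_abs_bound)
    moreover have "(LINT \<omega>|haar_Omega. G (P n \<omega>) - G (Z \<omega>)) = (LINT \<omega>|haar_Omega. G (P n \<omega>)) - (LINT \<omega>|haar_Omega. G (Z \<omega>))"
      by (rule Bochner_Integration.integral_diff[OF GP GZ])
    moreover have "(LINT \<omega>|haar_Omega. L * (V1 n \<omega> + V2 n \<omega>)) = L * ((LINT \<omega>|haar_Omega. V1 n \<omega>) + (LINT \<omega>|haar_Omega. V2 n \<omega>))"
      using V by simp
    moreover have "\<dots> \<le> E n" unfolding E_def by (intro mult_left_mono add_mono V(5,6) L)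
    ultimately show ?thesis by linarith
  qed
  show ?thesis
  proof (rule cesaro_limit_approx[where B = "B + B"])
    fix \<epsilon> :: real assume \<epsilon>: "\<epsilon> > 0"
    \<comment> \<open>The level n is fixed by \<epsilon> alone; the index k0 from which the
      approximation holds may then depend on n.\<close>
    from order_tendstoD(2)[OF Elim this] obtain n where n: "E n < \<epsilon>" unfolding eventually_sequentially by blast
    define u where "u = (\<lambda>k. L * (exp (- \<delta>1 * real n) * w1 k + exp (- \<delta>2 * real n) * w2 k))"
    obtain k0 where k0: "\<And>k. k \<ge> k0 \<Longrightarrow> (\<forall>s\<in>C\<^sub>1. cmod (F\<^sub>1 (s + \<i> * of_nat k * of_real h\<^sub>1) -
        dpoly \<alpha>\<^sub>1 (x1 n) (M1 n) (s + \<i> * of_nat k * of_real h\<^sub>1)) \<le> exp (- \<delta>1 * real n) * w1 k) \<and>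
        (\<forall>s\<in>C\<^sub>2. cmod (F\<^sub>2 (s + \<i> * of_nat k * of_real h\<^sub>2) -
        dpoly \<alpha>\<^sub>2 (x2 n) (M2 n) (s + \<i> * of_nat k * of_real h\<^sub>2)) \<le> exp (- \<delta>2 * real n) * w2 k)"
      using eventually_conj[OF ap1[rule_format, of n] ap2[rule_format, of n]] unfolding eventually_sequentially by (elim exE) (rule that, rule mp, erule spec)
    have nn: "0 \<le> exp (- \<delta>1 * real n) * w1 k" "0 \<le> exp (- \<delta>2 * real n) * w2 k" for k using w1 w2 by simp_all
    have 1: "\<bar>G (X k) - G (P n (shift_point \<alpha> h\<^sub>1 h\<^sub>2 k))\<bar> \<le> u k" if k: "k \<ge> k0" for k
      unfolding u_def
    proof (rule hol_lipschitzD[OF G X PH add_nonneg_nonneg[OF nn]])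
      show "dist (fst (X k) z) (fst (P n (shift_point \<alpha> h\<^sub>1 h\<^sub>2 k)) z) \<le> exp (- \<delta>1 * real n) * w1 k + exp (- \<delta>2 * real n) * w2 k"
        if z: "z \<in> C\<^sub>1" for z
        unfolding X1[OF subsetD[OF C(2) z]] dP1[OF subsetD[OF C(2) z]] dist_norm
        by (rule add_increasing2[OF nn(2) bspec[OF conjunct1[OF k0[OF k]] z]])
      show "dist (snd (X k) z) (snd (P n (shift_point \<alpha> h\<^sub>1 h\<^sub>2 k)) z) \<le> exp (- \<delta>1 * real n) * w1 k + exp (- \<delta>2 * real n) * w2 k"
        if z: "z \<in> C\<^sub>2" for z
        unfolding X2[OF subsetD[OF C(4) z]] dP2[OF subsetD[OF C(4) z]] dist_norm
        by (rule add_increasing[OF nn(1) bspec[OF conjunct2[OF k0[OF k]] z]])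
    qed
    have 2: "u k \<ge> 0" for k unfolding u_def using nn[of k] L by simp
    have 3: "(\<Sum>k\<le>N. u k) \<le> \<epsilon> * real (N + 1)" for N
    proof -
      have "(\<Sum>k\<le>N. u k) = L * (exp (- \<delta>1 * real n) * (\<Sum>k\<le>N. w1 k) + exp (- \<delta>2 * real n) * (\<Sum>k\<le>N. w2 k))"
        unfolding u_def by (simp add: sum_distrib_left sum.distrib distrib_left)
      also have "\<dots> \<le> L * (exp (- \<delta>1 * real n) * (K1 * real (N + 1)) + exp (- \<delta>2 * real n) * (K2 * real (N + 1)))"
        by (intro mult_left_mono add_mono L w1(3)[rule_format] w2(3)[rule_format]) simp_all
      also have "\<dots> = E n * real (N + 1)" by (simp add: E_def algebra_simps)
      also have "\<dots> \<le> \<epsilon> * real (N + 1)" using n by (intro mult_right_mono) auto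
      finally show ?thesis .
    qed
    have 4: "\<bar>G (X k) - G (P n (shift_point \<alpha> h\<^sub>1 h\<^sub>2 k))\<bar> \<le> B + B" for k
      using B[OF X[of k]] B[OF PH[of n "shift_point \<alpha> h\<^sub>1 h\<^sub>2 k"]] by linarith
    show "\<exists>f J u k0. (\<lambda>N. (\<Sum>k\<le>N. f k) / real (N + 1)) \<longlonglongrightarrow> J \<and> \<bar>J - (LINT \<omega>|haar_Omega. G (Z \<omega>))\<bar> \<le> \<epsilon> \<and>
      (\<forall>k\<ge>k0. \<bar>G (X k) - f k\<bar> \<le> u k) \<and> (\<forall>k::nat. u k \<ge> 0) \<and> (\<forall>N. (\<Sum>k\<le>N. u k) \<le> \<epsilon> * real (N + 1)) \<and> (\<forall>k. \<bar>G (X k) - f k\<bar> \<le> B + B)"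
      by (rule exI[of _ "\<lambda>k. G (P n (shift_point \<alpha> h\<^sub>1 h\<^sub>2 k))"], rule exI[of _ "LINT \<omega>|haar_Omega. G (P n \<omega>)"], rule exI[of _ u], rule exI[of _ k0],
          intro conjI allI impI equidistribution(2)[OF ind cP] order.trans[OF Idiff less_imp_le[OF n]] 1 2 3 4)
  qed
qed

subsection \<open>The limit theorem\<close>

lemma (in class_M) not_pole_vertical: "\<exists>R. \<forall>s. Re s \<ge> \<sigma>\<^sub>0 \<and> \<bar>Im s\<bar> > R \<longrightarrow> \<not> is_pole \<phi> s"
proof -
  obtain K where K: "compact K" "{s. Re s \<ge> \<sigma>\<^sub>0 \<and> is_pole \<phi> s} \<subseteq> K" using poles by blast
  obtain R where R: "\<And>s. s \<in> K \<Longrightarrow> cmod s \<le> R" using compact_imp_bounded[OF K(1)] unfolding bounded_iff by blast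
  have "\<not> is_pole \<phi> s" if s: "Re s \<ge> \<sigma>\<^sub>0 \<and> \<bar>Im s\<bar> > R" for s
  proof
    assume "is_pole \<phi> s"
    then have "cmod s \<le> R" using s K(2) by (intro R) auto
    then show False using s abs_Im_le_cmod[of s] by linarith
  qed
  then show ?thesis by blast
qed

text \<open>For \<alpha> = 1 the shifted series is the Dirichlet series of \<phi> with indices
  lowered by one. The poles lie in a compact set, so a sufficiently high starting height avoids
  them.\<close>

lemma (in class_M) class_M_mean_strip: "\<exists>T\<^sub>0 A. mean_strip 1 (\<lambda>m. c (Suc m)) \<phi> \<sigma>\<^sub>0 T\<^sub>0 A"
proof -
  obtain R where R: "\<forall>s. Re s \<ge> \<sigma>\<^sub>0 \<and> \<bar>Im s\<bar> > R \<longrightarrow> \<not> is_pole \<phi> s" using not_pole_vertical by blast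
  obtain C2 B t0 where gr: "\<forall>s. Re s \<ge> \<sigma>\<^sub>0 \<and> \<bar>Im s\<bar> \<ge> t0 \<longrightarrow> cmod (\<phi> s) \<le> B * \<bar>Im s\<bar> powr C2"
    using growth by (elim exE conjE) (rule that)
  let ?f = "\<lambda>t. (cmod (\<phi> (Complex \<sigma>\<^sub>0 t)))\<^sup>2"
  obtain A where "\<forall>\<^sub>F T in at_top. norm (integral {0..T} ?f) \<le> A * norm T"
    using landau_o.bigE[OF mean_square] by blast
  then obtain T1 where T1: "\<And>T. T \<ge> T1 \<Longrightarrow> norm (integral {0..T} ?f) \<le> A * norm T"
    unfolding eventually_at_top_linorder by blast
  \<comment> \<open>Above all poles, above the heights from which the growth bound and the
    asymptotic mean square bound hold, and positive.\<close>
  define T0 where "T0 = max 1 (max (R + 1) (max t0 T1))"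
  have T0: "T0 \<ge> 1" "T0 \<ge> R + 1" "T0 \<ge> t0" "T0 \<ge> T1" by (auto simp: T0_def)
  have hol: "\<phi> holomorphic_on {s. Re s \<ge> \<sigma>\<^sub>0 \<and> \<not> is_pole \<phi> s}" using analytic by (rule analytic_imp_holomorphic)
  have "mean_strip 1 (\<lambda>m. c (Suc m)) \<phi> \<sigma>\<^sub>0 T0 A"
  proof
    show "\<phi> holomorphic_on {z. \<sigma>\<^sub>0 \<le> Re z \<and> T0 \<le> Im z}"
    proof (rule holomorphic_on_subset[OF hol], safe)
      fix s assume s: "\<sigma>\<^sub>0 \<le> Re s" "T0 \<le> Im s" "is_pole \<phi> s"
      then have "Re s \<ge> \<sigma>\<^sub>0 \<and> \<bar>Im s\<bar> > R" using T0 by auto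
      with R s(3) show False by blast
    qed
    show "\<exists>B C. \<forall>z. \<sigma>\<^sub>0 \<le> Re z \<and> Re z \<le> X \<and> T0 \<le> Im z \<longrightarrow> cmod (\<phi> z) \<le> B * Im z powr C" for X
    proof (intro exI allI impI)
      fix z assume z: "\<sigma>\<^sub>0 \<le> Re z \<and> Re z \<le> X \<and> T0 \<le> Im z"
      then have "\<bar>Im z\<bar> = Im z" "Im z \<ge> t0" using T0 by auto
      with gr[rule_format, of z] z show "cmod (\<phi> z) \<le> B * Im z powr C2" by simp
    qed
    show "integral {T0..T} ?f \<le> A * T" if T: "T \<ge> T0" for T
    proof -
      \<comment> \<open>The mean square is given from 0 on. Restricting it to \<open>T0\<close>
        onwards uses integrability over the whole segment, which holds because no pole lies on the
        line of real part \<open>\<sigma>\<^sub>0\<close>.\<close>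
      obtain K where K: "K \<inter> {s. Re s = \<sigma>\<^sub>0} = {}" "{s. Re s \<ge> \<sigma>\<^sub>0 \<and> is_pole \<phi> s} \<subseteq> K" using poles by blast
      have line: "Complex \<sigma>\<^sub>0 t \<in> {s. Re s \<ge> \<sigma>\<^sub>0 \<and> \<not> is_pole \<phi> s}" for t
      proof (rule CollectI, intro conjI notI)
        assume "is_pole \<phi> (Complex \<sigma>\<^sub>0 t)"
        then have "Complex \<sigma>\<^sub>0 t \<in> K" using K(2) by auto
        then show False using K(1) by auto
      qed simp
      have "continuous_on {0..T} (\<lambda>t. Complex \<sigma>\<^sub>0 t)" unfolding Complex_eq by (intro continuous_intros)
      then have "continuous_on {0..T} (\<lambda>t. \<phi> (Complex \<sigma>\<^sub>0 t))"
        by (rule continuous_on_compose2[OF holomorphic_on_imp_continuous_on[OF hol]]) (use line in blast)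
      then have cont: "continuous_on {0..T} ?f" by (intro continuous_intros)
      have "integral {T0..T} ?f \<le> integral {0..T} ?f"
      proof (rule integral_subset_le)
        show "?f integrable_on {0..T}" by (rule integrable_continuous_real[OF cont])
        show "?f integrable_on {T0..T}" by (rule integrable_continuous_real[OF continuous_on_subset[OF cont]]) (use T0 in auto)
      qed (use T0 in auto)
      also have "\<dots> \<le> A * T" using T1[of T] T T0 by simp
      finally show ?thesis .
    qed
    show "(\<lambda>m. c (Suc m) * complex_of_real (real m + 1) powr (- z)) sums \<phi> z" if "Re z > 1" for z
      using dirichlet_series[rule_format, OF that] by (simp add: add.commute)
  qed (use sigma0 T0 in auto)
  then show ?thesis by blast
qed

text \<open>Vertical shifts preserve the real part and \<open>D_phi\<close> omits every vertical
  line through a pole, so no shift of D meets one.\<close>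

lemma (in class_M) shift_elem_hol_space:
  assumes "D \<subseteq> D_phi \<sigma>\<^sub>0 \<phi>"
  shows "(\<lambda>s\<in>D. \<phi> (s + \<i> * of_nat k * of_real h)) \<in> hol_space D"
proof -
  have hol: "\<phi> holomorphic_on {s. Re s \<ge> \<sigma>\<^sub>0 \<and> \<not> is_pole \<phi> s}" using analytic by (rule analytic_imp_holomorphic)
  have "(\<phi> \<circ> (\<lambda>s. s + \<i> * of_nat k * of_real h)) holomorphic_on D"
  proof (rule holomorphic_on_compose_gen[OF _ hol])
    show "(\<lambda>s. s + \<i> * of_nat k * of_real h) holomorphic_on D" by (intro holomorphic_intros)
    show "(\<lambda>s. s + \<i> * of_nat k * of_real h) ` D \<subseteq> {s. \<sigma>\<^sub>0 \<le> Re s \<and> \<not> is_pole \<phi> s}"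
    proof (rule image_subsetI, rule CollectI, intro conjI notI)
      fix s assume "s \<in> D"
      then have s: "Re s > \<sigma>\<^sub>0" "\<And>z. Re z \<ge> \<sigma>\<^sub>0 \<Longrightarrow> is_pole \<phi> z \<Longrightarrow> Re s \<noteq> Re z" using assms by (auto simp: D_phi_def)
      have re: "Re (s + \<i> * of_nat k * of_real h) = Re s" by simp
      show "\<sigma>\<^sub>0 \<le> Re (s + \<i> * of_nat k * of_real h)" using s(1) by simp
      assume "is_pole \<phi> (s + \<i> * of_nat k * of_real h)"
      from s(2)[OF _ this] s(1) show False unfolding re by simp
    qed
  qed
  then have "(\<lambda>s\<in>D. \<phi> (s + \<i> * of_nat k * of_real h)) holomorphic_on D"
    by (rule holomorphic_transform) simp
  then show ?thesis by (simp add: hol_space_def)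
qed

lemma zeta_shift_elem_hol_space:
  assumes \<alpha>: "0 < \<alpha>" "\<alpha> \<le> 1" and b: "periodic_seq b" and D: "D \<subseteq> D_zeta b"
  shows "(\<lambda>s\<in>D. periodic_hurwitz_zeta \<alpha> b (s + \<i> * of_nat k * of_real h)) \<in> hol_space D"
proof -
  have "(periodic_hurwitz_zeta \<alpha> b \<circ> (\<lambda>s. s + \<i> * of_nat k * of_real h)) holomorphic_on D"
  proof (rule holomorphic_on_compose_gen[OF _ periodic_hurwitz_zeta(1)[OF \<alpha> b]])
    show "(\<lambda>s. s + \<i> * of_nat k * of_real h) holomorphic_on D" by (intro holomorphic_intros)
    show "(\<lambda>s. s + \<i> * of_nat k * of_real h) ` D \<subseteq> (if period_mean b = 0 then UNIV else - {1})"
      using D by (auto simp: D_zeta_def complex_eq_iff)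
  qed
  then have "(\<lambda>s\<in>D. periodic_hurwitz_zeta \<alpha> b (s + \<i> * of_nat k * of_real h)) holomorphic_on D"
    by (rule holomorphic_transform) simp
  then show ?thesis by (simp add: hol_space_def)
qed

lemma compact_Re_bound:
  assumes "compact K" "\<And>s. s \<in> K \<Longrightarrow> Re s > \<sigma>"
  shows "\<exists>d>0. \<forall>s\<in>K. Re s \<ge> \<sigma> + d"
proof (cases "K = {}")
  case False
  from continuous_attains_inf[OF assms(1) False continuous_on_Re[OF continuous_on_id]]
  obtain x where "x \<in> K" "\<forall>y\<in>K. Re x \<le> Re y" by auto
  then show ?thesis using assms(2)[of x] by (intro exI[of _ "Re x - \<sigma>"]) auto
qed (auto intro: exI[of _ 1])

lemma (in class_M) random_dirichlet_phi:
  assumes ind: "rat_independent_family L_indices (L_elem \<alpha> h\<^sub>1 h\<^sub>2)" and h: "h\<^sub>1 > 0" and D: "open D" "D \<subseteq> D_phi \<sigma>\<^sub>0 \<phi>"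
  shows "random_dirichlet haar_Omega (\<lambda>m \<omega>. omega_ext (fst \<omega>) (Suc m)) 1 h\<^sub>1 (\<lambda>m. c (Suc m)) \<phi> D"
proof (intro random_dirichlet.intro orthonormal_omega_ext random_dirichlet_axioms.intro)
  obtain T0 A where str: "mean_strip 1 (\<lambda>m. c (Suc m)) \<phi> \<sigma>\<^sub>0 T0 A" using class_M_mean_strip by blast
  fix K assume K: "compact K" "K \<subseteq> D"
  have "Re s > \<sigma>\<^sub>0" if "s \<in> K" for s using that K D by (auto simp: D_phi_def)
  from compact_Re_bound[OF K(1) this] obtain d where "d > 0" "\<forall>s\<in>K. Re s \<ge> \<sigma>\<^sub>0 + d" by blast
  with str show "\<exists>\<sigma>\<^sub>0 T\<^sub>0 A d. mean_strip 1 (\<lambda>m. c (Suc m)) \<phi> \<sigma>\<^sub>0 T\<^sub>0 A \<and> d > 0 \<and> (\<forall>s\<in>K. Re s \<ge> \<sigma>\<^sub>0 + d)"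
    by (intro exI[of _ \<sigma>\<^sub>0] exI[of _ T0] exI[of _ A] exI[of _ d] conjI)
next
  show "cis (- (h\<^sub>1 * ln (real m + 1))) \<noteq> cis (- (h\<^sub>1 * ln (real m' + 1)))" if "m \<noteq> m'" for m m'
    by (rule log_shift_neq_1[OF ind that])
qed (use h D in auto)

text \<open>The left edge is placed strictly between 1/2 and K and below 1, where
  \<open>periodic_hurwitz_mean_strip\<close> supplies a mean square.\<close>

lemma random_dirichlet_zeta:
  assumes ind: "rat_independent_family L_indices (L_elem \<alpha> h\<^sub>1 h\<^sub>2)" and h: "h\<^sub>2 > 0"
    and \<alpha>: "0 < \<alpha>" "\<alpha> \<le> 1" and b: "periodic_seq b" and D: "open D" "D \<subseteq> D_zeta b"
  shows "random_dirichlet haar_Omega (\<lambda>m \<omega>. snd \<omega> m) \<alpha> h\<^sub>2 b (periodic_hurwitz_zeta \<alpha> b) D"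
proof (intro random_dirichlet.intro orthonormal_snd random_dirichlet_axioms.intro)
  fix K assume K: "compact K" "K \<subseteq> D"
  have "Re s > 1 / 2" if "s \<in> K" for s using that K D by (auto simp: D_zeta_def split: if_splits)
  from compact_Re_bound[OF K(1) this] obtain d where d: "d > 0" "\<forall>s\<in>K. Re s \<ge> 1 / 2 + d" by blast
  \<comment> \<open>d' \<le> d / 2 keeps K at distance d / 2 from the edge 1/2 + d', and d' \<le>
    1/4 keeps that edge below 1.\<close>
  define d' where "d' = min (d / 2) (1 / 4)"
  have d': "d' > 0" "d' \<le> d / 2" "d' < 1 / 2" using d by (auto simp: d'_def)
  obtain A where str: "mean_strip \<alpha> b (periodic_hurwitz_zeta \<alpha> b) (1 / 2 + d') 1 A"
    using periodic_hurwitz_mean_strip[OF \<alpha> b, of "1 / 2 + d'"] d' by auto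
  have "\<forall>s\<in>K. Re s \<ge> (1 / 2 + d') + d / 2" using d d' by (auto simp: field_simps)
  with str d show "\<exists>\<sigma>\<^sub>0 T\<^sub>0 A d. mean_strip \<alpha> b (periodic_hurwitz_zeta \<alpha> b) \<sigma>\<^sub>0 T\<^sub>0 A \<and> d > 0 \<and> (\<forall>s\<in>K. Re s \<ge> \<sigma>\<^sub>0 + d)"
    by (intro exI[of _ "1 / 2 + d'"] exI[of _ 1] exI[of _ A] exI[of _ "d / 2"] conjI) auto
next
  show "cis (- (h\<^sub>2 * ln (real m + \<alpha>))) \<noteq> cis (- (h\<^sub>2 * ln (real m' + \<alpha>)))" if "m \<noteq> m'" for m m'
    by (rule log_shift_neq_2[OF ind that])
qed (use h D \<alpha> in auto)

lemma integral_empirical: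
  fixes F :: "'a \<Rightarrow> real"
  assumes X: "\<And>k. X k \<in> topspace T" and F: "F \<in> borel_measurable (borel_of T)"
  shows "(LINT x|empirical T X N. F x) = (\<Sum>k\<le>N. F (X k)) / real (N + 1)"
proof -
  have "X \<in> uniform_count_measure {0..N} \<rightarrow>\<^sub>M borel_of T"
    using X by (auto simp: measurable_def sets_uniform_count_measure space_uniform_count_measure)
  from integral_distr[OF this F] have "(LINT x|empirical T X N. F x) = (LINT k|uniform_count_measure {0..N}. F (X k))"
    unfolding empirical_def .
  also have "\<dots> = (\<Sum>k\<in>{0..N}. F (X k)) / real (card {0..N})" by (rule integral_uniform_count_measure) simp
  finally show ?thesis by (simp add: atLeast0AtMost)
qed

theorem theorem2p2:
  fixes g :: "nat \<Rightarrow> nat" and f :: "nat \<Rightarrow> nat \<Rightarrow> nat" and a :: "nat \<Rightarrow> nat \<Rightarrow> complex"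
    and \<alpha>\<^sub>0 \<beta>\<^sub>0 \<sigma>\<^sub>0 :: real and c :: "nat \<Rightarrow> complex" and \<phi> :: "complex \<Rightarrow> complex"
    and \<alpha> h\<^sub>1 h\<^sub>2 :: real and b :: "nat \<Rightarrow> complex" and D\<^sub>1 D\<^sub>2 :: "complex set"
  assumes "class_M g f a \<alpha>\<^sub>0 \<beta>\<^sub>0 \<sigma>\<^sub>0 c \<phi>"
    and "0 < \<alpha>" and "\<alpha> \<le> 1"
    and "periodic_seq b"
    and "h\<^sub>1 > 0" and "h\<^sub>2 > 0"
    and "rat_independent_family L_indices (L_elem \<alpha> h\<^sub>1 h\<^sub>2)"
    and "open D\<^sub>1" and "D\<^sub>1 \<subseteq> D_phi \<sigma>\<^sub>0 \<phi>"
    and "open D\<^sub>2" and "D\<^sub>2 \<subseteq> D_zeta b"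
  shows "weakly_converges (H_prod D\<^sub>1 D\<^sub>2) (P_N \<phi> \<alpha> b h\<^sub>1 h\<^sub>2 D\<^sub>1 D\<^sub>2) (P_Z c \<alpha> b D\<^sub>1 D\<^sub>2)"
proof -
  interpret class_M g f a \<alpha>\<^sub>0 \<beta>\<^sub>0 \<sigma>\<^sub>0 c \<phi> by fact
  note ind = assms(7)
  let ?e1 = "\<lambda>m \<omega>. omega_ext (fst \<omega>) (Suc m) :: complex" and ?e2 = "\<lambda>m \<omega>. snd \<omega> m :: complex"
  have R1: "random_dirichlet haar_Omega ?e1 1 h\<^sub>1 (\<lambda>m. c (Suc m)) \<phi> D\<^sub>1" by (rule random_dirichlet_phi[OF ind assms(5,8,9)])
  have R2: "random_dirichlet haar_Omega ?e2 \<alpha> h\<^sub>2 b (periodic_hurwitz_zeta \<alpha> b) D\<^sub>2"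
    by (rule random_dirichlet_zeta[OF ind assms(6,2,3,4,10,11)])
  interpret R1: random_dirichlet haar_Omega ?e1 1 h\<^sub>1 "\<lambda>m. c (Suc m)" \<phi> D\<^sub>1 by (rule R1)
  interpret R2: random_dirichlet haar_Omega ?e2 \<alpha> h\<^sub>2 b "periodic_hurwitz_zeta \<alpha> b" D\<^sub>2 by (rule R2)
  define Z where "Z = (\<lambda>\<omega>. (R1.random_elem \<omega>, R2.random_elem \<omega>))"
  have Zm: "Z \<in> haar_Omega \<rightarrow>\<^sub>M borel_of (H_prod D\<^sub>1 D\<^sub>2)"
    unfolding Z_def
    by (rule hol_pair_measurable[OF assms(8,10) R1.random_elem_hol_space R1.random_elem_measurable R2.random_elem_hol_space R2.random_elem_measurable])
  \<comment> \<open>The powers of k + 1 in \<open>phi_random\<close> are those of the shifted series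
    with \<alpha> = 1, up to the order of the summands.\<close>
  have Z_eq: "(\<lambda>(\<omega>\<^sub>1, \<omega>\<^sub>2). (phi_random c D\<^sub>1 \<omega>\<^sub>1, zeta_random \<alpha> b D\<^sub>2 \<omega>\<^sub>2)) = Z"
    unfolding Z_def phi_random_def zeta_random_def by (rule ext) (simp add: case_prod_unfold add.commute)
  define X where "X = Z_shift \<phi> \<alpha> b h\<^sub>1 h\<^sub>2 D\<^sub>1 D\<^sub>2"
  have X: "X k \<in> hol_space D\<^sub>1 \<times> hol_space D\<^sub>2" for k
    unfolding X_def Z_shift_def using shift_elem_hol_space[OF assms(9)] zeta_shift_elem_hol_space[OF assms(2,3,4,11)] by blast
  have cont1: "continuous_on torus_Omega (?e1 m)" for m
    using torus_char_continuous[OF admissible_prime_exponents[of "Suc m"]] by (simp add: omega_ext_eq_char)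
  have cont2: "continuous_on torus_Omega (?e2 m)" for m
    using torus_char_continuous[OF admissible_single[of m]] by (simp only: snd_eq_char)
  have X1: "\<And>k s. s \<in> D\<^sub>1 \<Longrightarrow> fst (X k) s = \<phi> (s + \<i> * of_nat k * of_real h\<^sub>1)"
    and X2: "\<And>k s. s \<in> D\<^sub>2 \<Longrightarrow> snd (X k) s = periodic_hurwitz_zeta \<alpha> b (s + \<i> * of_nat k * of_real h\<^sub>2)"
    by (simp_all add: X_def Z_shift_def)
  show ?thesis
    unfolding weakly_converges_def
  proof (intro allI impI)
    fix F :: "(complex \<Rightarrow> complex) \<times> (complex \<Rightarrow> complex) \<Rightarrow> real"
    assume F: "continuous_map (H_prod D\<^sub>1 D\<^sub>2) euclideanreal F \<and> bounded (F ` topspace (H_prod D\<^sub>1 D\<^sub>2))"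
    have Fm: "F \<in> borel_measurable (borel_of (H_prod D\<^sub>1 D\<^sub>2))" using F by (intro continuous_map_measurable) simp
    have top: "topspace (H_prod D\<^sub>1 D\<^sub>2) = hol_space D\<^sub>1 \<times> hol_space D\<^sub>2" by (simp add: H_prod_def)
    obtain M where M: "\<And>y. y \<in> hol_space D\<^sub>1 \<times> hol_space D\<^sub>2 \<Longrightarrow> \<bar>F y\<bar> \<le> M"
      using F unfolding top bounded_iff by (auto simp: real_norm_def)
    have "(\<lambda>N. (\<Sum>k\<le>N. F (X k)) / real (N + 1)) \<longlonglongrightarrow> (LINT \<omega>|haar_Omega. F (Z \<omega>))"
    proof (rule portmanteau[OF assms(8,10) prob_space_haar_Omega Zm X _ M])
      show "(\<lambda>N. (\<Sum>k\<le>N. G (X k)) / real (N + 1)) \<longlonglongrightarrow> (LINT \<omega>|haar_Omega. G (Z \<omega>))"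
        if "hol_lipschitz D\<^sub>1 D\<^sub>2 C\<^sub>1 C\<^sub>2 L G" "\<And>y. y \<in> hol_space D\<^sub>1 \<times> hol_space D\<^sub>2 \<Longrightarrow> \<bar>G y\<bar> \<le> B" for C\<^sub>1 C\<^sub>2 L G B
        by (rule lipschitz_average[OF ind R1 R2 cont1 cont2 omega_ext_shift snd_shift that X X1 X2 fun_cong[OF Z_def] Zm])
      show "continuous_map (H_prod D\<^sub>1 D\<^sub>2) euclideanreal F" using F by simp
    qed
    moreover have "(LINT x|P_N \<phi> \<alpha> b h\<^sub>1 h\<^sub>2 D\<^sub>1 D\<^sub>2 N. F x) = (\<Sum>k\<le>N. F (X k)) / real (N + 1)" for N
      unfolding P_N_def X_def[symmetric] by (rule integral_empirical[OF _ Fm]) (use X top in simp)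
    moreover have "(LINT x|P_Z c \<alpha> b D\<^sub>1 D\<^sub>2. F x) = (LINT \<omega>|haar_Omega. F (Z \<omega>))"
      unfolding P_Z_def Z_eq by (rule integral_distr[OF Zm Fm])
    ultimately show "(\<lambda>N. LINT x|P_N \<phi> \<alpha> b h\<^sub>1 h\<^sub>2 D\<^sub>1 D\<^sub>2 N. F x) \<longlonglongrightarrow> (LINT x|P_Z c \<alpha> b D\<^sub>1 D\<^sub>2. F x)"
      by (simp only:)
  qed
qed

end
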